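(* Let $f$ be an invertible polynomial in $n$ variables, let $G$ be a subgroup of its group $G_f$ of diagonal symmetries, and let $(\widetilde f,\widetilde G)$ be the Berglund--Hübsch--Henningson dual pair of $(f,G)$. For $n$ even one has $$E^i(f,G)(t,\bar t)=E^i(\widetilde f,\widetilde G)(t^{-1},\bar t)\quad\text{for } i=0,1.$$ For $n$ odd one has $$E^0(f,G)(t,\bar t)=E^1(\widetilde f,\widetilde G)(t^{-1},\bar t),\qquad E^1(f,G)(t,\bar t)=E^0(\widetilde f,\widetilde G)(t^{-1},\bar t).$$
   Context: Invertible polynomials. An invertible polynomial is a quasihomogeneous polynomial $f(x)=\sum_{i=1}^n a_i\prod_{j=1}^n x_j^{E_{ij}}$ in $n$ variables with $n$ monomials, $a_i\in\mathbb{C}^*$, $E=(E_{ij})$ a matrix of non-negative integers with $\det E\ne0$; it is non-degenerate: both $f$ and its transpose $\widetilde f(x)=\sum_{i=1}^n a_i\prod_{j=1}^n x_j^{E_{ji}}$ have an isolated critical point at the origin. $G_f$ is the finite group of all $\mathrm{diag}(\lambda_1,\dots,\lambda_n)$ preserving $f$; writing $\lambda_j=e^{2\pi i a_j}$, it is identified with $\{a\in\mathbb{Q}^n/\mathbb{Z}^n: Ea\in\mathbb{Z}^n\}$. Similarly $G_{\widetilde f}=\{b\in\mathbb{Q}^n/\mathbb{Z}^n: E^Tb\in\mathbb{Z}^n\}$. The dual group of $G\subset G_f$ is $\widetilde G=\{b\in G_{\widetilde f}: b^TEa\in\mathbb{Z}\ \text{for all } a\in G\}\cong\mathrm{Hom}(G_f/G,\mathbb{C}^*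 )$. Quantum cohomology group. For $g\in G$ let $n_g=\dim(\mathbb{C}^n)^g$, $f^g=f|_{(\mathbb{C}^n)^g}$, $V_{f^g}$ its Milnor fibre, and $\mathcal{H}_g=H^{n_g-1}(V_{f^g};\mathbb{C})^G$ ($G$-invariant part; reduced cohomology if $n_g=1$; for $n_g=0$ one-dimensional with trivial $G$-action). $\mathcal{H}_{f,G}=\bigoplus_{g\in G}\mathcal{H}_g$, and for $i=0,1$, $\mathcal{H}_{f,G,i}=\bigoplus_{g\in G,\ n_g\equiv i\bmod 2}\mathcal{H}_g$. Bigrading. If $g=\mathrm{diag}(e^{2\pi i r_1},\dots,e^{2\pi i r_n})$, $0\le r_j<1$, then $\mathrm{age}(g)=\sum_jr_j$. The vanishing cohomology $H^{n_g-1}(V_{f^g};\mathbb{C})$ has the $\mathbb{Q}\times\mathbb{Q}$-grading $\bigoplus_{p+q=n_g}H_{f^g}^{p,q}$ determined by Steenbrink's mixed Hodge structure and the eigenvalues of the monodromy. Since $f^g$ is quasihomogeneous, this grading is described as follows. The vanishing cohomology is $G$-equivariantly isomorphic to $\Omega_{f^g}=\Omega^{n_g}/(df^g\wedge\Omega^{n_g-1})$ (polynomial forms on $(\mathbb{C}^n)^g$, natural $G$-action; $\Omega_{f^g}=\mathbb{C}$ of degree $0$ if $n_g=0$), and $H_{f^g}^{p,q}$ with $p+q=n_g$ corresponds to the classes of forms of weighted degree $q$, where $x_j$ and $dx_j$ have degree $q_j$ and $(q_1,\dots,q_n)^T=E^{-1}(1,\dots,1)^T$ (so $f$ has degree $1$).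 All other $H_{f^g}^{p,q}$ are $0$. The bigrading of $\mathcal{H}_{f,G,i}$ is $$(\mathcal{H}_{f,G,i})^{p,q}=\bigoplus_{g\in G,\ n_g\equiv i\bmod 2}\big(H_{f^g}^{\,p-\mathrm{age}(g),\,q-\mathrm{age}(g)}\big)^G,\qquad p,q\in\mathbb{Q}.$$ $E^i$-functions: for $i=0,1$, $$E^i(f,G)(t,\bar t)=\sum_{p,q\in\mathbb{Q}}\dim_{\mathbb{C}}(\mathcal{H}_{f,G,i})^{p,q}\,t^{p-\frac n2}\,\bar t^{\,q-\frac n2},$$ where $t,\bar t$ are independent formal variables with rational exponents allowed. *)

theory Defs
  imports "HOL-Analysis.Analysis" "HOL-Algebra.Group" "HOL-Library.Poly_Mapping"
begin

section \<open>Polynomials in the variables \<open>x\<^sub>j\<close>, \<open>j :: 'n\<close>\<close>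

type_synonym 'n mpoly = "('n \<Rightarrow>\<^sub>0 nat) \<Rightarrow>\<^sub>0 complex"

definition mpoly_smult :: "complex \<Rightarrow> 'n mpoly \<Rightarrow> 'n mpoly" where
  "mpoly_smult c p = Poly_Mapping.single 0 c * p"

definition mpoly_eval :: "'n::finite mpoly \<Rightarrow> complex ^ 'n \<Rightarrow> complex" where
  "mpoly_eval p z =
     (\<Sum>m\<in>Poly_Mapping.keys p.
        Poly_Mapping.lookup p m * (\<Prod>j\<in>UNIV. (z $ j) ^ Poly_Mapping.lookup m j))"

definition mpoly_deriv :: "'n \<Rightarrow> 'n mpoly \<Rightarrow> 'n mpoly" where
  "mpoly_deriv j p =
     (\<Sum>m\<in>Poly_Mapping.keys p.
        Poly_Mapping.single (m - Poly_Mapping.single j 1)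
          (of_nat (Poly_Mapping.lookup m j) * Poly_Mapping.lookup p m))"

text \<open>The polynomial \<open>p(l\<^sub>1 x\<^sub>1, \<dots>, l\<^sub>n x\<^sub>n)\<close>.\<close>

definition mpoly_diag :: "complex ^ 'n \<Rightarrow> 'n::finite mpoly \<Rightarrow> 'n mpoly" where
  "mpoly_diag l p =
     Poly_Mapping.mapp (\<lambda>m c. (\<Prod>j\<in>UNIV. (l $ j) ^ Poly_Mapping.lookup m j) * c) p"

text \<open>Restriction to the coordinate subspace \<open>{x. \<forall>j. j \<notin> I \<longrightarrow> x\<^sub>j = 0}\<close>.\<close>

definition mpoly_restrict :: "'n set \<Rightarrow> 'n mpoly \<Rightarrow> 'n mpoly" where
  "mpoly_restrict I p =
     Poly_Mapping.mapp (\<lambda>m c. if Poly_Mapping.keys m \<subseteq> I then c else 0) p"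

definition isolated_critical_point_0 :: "'n::finite mpoly \<Rightarrow> bool" where
  "isolated_critical_point_0 p \<longleftrightarrow>
     (\<forall>j. mpoly_eval (mpoly_deriv j p) 0 = 0) \<and>
     (\<forall>\<^sub>F z in at 0. \<exists>j. mpoly_eval (mpoly_deriv j p) z \<noteq> 0)"

definition quasihomogeneous :: "'n::finite mpoly \<Rightarrow> bool" where
  "quasihomogeneous p \<longleftrightarrow>
     (\<exists>(w :: 'n \<Rightarrow> nat) d. (\<forall>j. w j > 0) \<and> d > 0 \<and>
        (\<forall>m\<in>Poly_Mapping.keys p. (\<Sum>j\<in>UNIV. w j * Poly_Mapping.lookup m j) = d))"


section \<open>Invertible polynomials\<close>

definition mpoly_of :: "nat ^ 'n ^ 'n \<Rightarrow> complex ^ 'n \<Rightarrow> 'n::finite mpoly" where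
  "mpoly_of E a =
     (\<Sum>i\<in>UNIV. Poly_Mapping.single (\<Sum>j\<in>UNIV. Poly_Mapping.single j (E $ i $ j)) (a $ i))"

definition rat_matrix :: "nat ^ 'n ^ 'n \<Rightarrow> rat ^ 'n ^ 'n::finite" where
  "rat_matrix E = (\<chi> i j. of_nat (E $ i $ j))"

text \<open>The transpose of \<open>mpoly_of E a\<close> is \<open>mpoly_of (transpose E) a\<close>.\<close>

definition invertible_poly :: "nat ^ 'n ^ 'n \<Rightarrow> complex ^ 'n::finite \<Rightarrow> bool" where
  "invertible_poly E a \<longleftrightarrow>
     (\<forall>i. a $ i \<noteq> 0) \<and> det (rat_matrix E) \<noteq> 0 \<and>
     quasihomogeneous (mpoly_of E a) \<and>
     isolated_critical_point_0 (mpoly_of E a) \<and>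
     isolated_critical_point_0 (mpoly_of (transpose E) a)"

text \<open>Here \<open>1\<close> is the all-ones vector; in these weights \<open>mpoly_of E a\<close> has degree 1.\<close>

definition weights :: "nat ^ 'n ^ 'n \<Rightarrow> rat ^ 'n::finite" where
  "weights E = matrix_inv (rat_matrix E) *v 1"


section \<open>Diagonal symmetries and the dual group\<close>

text \<open>A diagonal matrix is represented by the vector of its diagonal entries; multiplication of
  vectors is componentwise and \<open>1\<close> is the all-ones vector.\<close>

definition diag_symmetries :: "'n::finite mpoly \<Rightarrow> (complex ^ 'n) monoid" where
  "diag_symmetries p =
     \<lparr>carrier = {l. (\<forall>j. l $ j \<noteq> 0) \<and> mpoly_diag l p = p}, mult = (*), one = 1\<rparr>"

text \<open>For a root of unity \<open>z\<close>: the \<open>r\<close> with \<open>0 \<le> r < 1\<close> and \<open>z = exp(2 \<pi> \<i> r)\<close>.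
  All entries of diagonal symmetries of an invertible polynomial are roots of unity.\<close>

definition phase :: "complex \<Rightarrow> rat" where
  "phase z = (THE r. 0 \<le> r \<and> r < 1 \<and> z = cis (2 * pi * of_rat r))"

definition age :: "complex ^ 'n::finite \<Rightarrow> rat" where
  "age g = (\<Sum>j\<in>UNIV. phase (g $ j))"

text \<open>The pairing \<open>b\<^sup>T E a\<close> modulo integers does not depend on the
  representatives of \<open>a\<close> and \<open>b\<close> modulo integer vectors, so those given by \<open>phase\<close> may be used.\<close>

definition dual_group ::
    "nat ^ 'n ^ 'n \<Rightarrow> complex ^ 'n \<Rightarrow> (complex ^ 'n) set \<Rightarrow> (complex ^ 'n::finite) set" where
  "dual_group E a G =
     {h \<in> carrier (diag_symmetries (mpoly_of (transpose E) a)).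
        \<forall>g\<in>G. (\<Sum>i\<in>UNIV. \<Sum>j\<in>UNIV. phase (h $ i) * of_nat (E $ i $ j) * phase (g $ j)) \<in> \<int>}"


section \<open>Polynomial differential forms\<close>

text \<open>\<open>\<omega> J\<close> is the coefficient of \<open>dx\<^sub>J = dx\<^bsub>j1\<^esub> \<and> \<dots> \<and> dx\<^bsub>jk\<^esub>\<close>, where \<open>j1 < \<dots> < jk\<close> are the
  elements of \<open>J\<close>.\<close>

type_synonym 'n form = "'n set \<Rightarrow> 'n mpoly"

text \<open>The \<open>k\<close>-forms on the coordinate subspace with coordinates \<open>x\<^sub>j\<close>, \<open>j \<in> I\<close>.\<close>

definition forms :: "'n set \<Rightarrow> nat \<Rightarrow> 'n form set" where
  "forms I k =
     {\<omega>. \<forall>J. (\<omega> J \<noteq> 0 \<longrightarrow> J \<subseteq> I \<and> card J = k) \<and>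
             (\<forall>m\<in>Poly_Mapping.keys (\<omega> J). Poly_Mapping.keys m \<subseteq> I)}"

definition differential :: "'n mpoly \<Rightarrow> 'n form" where
  "differential p = (\<lambda>J. if card J = 1 then mpoly_deriv (the_elem J) p else 0)"

text \<open>\<open>dx\<^sub>J \<and> dx\<^bsub>K - J\<^esub>\<close> is \<open>dx\<^sub>K\<close> up to the sign of the shuffle, whose inversions are counted.\<close>

definition wedge :: "'n::linorder form \<Rightarrow> 'n form \<Rightarrow> 'n form" where
  "wedge \<alpha> \<beta> =
     (\<lambda>K. \<Sum>J\<in>Pow K. (- 1) ^ card {(i, j). i \<in> J \<and> j \<in> K - J \<and> j < i} * \<alpha> J * \<beta> (K - J))"

text \<open>Pullback along \<open>x \<mapsto> (l\<^sub>1 x\<^sub>1, \<dots>, l\<^sub>n x\<^sub>n)\<close>.\<close>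

definition form_diag :: "complex ^ 'n \<Rightarrow> 'n::finite form \<Rightarrow> 'n form" where
  "form_diag l \<omega> = (\<lambda>J. mpoly_smult (\<Prod>j\<in>J. l $ j) (mpoly_diag l (\<omega> J)))"

definition form_homogeneous :: "rat ^ 'n \<Rightarrow> rat \<Rightarrow> 'n::finite form \<Rightarrow> bool" where
  "form_homogeneous w d \<omega> \<longleftrightarrow>
     (\<forall>J. \<forall>m\<in>Poly_Mapping.keys (\<omega> J).
        (\<Sum>j\<in>UNIV. w $ j * of_nat (Poly_Mapping.lookup m j)) + (\<Sum>j\<in>J. w $ j) = d)"

definition form_lincomb :: "('n form \<Rightarrow> complex) \<Rightarrow> 'n form set \<Rightarrow> 'n form" where
  "form_lincomb c B = (\<lambda>J. \<Sum>\<omega>\<in>B. mpoly_smult (c \<omega>) (\<omega> J))"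

text \<open>For subspaces \<open>V\<close> and \<open>W\<close>: the classes modulo \<open>W\<close> of the elements of \<open>B\<close> are
  distinct and form a basis of the image of \<open>V\<close> in the quotient by \<open>W\<close>.\<close>

definition basis_mod :: "'n form set \<Rightarrow> 'n form set \<Rightarrow> 'n form set \<Rightarrow> bool" where
  "basis_mod B V W \<longleftrightarrow>
     finite B \<and> B \<subseteq> V \<and>
     (\<forall>c. form_lincomb c B \<in> W \<longrightarrow> (\<forall>\<omega>\<in>B. c \<omega> = 0)) \<and>
     (\<forall>\<omega>\<in>V. \<exists>c. (\<lambda>J. \<omega> J - form_lincomb c B J) \<in> W)"

definition dim_mod :: "'n form set \<Rightarrow> 'n form set \<Rightarrow> nat" where
  "dim_mod V W = (if \<exists>B. basis_mod B V W then card (SOME B. basis_mod B V W) else 0)"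


section \<open>The quantum cohomology group\<close>

text \<open>The order on the index type serves only to fix the signs in \<open>wedge\<close>.\<close>

type_synonym 'n exponent_matrix = "nat ^ 'n ^ 'n"
type_synonym 'n diag = "complex ^ 'n"

text \<open>The fixed subspace of \<open>g\<close> is the coordinate subspace with coordinates
  \<open>x\<^sub>j\<close>, \<open>j \<in> fixed_coords g\<close>.\<close>

definition fixed_coords :: "complex ^ 'n \<Rightarrow> 'n::finite set" where
  "fixed_coords g = {j. g $ j = 1}"

definition fixed_dim :: "complex ^ 'n::finite \<Rightarrow> nat" where
  "fixed_dim g = card (fixed_coords g)"

text \<open>The subspace of top forms on the fixed subspace by which one divides to obtain
  \<open>\<Omega>\<close> of the restriction of \<open>p\<close>. If \<open>fixed_dim g = 0\<close> it is \<open>0\<close>, because the differential vanishes;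
  truncated subtraction does no harm.\<close>

definition df_wedge :: "'n::{finite,linorder} mpoly \<Rightarrow> 'n diag \<Rightarrow> 'n form set" where
  "df_wedge p g =
     wedge (differential (mpoly_restrict (fixed_coords g) p)) `
       forms (fixed_coords g) (fixed_dim g - 1)"

text \<open>The dimension of the \<open>G\<close>-invariant part of the \<open>(p, q)\<close> component of the vanishing cohomology of
  the restriction of \<open>mpoly_of E a\<close> to the fixed subspace of \<open>g\<close>. A class is \<open>G\<close>-invariant if it
  contains, with \<open>\<omega>\<close>, all its translates.\<close>

definition hodge_dim ::
    "'n::{finite,linorder} exponent_matrix \<Rightarrow> 'n diag \<Rightarrow> 'n diag set \<Rightarrow> 'n diag \<Rightarrow>
     rat \<Rightarrow> rat \<Rightarrow> nat" where
  "hodge_dim E a G g p q =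
     (if p + q = of_nat (fixed_dim g) then
        dim_mod
          {\<omega> \<in> forms (fixed_coords g) (fixed_dim g).
             form_homogeneous (weights E) q \<omega> \<and>
             (\<forall>h\<in>G. (\<lambda>J. form_diag h \<omega> J - \<omega> J) \<in> df_wedge (mpoly_of E a) g)}
          (df_wedge (mpoly_of E a) g)
      else 0)"

definition bigraded_dim ::
    "nat \<Rightarrow> 'n::{finite,linorder} exponent_matrix \<Rightarrow> 'n diag \<Rightarrow> 'n diag set \<Rightarrow>
     rat \<Rightarrow> rat \<Rightarrow> nat" where
  "bigraded_dim i E a G p q =
     (\<Sum>g\<in>{g \<in> G. fixed_dim g mod 2 = i}. hodge_dim E a G g (p - age g) (q - age g))"

text \<open>A formal sum of monomials in two variables \<open>t, u\<close> with rational exponents is represented by the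
  function mapping \<open>\<alpha>\<close> and \<open>\<beta>\<close> to the coefficient of \<open>t\<^sup>\<alpha> u\<^sup>\<beta>\<close>.\<close>

type_synonym formal_sum = "rat \<Rightarrow> rat \<Rightarrow> nat"

definition E_function ::
    "nat \<Rightarrow> 'n::{finite,linorder} exponent_matrix \<Rightarrow> 'n diag \<Rightarrow> 'n diag set \<Rightarrow>
     formal_sum" where
  "E_function i E a G =
     (\<lambda>\<alpha> \<beta>. bigraded_dim i E a G (\<alpha> + of_nat CARD('n) / 2) (\<beta> + of_nat CARD('n) / 2))"

definition invert_first :: "formal_sum \<Rightarrow> formal_sum" where
  "invert_first F = (\<lambda>\<alpha> \<beta>. F (- \<alpha>) \<beta>)"

end

theory Submission
  imports Defs
begin

text \<open>Let \<open>\<alpha>\<close> be the phases of an element of \<open>G\<close>, \<open>I = {j. \<alpha> j = 0}\<close>, and write a monomial top form on the fixed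
  subspace as \<open>x\<^sup>u dx\<^sub>I / x\<^sub>I\<close>. With \<open>u = E\<^sup>T c\<close> its degree is \<open>\<Sum>\<^sub>i c\<^sub>i\<close>, and it is \<open>G\<close>-invariant if and
  only if \<open>c\<close> modulo integers is an element \<open>b\<close> of the dual group. So the invariant part of the
  Jacobian module is a sum over such \<open>b\<close> of sectors attached to \<open>(E, \<alpha>, b)\<close>. As the dual of the dual
  group is \<open>G\<close>, it suffices to compare the sectors of \<open>(E, \<alpha>, b)\<close> and \<open>(E\<^sup>T, b, \<alpha>)\<close>: they have the same
  dimension, each lives in a single degree, and the two degrees match.

  This is an induction on the number of variables. A monomial \<open>x y\<close> forces a similar column, or row, and
  is eliminated together with it. (In its presence the polynomial need not be a sum of chains
  and loops, so that this classification is not available.) If there is no such monomial, then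
  every row has an entry \<open>\<ge> 2\<close> and at most one further entry, which is \<open>1\<close>. Then the sector
  has a basis indexed by certain subsets of \<open>{i. \<alpha>\<^sub>i = 0 \<and> b\<^sub>i = 0}\<close>, called alternating below, and duality
  is the passage to complements.\<close>

section \<open>Sectors\<close>

text \<open>Working with functionals on the quotient instead of the quotient itself turns linear
  independence into a construction of functionals and generation into a uniqueness statement. Both
  have concrete sources. For unit coefficients the integral of exp(-f) x^u dx/x is, up to a
  constant, the product of the values Gamma(c_i), as taking the monomials for new variables shows.
  Integration by parts along x_j makes the sum over i of E_ij \<psi>(\<open>raise i c\<close>) equal
  to u_j \<psi>(c), which is the required relation where u_j = 0. The product cannot be used as it
  stands: integral coordinates meet the poles, and for u_j > 0 the right side has to be 0 as well.
  Cutting it down to one sign pattern and one degree repairs both, and the admissible sign patterns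
  are the alternating sets. In the elimination, f = x y + x M + g(y, z), the variable x acts as a
  Lagrange multiplier that enforces y = -M and leaves g(-M, z). Rows and columns are kept as
  separate index sets so that each argument applies to a matrix and to its transpose.\<close>

text \<open>\<open>pull E R c\<close> is the exponent vector \<open>u = E\<^sup>T c\<close> of the form \<open>x\<^sup>u dx\<^sub>I / x\<^sub>I\<close> with coordinates \<open>c\<close>, and
  \<open>states\<close> are the coordinates of monomial top forms. Multiplication by the \<open>i\<close>-th monomial is \<open>raise i\<close>.
  The quotient by the Jacobian ideal is described by the linear functionals that vanish on the
  multiples of the partial derivatives; \<open>walls\<close> are the coordinates \<open>c\<close> for which \<open>x\<^sub>j x\<^sup>u / x\<^sub>I\<close> is a
  polynomial, so that its product with the \<open>j\<close>-th derivative gives a relation.\<close>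

definition pull :: "('r \<Rightarrow> 'c \<Rightarrow> nat) \<Rightarrow> 'r set \<Rightarrow> ('r \<Rightarrow> rat) \<Rightarrow> 'c \<Rightarrow> rat" where
  "pull E R c j = (\<Sum>i\<in>R. of_nat (E i j) * c i)"

definition coset :: "'r set \<Rightarrow> ('r \<Rightarrow> rat) \<Rightarrow> ('r \<Rightarrow> rat) set" where
  "coset R b = {c. (\<forall>i\<in>R. c i - b i \<in> \<int>) \<and> (\<forall>i. i \<notin> R \<longrightarrow> c i = 0)}"

definition states ::
    "('r \<Rightarrow> 'c \<Rightarrow> nat) \<Rightarrow> 'r set \<Rightarrow> 'c set \<Rightarrow> 'c set \<Rightarrow> ('r \<Rightarrow> rat) \<Rightarrow> ('r \<Rightarrow> rat) set" where
  "states E R C I b =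
     {c \<in> coset R b. (\<forall>j\<in>I. pull E R c j > 0) \<and> (\<forall>j\<in>C - I. pull E R c j = 0)}"

definition walls ::
    "('r \<Rightarrow> 'c \<Rightarrow> nat) \<Rightarrow> 'r set \<Rightarrow> 'c set \<Rightarrow> 'c set \<Rightarrow> ('r \<Rightarrow> rat) \<Rightarrow> 'c \<Rightarrow> ('r \<Rightarrow> rat) set" where
  "walls E R C I b j =
     {c \<in> coset R b. pull E R c j \<ge> 0 \<and> (\<forall>k\<in>I - {j}. pull E R c k > 0) \<and>
        (\<forall>k\<in>C - I. pull E R c k = 0)}"

definition raise :: "'r \<Rightarrow> ('r \<Rightarrow> rat) \<Rightarrow> 'r \<Rightarrow> rat" where
  "raise i c = c(i := c i + 1)"

definition lower :: "'r \<Rightarrow> ('r \<Rightarrow> rat) \<Rightarrow> 'r \<Rightarrow> rat" where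
  "lower i c = c(i := c i - 1)"

definition functionals ::
    "('r \<Rightarrow> 'c \<Rightarrow> nat) \<Rightarrow> 'r set \<Rightarrow> 'c set \<Rightarrow> 'c set \<Rightarrow> ('r \<Rightarrow> complex) \<Rightarrow> ('r \<Rightarrow> rat) \<Rightarrow>
     (('r \<Rightarrow> rat) \<Rightarrow> complex) set" where
  "functionals E R C I a b =
     {\<psi>. (\<forall>c. c \<notin> states E R C I b \<longrightarrow> \<psi> c = 0) \<and>
         (\<forall>j\<in>I. \<forall>c\<in>walls E R C I b j.
            (\<Sum>i\<in>R. a i * of_nat (E i j) * \<psi> (raise i c)) = 0)}"

text \<open>\<open>B\<close> represents a basis of the sector, all of whose degrees are \<open>\<kappa>\<close>.\<close>

definition sector_dim ::
    "('r \<Rightarrow> 'c \<Rightarrow> nat) \<Rightarrow> 'r set \<Rightarrow> 'c set \<Rightarrow> 'c set \<Rightarrow> ('r \<Rightarrow> complex) \<Rightarrow> ('r \<Rightarrow> rat) \<Rightarrow>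
     rat \<Rightarrow> nat \<Rightarrow> bool" where
  "sector_dim E R C I a b \<kappa> N \<longleftrightarrow>
     (\<exists>B. finite B \<and> card B = N \<and> B \<subseteq> states E R C I b \<and> (\<forall>c\<in>B. sum c R = \<kappa>) \<and>
        (\<forall>v. \<exists>\<psi>\<in>functionals E R C I a b. \<forall>c\<in>B. \<psi> c = v c) \<and>
        (\<forall>\<psi>\<in>functionals E R C I a b. (\<forall>c\<in>B. \<psi> c = 0) \<longrightarrow> (\<forall>c. \<psi> c = 0)))"

text \<open>Complex coefficients, because the combinations to which it is applied have values of
  functionals as coefficients.\<close>

definition independent_rows :: "('r \<Rightarrow> 'c \<Rightarrow> nat) \<Rightarrow> 'r set \<Rightarrow> 'c set \<Rightarrow> bool" where
  "independent_rows E R C \<longleftrightarrow>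
     (\<forall>x :: 'r \<Rightarrow> complex. (\<forall>j\<in>C. (\<Sum>i\<in>R. x i * of_nat (E i j)) = 0) \<longrightarrow> (\<forall>i\<in>R. x i = 0))"

lemma raise_lower [simp]: "raise i (lower i c) = c" "lower i (raise i c) = c"
  by (auto simp: raise_def lower_def)

lemma raise_commute: "raise i (raise j c) = raise j (raise i c)"
  by (auto simp: raise_def fun_eq_iff)

lemma raise_lower_commute: "raise i (lower j c) = lower j (raise i c)"
  by (auto simp: raise_def lower_def fun_eq_iff)

lemma pull_raise:
  assumes "finite R" "i \<in> R"
  shows "pull E R (raise i c) j = pull E R c j + of_nat (E i j)"
proof -
  have "pull E R (raise i c) j = of_nat (E i j) * (c i + 1) + (\<Sum>k\<in>R - {i}. of_nat (E k j) * c k)"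
    unfolding pull_def raise_def using assms by (subst sum.remove[of _ i]) auto
  moreover have "pull E R c j = of_nat (E i j) * c i + (\<Sum>k\<in>R - {i}. of_nat (E k j) * c k)"
    unfolding pull_def using assms by (subst sum.remove[of _ i]) auto
  ultimately show ?thesis by (simp add: algebra_simps)
qed

lemma pull_lower:
  assumes "finite R" "i \<in> R"
  shows "pull E R (lower i c) j = pull E R c j - of_nat (E i j)"
  using pull_raise[OF assms, of E "lower i c" j] by simp

lemma sum_raise:
  assumes "finite R" "i \<in> R"
  shows "sum (raise i c) R = sum c R + 1"
  using pull_raise[OF assms, of "\<lambda>_ _. 1" c] by (simp add: pull_def)

lemma coset_raise:
  assumes "c \<in> coset R b" "i \<in> R"
  shows "raise i c \<in> coset R b"
proof -
  have "c i + 1 - b i = (c i - b i) + 1" by simp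
  also have "\<dots> \<in> \<int>" using assms by (intro Ints_add) (auto simp: coset_def)
  finally show ?thesis using assms by (auto simp: coset_def raise_def)
qed

lemma coset_lower:
  assumes "c \<in> coset R b" "i \<in> R"
  shows "lower i c \<in> coset R b"
proof -
  have "c i - b i \<in> \<int>" using assms by (auto simp: coset_def)
  hence "(c i - b i) - 1 \<in> \<int>" by (rule Ints_diff) simp
  moreover have "c i - b i - 1 = c i - 1 - b i" by simp
  ultimately have "c i - 1 - b i \<in> \<int>" by metis
  thus ?thesis using assms by (auto simp: coset_def lower_def)
qed

lemma pull_coset_Ints:
  assumes "finite R" "c \<in> coset R b" "pull E R b j \<in> \<int>"
  shows "pull E R c j \<in> \<int>"
proof -
  have "pull E R c j = pull E R b j + (\<Sum>i\<in>R. of_nat (E i j) * (c i - b i))"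
    unfolding pull_def by (simp add: sum.distrib[symmetric] algebra_simps)
  also have "\<dots> \<in> \<int>"
    using assms by (intro Ints_add Ints_sum Ints_mult) (auto simp: coset_def)
  finally show ?thesis .
qed

lemma states_subset_walls: "c \<in> states E R C I b \<Longrightarrow> j \<in> I \<Longrightarrow> c \<in> walls E R C I b j"
  by (auto simp: states_def walls_def intro: less_imp_le)

lemma functionals_zero_outside:
  "\<psi> \<in> functionals E R C I a b \<Longrightarrow> c \<notin> states E R C I b \<Longrightarrow> \<psi> c = 0"
  by (simp add: functionals_def)

lemma functionals_wall:
  assumes "\<psi> \<in> functionals E R C I a b" "j \<in> I" "c \<in> walls E R C I b j"
  shows "(\<Sum>i\<in>R. a i * of_nat (E i j) * \<psi> (raise i c)) = 0"
  using assms by (simp add: functionals_def)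

text \<open>At an interior point all columns give a relation, and the rows are independent.\<close>

lemma functionals_interior:
  assumes "finite R" "independent_rows E R C" "\<forall>i\<in>R. a i \<noteq> 0"
    and "\<psi> \<in> functionals E R C I a b" "c \<in> states E R C I b" "i \<in> R"
  shows "\<psi> (raise i c) = 0"
proof -
  have "(\<Sum>i\<in>R. (a i * \<psi> (raise i c)) * of_nat (E i j)) = 0" if j: "j \<in> C" for j
  proof (cases "j \<in> I")
    case True
    then show ?thesis
      using functionals_wall[OF assms(4) True states_subset_walls[OF assms(5) True]]
      by (simp add: mult_ac)
  next
    case False
    \<comment> \<open>Outside \<open>I\<close> there is no wall relation, but each term vanishes by
      itself: if row \<open>i\<close> contains x_j, raising it gives x_j a positive exponent and
      leaves the states.\<close>
    have "\<psi> (raise i c) * of_nat (E i j) = 0" if i: "i \<in> R" for i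
    proof (cases "E i j = 0")
      case nz: False
      have "pull E R (raise i c) j = of_nat (E i j)"
        using assms(5) j False by (simp add: pull_raise assms(1) i states_def)
      hence "raise i c \<notin> states E R C I b"
        using nz j False by (auto simp: states_def)
      thus ?thesis using functionals_zero_outside[OF assms(4)] by simp
    qed simp
    thus ?thesis by (intro sum.neutral) (simp add: mult.assoc)
  qed
  hence "\<forall>i\<in>R. a i * \<psi> (raise i c) = 0"
    using assms(2) unfolding independent_rows_def
    by (elim allE[of _ "\<lambda>i. a i * \<psi> (raise i c)"]) auto
  thus ?thesis using assms(3,6) by auto
qed

lemma functionals_lower:
  assumes "finite R" "independent_rows E R C" "\<forall>i\<in>R. a i \<noteq> 0"
    and "\<psi> \<in> functionals E R C I a b" "lower i c \<in> states E R C I b" "i \<in> R"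
  shows "\<psi> c = 0"
  using functionals_interior[OF assms] by simp

text \<open>The floor makes the exponent an integer everywhere, so that the rule for
  \<open>raise\<close> holds without reference to the coset.\<close>

definition coeff_power :: "('r \<Rightarrow> complex) \<Rightarrow> 'r set \<Rightarrow> ('r \<Rightarrow> rat) \<Rightarrow> ('r \<Rightarrow> rat) \<Rightarrow> complex" where
  "coeff_power a R b c = (\<Prod>i\<in>R. a i powi \<lfloor>c i - b i\<rfloor>)"

lemma coeff_power_raise:
  assumes "finite R" "\<forall>i\<in>R. a i \<noteq> 0" "i \<in> R"
  shows "coeff_power a R b (raise i c) = a i * coeff_power a R b c"
proof -
  have fl: "\<lfloor>c i + 1 - b i\<rfloor> = \<lfloor>c i - b i\<rfloor> + 1"
    by (metis add_diff_eq add.commute diff_add_eq floor_add_int of_int_1)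
  have "coeff_power a R b (raise i c) =
      a i powi \<lfloor>c i + 1 - b i\<rfloor> * (\<Prod>k\<in>R - {i}. a k powi \<lfloor>c k - b k\<rfloor>)"
    unfolding coeff_power_def raise_def using assms by (subst prod.remove[of _ i]) auto
  also have "\<dots> = a i * (a i powi \<lfloor>c i - b i\<rfloor> * (\<Prod>k\<in>R - {i}. a k powi \<lfloor>c k - b k\<rfloor>))"
    using assms by (simp only: fl, subst power_int_add) auto
  also have "a i powi \<lfloor>c i - b i\<rfloor> * (\<Prod>k\<in>R - {i}. a k powi \<lfloor>c k - b k\<rfloor>) = coeff_power a R b c"
    unfolding coeff_power_def using assms by (subst (2) prod.remove[of _ i]) auto
  finally show ?thesis .
qed

lemma coeff_power_nonzero:
  "finite R \<Longrightarrow> \<forall>i\<in>R. a i \<noteq> 0 \<Longrightarrow> coeff_power a R b c \<noteq> 0"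
  by (simp add: coeff_power_def)

text \<open>The coefficients can be absorbed by rescaling the variables.\<close>

lemma functionals_rescale:
  assumes "finite R" "\<forall>i\<in>R. a i \<noteq> 0"
  shows "(\<lambda>c. coeff_power a R b c * \<psi> c) \<in> functionals E R C I a' b \<longleftrightarrow>
    \<psi> \<in> functionals E R C I (\<lambda>i. a' i * a i) b"
proof -
  have "(\<Sum>i\<in>R. a' i * of_nat (E i j) * (coeff_power a R b (raise i c) * \<psi> (raise i c))) =
      coeff_power a R b c * (\<Sum>i\<in>R. a' i * a i * of_nat (E i j) * \<psi> (raise i c))" for j c
    unfolding sum_distrib_left
    by (intro sum.cong refl) (simp add: coeff_power_raise assms)
  thus ?thesis
    unfolding functionals_def using coeff_power_nonzero[OF assms, of b] by simp
qed

text \<open>Multiplication by a nowhere vanishing function identifies the two spaces of functionals;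
  supports and degrees do not change, so the same basis serves.\<close>

lemma sector_dim_rescale:
  assumes "finite R" "\<forall>i\<in>R. a i \<noteq> 0" "sector_dim E R C I a' b \<kappa> N"
  shows "sector_dim E R C I (\<lambda>i. a' i * a i) b \<kappa> N"
proof -
  let ?p = "coeff_power a R b"
  obtain B where B: "finite B" "card B = N" "B \<subseteq> states E R C I b" "\<forall>c\<in>B. sum c R = \<kappa>"
    and ex: "\<forall>v. \<exists>\<psi>\<in>functionals E R C I a' b. \<forall>c\<in>B. \<psi> c = v c"
    and un: "\<forall>\<psi>\<in>functionals E R C I a' b. (\<forall>c\<in>B. \<psi> c = 0) \<longrightarrow> (\<forall>c. \<psi> c = 0)"
    using assms(3) unfolding sector_dim_def by (elim exE conjE) (rule that)
  have nz: "?p c \<noteq> 0" for c using coeff_power_nonzero[OF assms(1,2)] .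
  have "\<exists>\<psi>\<in>functionals E R C I (\<lambda>i. a' i * a i) b. \<forall>c\<in>B. \<psi> c = v c" for v
  proof -
    obtain \<psi> where \<psi>: "\<psi> \<in> functionals E R C I a' b" "\<forall>c\<in>B. \<psi> c = ?p c * v c"
      by (rule bexE[OF spec[OF ex, of "\<lambda>c. ?p c * v c"]])
    have "(\<lambda>c. ?p c * (\<psi> c / ?p c)) = \<psi>" using nz by (simp add: fun_eq_iff)
    hence "(\<lambda>c. \<psi> c / ?p c) \<in> functionals E R C I (\<lambda>i. a' i * a i) b"
      using functionals_rescale[OF assms(1,2), of b "\<lambda>c. \<psi> c / ?p c" E C I a'] \<psi>(1)
      by (simp only:)
    moreover have "\<forall>c\<in>B. \<psi> c / ?p c = v c" using \<psi>(2) nz by simp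
    ultimately show ?thesis by (intro bexI)
  qed
  moreover have "\<forall>c. \<psi> c = 0"
    if "\<psi> \<in> functionals E R C I (\<lambda>i. a' i * a i) b" "\<forall>c\<in>B. \<psi> c = 0" for \<psi>
  proof -
    have "(\<lambda>c. ?p c * \<psi> c) \<in> functionals E R C I a' b"
      using functionals_rescale[OF assms(1,2)] that(1) by blast
    thus ?thesis using un[rule_format, of "\<lambda>c. ?p c * \<psi> c"] that(2) nz by auto
  qed
  ultimately show ?thesis unfolding sector_dim_def using B by (intro exI[of _ B]) blast
qed

text \<open>The floor only makes the sign total; it is evaluated at integral exponents.\<close>

definition alt_sign :: "rat \<Rightarrow> complex" where
  "alt_sign q = (- 1) powi \<lfloor>q\<rfloor>"

lemma alt_sign_add_nat: "alt_sign (q + of_nat n) = (- 1) ^ n * alt_sign q"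
proof -
  have "\<lfloor>q + of_nat n\<rfloor> = \<lfloor>q\<rfloor> + int n"
    by (metis floor_add_int of_int_of_nat_eq)
  thus ?thesis unfolding alt_sign_def by (simp add: power_int_add mult.commute)
qed

lemma alt_sign_1 [simp]: "alt_sign 1 = - 1"
  by (simp add: alt_sign_def)

section \<open>Elimination of a quadratic monomial\<close>

text \<open>The polynomial has the form a_r x y + a_s x M + g, where M and g do not contain x and M
  does not contain y. Its x-derivative determines y as a multiple of M. The hypotheses are symmetric
  under transposition when (r, s) and (x, y) are exchanged.\<close>

locale reduction =
  fixes E :: "'r \<Rightarrow> 'c \<Rightarrow> nat" and R :: "'r set" and C :: "'c set"
    and r s :: 'r and x y :: 'c
  assumes finR: "finite R" and rR: "r \<in> R" and sR: "s \<in> R" and rs: "r \<noteq> s"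
    and xC: "x \<in> C" and yC: "y \<in> C" and xy: "x \<noteq> y"
    and row_r: "\<And>j. j \<in> C \<Longrightarrow> E r j = of_bool (j = x \<or> j = y)"
    and col_x: "\<And>i. i \<in> R \<Longrightarrow> E i x = of_bool (i = r \<or> i = s)"
    and Esy: "E s y = 0"
    and indep: "independent_rows E R C"
begin

text \<open>The exponents of g after the substitution of M for y.\<close>

definition D :: "'r \<Rightarrow> 'c \<Rightarrow> nat" where "D i l = E i l + E i y * E s l"
definition R' :: "'r set" where "R' = R - {r, s}"
definition C' :: "'c set" where "C' = C - {x, y}"
definition ypart :: "('r \<Rightarrow> rat) \<Rightarrow> rat" where "ypart c = (\<Sum>i\<in>R'. of_nat (E i y) * c i)"
definition rst :: "('r \<Rightarrow> rat) \<Rightarrow> 'r \<Rightarrow> rat" where "rst c = (\<lambda>i. if i \<in> R' then c i else 0)"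
text \<open>With unit coefficients the substitution is y = -M, and this is the coefficient that
  monomial \<open>i\<close> acquires.\<close>

definition sgns :: "'r \<Rightarrow> complex" where "sgns i = (- 1) ^ E i y"

text \<open>The exponent vector of a lift has entry \<open>e\<close> at \<open>x\<close> and \<open>y\<close>; \<open>e = 1\<close> if these coordinates are
  fixed and \<open>e = 0\<close> otherwise.\<close>

definition lift :: "rat \<Rightarrow> ('r \<Rightarrow> rat) \<Rightarrow> 'r \<Rightarrow> rat" where
  "lift e d = d(s := ypart d, r := e - ypart d)"

lemma finR': "finite R'" using finR by (simp add: R'_def)
lemma R'D: "i \<in> R' \<Longrightarrow> i \<in> R \<and> i \<noteq> r \<and> i \<noteq> s" by (simp add: R'_def)
lemma R_eq: "R = insert r (insert s R')" using rR sR by (auto simp: R'_def)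
lemma C_eq: "C = insert x (insert y C')" using xC yC by (auto simp: C'_def)
lemma C'D: "l \<in> C' \<Longrightarrow> l \<in> C \<and> l \<noteq> x \<and> l \<noteq> y" by (simp add: C'_def)

lemma sum_R: "sum f R = f r + f s + sum f R'" for f :: "'r \<Rightarrow> 'z::comm_monoid_add"
proof -
  have "sum f (insert r (insert s R')) = f r + f s + sum f R'"
    using rs finR' by (simp add: R'_def add.assoc)
  thus ?thesis by (simp flip: R_eq)
qed

lemma entries [simp]: "E r x = 1" "E r y = 1" "E s x = 1"
  using row_r[OF xC] row_r[OF yC] col_x[OF sR] by auto

lemma entries' [simp]:
  "i \<in> R' \<Longrightarrow> E i x = 0" "l \<in> C' \<Longrightarrow> E r l = 0"
  using col_x[of i] row_r[of l] by (auto simp: R'_def C'_def)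

lemma pull_x: "pull E R c x = c r + c s"
  unfolding pull_def sum_R by simp

lemma pull_y: "pull E R c y = c r + ypart c"
  unfolding pull_def sum_R ypart_def by (simp add: Esy)

lemma pull_D: "pull D R' c l = pull E R' c l + ypart c * of_nat (E s l)"
  unfolding pull_def D_def ypart_def sum_distrib_right
  by (simp add: sum.distrib algebra_simps)

text \<open>By columns x and y, \<open>c s - ypart c\<close> is the difference of the exponents of x
  and y. On points where these agree, \<open>E\<close> and \<open>D\<close> have the same
  exponents.\<close>

lemma pull_l:
  assumes "l \<in> C'"
  shows "pull E R c l = pull D R' c l + (pull E R c x - pull E R c y) * of_nat (E s l)"
proof -
  have "pull E R c l = of_nat (E s l) * c s + pull E R' c l"
    unfolding pull_def sum_R using assms by simp
  thus ?thesis by (simp add: pull_D pull_x pull_y algebra_simps)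
qed

lemma pull_rst [simp]: "pull X R' (rst c) l = pull X R' c l"
  unfolding pull_def by (intro sum.cong) (auto simp: rst_def)

lemma ypart_rst [simp]: "ypart (rst c) = ypart c"
  unfolding ypart_def by (intro sum.cong) (auto simp: rst_def)

lemma rst_raise: "i \<in> R' \<Longrightarrow> rst (raise i c) = raise i (rst c)"
  by (auto simp: rst_def raise_def)

lemma rst_upd [simp]: "rst (c(r := a)) = rst c" "rst (c(s := a)) = rst c"
  "rst (raise r c) = rst c" "rst (raise s c) = rst c" "rst (lower r c) = rst c"
  by (auto simp: rst_def R'_def raise_def lower_def)

lemma ypart_upd [simp]: "ypart (c(r := a)) = ypart c" "ypart (c(s := a)) = ypart c"
  unfolding ypart_def by (intro sum.cong; auto simp: R'_def)+

lemma pullD_upd [simp]: "pull D R' (c(r := a)) = pull D R' c" "pull D R' (c(s := a)) = pull D R' c"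
  unfolding pull_def by (intro ext sum.cong; auto simp: R'_def)+

lemma pull_lift_x [simp]: "pull E R (lift e d) x = e"
  using rs by (simp add: pull_x lift_def)

lemma pull_lift_y [simp]: "pull E R (lift e d) y = e"
  using rs by (simp add: pull_y lift_def)

lemma pull_lift_l: "l \<in> C' \<Longrightarrow> pull E R (lift e d) l = pull D R' d l"
  by (simp add: pull_l) (simp add: lift_def)

lemma rst_lift: "(\<And>i. i \<notin> R' \<Longrightarrow> d i = 0) \<Longrightarrow> rst (lift e d) = d"
  by (auto simp: rst_def lift_def R'_def)

lemma sum_lift: "sum (lift e d) R = e + sum d R'"
proof -
  have "sum (lift e d) R' = sum d R'"
    by (intro sum.cong) (auto simp: lift_def R'_def)
  thus ?thesis unfolding sum_R using rs by (simp add: lift_def)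
qed

lemma lift_rst:
  assumes "\<And>i. i \<notin> R \<Longrightarrow> c i = 0" "pull E R c x = e" "pull E R c y = e"
  shows "lift e (rst c) = c"
proof
  fix i
  have "lift e (rst c) i = (if i = r then e - ypart c else if i = s then ypart c else rst c i)"
    by (simp add: lift_def)
  thus "lift e (rst c) i = c i"
    using assms rs by (cases "i \<in> R") (auto simp: rst_def R'_def pull_x pull_y)
qed

lemma inj_lift: "inj_on (lift e) {d. \<forall>i. i \<notin> R' \<longrightarrow> d i = 0}"
  by (rule inj_on_inverseI[of _ rst]) (auto intro: rst_lift)

lemma independent_D: "independent_rows D R' C'"
  unfolding independent_rows_def
proof (intro allI impI ballI)
  fix z :: "'r \<Rightarrow> complex" and i
  assume z: "\<forall>l\<in>C'. (\<Sum>i\<in>R'. z i * of_nat (D i l)) = 0" and i: "i \<in> R'"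
  \<comment> \<open>The extension of \<open>z\<close> to \<open>r\<close> and \<open>s\<close> is
    forced: column y requires the coefficient \<open>- t\<close> at \<open>r\<close>, and column x
    then requires \<open>t\<close> at \<open>s\<close>.\<close>
  define t where "t = (\<Sum>i\<in>R'. z i * of_nat (E i y))"
  define w where "w = z(s := t, r := - t)"
  have w: "w r = - t" "w s = t" using rs by (auto simp: w_def)
  have wz: "(\<Sum>i\<in>R'. w i * f i) = (\<Sum>i\<in>R'. z i * f i)" for f
    by (intro sum.cong) (auto simp: w_def R'_def)
  have "(\<Sum>i\<in>R. w i * of_nat (E i j)) = 0" if j: "j \<in> C" for j
  proof -
    consider "j = x" | "j = y" | "j \<in> C'" using j by (auto simp: C'_def)
    thus ?thesis
    proof cases
      case 1
      then show ?thesis by (simp add: sum_R w)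
    next
      case 2
      then show ?thesis by (simp add: sum_R w wz Esy t_def)
    next
      case 3
      have "(\<Sum>i\<in>R'. z i * of_nat (D i j)) = (\<Sum>i\<in>R'. z i * of_nat (E i j)) + t * of_nat (E s j)"
        unfolding t_def sum_distrib_right sum.distrib[symmetric]
      by (intro sum.cong) (simp_all add: D_def algebra_simps)
      then show ?thesis using z 3 by (simp add: sum_R w wz add.commute)
    qed
  qed
  hence "\<forall>i\<in>R. w i = 0" using indep unfolding independent_rows_def by blast
  thus "z i = 0" using i by (auto simp: w_def R'_def)
qed

end

text \<open>The last two assumptions express that \<open>I\<close> consists of the coordinates fixed
  by a diagonal symmetry: invariance of x y makes the phases of x and y add up to an integer, and
  invariance of x M then gives M a variable that is not fixed whenever x is not fixed.\<close>

locale reduction_sector = reduction +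
  fixes I :: "'b set" and b :: "'a \<Rightarrow> rat"
  assumes IC: "I \<subseteq> C" and bint: "\<And>j. j \<in> C \<Longrightarrow> pull E R b j \<in> \<int>"
    and x_iff_y: "x \<in> I \<longleftrightarrow> y \<in> I"
    and not_fixed: "x \<notin> I \<Longrightarrow> \<exists>l\<in>C' - I. E s l > 0"
begin

definition I' where "I' = I - {x, y}"

lemma I'C': "I' \<subseteq> C'" using IC by (auto simp: I'_def C'_def)
lemma C'I': "C' - I' = C' - I" by (auto simp: I'_def C'_def)
lemma I'D: "l \<in> I' \<Longrightarrow> l \<in> I \<and> l \<in> C' \<and> l \<in> C" using IC by (auto simp: I'_def C'_def)

lemma coset_rst: "c \<in> coset R b \<Longrightarrow> rst c \<in> coset R' b"
  by (auto simp: coset_def rst_def R'_def)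

text \<open>Modulo integers, column x identifies \<open>b s\<close> with \<open>- b r\<close>, and
  column y identifies \<open>- b r\<close> with \<open>ypart b\<close>.\<close>

lemma coset_lift:
  assumes "d \<in> coset R' b" "e \<in> \<int>"
  shows "lift e d \<in> coset R b"
proof -
  have x: "b r + b s \<in> \<int>" using bint[OF xC] by (simp add: pull_x)
  have y: "b r + ypart b \<in> \<int>" using bint[OF yC] by (simp add: pull_y)
  have "ypart d - ypart b = (\<Sum>i\<in>R'. of_nat (E i y) * (d i - b i))"
    unfolding ypart_def by (simp add: sum_subtractf algebra_simps)
  also have "\<dots> \<in> \<int>" using assms(1) by (intro Ints_sum Ints_mult) (auto simp: coset_def)
  finally have d: "ypart d - ypart b \<in> \<int>" .
  have "ypart d - b s = (ypart d - ypart b) + (b r + ypart b) - (b r + b s)" by simp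
  also have "\<dots> \<in> \<int>" by (rule Ints_diff[OF Ints_add[OF d y] x])
  finally have 1: "ypart d - b s \<in> \<int>" .
  have "e - ypart d - b r = e - (ypart d - b s) - (b r + b s)" by simp
  also have "\<dots> \<in> \<int>" by (rule Ints_diff[OF Ints_diff[OF assms(2) 1] x])
  finally have 2: "e - ypart d - b r \<in> \<int>" .
  show ?thesis
    using assms(1) 1 2 rR sR rs unfolding coset_def lift_def R'_def by auto
qed

end

context reduction_sector
begin

lemma pull_Ints: "c \<in> coset R b \<Longrightarrow> j \<in> C \<Longrightarrow> pull E R c j \<in> \<int>"
  by (rule pull_coset_Ints[OF finR _ bint])

lemma gt_1: "c \<in> coset R b \<Longrightarrow> j \<in> C \<Longrightarrow> pull E R c j > 0 \<Longrightarrow> pull E R c j \<noteq> 1 \<Longrightarrow> pull E R c j \<ge> 2"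
  by (drule (1) pull_Ints) (auto elim!: Ints_cases)

lemma ge_1: "c \<in> coset R b \<Longrightarrow> j \<in> C \<Longrightarrow> pull E R c j > 0 \<Longrightarrow> pull E R c j \<ge> 1"
  by (drule (1) pull_Ints) (auto elim!: Ints_cases)

lemma pull_raise_E [simp]: "i \<in> R \<Longrightarrow> pull E R (raise i c) j = pull E R c j + of_nat (E i j)"
  by (rule pull_raise[OF finR])

lemma pull_lower_E [simp]: "i \<in> R \<Longrightarrow> pull E R (lower i c) j = pull E R c j - of_nat (E i j)"
  by (rule pull_lower[OF finR])

lemma pull_raise_D [simp]: "i \<in> R' \<Longrightarrow> pull D R' (raise i c) j = pull D R' c j + of_nat (D i j)"
  by (rule pull_raise[OF finR'])

lemma rR' [simp]: "r \<in> R" "s \<in> R" using rR sR by auto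
lemma R'R [simp]: "i \<in> R' \<Longrightarrow> i \<in> R" by (simp add: R'_def)

text \<open>A relaxation of the states: nothing is required at x and y, and exponents outside
  \<open>I\<close> need only be nonnegative. Unlike the states, such points are stable under raising
  any row and under lowering \<open>r\<close>, so the elimination can pass through them.\<close>

definition weak :: "('a \<Rightarrow> rat) \<Rightarrow> bool" where
  "weak c \<longleftrightarrow> c \<in> coset R b \<and> (\<forall>l\<in>I'. pull E R c l > 0) \<and> (\<forall>l\<in>C' - I. pull E R c l \<ge> 0)"

lemma weak_coset: "weak c \<Longrightarrow> c \<in> coset R b" by (simp add: weak_def)

lemma weak_raise: "weak c \<Longrightarrow> i \<in> R \<Longrightarrow> weak (raise i c)"
  unfolding weak_def using coset_raise by (auto simp: add_pos_nonneg)

lemma weak_raise_wall: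
  assumes "c \<in> coset R b" "pull E R c l \<ge> 0" "\<forall>k\<in>I' - {l}. pull E R c k > 0"
    "\<forall>k\<in>C' - I. pull E R c k \<ge> 0" "i \<in> R" "E i l > 0"
  shows "weak (raise i c)"
proof -
  have "pull E R (raise i c) k > 0" if "k \<in> I'" for k
    using assms that by (cases "k = l") (auto simp: add_pos_nonneg add_nonneg_pos)
  thus ?thesis using assms unfolding weak_def by (auto simp: coset_raise)
qed

lemma weak_lower_r: "weak c \<Longrightarrow> weak (lower r c)"
  unfolding weak_def using coset_lower[of c R b r] I'C' by auto

end

section \<open>Elimination when x and y are fixed\<close>

locale reduction_fixed = reduction_sector +
  assumes xI: "x \<in> I"
begin

lemma yI: "y \<in> I" using xI x_iff_y by simp

lemma C_I: "C - I = C' - I" using xI yI by (auto simp: C'_def)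
lemma I_eq: "I = insert x (insert y I')" using xI yI by (auto simp: I'_def)

lemma states_iff:
  "c \<in> states E R C I b \<longleftrightarrow> weak c \<and> pull E R c x > 0 \<and> pull E R c y > 0 \<and>
     (\<forall>l\<in>C' - I. pull E R c l = 0)"
  unfolding states_def C_I weak_def using I_eq by auto

lemma wallsI:
  assumes "c \<in> coset R b" "pull E R c j \<ge> 0" "x \<noteq> j \<Longrightarrow> pull E R c x > 0"
    "y \<noteq> j \<Longrightarrow> pull E R c y > 0" "\<And>k. k \<in> I' \<Longrightarrow> k \<noteq> j \<Longrightarrow> pull E R c k > 0"
    "\<And>k. k \<in> C' - I \<Longrightarrow> pull E R c k = 0"
  shows "c \<in> walls E R C I b j"
  unfolding walls_def C_I using assms by (auto simp: I'_def)

lemma statesD_iff: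
  "d \<in> states D R' C' I' b \<longleftrightarrow> d \<in> coset R' b \<and> (\<forall>l\<in>I'. pull D R' d l > 0) \<and>
     (\<forall>l\<in>C' - I. pull D R' d l = 0)"
  unfolding states_def C'I' by auto

text \<open>A functional on the states of \<open>D\<close> is extended by eliminating first the exponent of \<open>x\<close>, using
  the relation of column \<open>y\<close>, and then that of \<open>y\<close>, using the relation of column \<open>x\<close>.\<close>

fun ext_aux :: "(('a \<Rightarrow> rat) \<Rightarrow> complex) \<Rightarrow> nat \<Rightarrow> ('a \<Rightarrow> rat) \<Rightarrow> complex" where
  "ext_aux \<psi> 0 c = (if c \<in> states E R C I b then - alt_sign (pull E R c y) * \<psi> (rst c) else 0)"
| "ext_aux \<psi> (Suc m) c =
     (if c \<in> states E R C I b \<and> pull E R c y = 1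
      then - (\<Sum>i\<in>R'. of_nat (E i y) * ext_aux \<psi> m (raise i (lower r c))) else 0)"

text \<open>The counter is the exponent of x less one, so the recursion ends at exponent 1. The sign
  of the base case is normalised to be 1 at y-exponent 1, so that \<open>ext\<close> agrees with
  \<psi> on lifted states.\<close>

definition ext :: "(('a \<Rightarrow> rat) \<Rightarrow> complex) \<Rightarrow> ('a \<Rightarrow> rat) \<Rightarrow> complex" where
  "ext \<psi> c = ext_aux \<psi> (nat \<lfloor>pull E R c x\<rfloor> - 1) c"

lemma ext_outside: "c \<notin> states E R C I b \<Longrightarrow> ext \<psi> c = 0"
  unfolding ext_def by (cases "nat \<lfloor>pull E R c x\<rfloor> - 1") simp_all

lemma pull_rl_x: "i \<in> R' \<Longrightarrow> pull E R (raise i (lower r c)) x = pull E R c x - 1" 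
  by simp

text \<open>There is no other choice: a state both of whose exponents exceed 1 lies above an
  interior point along the row x y, and every functional vanishes there.\<close>

lemma ext_zero:
  assumes "pull E R c x \<ge> 2" "pull E R c y \<noteq> 1"
  shows "ext \<psi> c = 0"
proof -
  have "nat \<lfloor>pull E R c x\<rfloor> - 1 \<noteq> 0" using assms(1) by linarith
  then obtain m where "nat \<lfloor>pull E R c x\<rfloor> - 1 = Suc m" using not0_implies_Suc by blast
  thus ?thesis using assms(2) by (simp add: ext_def)
qed

lemma ext_step:
  assumes "c \<in> states E R C I b" "pull E R c x \<ge> 2" "pull E R c y = 1"
  shows "ext \<psi> c = - (\<Sum>i\<in>R'. of_nat (E i y) * ext \<psi> (raise i (lower r c)))"
proof -
  have "nat \<lfloor>pull E R c x\<rfloor> - 1 \<noteq> 0" using assms(2) by linarith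
  then obtain m where m: "nat \<lfloor>pull E R c x\<rfloor> - 1 = Suc m" using not0_implies_Suc by blast
  hence "nat (\<lfloor>pull E R c x\<rfloor> - 1) - 1 = m" by linarith
  hence "ext \<psi> (raise i (lower r c)) = ext_aux \<psi> m (raise i (lower r c))" if "i \<in> R'" for i
    unfolding ext_def pull_rl_x[OF that] by simp
  thus ?thesis using assms m by (simp add: ext_def)
qed

text \<open>A weak point off the states has a positive exponent outside \<open>I\<close>. Since the
  y-exponent is at least 1, the corresponding exponent for \<open>D\<close> is at least as large, so
  \<psi> vanishes as well and the formula persists.\<close>

lemma ext_base:
  assumes \<psi>: "\<psi> \<in> functionals D R' C' I' a b" and c: "weak c" "pull E R c x = 1" "pull E R c y > 0"
  shows "ext \<psi> c = - alt_sign (pull E R c y) * \<psi> (rst c)"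
proof (cases "c \<in> states E R C I b")
  case True
  then show ?thesis using c by (simp add: ext_def)
next
  case False
  then obtain l where l: "l \<in> C' - I" "pull E R c l \<noteq> 0" using c unfolding states_iff by auto
  hence "pull E R c l > 0" using c(1) by (auto simp: weak_def order_less_le)
  moreover have "pull E R c l = pull D R' c l + (1 - pull E R c y) * of_nat (E s l)"
    using pull_l[of l c] l c by simp
  moreover have "(1 - pull E R c y) * of_nat (E s l) \<le> 0"
    using ge_1[OF weak_coset[OF c(1)] yC c(3)] by (simp add: mult_nonpos_nonneg)
  ultimately have "pull D R' (rst c) l > 0" by simp
  hence "rst c \<notin> states D R' C' I' b" using l unfolding statesD_iff by auto
  thus ?thesis using functionals_zero_outside[OF \<psi>] ext_outside[OF False] by simp
qed

text \<open>The vanishing extends to points whose exponents outside \<open>I\<close> are nonnegative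
  instead of zero: once such an exponent is positive, every raised point lies outside the
  states.\<close>

lemma functionalD_interior:
  assumes \<psi>: "\<psi> \<in> functionals D R' C' I' a b" and a: "\<forall>i\<in>R'. a i \<noteq> 0"
    and d: "d \<in> coset R' b" "\<And>l. l \<in> I' \<Longrightarrow> pull D R' d l > 0"
      "\<And>l. l \<in> C' - I \<Longrightarrow> pull D R' d l \<ge> 0" and i: "i \<in> R'"
  shows "\<psi> (raise i d) = 0"
proof (cases "\<forall>l\<in>C' - I. pull D R' d l = 0")
  case True
  hence "d \<in> states D R' C' I' b" using d unfolding statesD_iff by auto
  thus ?thesis using functionals_interior[OF finR' independent_D a \<psi> _ i] by blast
next
  case False
  then obtain l where l: "l \<in> C' - I" "pull D R' d l > 0" using d(3) by force
  hence "pull D R' (raise i d) l > 0" using i by (simp add: add_pos_nonneg)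
  hence "raise i d \<notin> states D R' C' I' b" using l unfolding statesD_iff by auto
  thus ?thesis using functionals_zero_outside[OF \<psi>] by simp
qed

lemma coset_rst': "weak c \<Longrightarrow> rst c \<in> coset R' b"
  by (simp add: coset_rst weak_coset)

lemma functionalD_wall:
  assumes \<psi>: "\<psi> \<in> functionals D R' C' I' a b" and l: "l \<in> I'"
    and d: "d \<in> coset R' b" "pull D R' d l \<ge> 0" "\<And>k. k \<in> I' \<Longrightarrow> k \<noteq> l \<Longrightarrow> pull D R' d k > 0"
      "\<And>k. k \<in> C' - I \<Longrightarrow> pull D R' d k \<ge> 0"
  shows "(\<Sum>i\<in>R'. a i * of_nat (D i l) * \<psi> (raise i d)) = 0"
proof (cases "\<forall>k\<in>C' - I. pull D R' d k = 0")
  case True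
  hence "d \<in> walls D R' C' I' b l" using d unfolding walls_def C'I' by auto
  thus ?thesis using functionals_wall[OF \<psi> l] by blast
next
  case False
  then obtain k where k: "k \<in> C' - I" "pull D R' d k > 0" using d(4) by force
  have "\<psi> (raise i d) = 0" if "i \<in> R'" for i
  proof -
    have "pull D R' (raise i d) k > 0" using k that by (simp add: add_pos_nonneg)
    hence "raise i d \<notin> states D R' C' I' b" using k(1) unfolding statesD_iff by auto
    thus ?thesis using functionals_zero_outside[OF \<psi>] by simp
  qed
  thus ?thesis by simp
qed

lemma sgns_nonzero: "\<forall>i\<in>R'. sgns i \<noteq> 0" by (simp add: sgns_def)

lemma pullD_eq: "l \<in> C' \<Longrightarrow>
    pull D R' c l = pull E R c l + (pull E R c y - pull E R c x) * of_nat (E s l)"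
  by (simp add: pull_l algebra_simps)

lemma weak_off: "weak c \<Longrightarrow> c \<notin> states E R C I b \<Longrightarrow> pull E R c x > 0 \<Longrightarrow> pull E R c y > 0 \<Longrightarrow>
    \<exists>k\<in>C' - I. pull E R c k > 0"
  unfolding states_iff weak_def by (auto simp: order_less_le)

text \<open>Both relations that involve the coordinates \<open>l \<noteq> x, y\<close>, by a common induction on the exponent
  of \<open>x\<close>.\<close>

lemma ext_interior_and_walls:
  assumes \<psi>: "\<psi> \<in> functionals D R' C' I' sgns b"
  shows "(\<forall>c i. weak c \<longrightarrow> pull E R c x = of_nat (Suc m) \<longrightarrow> pull E R c y > 0 \<longrightarrow> i \<in> R \<longrightarrow>
        ext \<psi> (raise i c) = 0) \<and>
    (\<forall>c l. c \<in> coset R b \<longrightarrow> pull E R c x = of_nat (Suc m) \<longrightarrow> pull E R c y > 0 \<longrightarrow>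
      l \<in> I' \<longrightarrow> pull E R c l = 0 \<longrightarrow> (\<forall>k\<in>I' - {l}. pull E R c k > 0) \<longrightarrow>
      (\<forall>k\<in>C' - I. pull E R c k \<ge> 0) \<longrightarrow>
      of_nat (E s l) * ext \<psi> (raise s c) + (\<Sum>i\<in>R'. of_nat (E i l) * ext \<psi> (raise i c)) = 0)"
proof (induction m)
  case 0
  have int: "ext \<psi> (raise i c) = 0"
    if c: "weak c" "pull E R c x = 1" "pull E R c y > 0" and i: "i \<in> R" for c i
  proof -
    have uy: "pull E R c y \<ge> 1" using ge_1[OF weak_coset yC] c by simp
    have zero: "\<psi> (raise j (rst c)) = 0" if "j \<in> R'" for j
    proof (rule functionalD_interior[OF \<psi> sgns_nonzero coset_rst'[OF c(1)] _ _ that])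
      fix l assume "l \<in> I'"
      thus "pull D R' (rst c) l > 0" using c uy I'C' by (auto simp: pullD_eq weak_def add_pos_nonneg)
    next
      fix l assume "l \<in> C' - I"
      thus "pull D R' (rst c) l \<ge> 0" using c uy by (auto simp: pullD_eq weak_def)
    qed
    \<comment> \<open>Raising \<open>r\<close> makes both exponents at least 2, where
      \<open>ext\<close> vanishes. Raising \<open>s\<close> is unfolded once by the recursion. The
      other rows keep the x-exponent 1, at which \<open>ext\<close> is given by \<psi>.\<close>
    consider "i = r" | "i = s" | "i \<in> R'" using i by (auto simp: R'_def)
    thus ?thesis
    proof cases
      case 1
      thus ?thesis using c by (intro ext_zero) auto
    next
      case 2
      show ?thesis
      proof (cases "pull E R c y = 1 \<and> raise s c \<in> states E R C I b")
        case True
        have "of_nat (E j y) * ext \<psi> (raise j (lower r (raise s c))) = 0" if j: "j \<in> R'" for j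
        proof (cases "E j y = 0")
          case False
          thus ?thesis
            using j c True zero[OF j]
            by (subst ext_base[OF \<psi>]) (auto intro!: weak_raise weak_lower_r simp: rst_raise Esy)
        qed simp
        thus ?thesis unfolding 2 using True c by (subst ext_step) (auto simp: Esy intro!: sum.neutral)
      next
        case False
        thus ?thesis unfolding 2 using c
          by (cases "pull E R c y = 1") (auto intro: ext_zero ext_outside simp: Esy)
      qed
    next
      case 3
      thus ?thesis
        using c zero[OF 3] by (subst ext_base[OF \<psi>]) (auto intro: weak_raise simp: rst_raise add_pos_nonneg)
    qed
  qed
  have wall: "of_nat (E s l) * ext \<psi> (raise s c) + (\<Sum>i\<in>R'. of_nat (E i l) * ext \<psi> (raise i c)) = 0"
    if c: "c \<in> coset R b" "pull E R c x = 1" "pull E R c y > 0"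
      and l: "l \<in> I'" "pull E R c l = 0" and pos: "\<forall>k\<in>I' - {l}. pull E R c k > 0"
      and off: "\<forall>k\<in>C' - I. pull E R c k \<ge> 0" for c l
  proof -
    have uy: "pull E R c y \<ge> 1" using ge_1[OF c(1) yC] c by simp
    have lC: "l \<in> C'" using l(1) I'C' by auto
    define d where "d = rst c"
    have d: "d \<in> coset R' b" by (simp add: d_def coset_rst c)
    have weak: "weak (raise i c)" if "i \<in> R" "E i l > 0" for i
      using that c l pos off by (intro weak_raise_wall[of c l]) auto
    have ud: "pull D R' d k = pull E R c k + (pull E R c y - 1) * of_nat (E s k)" if "k \<in> C'" for k
      unfolding d_def using that c by (simp add: pullD_eq)
    have "of_nat (E i l) * ext \<psi> (raise i c) =
        - alt_sign (pull E R c y) * (of_nat (E i l) * sgns i * \<psi> (raise i d))" if i: "i \<in> R'" for i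
    proof (cases "E i l = 0")
      case False
      have "ext \<psi> (raise i c) = - alt_sign (pull E R c y) * (sgns i * \<psi> (raise i d))"
        using c i weak[of i] False
        by (subst ext_base[OF \<psi>]) (auto simp: rst_raise d_def alt_sign_add_nat sgns_def add_pos_nonneg)
      thus ?thesis by simp
    qed simp
    hence S: "(\<Sum>i\<in>R'. of_nat (E i l) * ext \<psi> (raise i c)) =
        - alt_sign (pull E R c y) * (\<Sum>i\<in>R'. of_nat (E i l) * sgns i * \<psi> (raise i d))"
      by (simp add: sum_distrib_left)
    have wallD: "(\<Sum>i\<in>R'. sgns i * of_nat (D i l) * \<psi> (raise i d)) = 0"
      using uy c l pos off I'C' lC
      by (intro functionalD_wall[OF \<psi> l(1) d]) (auto simp: ud add_pos_nonneg)
    \<comment> \<open>For y-exponent above 1 the term of \<open>s\<close> is 0, and either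
      \<open>D\<close> and \<open>E\<close> agree in column l or the \<open>D\<close>-exponent at l
      is positive and every term vanishes. For y-exponent 1 the term of \<open>s\<close> unfolds and
      supplies the part \<open>E i y * E s l\<close> of \<open>D i l\<close>.\<close>
    show ?thesis
    proof (cases "pull E R c y = 1")
      case False
      have "(\<Sum>i\<in>R'. of_nat (E i l) * sgns i * \<psi> (raise i d)) = 0"
      proof (cases "E s l = 0")
        case True
        thus ?thesis using wallD by (simp add: D_def mult_ac)
      next
        case nz: False
        have "\<psi> (raise i d) = 0" if i: "i \<in> R'" for i
        proof (rule functionalD_interior[OF \<psi> sgns_nonzero d _ _ i])
          fix k assume k: "k \<in> I'"
          show "pull D R' d k > 0"
          proof (cases "k = l")
            case True
            thus ?thesis using nz False uy l lC by (simp add: ud)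
          next
            case False
            thus ?thesis using k pos uy I'C' by (auto simp: ud add_pos_nonneg)
          qed
        qed (use off uy in \<open>auto simp: ud\<close>)
        thus ?thesis by simp
      qed
      moreover have "ext \<psi> (raise s c) = 0" using False c by (intro ext_zero) (auto simp: Esy)
      ultimately show ?thesis using S by simp
    next
      case True
      have "of_nat (E s l) * ext \<psi> (raise s c) =
          of_nat (E s l) * (\<Sum>j\<in>R'. of_nat (E j y) * sgns j * \<psi> (raise j d))"
      proof (cases "E s l = 0")
        case False
        hence ws: "weak (raise s c)" using weak by simp
        show ?thesis
        proof (cases "raise s c \<in> states E R C I b")
          case st: True
          have "of_nat (E j y) * ext \<psi> (raise j (lower r (raise s c))) =
              - (of_nat (E j y) * sgns j * \<psi> (raise j d))" if j: "j \<in> R'" for j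
          proof (cases "E j y = 0")
            case False
            have "alt_sign (of_nat (E j y)) = sgns j"
              using alt_sign_add_nat[of 0 "E j y"] by (simp add: sgns_def) (simp add: alt_sign_def)
            thus ?thesis
              using j c True False ws
              by (subst ext_base[OF \<psi>])
                (auto intro!: weak_raise weak_lower_r simp: rst_raise Esy d_def)
          qed simp
          thus ?thesis using True c st by (subst ext_step) (auto simp: Esy sum_negf)
        next
          case nst: False
          obtain k where k: "k \<in> C' - I" "pull E R (raise s c) k > 0"
            using weak_off[OF ws nst] c by (auto simp: Esy)
          have "of_nat (E j y) * sgns j * \<psi> (raise j d) = 0" if j: "j \<in> R'" for j
          proof (cases "E j y = 0")
            case False
            have "0 < pull E R c k + of_nat (E s k)" using k by simp
            also have "of_nat (E s k) \<le> (of_nat (E j y * E s k) :: rat)"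
              unfolding of_nat_le_iff using False by simp
            finally have "0 < pull D R' (raise j d) k"
              using k True j by (simp add: ud D_def add_pos_nonneg)
            hence "raise j d \<notin> states D R' C' I' b" using k(1) unfolding statesD_iff by auto
            thus ?thesis using functionals_zero_outside[OF \<psi>] by simp
          qed simp
          hence "(\<Sum>j\<in>R'. of_nat (E j y) * sgns j * \<psi> (raise j d)) = 0"
            by (intro sum.neutral ballI)
          thus ?thesis using ext_outside[OF nst] by simp
        qed
      qed simp
      also have "\<dots> + (\<Sum>i\<in>R'. of_nat (E i l) * ext \<psi> (raise i c)) =
          (\<Sum>i\<in>R'. sgns i * of_nat (D i l) * \<psi> (raise i d))"
        unfolding S True by (simp add: D_def sum_distrib_left sum.distrib[symmetric] algebra_simps)
      finally show ?thesis using wallD by simp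
    qed
  qed
  show ?case using int wall by simp
next
  case (Suc m)
  note IH1 = Suc[THEN conjunct1, rule_format] and IH2 = Suc[THEN conjunct2, rule_format]
  have int: "ext \<psi> (raise i c) = 0"
    if c: "weak c" "pull E R c x = of_nat (Suc (Suc m))" "pull E R c y > 0" and i: "i \<in> R" for c i
  proof -
    have uy: "pull E R c y \<ge> 1" using ge_1[OF weak_coset yC] c by simp
    show ?thesis
    proof (cases "raise i c \<in> states E R C I b \<and> pull E R (raise i c) y = 1")
      case True
      have "i \<noteq> r" "pull E R c y = 1" "E i y = 0" using True uy i by auto
      have "of_nat (E j y) * ext \<psi> (raise j (lower r (raise i c))) = 0" if j: "j \<in> R'" for j
      proof (cases "E j y = 0")
        case False
        have "ext \<psi> (raise i (raise j (lower r c))) = 0"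
          using False j c \<open>pull E R c y = 1\<close>
          by (intro IH1) (auto intro!: weak_raise weak_lower_r simp: i)
        thus ?thesis by (simp add: raise_commute raise_lower_commute)
      qed simp
      thus ?thesis using True c i by (subst ext_step) (auto intro!: sum.neutral)
    next
      case False
      thus ?thesis using c i by (cases "pull E R (raise i c) y = 1") (auto intro: ext_zero ext_outside)
    qed
  qed
  have wall: "of_nat (E s l) * ext \<psi> (raise s c) + (\<Sum>i\<in>R'. of_nat (E i l) * ext \<psi> (raise i c)) = 0"
    if c: "c \<in> coset R b" "pull E R c x = of_nat (Suc (Suc m))" "pull E R c y > 0"
      and l: "l \<in> I'" "pull E R c l = 0" and pos: "\<forall>k\<in>I' - {l}. pull E R c k > 0"
      and off: "\<forall>k\<in>C' - I. pull E R c k \<ge> 0" for c l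
  proof (cases "pull E R c y = 1")
    case False
    hence "pull E R c y \<ge> 2" using gt_1[OF c(1) yC] c by simp
    hence "ext \<psi> (raise i c) = 0" if "i \<in> R" for i
      using c that by (intro ext_zero) auto
    thus ?thesis by simp
  next
    case True
    have lC: "l \<in> C'" using l(1) I'C' by auto
    \<comment> \<open>The neighbours over which the recursion of \<open>ext\<close> runs; their
      x-exponent is smaller by one.\<close>
    define t where "t j = raise j (lower r c)" for j
    have weak: "weak (raise i c)" if "i \<in> R" "E i l > 0" for i
      using that c l pos off by (intro weak_raise_wall[of c l]) auto
    have tp: "pull E R (t j) k = pull E R c k + of_nat (E j k) - of_nat (E r k)" if "j \<in> R'" for j k
      using that by (simp add: t_def)
    have ct: "t j \<in> coset R b" if "j \<in> R'" for j
      using that c by (simp add: t_def coset_raise coset_lower)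
    \<comment> \<open>Only a row free of y keeps the y-exponent 1, at which the recursion
      unfolds.\<close>
    have step: "of_nat (E i l) * ext \<psi> (raise i c) =
        - (\<Sum>j\<in>R'. of_nat (E j y) * (of_nat (E i l) * ext \<psi> (raise i (t j))))"
      if i: "i \<in> R" "i \<noteq> r" "E i y = 0" for i
    proof (cases "E i l = 0")
      case False
      hence w: "weak (raise i c)" using weak i by simp
      have "ext \<psi> (raise i c) = - (\<Sum>j\<in>R'. of_nat (E j y) * ext \<psi> (raise i (t j)))"
      proof (cases "raise i c \<in> states E R C I b")
        case st: True
        have "raise i (t j) = raise j (lower r (raise i c))" for j
          by (simp add: t_def raise_commute raise_lower_commute)
        thus ?thesis using True c st i by (subst ext_step) auto
      next
        case nst: False
        obtain k where k: "k \<in> C' - I" "pull E R (raise i c) k > 0"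
          using weak_off[OF w nst] c i by auto
        have "ext \<psi> (raise i (t j)) = 0" if "j \<in> R'" for j
        proof -
          have "pull E R (raise i (t j)) k > 0"
            using k i that by (simp add: tp add_pos_nonneg)
          hence "raise i (t j) \<notin> states E R C I b" using k(1) less_irrefl unfolding states_iff by metis
          thus ?thesis by (rule ext_outside)
        qed
        thus ?thesis using ext_outside[OF nst] by simp
      qed
      thus ?thesis by (simp add: sum_distrib_left mult_ac)
    qed simp
    have zero1: "of_nat (E i l) * ext \<psi> (raise i c) = 0" if "i \<in> R'" "E i y \<noteq> 0" for i
    proof -
      have "ext \<psi> (raise i c) = 0" using that True c by (intro ext_zero) auto
      thus ?thesis by simp
    qed
    have zero2: "of_nat (E i l) * ext \<psi> (raise i (t j)) = 0"
      if i: "i \<in> R'" "E i y \<noteq> 0" and j: "j \<in> R'" "E j y \<noteq> 0" for i j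
    proof (cases "E i l = 0")
      case False
      \<comment> \<open>At x-exponent 1 the value is one of \<psi>, at a point raised twice. The
        point \<open>raise i d\<close> is interior for \<open>D\<close>, because row
        \<open>i\<close> contains y and its \<open>D\<close>-entries compensate the subtracted row
        \<open>s\<close>.\<close>
      show ?thesis
      proof (cases m)
        case 0
        define d where "d = rst c"
        have ud: "pull D R' d k = pull E R c k - of_nat (E s k)" if "k \<in> C'" for k
          unfolding d_def using that c 0 True by (simp add: pullD_eq)
        have ge: "of_nat (E s k) \<le> (of_nat (E i y * E s k) :: rat)" for k
          unfolding of_nat_le_iff using i by simp
        have d: "raise i d \<in> coset R' b" using i by (simp add: d_def coset_raise coset_rst c)
        have "\<psi> (raise j (raise i d)) = 0"
        proof (rule functionalD_interior[OF \<psi> sgns_nonzero d _ _ j(1)])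
          fix k assume k: "k \<in> I'"
          have "pull E R c k + of_nat (E i k) > 0"
            using k pos l False by (cases "k = l") (auto simp: add_pos_nonneg)
          thus "pull D R' (raise i d) k > 0" using k i ge[of k] I'C' by (auto simp: ud D_def)
        next
          fix k assume k: "k \<in> C' - I"
          have "pull E R c k + of_nat (E i k) \<ge> 0" using off k by simp
          thus "pull D R' (raise i d) k \<ge> 0" using k i ge[of k] by (auto simp: ud D_def)
        qed
        moreover have "weak (raise i (t j))"
          using weak_raise[OF weak_lower_r[OF weak[of i]], of j] i j False
          by (simp add: t_def raise_commute raise_lower_commute)
        ultimately show ?thesis
          using i j c True 0 by (subst ext_base[OF \<psi>])
            (auto simp: tp t_def rst_raise d_def raise_commute)
      next
        case (Suc m')
        have "ext \<psi> (raise i (t j)) = 0" using i j c True Suc by (intro ext_zero) (auto simp: tp)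
        thus ?thesis by simp
      qed
    qed simp
    \<comment> \<open>The relation of column l at \<open>t j\<close>, by induction: a wall relation
      if row \<open>j\<close> is free of x_l, and an interior one otherwise.\<close>
    have bracket: "of_nat (E s l) * ext \<psi> (raise s (t j)) +
        (\<Sum>i\<in>R'. of_nat (E i l) * ext \<psi> (raise i (t j))) = 0"
      if j: "j \<in> R'" "E j y \<noteq> 0" for j
    proof (cases "E j l = 0")
      case True': True
      show ?thesis
        using j True True' c l pos off I'C' lC by (intro IH2) (auto simp: ct tp add_pos_nonneg)
    next
      case False
      have "weak (t j)"
        using weak_lower_r[OF weak[of j]] j False by (simp add: t_def raise_lower_commute)
      hence "ext \<psi> (raise i (t j)) = 0" if "i \<in> R" for i
        using that j True c by (intro IH1) (auto simp: tp)
      thus ?thesis by simp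
    qed
    define Z where "Z = {i \<in> R'. E i y = 0}"
    have Z: "(\<Sum>i\<in>R'. of_nat (E i l) * ext \<psi> (raise i c)) = (\<Sum>i\<in>Z. of_nat (E i l) * ext \<psi> (raise i c))"
      unfolding Z_def using zero1 finR' by (intro sum.mono_neutral_right) auto
    have Zt: "of_nat (E j y) * (\<Sum>i\<in>Z. of_nat (E i l) * ext \<psi> (raise i (t j))) =
        of_nat (E j y) * (\<Sum>i\<in>R'. of_nat (E i l) * ext \<psi> (raise i (t j)))" if "j \<in> R'" for j
    proof (cases "E j y = 0")
      case False
      have "(\<Sum>i\<in>Z. of_nat (E i l) * ext \<psi> (raise i (t j))) =
          (\<Sum>i\<in>R'. of_nat (E i l) * ext \<psi> (raise i (t j)))"
        unfolding Z_def using zero2[OF _ _ that False] finR' by (intro sum.mono_neutral_left) auto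
      thus ?thesis by simp
    qed simp
    have "of_nat (E s l) * ext \<psi> (raise s c) + (\<Sum>i\<in>Z. of_nat (E i l) * ext \<psi> (raise i c)) =
        - (\<Sum>j\<in>R'. of_nat (E j y) * (of_nat (E s l) * ext \<psi> (raise s (t j)))) -
        (\<Sum>i\<in>Z. \<Sum>j\<in>R'. of_nat (E j y) * (of_nat (E i l) * ext \<psi> (raise i (t j))))"
      using step[of s] rs Esy step
      by (simp add: sum_negf[symmetric] Z_def R'_def)
    also have "\<dots> = - (\<Sum>j\<in>R'. of_nat (E j y) * (of_nat (E s l) * ext \<psi> (raise s (t j)) +
        (\<Sum>i\<in>Z. of_nat (E i l) * ext \<psi> (raise i (t j)))))"
      by (subst sum.swap) (simp add: sum.distrib algebra_simps sum_distrib_left)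
    also have "\<dots> = - (\<Sum>j\<in>R'. of_nat (E j y) * (of_nat (E s l) * ext \<psi> (raise s (t j)) +
        (\<Sum>i\<in>R'. of_nat (E i l) * ext \<psi> (raise i (t j)))))"
      by (intro arg_cong[where f = uminus] sum.cong refl) (simp only: distrib_left Zt)
    also have "\<dots> = 0"
    proof -
      have "of_nat (E j y) * (of_nat (E s l) * ext \<psi> (raise s (t j)) +
        (\<Sum>i\<in>R'. of_nat (E i l) * ext \<psi> (raise i (t j)))) = 0" if "j \<in> R'" for j
        using bracket[OF that] by (cases "E j y = 0") simp_all
      thus ?thesis unfolding neg_equal_0_iff_equal by (intro sum.neutral ballI)
    qed
    finally show ?thesis using Z by simp
  qed
  show ?case using int wall by blast
qed

end

context reduction_fixed
begin

text \<open>Column x holds because the base values alternate in sign with the y-exponent, and column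
  y because it is the recursion. The other columns and the points off the walls are the common
  induction above.\<close>

lemma ext_functional:
  assumes \<psi>: "\<psi> \<in> functionals D R' C' I' sgns b"
  shows "ext \<psi> \<in> functionals E R C I (\<lambda>_. 1) b"
proof -
  have "(\<Sum>i\<in>R. of_nat (E i j) * ext \<psi> (raise i c)) = 0"
    if j: "j \<in> I" and c: "c \<in> walls E R C I b j" for j c
  proof -
    have cos: "c \<in> coset R b" using c by (simp add: walls_def)
    have off: "\<forall>k\<in>C' - I. pull E R c k = 0" using c C_I by (simp add: walls_def)
    have nn: "pull E R c j \<ge> 0" using c by (simp add: walls_def)
    have pos: "pull E R c k > 0" if "k \<in> I" "k \<noteq> j" for k using c that by (simp add: walls_def)
    have Suc_x: "\<exists>m. pull E R c x = of_nat (Suc m)" if "pull E R c x > 0"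
    proof -
      from pull_Ints[OF cos xC] obtain z where z: "pull E R c x = of_int z" by (auto elim: Ints_cases)
      with that have "z > 0" by simp
      hence "pull E R c x = of_nat (Suc (nat (z - 1)))" using z by simp
      thus ?thesis by blast
    qed
    show ?thesis
    proof (cases "pull E R c j = 0")
      case False
      hence all: "pull E R c k > 0" if "k \<in> I" for k using pos[OF that] nn by (cases "k = j") auto
      hence w: "weak c" using off cos by (auto simp: weak_def dest: I'D)
      obtain m where "pull E R c x = of_nat (Suc m)" using Suc_x all xI by blast
      hence "ext \<psi> (raise i c) = 0" if "i \<in> R" for i
        using ext_interior_and_walls[OF \<psi>, of m] w all[OF yI] that by blast
      thus ?thesis by simp
    next
      case True
      consider "j = x" | "j = y" | "j \<in> I'" using j by (auto simp: I'_def)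
      thus ?thesis
      proof cases
        case 1
        have w: "weak c" using off cos pos 1 by (auto simp: weak_def I'_def)
        have y: "pull E R c y > 0" using pos[OF yI] xy 1 by auto
        have "ext \<psi> (raise r c) + ext \<psi> (raise s c) = 0"
          using w y True 1 alt_sign_add_nat[of "pull E R c y" 1]
          by (subst (1 2) ext_base[OF \<psi>]) (auto intro: weak_raise simp: Esy)
        thus ?thesis using 1 by (simp add: sum_R)
      next
        case 2
        have w: "weak c" using off cos pos 2 by (auto simp: weak_def I'_def)
        have x: "pull E R c x > 0" using pos[OF xI] xy 2 by auto
        have "raise r c \<in> states E R C I b"
          using w x True 2 off by (auto simp: states_iff weak_raise)
        hence "ext \<psi> (raise r c) = - (\<Sum>i\<in>R'. of_nat (E i y) * ext \<psi> (raise i c))"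
          using ge_1[OF cos xC x] True 2 by (subst ext_step) auto
        thus ?thesis using 2 by (simp add: sum_R Esy)
      next
        case 3
        have ne: "x \<noteq> j" "y \<noteq> j" using 3 by (auto simp: I'_def)
        obtain m where "pull E R c x = of_nat (Suc m)" using Suc_x pos[OF xI] ne by blast
        moreover have "\<forall>k\<in>I' - {j}. pull E R c k > 0" using pos by (auto dest: I'D)
        ultimately have "of_nat (E s j) * ext \<psi> (raise s c) +
            (\<Sum>i\<in>R'. of_nat (E i j) * ext \<psi> (raise i c)) = 0"
          using ext_interior_and_walls[OF \<psi>, of m] cos pos[OF yI] ne 3 True off by auto
        moreover have "E r j = 0" using 3 I'C' by auto
        ultimately show ?thesis by (simp add: sum_R)
      qed
    qed
  qed
  thus ?thesis unfolding functionals_def by (auto simp: ext_outside)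
qed

text \<open>The relation of column x trades row \<open>r\<close> for row \<open>s\<close> at the
  cost of a sign; repeating it brings the y-exponent down to 1.\<close>

lemma functional_base:
  assumes \<psi>: "\<psi> \<in> functionals E R C I (\<lambda>_. 1) b"
  shows "weak c \<Longrightarrow> pull E R c x = 1 \<Longrightarrow> pull E R c y = of_nat (Suc n) \<Longrightarrow>
    \<psi> c = (- 1) ^ n * \<psi> (lift 1 (rst c))"
proof (induction n arbitrary: c)
  case 0
  have "lift 1 (rst c) = c" using 0 by (intro lift_rst) (auto simp: weak_def coset_def)
  thus ?case by simp
next
  case (Suc n)
  show ?case
  proof (cases "c \<in> states E R C I b")
    case True
    have "lower r c \<in> walls E R C I b x"
      using Suc.prems True coset_lower[OF weak_coset[OF Suc.prems(1)], of r]
      I'C' by (intro wallsI) (auto simp: weak_def states_iff xy)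
    from functionals_wall[OF \<psi> xI this]
    have "\<psi> c + \<psi> (raise s (lower r c)) = 0" by (simp add: sum_R)
    moreover have "\<psi> (raise s (lower r c)) = (- 1) ^ n * \<psi> (lift 1 (rst (raise s (lower r c))))"
      using Suc.prems by (intro Suc.IH) (auto intro!: weak_raise weak_lower_r simp: Esy)
    ultimately show ?thesis by (simp add: add_eq_0_iff)
  next
    case False
    then obtain k where k: "k \<in> C' - I" "pull E R c k > 0"
      using weak_off[OF Suc.prems(1) False] Suc.prems by auto
    hence "pull E R (lift 1 (rst c)) k > 0"
      using Suc.prems by (simp add: pull_lift_l pullD_eq add_pos_nonneg)
    hence "lift 1 (rst c) \<notin> states E R C I b" using k(1) less_irrefl unfolding states_iff by metis
    thus ?thesis using functionals_zero_outside[OF \<psi>] False by simp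
  qed
qed

lemma lift_states_iff:
  assumes "d \<in> coset R' b"
  shows "lift 1 d \<in> states E R C I b \<longleftrightarrow> d \<in> states D R' C' I' b"
proof -
  have "pull E R (lift 1 d) l = pull D R' d l" if "l \<in> I' \<or> l \<in> C' - I" for l
    using that I'C' by (intro pull_lift_l) auto
  thus ?thesis unfolding states_iff statesD_iff weak_def
    using assms coset_lift[OF assms, of 1] by auto
qed

text \<open>Since \<open>lift\<close> overwrites the entries at \<open>r\<close> and
  \<open>s\<close>, the guard is what makes the restriction vanish off the coset.\<close>

definition res :: "(('a \<Rightarrow> rat) \<Rightarrow> complex) \<Rightarrow> ('a \<Rightarrow> rat) \<Rightarrow> complex" where
  "res \<psi> d = (if d \<in> coset R' b then \<psi> (lift 1 d) else 0)"

lemma rst_lift_coset: "d \<in> coset R' b \<Longrightarrow> rst (lift e d) = d"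
  by (rule rst_lift) (simp add: coset_def)

text \<open>The wall relation of \<open>E\<close> at a lifted point has an additional term for row
  \<open>s\<close>. Column y expresses it by the rows in \<open>R'\<close>, and the result is the
  relation of \<open>D\<close>, whose entries split as \<open>E i l + E i y * E s l\<close>.\<close>

lemma res_functional:
  assumes \<psi>: "\<psi> \<in> functionals E R C I (\<lambda>_. 1) b"
  shows "res \<psi> \<in> functionals D R' C' I' sgns b"
proof -
  have out: "res \<psi> d = 0" if "d \<notin> states D R' C' I' b" for d
    using that functionals_zero_outside[OF \<psi>, of "lift 1 d"] lift_states_iff[of d]
    by (auto simp: res_def)
  have "(\<Sum>i\<in>R'. sgns i * of_nat (D i l) * res \<psi> (raise i d)) = 0"
    if l: "l \<in> I'" and d: "d \<in> walls D R' C' I' b l" for l d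
  proof -
    have cos: "d \<in> coset R' b" using d by (simp add: walls_def)
    have lC: "l \<in> C'" "l \<in> I" "l \<noteq> x" "l \<noteq> y" using l I'D C'D by blast+
    define c where "c = lift 1 d"
    have cc: "c \<in> coset R b" unfolding c_def by (rule coset_lift[OF cos]) simp
    have cx: "pull E R c x = 1" "pull E R c y = 1" by (simp_all add: c_def)
    have cl: "pull E R c k = pull D R' d k" if "k \<in> C'" for k
      using that by (simp add: c_def pull_lift_l)
    have c1: "pull E R c l \<ge> 0" "\<And>k. k \<in> I' \<Longrightarrow> k \<noteq> l \<Longrightarrow> pull E R c k > 0"
      "\<And>k. k \<in> C' - I \<Longrightarrow> pull E R c k = 0"
      using d lC I'C' unfolding walls_def C'I' by (auto simp: cl)
    have "c \<in> walls E R C I b l"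
      using c1 cc cx by (intro wallsI) auto
    from functionals_wall[OF \<psi> lC(2) this]
    have rel: "of_nat (E s l) * \<psi> (raise s c) + (\<Sum>i\<in>R'. of_nat (E i l) * \<psi> (raise i c)) = 0"
      using lC by (simp add: sum_R)
    have weak: "weak (raise i c)" if "i \<in> R" "E i l > 0" for i
      using that c1 cc by (intro weak_raise_wall[of c l]) auto
    have rst: "rst c = d" by (simp add: c_def rst_lift_coset cos)
    have res_d: "\<psi> (lift 1 (raise i d)) = res \<psi> (raise i d)" if "i \<in> R'" for i
      using that cos by (simp add: res_def coset_raise)
    have 1: "of_nat (E i l) * \<psi> (raise i c) = sgns i * of_nat (E i l) * res \<psi> (raise i d)"
      if i: "i \<in> R'" for i
    proof (cases "E i l = 0")
      case False
      have "\<psi> (raise i c) = (- 1) ^ E i y * \<psi> (lift 1 (rst (raise i c)))"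
        using weak[of i] False i cx by (intro functional_base[OF \<psi>]) auto
      thus ?thesis using i by (simp add: rst_raise rst res_d sgns_def)
    qed simp
    have 2: "of_nat (E s l) * \<psi> (raise s c) =
        of_nat (E s l) * (\<Sum>j\<in>R'. of_nat (E j y) * sgns j * res \<psi> (raise j d))"
    proof (cases "E s l = 0")
      case False
      hence ws: "weak (raise s c)" using weak by simp
      \<comment> \<open>The point below \<open>raise s c\<close> on the wall of column y. Its
        y-exponent is 0, so raising row \<open>j\<close> gives y-exponent \<open>E j y\<close> and
        hence a sign opposite to \<open>sgns j\<close>.\<close>
      define c0 where "c0 = lower r (raise s c)"
      have r0: "raise r c0 = raise s c" by (simp add: c0_def)
      show ?thesis
      proof (cases "raise s c \<in> states E R C I b")
        case st: True
        have "c0 \<in> walls E R C I b y"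
          using st cx cc I'C'
          by (intro wallsI) (auto simp: states_iff weak_def c0_def Esy coset_lower)
        from functionals_wall[OF \<psi> yI this]
        have "\<psi> (raise s c) = - (\<Sum>j\<in>R'. of_nat (E j y) * \<psi> (raise j c0))"
          by (simp add: sum_R Esy r0 add_eq_0_iff)
        moreover have "of_nat (E j y) * \<psi> (raise j c0) = - (of_nat (E j y) * sgns j * res \<psi> (raise j d))"
          if j: "j \<in> R'" for j
        proof (cases "E j y")
          case (Suc n)
          have "\<psi> (raise j c0) = (- 1) ^ n * \<psi> (lift 1 (rst (raise j c0)))"
            using ws Suc j cx
            by (intro functional_base[OF \<psi>]) (auto intro!: weak_raise weak_lower_r simp: c0_def Esy)
          thus ?thesis using j Suc by (simp add: rst_raise c0_def rst res_d sgns_def)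
        qed simp
        ultimately show ?thesis by (simp add: sum_negf)
      next
        case nst: False
        obtain k where k: "k \<in> C' - I" "pull E R (raise s c) k > 0"
          using weak_off[OF ws nst] cx by (auto simp: Esy)
        have "of_nat (E j y) * sgns j * res \<psi> (raise j d) = 0" if j: "j \<in> R'" for j
        proof (cases "E j y = 0")
          case False
          have "E s k > 0" using k c1(3) by simp
          hence "pull D R' (raise j d) k > 0"
            using k c1(3)[OF k(1)] False j cl[of k] by (simp add: D_def del: of_nat_add)
          hence "raise j d \<notin> states D R' C' I' b" using k(1) unfolding statesD_iff by auto
          thus ?thesis using out by simp
        qed simp
        hence "(\<Sum>j\<in>R'. of_nat (E j y) * sgns j * res \<psi> (raise j d)) = 0"
          by (intro sum.neutral ballI)
        thus ?thesis using functionals_zero_outside[OF \<psi> nst] by simp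
      qed
    qed simp
    have "(\<Sum>i\<in>R'. sgns i * of_nat (D i l) * res \<psi> (raise i d)) =
        of_nat (E s l) * (\<Sum>j\<in>R'. of_nat (E j y) * sgns j * res \<psi> (raise j d)) +
        (\<Sum>i\<in>R'. sgns i * of_nat (E i l) * res \<psi> (raise i d))"
      by (simp add: D_def sum_distrib_left sum.distrib[symmetric] algebra_simps)
    thus ?thesis using rel 1 2 by simp
  qed
  thus ?thesis unfolding functionals_def using out by simp
qed

text \<open>Induction on the exponent of x. If both exponents exceed 1, the state lies above an
  interior point. If the y-exponent is 1, column y expresses the value by values at smaller
  x-exponent. At x-exponent 1 it is, up to sign, a value of \<open>res\<close>.\<close>

lemma res_zero_imp_zero:
  assumes \<psi>: "\<psi> \<in> functionals E R C I (\<lambda>_. 1) b" and res: "\<And>d. res \<psi> d = 0"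
  shows "\<psi> c = 0"
proof (cases "c \<in> states E R C I b")
  case True
  then show ?thesis
  proof (induction "nat \<lfloor>pull E R c x\<rfloor>" arbitrary: c rule: less_induct)
    case less
    have c: "weak c" "pull E R c x > 0" "pull E R c y > 0" using less.prems by (auto simp: states_iff)
    have ux: "pull E R c x \<ge> 1" and uy: "pull E R c y \<ge> 1"
      using ge_1[OF weak_coset[OF c(1)]] c xC yC by auto
    consider "pull E R c x = 1" | "pull E R c x \<ge> 2" "pull E R c y \<noteq> 1"
      | "pull E R c x \<ge> 2" "pull E R c y = 1"
      using gt_1[OF weak_coset[OF c(1)] xC c(2)] by blast
    thus ?case
    proof cases
      case 1
      from pull_Ints[OF weak_coset[OF c(1)] yC] obtain z where z: "pull E R c y = of_int z"
        by (auto elim: Ints_cases)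
      hence "pull E R c y = of_nat (Suc (nat (z - 1)))" using uy by simp
      from functional_base[OF \<psi> c(1) 1 this]
      show ?thesis using res[of "rst c"] coset_rst'[OF c(1)] by (simp add: res_def)
    next
      case 2
      hence "pull E R c y \<ge> 2" using gt_1[OF weak_coset[OF c(1)] yC c(3)] by blast
      hence "lower r c \<in> states E R C I b"
        using 2 less.prems weak_lower_r[OF c(1)] by (auto simp: states_iff)
      thus ?thesis using functionals_lower[OF finR indep _ \<psi>, of r] by simp
    next
      case 3
      have "lower r c \<in> walls E R C I b y"
        using less.prems 3 coset_lower[OF weak_coset[OF c(1)], of r]
        I'C' by (intro wallsI) (auto simp: states_iff weak_def)
      from functionals_wall[OF \<psi> yI this]
      have "\<psi> c = - (\<Sum>i\<in>R'. of_nat (E i y) * \<psi> (raise i (lower r c)))"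
        by (simp add: sum_R Esy add_eq_0_iff)
      moreover have "\<psi> (raise i (lower r c)) = 0" if i: "i \<in> R'" for i
      proof (cases "raise i (lower r c) \<in> states E R C I b")
        case True
        have "nat \<lfloor>pull E R (raise i (lower r c)) x\<rfloor> < nat \<lfloor>pull E R c x\<rfloor>"
          using i 3 by simp
        from less.hyps[OF this True] show ?thesis .
      qed (use functionals_zero_outside[OF \<psi>] in simp)
      ultimately show ?thesis by simp
    qed
  qed
qed (rule functionals_zero_outside[OF \<psi>])

text \<open>Lifting multiplies by dx dy, which has the degree 1 of the monomial x y.\<close>

lemma sector_dim_reduce:
  assumes "sector_dim D R' C' I' (\<lambda>_. 1) b \<kappa> N"
  shows "sector_dim E R C I (\<lambda>_. 1) b (\<kappa> + 1) N"
proof -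
  have "sector_dim D R' C' I' sgns b \<kappa> N"
    using sector_dim_rescale[OF finR' sgns_nonzero assms] by simp
  then obtain B where B: "finite B" "card B = N" "B \<subseteq> states D R' C' I' b" "\<forall>c\<in>B. sum c R' = \<kappa>"
    and ex: "\<forall>v. \<exists>\<psi>\<in>functionals D R' C' I' sgns b. \<forall>c\<in>B. \<psi> c = v c"
    and un: "\<forall>\<psi>\<in>functionals D R' C' I' sgns b. (\<forall>c\<in>B. \<psi> c = 0) \<longrightarrow> (\<forall>c. \<psi> c = 0)"
    unfolding sector_dim_def by (elim exE conjE) (rule that)
  have cos: "d \<in> coset R' b" if "d \<in> B" for d using that B(3) by (auto simp: statesD_iff)
  have "inj_on (lift 1) B"
    by (rule inj_on_subset[OF inj_lift]) (use cos in \<open>auto simp: coset_def\<close>)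
  hence "card (lift 1 ` B) = N" using B(2) card_image by blast
  moreover have "lift 1 ` B \<subseteq> states E R C I b" using B(3) cos lift_states_iff by blast
  moreover have "\<exists>\<psi>\<in>functionals E R C I (\<lambda>_. 1) b. \<forall>c\<in>lift 1 ` B. \<psi> c = v c" for v
  proof -
    obtain \<psi> where \<psi>: "\<psi> \<in> functionals D R' C' I' sgns b" "\<forall>d\<in>B. \<psi> d = v (lift 1 d)"
      by (rule bexE[OF spec[OF ex, of "\<lambda>d. v (lift 1 d)"]])
    have "ext \<psi> (lift 1 d) = v (lift 1 d)" if "d \<in> B" for d
    proof -
      have "weak (lift 1 d)" using lift_states_iff[OF cos[OF that]] that B(3) by (auto simp: states_iff)
      thus ?thesis using \<psi>(2) that by (subst ext_base[OF \<psi>(1)]) (auto simp: rst_lift_coset cos)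
    qed
    thus ?thesis using ext_functional[OF \<psi>(1)] by blast
  qed
  moreover have "\<forall>c. \<psi> c = 0"
    if "\<psi> \<in> functionals E R C I (\<lambda>_. 1) b" "\<forall>c\<in>lift 1 ` B. \<psi> c = 0" for \<psi>
  proof -
    have "\<forall>d. res \<psi> d = 0"
      using un[rule_format, OF res_functional[OF that(1)]] that(2) cos by (auto simp: res_def)
    thus ?thesis using res_zero_imp_zero[OF that(1)] by blast
  qed
  moreover have "\<forall>c\<in>lift 1 ` B. sum c R = \<kappa> + 1" using B(4) by (auto simp: sum_lift)
  ultimately show ?thesis unfolding sector_dim_def using B(1) by (intro exI[of _ "lift 1 ` B"]) blast
qed

end

section \<open>Elimination when x and y are not fixed\<close>

locale reduction_free = reduction_sector +
  assumes xI: "x \<notin> I"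
begin

lemma yI: "y \<notin> I" using xI x_iff_y by simp

lemma C_I: "C - I = insert x (insert y (C' - I))" using xI yI xC yC by (auto simp: C'_def)
lemma I'_eq: "I' = I" using xI yI by (auto simp: I'_def)

lemma pulls_eq:
  assumes "pull E R c x = 0" "pull E R c y = 0" "l \<in> C'"
  shows "pull E R c l = pull D R' c l"
  using assms by (simp add: pull_l)

lemma IC': "I \<subseteq> C'" using I'C' I'_eq by simp

text \<open>The exponents of x and y are 0 on all states, where \<open>rst\<close> and
  \<open>lift 0\<close> are inverse to each other. So functionals are merely transported in this
  case, without any recursion.\<close>

lemma states_iff:
  "c \<in> states E R C I b \<longleftrightarrow>
     c \<in> coset R b \<and> pull E R c x = 0 \<and> pull E R c y = 0 \<and> rst c \<in> states D R' C' I b"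
proof (cases "pull E R c x = 0 \<and> pull E R c y = 0")
  case True
  hence "pull E R c l = pull D R' (rst c) l" if "l \<in> I \<or> l \<in> C' - I" for l
    using that IC' by (subst pulls_eq) auto
  thus ?thesis unfolding states_def C_I using True by (auto simp: coset_rst)
qed (auto simp: states_def C_I)

lemma walls_iff:
  "l \<in> I \<Longrightarrow> c \<in> walls E R C I b l \<longleftrightarrow>
     c \<in> coset R b \<and> pull E R c x = 0 \<and> pull E R c y = 0 \<and> rst c \<in> walls D R' C' I b l"
proof (cases "pull E R c x = 0 \<and> pull E R c y = 0")
  case True
  assume "l \<in> I"
  have "pull E R c l = pull D R' (rst c) l" if "l \<in> I \<or> l \<in> C' - I" for l
    using that IC' True by (subst pulls_eq) auto
  thus ?thesis unfolding walls_def C_I using True \<open>l \<in> I\<close> by (auto simp: coset_rst)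
qed (auto simp: walls_def C_I)

lemma lift_coset: "d \<in> coset R' b \<Longrightarrow> lift 0 d \<in> coset R b"
  by (rule coset_lift) simp_all

lemma rst_lift_coset: "d \<in> coset R' b \<Longrightarrow> rst (lift e d) = d"
  by (rule rst_lift) (simp add: coset_def)

lemma lift_states_iff:
  assumes "d \<in> coset R' b"
  shows "lift 0 d \<in> states E R C I b \<longleftrightarrow> d \<in> states D R' C' I b"
  unfolding states_iff using assms by (simp add: lift_coset rst_lift_coset)

lemma lift_raise: "i \<in> R' \<Longrightarrow> E i y = 0 \<Longrightarrow> lift 0 (raise i d) = raise i (lift 0 d)"
proof -
  assume i: "i \<in> R'" "E i y = 0"
  have "ypart (raise i d) = ypart d"
    unfolding ypart_def using i by (intro sum.cong) (auto simp: raise_def)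
  thus ?thesis using i by (auto simp: lift_def raise_def R'_def fun_eq_iff)
qed

text \<open>The two sides of a relation of \<open>E\<close> and of \<open>D\<close> have the same nonzero terms.\<close>

lemma relation_eq:
  assumes \<psi>: "\<forall>c. c \<notin> states E R C I b \<longrightarrow> \<psi> c = 0"
    and \<theta>: "\<forall>d. d \<notin> states D R' C' I b \<longrightarrow> \<theta> d = 0"
    and eq: "\<And>i. i \<in> R' \<Longrightarrow> E i y = 0 \<Longrightarrow> \<psi> (raise i c) = \<theta> (raise i (rst c))"
    and c: "l \<in> I" "c \<in> walls E R C I b l"
  shows "(\<Sum>i\<in>R. of_nat (E i l) * \<psi> (raise i c)) =
    (\<Sum>i\<in>R'. of_nat (D i l) * \<theta> (raise i (rst c)) :: complex)"
proof -
  have lC: "l \<in> C'" using c IC' by auto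
  have 0: "pull E R c x = 0" "pull E R c y = 0" using c by (simp_all add: walls_iff)
  have "raise s c \<notin> states E R C I b" using 0 by (simp add: states_iff)
  moreover have "of_nat (E i l) * \<psi> (raise i c) = of_nat (D i l) * \<theta> (raise i (rst c))"
    if i: "i \<in> R'" for i
  proof (cases "E i y = 0")
    case True
    thus ?thesis using eq[OF i] by (simp add: D_def)
  next
    case False
    \<comment> \<open>M contains a variable that is not fixed. A row of \<open>D\<close> that arises
      from a row with y contains this variable too, so raising it leaves the states.\<close>
    obtain k where k: "k \<in> C' - I" "E s k > 0" using not_fixed[OF xI] by blast
    have "raise i c \<notin> states E R C I b" using 0 False i by (simp add: states_iff)
    moreover have "rst c \<in> walls D R' C' I b l" using c by (simp add: walls_iff)
    hence "pull D R' (rst c) k = 0" using k by (simp add: walls_def)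
    hence "pull D R' (raise i (rst c)) k > 0" using False k i by (simp add: D_def del: of_nat_add)
    hence "raise i (rst c) \<notin> states D R' C' I b" using k(1) by (auto simp: states_def)
    ultimately show ?thesis using \<psi> \<theta> by simp
  qed
  ultimately show ?thesis using lC \<psi> by (simp add: sum_R)
qed

definition ext :: "(('a \<Rightarrow> rat) \<Rightarrow> complex) \<Rightarrow> ('a \<Rightarrow> rat) \<Rightarrow> complex" where
  "ext \<psi> c = (if c \<in> states E R C I b then \<psi> (rst c) else 0)"

definition res :: "(('a \<Rightarrow> rat) \<Rightarrow> complex) \<Rightarrow> ('a \<Rightarrow> rat) \<Rightarrow> complex" where
  "res \<psi> d = (if d \<in> coset R' b then \<psi> (lift 0 d) else 0)"

lemma ext_functional:
  assumes \<psi>: "\<psi> \<in> functionals D R' C' I (\<lambda>_. 1) b"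
  shows "ext \<psi> \<in> functionals E R C I (\<lambda>_. 1) b"
proof -
  have "(\<Sum>i\<in>R. of_nat (E i l) * ext \<psi> (raise i c)) = 0"
    if l: "l \<in> I" and c: "c \<in> walls E R C I b l" for l c
  proof -
    have "ext \<psi> (raise i c) = \<psi> (raise i (rst c))" if i: "i \<in> R'" "E i y = 0" for i
    proof (cases "raise i c \<in> states E R C I b")
      case False
      hence "raise i (rst c) \<notin> states D R' C' I b"
        using c l i by (simp add: states_iff walls_iff coset_raise rst_raise)
      thus ?thesis using functionals_zero_outside[OF \<psi>] False by (simp add: ext_def)
    qed (use i in \<open>simp add: ext_def rst_raise\<close>)
    hence "(\<Sum>i\<in>R. of_nat (E i l) * ext \<psi> (raise i c)) =
        (\<Sum>i\<in>R'. of_nat (D i l) * \<psi> (raise i (rst c)))"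
      using functionals_zero_outside[OF \<psi>] by (intro relation_eq[OF _ _ _ l c]) (auto simp: ext_def)
    also have "\<dots> = 0" using functionals_wall[OF \<psi> l, of "rst c"] c l by (simp add: walls_iff)
    finally show ?thesis .
  qed
  thus ?thesis unfolding functionals_def by (auto simp: ext_def)
qed

lemma res_functional:
  assumes \<psi>: "\<psi> \<in> functionals E R C I (\<lambda>_. 1) b"
  shows "res \<psi> \<in> functionals D R' C' I (\<lambda>_. 1) b"
proof -
  have out: "res \<psi> d = 0" if "d \<notin> states D R' C' I b" for d
    using that functionals_zero_outside[OF \<psi>, of "lift 0 d"] lift_states_iff[of d]
    by (auto simp: res_def)
  have "(\<Sum>i\<in>R'. of_nat (D i l) * res \<psi> (raise i d)) = 0"
    if l: "l \<in> I" and d: "d \<in> walls D R' C' I b l" for l d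
  proof -
    have cos: "d \<in> coset R' b" using d by (simp add: walls_def)
    have w: "lift 0 d \<in> walls E R C I b l"
      using d l cos by (simp add: walls_iff lift_coset rst_lift_coset)
    have "\<psi> (raise i (lift 0 d)) = res \<psi> (raise i (rst (lift 0 d)))" if "i \<in> R'" "E i y = 0" for i
      using that cos by (simp add: rst_lift_coset res_def coset_raise lift_raise)
    hence "(\<Sum>i\<in>R. of_nat (E i l) * \<psi> (raise i (lift 0 d))) =
        (\<Sum>i\<in>R'. of_nat (D i l) * res \<psi> (raise i (rst (lift 0 d))))"
      using functionals_zero_outside[OF \<psi>] out by (intro relation_eq[OF _ _ _ l w]) auto
    moreover have "(\<Sum>i\<in>R. of_nat (E i l) * \<psi> (raise i (lift 0 d))) = 0"
      using functionals_wall[OF \<psi> l w] by simp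
    ultimately show ?thesis by (simp add: rst_lift_coset cos)
  qed
  thus ?thesis unfolding functionals_def using out by simp
qed

lemma sector_dim_reduce:
  assumes "sector_dim D R' C' I' (\<lambda>_. 1) b \<kappa> N"
  shows "sector_dim E R C I (\<lambda>_. 1) b \<kappa> N"
proof -
  obtain B where B: "finite B" "card B = N" "B \<subseteq> states D R' C' I b" "\<forall>c\<in>B. sum c R' = \<kappa>"
    and ex: "\<forall>v. \<exists>\<psi>\<in>functionals D R' C' I (\<lambda>_. 1) b. \<forall>c\<in>B. \<psi> c = v c"
    and un: "\<forall>\<psi>\<in>functionals D R' C' I (\<lambda>_. 1) b. (\<forall>c\<in>B. \<psi> c = 0) \<longrightarrow> (\<forall>c. \<psi> c = 0)"
    using assms unfolding sector_dim_def I'_eq by (elim exE conjE) (rule that)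
  have cos: "d \<in> coset R' b" if "d \<in> B" for d using that B(3) by (auto simp: states_def)
  have "inj_on (lift 0) B"
    by (rule inj_on_subset[OF inj_lift]) (use cos in \<open>auto simp: coset_def\<close>)
  hence "card (lift 0 ` B) = N" using B(2) card_image by blast
  moreover have st: "lift 0 ` B \<subseteq> states E R C I b" using B(3) cos lift_states_iff by blast
  moreover have "\<exists>\<psi>\<in>functionals E R C I (\<lambda>_. 1) b. \<forall>c\<in>lift 0 ` B. \<psi> c = v c" for v
  proof -
    obtain \<psi> where \<psi>: "\<psi> \<in> functionals D R' C' I (\<lambda>_. 1) b" "\<forall>d\<in>B. \<psi> d = v (lift 0 d)"
      by (rule bexE[OF spec[OF ex, of "\<lambda>d. v (lift 0 d)"]])
    have "ext \<psi> (lift 0 d) = v (lift 0 d)" if "d \<in> B" for d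
      using st that \<psi>(2) by (auto simp: ext_def rst_lift_coset cos)
    thus ?thesis using ext_functional[OF \<psi>(1)] by blast
  qed
  moreover have "\<forall>c. \<psi> c = 0"
    if \<psi>: "\<psi> \<in> functionals E R C I (\<lambda>_. 1) b" "\<forall>c\<in>lift 0 ` B. \<psi> c = 0" for \<psi>
  proof
    fix c
    have res: "\<forall>d. res \<psi> d = 0"
      using un[rule_format, OF res_functional[OF that(1)]] that(2) cos by (auto simp: res_def)
    show "\<psi> c = 0"
    proof (cases "c \<in> states E R C I b")
      case True
      hence c: "c \<in> coset R b" "pull E R c x = 0" "pull E R c y = 0" by (simp_all add: states_iff)
      hence "lift 0 (rst c) = c" by (intro lift_rst) (auto simp: coset_def)
      thus ?thesis using res[rule_format, of "rst c"] coset_rst[OF c(1)] by (simp add: res_def)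
    qed (rule functionals_zero_outside[OF \<psi>(1)])
  qed
  moreover have "\<forall>c\<in>lift 0 ` B. sum c R = \<kappa>" using B(4) by (auto simp: sum_lift)
  ultimately show ?thesis unfolding sector_dim_def using B(1) by (intro exI[of _ "lift 0 ` B"]) blast
qed

end

section \<open>Sectors without quadratic monomials\<close>

text \<open>\<open>gam\<close> is the Gamma function, with its poles replaced by residues.\<close>

definition gam :: "rat \<Rightarrow> real" where
  "gam q = (if q \<in> \<int> \<and> q \<le> 0 then (- 1) powi \<lfloor>q\<rfloor> / Gamma (1 - of_rat q) else Gamma (of_rat q))"

lemma of_rat_nonpos_Ints: "of_rat q \<in> (\<int>\<^sub>\<le>\<^sub>0 :: real set) \<longleftrightarrow> q \<in> \<int> \<and> q \<le> 0"
proof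
  assume "of_rat q \<in> (\<int>\<^sub>\<le>\<^sub>0 :: real set)"
  then obtain n where "of_rat q = (of_int n :: real)" "n \<le> 0" by (auto elim: nonpos_Ints_cases)
  hence "q = of_int n" by (metis of_rat_eq_iff of_rat_of_int_eq)
  thus "q \<in> \<int> \<and> q \<le> 0" using \<open>n \<le> 0\<close> by simp
qed (auto elim!: Ints_cases simp: nonpos_Ints_def)

lemma gam_nonzero: "gam q \<noteq> 0"
proof (cases "q \<in> \<int> \<and> q \<le> 0")
  case True
  have "(0::real) < 1 - of_rat q"
    using True by (simp add: less_diff_eq of_rat_less_1_iff[symmetric])
  hence "Gamma (1 - of_rat q :: real) \<noteq> 0" using Gamma_real_pos less_imp_neq by metis
  thus ?thesis using True by (simp add: gam_def)
next
  case False
  hence "gam q = Gamma (of_rat q)" by (auto simp: gam_def)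
  thus ?thesis using False by (simp add: Gamma_eq_zero_iff of_rat_nonpos_Ints)
qed

lemma gam_nonpos: "gam (of_int (- int m)) = (- 1) powi (- int m) / Gamma (1 + of_nat m)"
proof -
  have "of_rat (of_int (- int m)) = - real m" by (simp add: of_rat_minus)
  moreover have "\<lfloor>of_int (- int m) :: rat\<rfloor> = - int m" by (rule floor_of_int)
  moreover have "(of_int (- int m) :: rat) \<in> \<int> \<and> (of_int (- int m) :: rat) \<le> 0" by simp
  ultimately show ?thesis unfolding gam_def by simp
qed

text \<open>The residues (-1)^n / n! of Gamma at -n satisfy the functional equation among
  themselves; it breaks only in the passage from the residue at 0 to the value at 1.\<close>

lemma gam_plus1:
  assumes "q \<noteq> 0"
  shows "gam (q + 1) = of_rat q * gam q"
proof (cases "q \<in> \<int> \<and> q \<le> 0")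
  case True
  then obtain n where n: "q = of_int n" by (auto elim: Ints_cases)
  hence n0: "n < 0" using True assms by simp
  define m where "m = nat (- n - 1)"
  have m: "n = - int (Suc m)" using n0 by (simp add: m_def)
  define X g where "X = (- 1 :: real) powi (- int m)" and "g = Gamma (1 + real m)"
  have "q + 1 = of_int (- int m)" by (simp add: n m)
  hence 1: "gam (q + 1) = X / g" by (simp only: gam_nonpos X_def g_def)
  have "Gamma (1 + real (Suc m)) = real (Suc m) * g"
    using Gamma_plus1[of "real (Suc m)"] by (simp add: nonpos_Ints_def add_ac g_def)
  moreover have "(- 1 :: real) powi (- int (Suc m)) = - X"
    by (simp only: power_int_minus power_int_of_nat power_Suc X_def) simp
  moreover have "gam q = (- 1) powi (- int (Suc m)) / Gamma (1 + real (Suc m))"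
    unfolding n m by (rule gam_nonpos)
  ultimately have 2: "gam q = - X / (real (Suc m) * g)" by (simp only:)
  have 3: "of_rat q = - real (Suc m)" unfolding n m by (simp add: of_rat_diff of_rat_minus)
  show ?thesis unfolding 1 2 3 by (simp del: of_nat_Suc)
next
  case False
  have "\<not> (q + 1 \<in> \<int> \<and> q + 1 \<le> 0)"
  proof
    assume a: "q + 1 \<in> \<int> \<and> q + 1 \<le> 0"
    hence "q + 1 - 1 \<in> \<int>" by (intro Ints_diff) auto
    thus False using False a by simp
  qed
  hence "gam (q + 1) = Gamma (of_rat (q + 1))" unfolding gam_def by (rule if_not_P)
  moreover have "gam q = Gamma (of_rat q)" unfolding gam_def using False by (rule if_not_P)
  moreover have "(of_rat q :: real) \<notin> \<int>\<^sub>\<le>\<^sub>0" using False of_rat_nonpos_Ints by blast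
  ultimately show ?thesis using Gamma_plus1[of "of_rat q :: real"] by (simp add: of_rat_add)
qed

text \<open>The off-diagonal entries form a partial permutation matrix: monomial \<open>i\<close> is
  a power of x_i, possibly times one further variable, and the arrows \<open>pts\<close> to these
  further variables form disjoint chains and loops.\<close>

locale base =
  fixes A :: "'r \<Rightarrow> 'r \<Rightarrow> nat" and R :: "'r set"
  assumes finR: "finite R"
    and diag: "\<And>i. i \<in> R \<Longrightarrow> A i i \<ge> 2"
    and off: "\<And>i k. i \<in> R \<Longrightarrow> k \<in> R \<Longrightarrow> i \<noteq> k \<Longrightarrow> A i k \<le> 1"
    and row: "\<And>i k l. i \<in> R \<Longrightarrow> k \<in> R \<Longrightarrow> l \<in> R \<Longrightarrow> k \<noteq> i \<Longrightarrow> l \<noteq> i \<Longrightarrow> A i k = 1 \<Longrightarrow> A i l = 1 \<Longrightarrow> k = l"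
    and col: "\<And>i k l. i \<in> R \<Longrightarrow> k \<in> R \<Longrightarrow> l \<in> R \<Longrightarrow> k \<noteq> i \<Longrightarrow> l \<noteq> i \<Longrightarrow> A k i = 1 \<Longrightarrow> A l i = 1 \<Longrightarrow> k = l"
begin

definition pts :: "'r \<Rightarrow> 'r \<Rightarrow> bool" where
  "pts i k \<longleftrightarrow> i \<in> R \<and> k \<in> R \<and> i \<noteq> k \<and> A i k = 1"

lemma pts_unique: "pts i k \<Longrightarrow> pts i l \<Longrightarrow> k = l" "pts k i \<Longrightarrow> pts l i \<Longrightarrow> k = l"
  using row[of i k l] col[of i k l] by (auto simp: pts_def)

lemma entry_zero: "i \<in> R \<Longrightarrow> k \<in> R \<Longrightarrow> i \<noteq> k \<Longrightarrow> \<not> pts i k \<Longrightarrow> A i k = 0"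
  using off[of i k] by (auto simp: pts_def)

lemma column_sum:
  fixes f :: "'r \<Rightarrow> 'z::field"
  assumes k: "k \<in> R"
  shows "\<nexists>p. pts p k \<Longrightarrow> (\<Sum>i\<in>R. of_nat (A i k) * f i) = of_nat (A k k) * f k"
    and "pts p k \<Longrightarrow> (\<Sum>i\<in>R. of_nat (A i k) * f i) = of_nat (A k k) * f k + f p"
proof -
  have rem: "(\<Sum>i\<in>R. of_nat (A i k) * f i) =
      of_nat (A k k) * f k + (\<Sum>i\<in>R - {k}. of_nat (A i k) * f i)"
    using finR k by (rule sum.remove)
  show "\<nexists>p. pts p k \<Longrightarrow> (\<Sum>i\<in>R. of_nat (A i k) * f i) = of_nat (A k k) * f k"
    unfolding rem using entry_zero[OF _ k] by (simp add: sum.neutral)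
  assume p: "pts p k"
  have "(\<Sum>i\<in>R - {k}. of_nat (A i k) * f i) = (\<Sum>i\<in>{p}. of_nat (A i k) * f i)"
  proof (rule sum.mono_neutral_right)
    show "finite (R - {k})" "{p} \<subseteq> R - {k}" using p finR by (auto simp: pts_def)
    show "\<forall>i\<in>R - {k} - {p}. of_nat (A i k) * f i = 0"
    proof
      fix i assume i: "i \<in> R - {k} - {p}"
      hence "\<not> pts i k" using pts_unique(2)[OF p] by blast
      thus "of_nat (A i k) * f i = 0" using entry_zero[of i k] i k by simp
    qed
  qed
  thus "(\<Sum>i\<in>R. of_nat (A i k) * f i) = of_nat (A k k) * f k + f p"
    unfolding rem using p by (simp add: pts_def)
qed

lemma pull_none: "k \<in> R \<Longrightarrow> \<nexists>p. pts p k \<Longrightarrow> pull A R c k = of_nat (A k k) * c k"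
  unfolding pull_def by (rule column_sum)

lemma pull_some: "pts p k \<Longrightarrow> pull A R c k = of_nat (A k k) * c k + c p"
  unfolding pull_def by (rule column_sum) (auto simp: pts_def)

lemma pts_R: "pts i k \<Longrightarrow> i \<in> R \<and> k \<in> R \<and> i \<noteq> k" by (simp add: pts_def)

end

lemma functionals_sum:
  assumes "\<And>s. s \<in> T \<Longrightarrow> f s \<in> functionals E R C I a b"
  shows "(\<lambda>c. \<Sum>s\<in>T. w s * f s c) \<in> functionals E R C I a b"
proof -
  have "(\<Sum>i\<in>R. a i * of_nat (E i j) * (\<Sum>s\<in>T. w s * f s (raise i c))) = 0"
    if "j \<in> I" "c \<in> walls E R C I b j" for j c
  proof -
    have "(\<Sum>i\<in>R. a i * of_nat (E i j) * (\<Sum>s\<in>T. w s * f s (raise i c))) =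
        (\<Sum>s\<in>T. w s * (\<Sum>i\<in>R. a i * of_nat (E i j) * f s (raise i c)))"
      unfolding sum_distrib_left by (subst sum.swap) (simp add: mult_ac)
    also have "\<dots> = 0" using assms that by (intro sum.neutral) (simp add: functionals_def)
    finally show ?thesis .
  qed
  thus ?thesis using assms by (simp add: functionals_def)
qed

text \<open>\<open>I_closed\<close> is the invariance of x_i^m x_k under the twist: if x_i is fixed,
  so is x_k. \<open>b_closed\<close> is the same statement for the transpose, where the arrows are
  reversed.\<close>

locale base_sector = base +
  fixes I :: "'a set" and b :: "'a \<Rightarrow> rat"
  assumes IR: "I \<subseteq> R"
    and I_closed: "\<And>i k. pts i k \<Longrightarrow> i \<in> I \<Longrightarrow> k \<in> I"
    and b_range: "\<And>i. i \<in> R \<Longrightarrow> 0 \<le> b i \<and> b i < 1"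
    and b_closed: "\<And>i k. pts i k \<Longrightarrow> b k = 0 \<Longrightarrow> b i = 0"
    and bint: "\<And>k. k \<in> R \<Longrightarrow> pull A R b k \<in> \<int>"
    and indep: "independent_rows A R R"
begin

definition J where "J = {i \<in> R. b i = 0}"
definition K where "K = I \<inter> J"

text \<open>\<open>K\<close> splits under \<open>pts\<close> into paths and cycles. An alternating
  set takes every second vertex, including the first of a path and excluding the last: one choice
  for an even path, two for an even cycle, none if some path or cycle is odd.\<close>

definition alternating :: "'a set \<Rightarrow> bool" where
  "alternating S \<longleftrightarrow> S \<subseteq> K \<and> (\<forall>i\<in>K. i \<in> S \<longleftrightarrow> \<not> (\<exists>p\<in>S. pts p i)) \<and> (\<forall>i\<in>S. \<exists>k\<in>K. pts i k)"

definition bas :: "'a set \<Rightarrow> 'a \<Rightarrow> rat" where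
  "bas S i = (if i \<in> R then b i + of_bool (i \<in> S) else 0)"

definition positive_part :: "('a \<Rightarrow> rat) \<Rightarrow> 'a set" where
  "positive_part c = {i \<in> K. c i \<ge> 1}"

abbreviation "st \<equiv> states A R R I b"

lemma pull_Ints: "c \<in> coset R b \<Longrightarrow> k \<in> R \<Longrightarrow> pull A R c k \<in> \<int>"
  by (rule pull_coset_Ints[OF finR _ bint])

text \<open>Predecessors of points outside \<open>I\<close> lie outside \<open>I\<close>, so the
  columns there form a strictly diagonally dominant system: twice the largest modulus of a
  coordinate is at most that modulus.\<close>

lemma off_I_zero:
  assumes "\<And>k. k \<in> R - I \<Longrightarrow> pull A R c k = 0" and "k \<in> R - I"
  shows "c k = 0"
proof -
  let ?M = "Max ((\<lambda>k. \<bar>c k\<bar>) ` (R - I))"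
  have fin: "finite ((\<lambda>k. \<bar>c k\<bar>) ` (R - I))" using finR by simp
  hence le: "\<bar>c k\<bar> \<le> ?M" if "k \<in> R - I" for k using that by (intro Max_ge) auto
  have "?M \<in> (\<lambda>k. \<bar>c k\<bar>) ` (R - I)" using fin assms(2) by (intro Max_in) auto
  then obtain m where m: "m \<in> R - I" "\<bar>c m\<bar> = ?M" by force
  have "of_nat (A m m) * \<bar>c m\<bar> \<le> ?M"
  proof (cases "\<exists>p. pts p m")
    case True
    then obtain p where p: "pts p m" by blast
    hence "p \<in> R - I" using m I_closed pts_R by blast
    moreover have "of_nat (A m m) * c m = - c p" using assms(1)[OF m(1)] pull_some[OF p, of c] by simp
    hence "of_nat (A m m) * \<bar>c m\<bar> = \<bar>c p\<bar>" by (metis abs_minus_cancel abs_mult abs_of_nat)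
    ultimately show ?thesis using le by simp
  next
    case False
    hence "c m = 0" using assms(1)[OF m(1)] pull_none[of m c] m diag[of m] by simp
    thus ?thesis using m by simp
  qed
  moreover have "2 * \<bar>c m\<bar> \<le> of_nat (A m m) * \<bar>c m\<bar>"
    using diag[of m] m(1) by (intro mult_right_mono) auto
  ultimately have "?M \<le> 0" using m by simp
  thus ?thesis using le[OF assms(2)] by simp
qed

lemma states_off_I: "c \<in> st \<Longrightarrow> k \<in> R - I \<Longrightarrow> c k = 0"
  by (rule off_I_zero) (auto simp: states_def)

lemma walls_off_I: "c \<in> walls A R R I b l \<Longrightarrow> k \<in> R - I \<Longrightarrow> c k = 0"
  by (rule off_I_zero) (auto simp: walls_def)

lemma coset_J: "c \<in> coset R b \<Longrightarrow> i \<in> J \<Longrightarrow> c i \<in> \<int>"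
  by (force simp: coset_def J_def)

lemma coset_not_J:
  assumes "c \<in> coset R b" "i \<in> R" "i \<notin> J"
  shows "c i \<notin> \<int>"
proof
  assume "c i \<in> \<int>"
  hence "c i - (c i - b i) \<in> \<int>" using assms by (intro Ints_diff) (auto simp: coset_def)
  hence "b i \<in> \<int>" by simp
  thus False using b_range[OF assms(2)] assms by (auto simp: J_def elim!: Ints_cases)
qed

text \<open>Coordinates outside \<open>I\<close> vanish on states and are therefore integral, which
  is possible only where \<open>b\<close> is 0.\<close>

lemma states_empty:
  assumes "\<not> R - I \<subseteq> J"
  shows "st = {}"
proof -
  have False if "c \<in> st" for c
  proof -
    obtain i where i: "i \<in> R - I" "i \<notin> J" using assms by blast
    hence "c i = 0" using states_off_I[OF that] by blast
    moreover have "c i \<notin> \<int>" using i that by (intro coset_not_J) (auto simp: states_def)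
    ultimately show False by simp
  qed
  thus ?thesis by blast
qed

lemma sector_dim_empty:
  assumes "\<not> R - I \<subseteq> J"
  shows "sector_dim A R R I a b \<kappa> 0"
proof -
  have "(\<lambda>_. 0) \<in> functionals A R R I a b" by (simp add: functionals_def)
  moreover have "\<forall>c. \<psi> c = 0" if "\<psi> \<in> functionals A R R I a b" for \<psi>
    using functionals_zero_outside[OF that] states_empty[OF assms] by blast
  ultimately show ?thesis unfolding sector_dim_def by (intro exI[of _ "{}"]) auto
qed

text \<open>Up to a constant the integral of exp(-f) x^u dx/x for unit coefficients, with residues
  in place of poles.\<close>

definition weight :: "('a \<Rightarrow> rat) \<Rightarrow> complex" where "weight c = of_real (\<Prod>i\<in>R. gam (c i))"

lemma weight_nonzero: "weight c \<noteq> 0"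
  using finR gam_nonzero by (simp add: weight_def)

lemma weight_raise:
  assumes "i \<in> R" "c i \<noteq> 0"
  shows "weight (raise i c) = of_real (of_rat (c i)) * weight c"
proof -
  have "(\<Prod>k\<in>R. gam (raise i c k)) = gam (c i + 1) * (\<Prod>k\<in>R - {i}. gam (c k))"
    unfolding raise_def using assms finR by (subst prod.remove[of _ i]) auto
  also have "\<dots> = of_rat (c i) * (gam (c i) * (\<Prod>k\<in>R - {i}. gam (c k)))"
    using gam_plus1[OF assms(2)] by simp
  also have "gam (c i) * (\<Prod>k\<in>R - {i}. gam (c k)) = (\<Prod>k\<in>R. gam (c k))"
    using assms finR by (subst (2) prod.remove[of _ i]) auto
  finally show ?thesis by (simp add: weight_def)
qed

text \<open>Fixing the positive part avoids the step of a coordinate from 0 to 1, at which the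
  recursion for \<open>gam\<close> fails. Fixing the degree, which is the least possible one,
  discards the points above interior ones, where a functional has to vanish.\<close>

definition basic_functional :: "'a set \<Rightarrow> ('a \<Rightarrow> rat) \<Rightarrow> complex" where
  "basic_functional S c =
     (if c \<in> st \<and> positive_part c = S \<and> sum c R = sum (bas S) R then weight c else 0)"

lemma alternatingD:
  assumes "alternating S"
  shows "S \<subseteq> K" "i \<in> S \<Longrightarrow> \<exists>k\<in>K. pts i k" "i \<in> S \<Longrightarrow> pts p i \<Longrightarrow> p \<notin> S"
    "i \<in> K \<Longrightarrow> i \<notin> S \<Longrightarrow> \<exists>p\<in>S. pts p i" "i \<in> S \<Longrightarrow> pts i k \<Longrightarrow> k \<in> K - S"
proof -
  show *: "S \<subseteq> K" "i \<in> S \<Longrightarrow> \<exists>k\<in>K. pts i k" "i \<in> S \<Longrightarrow> pts p i \<Longrightarrow> p \<notin> S"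
    "i \<in> K \<Longrightarrow> i \<notin> S \<Longrightarrow> \<exists>p\<in>S. pts p i" for i p
    using assms unfolding alternating_def by blast+
  assume "i \<in> S" "pts i k"
  moreover from this have "k \<in> K" using *(2) pts_unique by blast
  ultimately show "k \<in> K - S" using assms unfolding alternating_def by blast
qed

lemma K_R: "K \<subseteq> R" "K \<subseteq> I" "K \<subseteq> J" using IR by (auto simp: K_def)

text \<open>A state with the same positive part as an alternating set has at least the degree of the basic
  state: where it falls below, its predecessor makes up for it.\<close>

lemma degree_bound:
  assumes S: "alternating S" and c: "c \<in> st" and P: "positive_part c = S" and RJ: "R - I \<subseteq> J"
  shows "sum (bas S) R \<le> sum c R"
proof -
  note SD = alternatingD[OF S]
  have cos: "c \<in> coset R b" using c by (simp add: states_def)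
  define d where "d i = c i - bas S i" for i
  have dint: "d i \<in> \<int>" if "i \<in> R" for i
  proof -
    have "c i - b i \<in> \<int>" using that cos by (auto simp: coset_def)
    hence "c i - b i - of_bool (i \<in> S) \<in> \<int>" by (rule Ints_diff) simp
    thus ?thesis using that by (simp add: d_def bas_def algebra_simps)
  qed
  have comp: "\<exists>p. pts p j \<and> d p \<ge> - d j" if j: "j \<in> R" "d j < 0" for j
  proof -
    obtain n where n: "d j = of_int n" "n < 0" using dint[OF j(1)] j(2) by (auto elim: Ints_cases)
    have jI: "j \<in> I"
    proof (rule ccontr)
      assume "j \<notin> I"
      hence "c j = 0" "j \<in> J" "j \<notin> S" using states_off_I[OF c] j RJ SD(1) K_R by auto
      thus False using j by (simp add: d_def bas_def J_def)
    qed
    have pos: "pull A R c j > 0" using c jI by (simp add: states_def)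
    have jS: "j \<notin> S"
      using j P SD(1) K_R by (auto simp: d_def bas_def positive_part_def J_def)
    show ?thesis
    proof (cases "j \<in> J")
      case True
      hence jK: "j \<in> K" using jI by (simp add: K_def)
      obtain p where p: "p \<in> S" "pts p j" using SD(4)[OF jK jS] by blast
      have cj: "c j = of_int n" using n True jS j by (simp add: d_def bas_def J_def)
      have "p \<in> R" "b p = 0" using p SD(1) K_R by (auto simp: J_def)
      moreover from this obtain m where m: "d p = of_int m" using dint by (auto elim: Ints_cases)
      ultimately have "c p = of_int (m + 1)" using p by (simp add: d_def bas_def)
      hence "pull A R c j = of_int (int (A j j) * n + m + 1)" using pull_some[OF p(2), of c] cj by simp
      hence "int (A j j) * n + m + 1 > 0" using pos by (simp only: of_int_0_less_iff)
      hence "int (A j j) * n + m \<ge> 0" by simp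
      moreover have "int (A j j) * n \<le> 1 * n" using n diag[OF j(1)] by (intro mult_right_mono_neg) auto
      ultimately have "m \<ge> - n" by simp
      thus ?thesis using p m n by (metis of_int_le_iff of_int_minus)
    next
      case False
      have bj: "b j > 0" using b_range[OF j(1)] False j by (auto simp: J_def order_less_le)
      have cj: "c j = b j + of_int n" using n jS j by (simp add: d_def bas_def)
      have "of_int n \<le> (- 1 :: rat)" using n by simp
      hence cj0: "c j < 0" using cj b_range[OF j(1)] by linarith
      have "\<exists>p. pts p j"
      proof (rule ccontr)
        assume "\<not> ?thesis"
        hence "pull A R c j \<le> 0" using pull_none[OF j(1), of c] cj0 by (simp add: mult_nonneg_nonpos)
        thus False using pos by simp
      qed
      then obtain p where p: "pts p j" by blast
      have pj: "pull A R c j = of_nat (A j j) * c j + c p" by (rule pull_some[OF p])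
      have "of_nat (A j j) * c j \<le> 0" using cj0 by (simp add: mult_nonneg_nonpos)
      hence cp: "c p > 0" using pos pj by simp
      have pR: "p \<in> R" using pts_R[OF p] by simp
      have pI: "p \<in> I" using cp states_off_I[OF c, of p] pR by force
      \<comment> \<open>An integral coordinate at the predecessor would be positive, which puts the
        predecessor into \<open>S\<close> and its target \<open>j\<close> into
        \<open>K\<close>.\<close>
      have pJ: "p \<notin> J"
      proof
        assume "p \<in> J"
        hence "p \<in> K" using pI by (simp add: K_def)
        moreover have "c p \<ge> 1" using coset_J[OF cos \<open>p \<in> J\<close>] cp by (auto elim!: Ints_cases)
        ultimately have "p \<in> S" using P by (auto simp: positive_part_def)
        hence "j \<in> K" using SD(5) p by blast
        thus False using False K_R by blast
      qed
      hence pS: "p \<notin> S" using SD(1) K_R by blast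
      obtain m where m: "d p = of_int m" using dint[OF pR] by (auto elim: Ints_cases)
      have cpm: "c p = b p + of_int m" using m pS pR by (simp add: d_def bas_def)
      have B: "pull A R b j = of_nat (A j j) * b j + b p" by (rule pull_some[OF p])
      obtain z where z: "pull A R b j = of_int z" using bint[OF j(1)] by (auto elim: Ints_cases)
      \<comment> \<open>Both \<open>b j\<close> and \<open>b p\<close> are below 1, so the integral
        exponent of \<open>b\<close> in column \<open>j\<close> is at most \<open>A j j\<close>.
        This bounds what the nonintegral parts can contribute.\<close>
      have "of_nat (A j j) * b j \<le> of_nat (A j j) * 1"
        using b_range[OF j(1)] by (intro mult_left_mono) auto
      hence "of_int z < (of_nat (A j j) + 1 :: rat)" using z B b_range[OF pR] by simp
      hence "of_int z < (of_int (int (A j j) + 1) :: rat)" by simp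
      hence zA: "z \<le> int (A j j)" by (simp only: of_int_less_iff)
      have "pull A R c j = of_int (int (A j j) * n + z + m)"
        using pj cj cpm B z by (simp add: algebra_simps)
      hence "int (A j j) * n + z + m > 0" using pos by (simp only: of_int_0_less_iff)
      hence "int (A j j) * (n + 1) + m > 0" using zA by (simp add: algebra_simps)
      moreover have "int (A j j) * (n + 1) \<le> 1 * (n + 1)"
        using n diag[OF j(1)] by (intro mult_right_mono_neg) auto
      ultimately have "m \<ge> - n" by simp
      thus ?thesis using p m n by (metis of_int_le_iff of_int_minus)
    qed
  qed
  \<comment> \<open>Distinct deficient coordinates have distinct predecessors, none of them
    deficient, so the surplus outweighs the deficit.\<close>
  define Ng where "Ng = {j \<in> R. d j < 0}"
  define pr where "pr j = (SOME p. pts p j \<and> d p \<ge> - d j)" for j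
  have pr: "pts (pr j) j" "d (pr j) \<ge> - d j" if "j \<in> Ng" for j
    using someI_ex[OF comp, of j] that by (auto simp: pr_def Ng_def)
  have inj: "inj_on pr Ng" using pr(1) pts_unique(1) by (metis inj_onI)
  have im: "pr ` Ng \<subseteq> R - Ng"
  proof
    fix i assume "i \<in> pr ` Ng"
    then obtain j where j: "j \<in> Ng" "i = pr j" by blast
    thus "i \<in> R - Ng" using pr[OF j(1)] pts_R[of i j] by (auto simp: Ng_def)
  qed
  have "- sum d Ng = (\<Sum>j\<in>Ng. - d j)" by (simp add: sum_negf)
  also have "\<dots> \<le> (\<Sum>j\<in>Ng. d (pr j))" using pr by (intro sum_mono)
  also have "\<dots> = sum d (pr ` Ng)" using inj by (simp add: sum.reindex)
  also have "\<dots> \<le> sum d (R - Ng)" using im finR by (intro sum_mono2) (auto simp: Ng_def)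
  also have "\<dots> = sum d R - sum d Ng" using finR by (intro sum_diff) (auto simp: Ng_def)
  finally have "sum d R \<ge> 0" by simp
  thus ?thesis by (simp add: d_def sum_subtractf)
qed

end

section \<open>Existence and uniqueness of functionals for chains and loops\<close>

context base_sector
begin

lemma states_raise:
  assumes c: "c \<in> walls A R R I b l" and l: "l \<in> I" and i: "i \<in> I" "A i l > 0"
  shows "raise i c \<in> st"
proof -
  have iR: "i \<in> R" and lR: "l \<in> R" using i l IR by auto
  have "pull A R (raise i c) k > 0" if k: "k \<in> I" for k
  proof (cases "k = l")
    case True
    have "pull A R c l \<ge> 0" using c by (simp add: walls_def)
    thus ?thesis using True i by (simp add: pull_raise finR iR add_nonneg_pos)
  next
    case False
    thus ?thesis using c k by (simp add: pull_raise finR iR walls_def add_pos_nonneg)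
  qed
  moreover have "pull A R (raise i c) k = 0" if k: "k \<in> R - I" for k
  proof -
    have "A i k = 0" using k i iR I_closed[of i k] by (intro entry_zero) auto
    thus ?thesis using c k by (simp add: pull_raise finR iR walls_def)
  qed
  moreover have "raise i c \<in> coset R b" using c iR by (simp add: coset_raise walls_def)
  ultimately show ?thesis by (simp add: states_def)
qed

lemma positive_part_raise:
  assumes "c \<in> coset R b" "i \<in> R" "c i \<noteq> 0"
  shows "positive_part (raise i c) = positive_part c"
proof -
  have "c i + 1 \<ge> 1 \<longleftrightarrow> c i \<ge> 1" if "i \<in> K"
  proof -
    have "c i \<in> \<int>" using coset_J[OF assms(1)] that K_R by blast
    thus ?thesis using assms(3) by (auto elim!: Ints_cases)
  qed
  thus ?thesis unfolding positive_part_def raise_def by auto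
qed

lemma positive_part_raise0:
  "c i = 0 \<Longrightarrow> i \<in> K \<Longrightarrow> positive_part (raise i c) = insert i (positive_part c)"
  unfolding positive_part_def raise_def by auto

text \<open>Raising a nonzero coordinate multiplies \<open>weight\<close> by that coordinate, so the
  terms of column l add up to \<open>weight c\<close> times the exponent at l. This exponent is 0,
  since otherwise \<open>c\<close> would be a state below the degree bound. Raising a coordinate
  from 0 to 1 changes the positive part, and alternation prevents it from ending in \<open>S\<close>
  that way.\<close>

lemma basic_functional_in:
  assumes S: "alternating S" and RJ: "R - I \<subseteq> J"
  shows "basic_functional S \<in> functionals A R R I (\<lambda>_. 1) b"
proof -
  note SD = alternatingD[OF S]
  let ?f = "basic_functional S"
  have "(\<Sum>i\<in>R. of_nat (A i l) * ?f (raise i c)) = 0"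
    if l: "l \<in> I" and c: "c \<in> walls A R R I b l" for l c
  proof -
    have cos: "c \<in> coset R b" using c by (simp add: walls_def)
    have lR: "l \<in> R" using l IR by auto
    have offI: "?f (raise i c) = 0 \<and> c i = 0" if i: "i \<in> R - I" for i
    proof -
      have "c i = 0" using walls_off_I[OF c] i by blast
      hence "raise i c i \<noteq> 0" by (simp add: raise_def)
      hence "raise i c \<notin> st" using states_off_I[of "raise i c" i] i by blast
      thus ?thesis using \<open>c i = 0\<close> by (simp add: basic_functional_def)
    qed
    have zero_K: "i \<in> K" if "i \<in> I" "c i = 0" for i
    proof (rule ccontr)
      assume "i \<notin> K"
      hence "c i \<notin> \<int>" using that IR by (intro coset_not_J[OF cos]) (auto simp: K_def)
      thus False using that by simp
    qed
    have deg: "sum (raise i c) R = sum c R + 1" if "i \<in> R" for i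
      using that finR by (simp add: sum_raise)
    show ?thesis
    proof (cases "positive_part c = S \<and> sum c R + 1 = sum (bas S) R")
      case True
      have "of_nat (A i l) * ?f (raise i c) = weight c * of_real (of_rat (of_nat (A i l) * c i))"
        if i: "i \<in> R" for i
      proof -
        consider "i \<notin> I" | "A i l = 0" | "i \<in> I" "A i l > 0" "c i = 0" | "i \<in> I" "A i l > 0" "c i \<noteq> 0"
          by blast
        thus ?thesis
        proof cases
          case 3
          have "i \<notin> S" using True 3 by (auto simp: positive_part_def)
          hence "positive_part (raise i c) \<noteq> S" using positive_part_raise0[of c i, OF 3(3) zero_K] 3 by blast
          thus ?thesis using 3 by (simp add: basic_functional_def)
        next
          case 4
          have "?f (raise i c) = weight (raise i c)"
            using states_raise[OF c l 4(1,2)] positive_part_raise[OF cos i 4(3)] True deg[OF i]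
            by (simp add: basic_functional_def)
          thus ?thesis using weight_raise[of i c, OF i 4(3)] by (simp add: of_rat_mult)
        qed (use offI i in auto)
      qed
      hence "(\<Sum>i\<in>R. of_nat (A i l) * ?f (raise i c)) = weight c * of_real (of_rat (pull A R c l))"
        by (simp add: pull_def of_rat_sum sum_distrib_left)
      \<comment> \<open>A positive exponent would make \<open>c\<close> a state with positive part
        \<open>S\<close> and degree one less than that of \<open>bas S\<close>.\<close>
      moreover have "pull A R c l = 0"
      proof (rule ccontr)
        assume nz: "pull A R c l \<noteq> 0"
        have "pull A R c k > 0" if "k \<in> I" for k
          using c that nz by (cases "k = l") (auto simp: walls_def)
        hence "c \<in> st" using c by (simp add: states_def walls_def)
        from degree_bound[OF S this _ RJ] True show False by simp
      qed
      ultimately show ?thesis by simp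
    next
      case False
      have "of_nat (A i l) * ?f (raise i c) = 0" if i: "i \<in> R" for i
      proof (rule ccontr)
        assume nz: "of_nat (A i l) * ?f (raise i c) \<noteq> 0"
        hence A: "A i l > 0" and f: "?f (raise i c) \<noteq> 0" by auto
        hence P: "positive_part (raise i c) = S" and D: "sum c R + 1 = sum (bas S) R"
          using deg[OF i] by (auto simp: basic_functional_def split: if_splits)
        have iI: "i \<in> I" using offI f i by blast
        have ci: "c i = 0"
          using positive_part_raise[OF cos i] P D False by blast
        have iK: "i \<in> K" using zero_K[OF iI ci] .
        hence iS: "i \<in> S" and PS: "positive_part c \<subseteq> S" using P positive_part_raise0[of c i, OF ci] by auto
        \<comment> \<open>Here \<open>i\<close> is raised from 0 into \<open>S\<close>. If
          \<open>i = l\<close>, positivity of the exponent at the successor puts the successor into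
          \<open>S\<close>; otherwise positivity at \<open>i\<close> itself puts the predecessor
          into \<open>S\<close>. Both contradict alternation.\<close>
        show False
        proof (cases "i = l")
          case True
          obtain k where k: "pts i k" using SD(2)[OF iS] by blast
          have kK: "k \<in> K - S" using SD(5)[OF iS k] .
          have "pull A R c k > 0"
            using c kK K_R k True by (auto simp: walls_def pts_def)
          hence "of_nat (A k k) * c k > 0" using pull_some[OF k, of c] ci by simp
          hence "c k > 0" by (simp add: zero_less_mult_iff)
          moreover have "c k \<in> \<int>" using kK K_R by (intro coset_J[OF cos]) auto
          ultimately have "c k \<ge> 1" by (auto elim!: Ints_cases)
          hence "k \<in> S" using kK PS by (auto simp: positive_part_def)
          thus False using kK by blast
        next
          case False
          have pull_i: "pull A R c i > 0" using c iI False by (simp add: walls_def)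
          have "\<exists>p. pts p i"
          proof (rule ccontr)
            assume "\<not> ?thesis"
            hence "pull A R c i = 0" using pull_none[OF i, of c] ci by simp
            thus False using pull_i by simp
          qed
          then obtain p where p: "pts p i" by blast
          have cp: "c p > 0" using pull_i pull_some[OF p, of c] ci by simp
          have pR: "p \<in> R" using pts_R[OF p] by simp
          have pI: "p \<in> I" using cp walls_off_I[OF c, of p] pR by force
          have "p \<in> J" using b_closed[OF p] iK K_R pR by (auto simp: J_def)
          hence "p \<in> K" using pI by (simp add: K_def)
          moreover have "c p \<ge> 1" using coset_J[OF cos \<open>p \<in> J\<close>] cp by (auto elim!: Ints_cases)
          ultimately have "p \<in> S" using PS by (auto simp: positive_part_def)
          thus False using SD(3)[OF iS p] by blast
        qed
      qed
      thus ?thesis by (intro sum.neutral ballI)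
    qed
  qed
  thus ?thesis unfolding functionals_def by (auto simp: basic_functional_def)
qed

lemma bas_coset: "bas S \<in> coset R b"
  by (auto simp: coset_def bas_def)

lemma bas_nonneg: "bas S i \<ge> 0"
  using b_range[of i] by (auto simp: bas_def)

lemma pull_ge:
  assumes "\<And>i. i \<in> R \<Longrightarrow> c i \<ge> 0" "i \<in> R"
  shows "pull A R c k \<ge> of_nat (A i k) * c i"
  unfolding pull_def using assms finR by (intro member_le_sum) auto

text \<open>A fixed variable gets its positive exponent from its own row, except at points of
  \<open>K - S\<close>, where the own coordinate is 0 and the predecessor in \<open>S\<close>
  provides it.\<close>

lemma bas_states:
  assumes "alternating S" "R - I \<subseteq> J"
  shows "bas S \<in> st"
proof -
  note SD = alternatingD[OF assms(1)]
  have "pull A R (bas S) k > 0" if k: "k \<in> I" for k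
  proof -
    have kR: "k \<in> R" using k IR by blast
    have "\<exists>i\<in>R. A i k > 0 \<and> bas S i > 0"
    proof (cases "k \<in> K - S")
      case True
      then obtain p where p: "p \<in> S" "pts p k" using SD(4) by blast
      hence "bas S p > 0" using b_range[of p] pts_R[of p k] by (simp add: bas_def add_nonneg_pos)
      thus ?thesis using p by (intro bexI[of _ p]) (auto simp: pts_def)
    next
      case False
      hence "bas S k > 0" using k kR b_range[OF kR]
        by (auto simp: bas_def K_def J_def order_less_le)
      thus ?thesis using kR diag[OF kR] by (intro bexI[of _ k]) auto
    qed
    then obtain i where i: "i \<in> R" "A i k > 0" "bas S i > 0" by blast
    have "0 < of_nat (A i k) * bas S i" using i by simp
    also have "\<dots> \<le> pull A R (bas S) k" using i by (intro pull_ge bas_nonneg)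
    finally show ?thesis .
  qed
  moreover have "pull A R (bas S) k = 0" if k: "k \<in> R - I" for k
  proof -
    have z: "bas S i = 0" if "i \<in> R - I" for i
      using that assms(2) SD(1) K_R by (auto simp: bas_def J_def)
    show ?thesis
    proof (cases "\<exists>p. pts p k")
      case True
      then obtain p where p: "pts p k" by blast
      hence "p \<in> R - I" using I_closed k pts_R by blast
      thus ?thesis using pull_some[OF p, of "bas S"] z k by simp
    qed (use pull_none[of k "bas S"] z k in simp)
  qed
  ultimately show ?thesis by (simp add: states_def bas_coset)
qed

lemma positive_part_bas: "S \<subseteq> K \<Longrightarrow> positive_part (bas S) = S"
  using K_R IR by (auto simp: positive_part_def bas_def J_def subset_iff)

lemma pull_lower_other:
  "i \<in> R \<Longrightarrow> k \<in> R \<Longrightarrow> k \<noteq> i \<Longrightarrow> \<not> pts i k \<Longrightarrow> pull A R (lower i c) k = pull A R c k"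
  using entry_zero[of i k] by (simp add: pull_lower finR)

text \<open>Lowering row \<open>i\<close> affects only x_i and the variable to which
  \<open>i\<close> points, so positivity has to be checked there alone.\<close>

lemma lower_in_walls:
  assumes c: "c \<in> st" and i: "i \<in> I" and l: "l \<in> I" "pull A R (lower i c) l \<ge> 0"
    and rest: "\<And>k. k \<in> I \<Longrightarrow> k \<noteq> l \<Longrightarrow> k = i \<or> pts i k \<Longrightarrow> pull A R (lower i c) k > 0"
  shows "lower i c \<in> walls A R R I b l"
    and "pull A R (lower i c) l > 0 \<Longrightarrow> lower i c \<in> st"
proof -
  have iR: "i \<in> R" using i IR by blast
  have "pull A R (lower i c) k > 0" if k: "k \<in> I" "k \<noteq> l" for k
  proof (cases "k = i \<or> pts i k")
    case False
    hence "pull A R (lower i c) k = pull A R c k" using iR k IR by (intro pull_lower_other) auto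
    thus ?thesis using c k by (simp add: states_def)
  qed (use rest k in blast)
  moreover have "pull A R (lower i c) k = 0" if k: "k \<in> R - I" for k
  proof -
    have "pull A R (lower i c) k = pull A R c k"
      using iR k i I_closed by (intro pull_lower_other) auto
    thus ?thesis using c k by (simp add: states_def)
  qed
  moreover have "lower i c \<in> coset R b" using c iR by (simp add: coset_lower states_def)
  ultimately show "lower i c \<in> walls A R R I b l" using l by (simp add: walls_def)
  show "lower i c \<in> st" if "pull A R (lower i c) l > 0"
    using \<open>lower i c \<in> walls A R R I b l\<close> that unfolding walls_def states_def by auto
qed

context
  fixes \<psi> assumes \<psi>: "\<psi> \<in> functionals A R R I (\<lambda>_. 1) b"
begin

lemma lower_zero: "lower i c \<in> st \<Longrightarrow> i \<in> R \<Longrightarrow> \<psi> c = 0"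
  by (rule functionals_lower[OF finR indep _ \<psi>]) simp

lemma wall_none:
  assumes "c \<in> walls A R R I b k" "k \<in> I" "\<nexists>p. pts p k"
  shows "\<psi> (raise k c) = 0"
proof -
  have "k \<in> R" using assms IR by blast
  thus ?thesis
    using functionals_wall[OF \<psi> assms(2,1)] diag[of k] column_sum(1)[of k "\<lambda>i. \<psi> (raise i c)"] assms(3)
    by auto
qed

lemma wall_some:
  assumes "c \<in> walls A R R I b k" "k \<in> I" "pts p k"
  shows "of_nat (A k k) * \<psi> (raise k c) + \<psi> (raise p c) = 0"
proof -
  have "k \<in> R" using assms IR by blast
  thus ?thesis
    using functionals_wall[OF \<psi> assms(2,1)] column_sum(2)[of k p "\<lambda>i. \<psi> (raise i c)"] assms(3)
    by auto
qed

text \<open>After lowering, coordinate \<open>i\<close> is still positive and by itself keeps all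
  variables of row \<open>i\<close> at positive exponents, so \<open>c\<close> lies above a
  state.\<close>

lemma zero_if_excess:
  assumes c: "c \<in> st" and nn: "\<And>i. i \<in> R \<Longrightarrow> c i \<ge> 0" and i: "i \<in> I" "c i > 1"
  shows "\<psi> c = 0"
proof -
  have iR: "i \<in> R" using i IR by blast
  have nn': "lower i c j \<ge> 0" if "j \<in> R" for j using nn that i by (simp add: lower_def)
  have pos: "pull A R (lower i c) k > 0" if "A i k > 0" for k
  proof -
    have "0 < of_nat (A i k) * lower i c i" using that i by (simp add: lower_def)
    also have "\<dots> \<le> pull A R (lower i c) k" using nn' iR by (intro pull_ge)
    finally show ?thesis .
  qed
  have "A i i > 0" using diag[OF iR] by simp
  hence "lower i c \<in> st"
    using pos by (intro lower_in_walls(2)[OF c i(1) i(1)]) (auto simp: pts_def less_imp_le)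
  thus ?thesis using lower_zero iR by blast
qed

text \<open>The fixed coordinates lie between 0 and 1 by the preceding vanishing. Congruence to
  \<open>b\<close> leaves 0 or 1 on \<open>K\<close> and only \<open>b i\<close> elsewhere.\<close>

lemma nonneg_is_bas:
  assumes c: "c \<in> st" and nn: "\<And>i. i \<in> R \<Longrightarrow> c i \<ge> 0" and nz: "\<psi> c \<noteq> 0" and RJ: "R - I \<subseteq> J"
  shows "c = bas (positive_part c)"
proof
  fix i
  have cos: "c \<in> coset R b" using c by (simp add: states_def)
  consider "i \<notin> R" | "i \<in> R - I" | "i \<in> K" | "i \<in> I - J" "i \<in> R" using IR by (auto simp: K_def)
  thus "c i = bas (positive_part c) i"
  proof cases
    case 1
    thus ?thesis using cos by (simp add: coset_def bas_def)
  next
    case 2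
    thus ?thesis using states_off_I[OF c] RJ K_R by (auto simp: bas_def positive_part_def J_def)
  next
    case 3
    have "c i \<le> 1" using zero_if_excess[OF c nn] nz 3 K_R by (meson not_le subsetD)
    moreover have "c i \<ge> 0" using nn 3 K_R IR by auto
    moreover have "c i \<in> \<int>" using coset_J[OF cos] 3 K_R by blast
    ultimately have "c i = 0 \<or> c i = 1" by (auto elim!: Ints_cases)
    thus ?thesis using 3 K_R IR by (auto simp: bas_def positive_part_def J_def)
  next
    case 4
    have "c i \<le> 1" using zero_if_excess[OF c nn] nz 4 by (meson not_le DiffD1)
    moreover have "c i - b i \<in> \<int>" using cos 4 by (simp add: coset_def)
    then obtain n where "c i - b i = of_int n" by (auto elim: Ints_cases)
    moreover have "b i > 0" "b i < 1" using b_range[of i] 4 by (auto simp: J_def order_less_le)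
    ultimately have "of_int n < (1::rat)" "of_int n > (- 1::rat)" "c i = b i + of_int n"
      using nn[of i] 4 by linarith+
    thus ?thesis using 4 by (auto simp: bas_def positive_part_def K_def)
  qed
qed

definition bad :: "'a set set" where
  "bad = {S. S \<subseteq> K \<and> bas S \<in> st \<and> \<not> alternating S}"

text \<open>Some \<open>i\<close> in \<open>S\<close> has no successor in \<open>K\<close> or has
  its successor in \<open>S\<close>. The variable to which it points, if any, then keeps a positive
  exponent when \<open>i\<close> is lowered. Unless the value vanishes at once, column
  \<open>i\<close> moves the unit from \<open>i\<close> to its predecessor with the factor
  \<open>- A i i\<close>, of modulus at least 2.\<close>

lemma bad_step:
  assumes S: "S \<in> bad"
  shows "\<psi> (bas S) = 0 \<or> (\<exists>S'\<in>bad. 2 * norm (\<psi> (bas S)) \<le> norm (\<psi> (bas S')))"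
proof -
  let ?c = "bas S"
  have SK: "S \<subseteq> K" and c: "?c \<in> st" and na: "\<not> alternating S" using S by (auto simp: bad_def)
  have S1: "?c i = 1" if "i \<in> S" for i using that SK K_R IR by (auto simp: bas_def J_def)
  have K0: "?c i = 0" if "i \<in> K - S" for i using that K_R IR by (auto simp: bas_def J_def)
  have dom: "\<exists>p\<in>S. pts p k" if k: "k \<in> K - S" for k
  proof -
    have kR: "k \<in> R" and pull: "pull A R ?c k > 0" using k c K_R IR by (auto simp: states_def)
    have "\<exists>p. pts p k" using pull pull_none[OF kR, of ?c] K0[OF k] by auto
    then obtain p where p: "pts p k" by blast
    have "?c p > 0" using pull pull_some[OF p, of ?c] K0[OF k] by simp
    moreover have "b p = 0" using b_closed[OF p] k K_R by (auto simp: J_def)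
    ultimately have "p \<in> S" by (auto simp: bas_def split: if_splits)
    thus ?thesis using p by blast
  qed
  obtain i where iS: "i \<in> S" and bad_i: "(\<nexists>k. k \<in> K \<and> pts i k) \<or> (\<exists>k\<in>S. pts i k)"
    using na SK dom unfolding alternating_def by blast
  have i: "i \<in> I" "i \<in> R" "i \<in> J" using iS SK K_R IR by auto
  have ci: "lower i ?c i = 0" using S1[OF iS] by (simp add: lower_def)
  have tgt: "?c t > 0" if t: "pts i t" for t
  proof (cases "t \<in> K")
    case True
    hence "t \<in> S" using bad_i t pts_unique(1) by blast
    thus ?thesis using S1 by simp
  next
    case False
    have "t \<in> I" "t \<in> R" using I_closed[OF t] i pts_R[OF t] by auto
    thus ?thesis using False b_range[of t] by (auto simp: bas_def K_def J_def order_less_le)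
  qed
  have tpull: "pull A R (lower i ?c) k > 0" if "pts i k" for k
  proof -
    have "lower i ?c k = ?c k" using pts_R[OF that] by (auto simp: lower_def)
    moreover have "A k k > 0" using diag[of k] pts_R[OF that] by simp
    ultimately show ?thesis using tgt[OF that] ci pull_some[OF that, of "lower i ?c"] by simp
  qed
  have wall: "lower i ?c \<in> walls A R R I b i"
    and stat: "pull A R (lower i ?c) i > 0 \<Longrightarrow> lower i ?c \<in> st"
    if "pull A R (lower i ?c) i \<ge> 0"
    using lower_in_walls[OF c i(1) i(1) that] tpull by blast+
  show ?thesis
  proof (cases "\<exists>p. pts p i")
    case False
    hence "pull A R (lower i ?c) i = 0" using pull_none[OF i(2), of "lower i ?c"] ci by simp
    hence "\<psi> (raise i (lower i ?c)) = 0" using wall_none[OF wall i(1)] False by simp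
    thus ?thesis by simp
  next
    case True
    then obtain p where p: "pts p i" by blast
    have cp: "lower i ?c p = ?c p" using pts_R[OF p] by (simp add: lower_def)
    have pi: "pull A R (lower i ?c) i = ?c p" using pull_some[OF p, of "lower i ?c"] ci cp by simp
    have pK: "?c p = 0 \<Longrightarrow> raise p (lower i ?c) \<in> st \<Longrightarrow> p \<in> K - S"
    proof -
      assume 0: "?c p = 0" and r: "raise p (lower i ?c) \<in> st"
      have "raise p (lower i ?c) p = 1" using 0 cp by (simp add: raise_def)
      hence "p \<in> I" using states_off_I[OF r, of p] pts_R[OF p] by force
      moreover have "p \<in> J" using b_closed[OF p] i pts_R[OF p] by (auto simp: J_def)
      ultimately show "p \<in> K - S" using S1 0 by (force simp: K_def)
    qed
    show ?thesis
    proof (cases "?c p > 0 \<or> raise p (lower i ?c) \<notin> st")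
      case True
      show ?thesis
      proof (cases "?c p > 0")
        case True
        hence "lower i ?c \<in> st" using stat pi by simp
        thus ?thesis using lower_zero i by blast
      next
        case False
        hence "?c p = 0" using bas_nonneg[of S p] by simp
        hence "of_nat (A i i) * \<psi> ?c = 0"
          using wall_some[OF wall i(1) p] pi True functionals_zero_outside[OF \<psi>] by simp
        thus ?thesis using diag[OF i(2)] by simp
      qed
    next
      case False
      hence 0: "?c p = 0" using bas_nonneg[of S p] by (simp add: order_less_le)
      have pK: "p \<in> K - S" using pK[OF 0] False by blast
      define S' where "S' = insert p (S - {i})"
      have eq: "raise p (lower i ?c) = bas S'"
        using pts_R[OF p] iS pK by (auto simp: fun_eq_iff raise_def lower_def bas_def S'_def)
      \<comment> \<open>The predecessor of \<open>p\<close> lies in \<open>S\<close> and survives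
        the move, so the new set contains both ends of an arrow and is bad again.\<close>
      obtain q where q: "q \<in> S" "pts q p" using dom[OF pK] by blast
      have "q \<noteq> i" using tgt q 0 by force
      hence "q \<in> S'" "p \<in> S'" using q by (auto simp: S'_def)
      hence "\<not> alternating S'" using q alternatingD(3) by blast
      hence S': "S' \<in> bad" using False eq SK pK by (auto simp: bad_def S'_def)
      have "of_nat (A i i) * \<psi> ?c = - \<psi> (bas S')"
        using wall_some[OF wall i(1) p] pi 0 by (simp add: eq eq_neg_iff_add_eq_0)
      hence "norm (of_nat (A i i) * \<psi> ?c) = norm (\<psi> (bas S'))" by simp
      hence "of_nat (A i i) * norm (\<psi> ?c) = norm (\<psi> (bas S'))" by (simp add: norm_mult)
      moreover have "2 * norm (\<psi> ?c) \<le> of_nat (A i i) * norm (\<psi> ?c)"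
        using diag[OF i(2)] by (intro mult_right_mono) auto
      ultimately show ?thesis using S' by auto
    qed
  qed
qed

text \<open>Moving units backwards may run around a loop, so that no termination measure is
  available. Instead the norm at least doubles with each move, which a finite family allows only if
  all values vanish.\<close>

lemma bad_zero:
  assumes "S \<in> bad"
  shows "\<psi> (bas S) = 0"
proof -
  let ?M = "Max ((\<lambda>S. norm (\<psi> (bas S))) ` bad)"
  have "finite K" using K_R IR finR by (meson finite_subset)
  hence "finite bad" by (auto simp: bad_def intro: finite_subset[of _ "Pow K"])
  hence fin: "finite ((\<lambda>S. norm (\<psi> (bas S))) ` bad)" by simp
  hence le: "norm (\<psi> (bas S)) \<le> ?M" if "S \<in> bad" for S using that by (intro Max_ge) auto
  have "?M \<in> (\<lambda>S. norm (\<psi> (bas S))) ` bad" using fin assms by (intro Max_in) auto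
  then obtain S0 where S0: "S0 \<in> bad" "norm (\<psi> (bas S0)) = ?M" by force
  have "?M \<le> 0"
  proof (cases "\<psi> (bas S0) = 0")
    case False
    then obtain S' where "S' \<in> bad" "2 * norm (\<psi> (bas S0)) \<le> norm (\<psi> (bas S'))"
      using bad_step[OF S0(1)] by blast
    thus ?thesis using le[of S'] S0 by simp
  qed (use S0 in simp)
  from order_trans[OF le[OF assms] this] show ?thesis by simp
qed

text \<open>A negative coordinate \<open>i\<close> is compensated by a large predecessor
  \<open>p\<close>, and the wall of column \<open>i\<close> exchanges a unit of \<open>p\<close> for
  a unit of \<open>i\<close>, which reduces the total negativity. A nonnegative state with nonzero
  value is of the form \<open>bas S\<close>, where \<open>S\<close> is alternating or bad.\<close>

lemma zero_if_zero_on_basis: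
  assumes RJ: "R - I \<subseteq> J" and basis: "\<And>S. alternating S \<Longrightarrow> \<psi> (bas S) = 0"
  shows "\<psi> c = 0"
proof (cases "c \<in> st")
  case True
  thus ?thesis
  proof (induction "\<Sum>i\<in>R. nat \<lceil>- c i\<rceil>" arbitrary: c rule: less_induct)
    case less
    note c = less.prems
    have cos: "c \<in> coset R b" using c by (simp add: states_def)
    show ?case
    proof (cases "\<forall>i\<in>R. c i \<ge> 0")
      case True
      show ?thesis
      proof (rule ccontr)
        assume nz: "\<psi> c \<noteq> 0"
        define S where "S = positive_part c"
        have c_eq: "c = bas S" using nonneg_is_bas[OF c _ nz RJ] True by (simp add: S_def)
        have "S \<subseteq> K" by (auto simp: S_def positive_part_def)
        hence "alternating S \<or> S \<in> bad" using c c_eq by (auto simp: bad_def)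
        thus False using basis bad_zero nz c_eq by auto
      qed
    next
      case False
      let ?N = "{i \<in> R. c i < 0}"
      have fin: "finite (c ` ?N)" using finR by simp
      have ne: "c ` ?N \<noteq> {}" using False by (auto simp: not_le)
      \<comment> \<open>The most negative coordinate is chosen: a predecessor q of \<open>p\<close>
        then satisfies c_q >= c_i, which keeps the exponent of x_p positive after \<open>p\<close>
        is lowered.\<close>
      from Min_in[OF fin ne] obtain i where i: "i \<in> R" "c i < 0" "c i = Min (c ` ?N)" by auto
      have min: "c j \<ge> c i" if "j \<in> R" "c j < 0" for j
        unfolding i(3) using that fin by (intro Min_le) auto
      have iI: "i \<in> I" using states_off_I[OF c, of i] i by force
      have pull_i: "pull A R c i \<ge> 1"
        using pull_Ints[OF cos i(1)] c iI by (auto simp: states_def elim!: Ints_cases)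
      have Ai: "of_nat (A i i) * c i \<le> 2 * c i"
        using diag[OF i(1)] i(2) by (intro mult_right_mono_neg) auto
      have "\<exists>p. pts p i"
      proof (rule ccontr)
        assume "\<not> ?thesis"
        hence "pull A R c i = of_nat (A i i) * c i" using pull_none[OF i(1), of c] by simp
        hence "pull A R c i \<le> 0" using Ai i(2) by linarith
        thus False using pull_i by simp
      qed
      then obtain p where p: "pts p i" by blast
      have pR: "p \<in> R" "p \<noteq> i" using pts_R[OF p] by auto
      have pull_i_eq: "pull A R c i = of_nat (A i i) * c i + c p" by (rule pull_some[OF p])
      have cp: "c p \<ge> 1 - 2 * c i" using pull_i pull_i_eq Ai by linarith
      hence cp1: "c p > 1" using i(2) by linarith
      have pI: "p \<in> I" using cp1 states_off_I[OF c, of p] pR by force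
      have Ap: "of_nat (A p p) * (c p - 1) \<ge> 2 * (c p - 1)"
        using diag[OF pR(1)] cp1 by (intro mult_right_mono) auto
      have pull_p: "pull A R c p > of_nat (A p p)"
      proof (cases "\<exists>q. pts q p")
        case False
        hence "pull A R c p = of_nat (A p p) * c p" using pull_none pR by blast
        thus ?thesis using Ap cp1 by (simp add: algebra_simps)
      next
        case True
        then obtain q where q: "pts q p" by blast
        have eq: "pull A R c p = of_nat (A p p) * c p + c q" by (rule pull_some[OF q])
        have "c q \<ge> c i" using min[of q] pts_R[OF q] i(2) by (cases "c q < 0") auto
        moreover have "pull A R c p - of_nat (A p p) = of_nat (A p p) * (c p - 1) + c q"
          unfolding eq by (simp add: algebra_simps)
        moreover have "of_nat (A p p) * (c p - 1) \<ge> 2 * c p - 2" using Ap by simp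
        moreover have "2 * c p - 2 + c i > 0" using cp i(2) by linarith
        ultimately have "pull A R c p - of_nat (A p p) > 0" by linarith
        thus ?thesis by simp
      qed
      have low_p: "pull A R (lower p c) p > 0" using pull_p pR finR by (simp add: pull_lower)
      have low_i: "pull A R (lower p c) i = pull A R c i - 1"
        using p pR finR by (simp add: pull_lower pts_def)
      have rest: "pull A R (lower p c) k > 0" if "k \<in> I" "k \<noteq> i" "k = p \<or> pts p k" for k
        using that low_p pts_unique(1)[OF p] by blast
      show ?thesis
      proof (cases "pull A R c i > 1")
        case True
        hence "lower p c \<in> st"
          using low_i rest by (intro lower_in_walls(2)[OF c pI iI]) auto
        thus ?thesis using lower_zero pR by blast
      next
        case False
        hence "lower p c \<in> walls A R R I b i"
          using low_i rest pull_i by (intro lower_in_walls(1)[OF c pI iI]) auto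
        from wall_some[OF this iI p]
        have rel: "of_nat (A i i) * \<psi> (raise i (lower p c)) + \<psi> c = 0" by simp
        have "\<psi> (raise i (lower p c)) = 0"
        proof (cases "raise i (lower p c) \<in> st")
          case True
          let ?c' = "raise i (lower p c)"
          have "(\<Sum>k\<in>R. nat \<lceil>- ?c' k\<rceil>) < (\<Sum>k\<in>R. nat \<lceil>- c k\<rceil>)"
          proof (rule sum_strict_mono_ex1[OF finR])
            show "\<forall>k\<in>R. nat \<lceil>- ?c' k\<rceil> \<le> nat \<lceil>- c k\<rceil>"
            proof
              fix k assume "k \<in> R"
              show "nat \<lceil>- ?c' k\<rceil> \<le> nat \<lceil>- c k\<rceil>"
              proof (cases "k = p")
                case True
                hence "\<lceil>- ?c' k\<rceil> \<le> 0" using cp1 pR by (simp add: raise_def lower_def ceiling_le_iff)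
                thus ?thesis by simp
              next
                case False
                have "- ?c' k \<le> - c k" using False by (auto simp: raise_def lower_def)
                thus ?thesis by (intro nat_mono ceiling_mono)
              qed
            qed
            have "?c' i = c i + 1" using pR by (simp add: raise_def lower_def)
            hence "- ?c' i = - c i - 1" by simp
            hence "\<lceil>- ?c' i\<rceil> = \<lceil>- c i\<rceil> - 1" by (simp only: ceiling_diff_one)
            moreover have "\<lceil>- c i\<rceil> > 0" using i(2) by simp
            ultimately have "nat \<lceil>- ?c' i\<rceil> < nat \<lceil>- c i\<rceil>" by simp
            thus "\<exists>k\<in>R. nat \<lceil>- ?c' k\<rceil> < nat \<lceil>- c k\<rceil>" using i(1) by blast
          qed
          from less.hyps[OF this True] show ?thesis .
        qed (rule functionals_zero_outside[OF \<psi>])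
        thus ?thesis using rel by simp
      qed
    qed
  qed
qed (rule functionals_zero_outside[OF \<psi>])

end

text \<open>Passing to the successor is a bijection from \<open>S\<close> to \<open>K - S\<close>.
  Hence all basic states of a sector have the same degree.\<close>

lemma card_alternating:
  assumes "alternating S"
  shows "2 * card S = card K"
proof -
  note SD = alternatingD[OF assms]
  have fK: "finite K" using K_R IR finR by (meson finite_subset)
  define nx where "nx i = (THE k. pts i k)" for i
  have nx: "pts i (nx i)" if "i \<in> S" for i
    unfolding nx_def using SD(2)[OF that] pts_unique(1) by (metis theI)
  have "inj_on nx S" using nx pts_unique(2) by (metis inj_onI)
  moreover have "nx ` S = K - S"
  proof
    show "nx ` S \<subseteq> K - S" using nx SD(5) by blast
    show "K - S \<subseteq> nx ` S"
    proof
      fix k assume "k \<in> K - S"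
      then obtain p where "p \<in> S" "pts p k" using SD(4) by blast
      thus "k \<in> nx ` S" using nx pts_unique(1) by blast
    qed
  qed
  ultimately have "card (K - S) = card S" using card_image by metis
  moreover have "card K = card S + card (K - S)"
    using SD(1) fK by (metis card_Diff_subset card_mono finite_subset le_add_diff_inverse)
  ultimately show ?thesis by simp
qed

text \<open>Basic states of different alternating sets have different positive parts, so the basic
  functionals, divided by weights, are dual to them.\<close>

theorem sector_dim_base:
  assumes RJ: "R - I \<subseteq> J"
  shows "sector_dim A R R I (\<lambda>_. 1) b (sum b R + of_nat (card K) / 2) (card {S. alternating S})"
proof -
  let ?B = "bas ` {S. alternating S}"
  have fK: "finite K" using K_R IR finR by (meson finite_subset)
  have fin: "finite {S. alternating S}"
    by (rule finite_subset[of _ "Pow K"]) (auto simp: fK dest: alternatingD(1))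
  have pp: "positive_part (bas S) = S" if "alternating S" for S
    using positive_part_bas alternatingD(1)[OF that] by blast
  have inj: "inj_on bas {S. alternating S}" using pp by (metis inj_onI mem_Collect_eq)
  have st: "bas S \<in> st" if "alternating S" for S using bas_states[OF that RJ] .
  have deg: "sum (bas S) R = sum b R + of_nat (card K) / 2" if "alternating S" for S
  proof -
    have "S \<subseteq> R" using alternatingD(1)[OF that] K_R IR by blast
    hence "(\<Sum>i\<in>R. of_bool (i \<in> S)) = (of_nat (card S) :: rat)"
      using finR by (simp add: Int_absorb1 flip: Int_def)
    moreover have "of_nat (card K) / 2 = (of_nat (card S) :: rat)"
      using card_alternating[OF that] by (metis nonzero_mult_div_cancel_left of_nat_mult of_nat_numeral zero_neq_numeral)
    ultimately show ?thesis by (simp add: bas_def sum.distrib)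
  qed
  have ex: "\<exists>\<psi>\<in>functionals A R R I (\<lambda>_. 1) b. \<forall>c\<in>?B. \<psi> c = v c" for v
  proof (intro bexI ballI)
    let ?\<psi> = "\<lambda>c. \<Sum>S\<in>{S. alternating S}. v (bas S) / weight (bas S) * basic_functional S c"
    show "?\<psi> \<in> functionals A R R I (\<lambda>_. 1) b"
      using basic_functional_in[OF _ RJ] by (intro functionals_sum) simp
    fix c assume "c \<in> ?B"
    then obtain T where T: "alternating T" "c = bas T" by blast
    have "?\<psi> c = (\<Sum>S\<in>{T}. v (bas S) / weight (bas S) * basic_functional S c)"
      using fin T pp[OF T(1)] by (intro sum.mono_neutral_right) (auto simp: basic_functional_def)
    also have "\<dots> = v c"
      using T st[OF T(1)] pp[OF T(1)] weight_nonzero by (simp add: basic_functional_def)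
    finally show "?\<psi> c = v c" .
  qed
  have un: "\<forall>c. \<psi> c = 0" if "\<psi> \<in> functionals A R R I (\<lambda>_. 1) b" "\<forall>c\<in>?B. \<psi> c = 0" for \<psi>
    using zero_if_zero_on_basis[OF that(1) RJ] that(2) by blast
  show ?thesis unfolding sector_dim_def
  proof (intro exI[of _ ?B] conjI)
    show "finite ?B" "card ?B = card {S. alternating S}" "?B \<subseteq> st"
      using fin inj st by (auto simp: card_image)
    show "\<forall>c\<in>?B. sum c R = sum b R + of_nat (card K) / 2" using deg by blast
  qed (use ex un in blast)+
qed

end

section \<open>Isolated critical points\<close>

definition critical :: "('r \<Rightarrow> 'c \<Rightarrow> nat) \<Rightarrow> 'r set \<Rightarrow> 'c set \<Rightarrow> ('r \<Rightarrow> complex) \<Rightarrow> complex ^ 'c \<Rightarrow> bool" where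
  "critical E R C a z \<longleftrightarrow>
     (\<forall>j\<in>C. (\<Sum>i\<in>R. a i * of_nat (E i j) * (z $ j) ^ (E i j - 1) *
        (\<Prod>k\<in>C - {j}. (z $ k) ^ E i k)) = 0)"

text \<open>The coefficients are existentially quantified because the elimination changes them.
  Coordinates outside \<open>C\<close> do not enter and stay free.\<close>

definition isolated :: "('r \<Rightarrow> 'c::finite \<Rightarrow> nat) \<Rightarrow> 'r set \<Rightarrow> 'c set \<Rightarrow> bool" where
  "isolated E R C \<longleftrightarrow>
     (\<exists>a. (\<forall>i\<in>R. a i \<noteq> 0) \<and>
        (\<forall>\<^sub>F z in nhds 0. critical E R C a z \<longrightarrow> (\<forall>j\<in>C. z $ j = 0)))"

lemma independent_rows_nonzero:
  assumes "finite R" "finite C" "independent_rows E R C" "i \<in> R"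
  shows "sum (E i) C \<noteq> 0"
proof
  assume "sum (E i) C = 0"
  hence "E i j = 0" if "j \<in> C" for j using that assms(2) by simp
  hence "\<forall>j\<in>C. (\<Sum>k\<in>R. of_bool (k = i) * of_nat (E k j)) = (0::complex)"
    by (intro ballI sum.neutral) auto
  hence "\<forall>k\<in>R. of_bool (k = i) = (0::complex)"
    using assms(3) unfolding independent_rows_def
    by (elim allE[of _ "\<lambda>k. of_bool (k = i)"]) blast
  thus False using assms(4) by auto
qed

lemma norm_axis_complex: "norm (axis j t :: complex ^ 'c::finite) = norm t"
proof -
  have "(\<Sum>k\<in>UNIV. (norm ((axis j t :: complex ^ 'c) $ k))\<^sup>2) = (norm t)\<^sup>2"
    by (subst sum.remove[of _ j]) (auto simp: axis_def)
  thus ?thesis by (simp add: norm_vec_def L2_set_def)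
qed

text \<open>Otherwise the whole \<open>x\<^sub>j\<close>-axis would consist of critical points.\<close>

lemma isolated_good_row:
  fixes E :: "'r \<Rightarrow> 'c::finite \<Rightarrow> nat"
  assumes iso: "isolated E R C" and finR: "finite R" and indep: "independent_rows E R C"
    and row: "\<And>i. i \<in> R \<Longrightarrow> sum (E i) C \<noteq> 1" and j: "j \<in> C"
  shows "\<exists>i\<in>R. E i j \<ge> 1 \<and> sum (E i) (C - {j}) \<le> 1"
proof (rule ccontr)
  assume neg: "\<not> ?thesis"
  have ge2: "sum (E i) (C - {j}) \<ge> 2" if i: "i \<in> R" for i
  proof (cases "E i j = 0")
    case True
    have "sum (E i) C = E i j + sum (E i) (C - {j})" using j by (intro sum.remove) auto
    hence "sum (E i) (C - {j}) \<noteq> 0" "sum (E i) (C - {j}) \<noteq> 1"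
      using True row[OF i] independent_rows_nonzero[OF finR _ indep i] by (metis add_0 finite)+
    thus ?thesis by linarith
  next
    case False
    thus ?thesis using neg i by (auto simp: not_le)
  qed
  \<comment> \<open>Every row has degree at least 2 in the variables other than x_j, so each term of
    each derivative retains such a variable, and it vanishes on the axis.\<close>
  have crit: "critical E R C a (axis j t)" for a t
    unfolding critical_def
  proof (intro ballI sum.neutral)
    fix m i assume m: "m \<in> C" and i: "i \<in> R"
    have ex: "\<exists>k\<in>C - {j}. k \<noteq> m \<and> E i k > 0" if "E i m \<le> 1 \<or> m = j"
    proof (rule ccontr)
      assume "\<not> ?thesis"
      hence "sum (E i) (C - {j}) \<le> sum (E i) ({m} - {j})"
        by (subst sum.mono_neutral_right[of "C - {j}" "{m} \<inter> (C - {j})"]) (auto intro!: sum_mono2)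
      also have "\<dots> \<le> 1" using that by (cases "m = j") auto
      finally show False using ge2[OF i] by simp
    qed
    show "a i * of_nat (E i m) * (axis j t $ m) ^ (E i m - 1) *
        (\<Prod>k\<in>C - {m}. (axis j t $ k) ^ E i k) = 0"
    proof (cases "E i m \<le> 1 \<or> m = j")
      case True
      then obtain k where k: "k \<in> C - {j}" "k \<noteq> m" "E i k > 0" using ex by blast
      hence "(\<Prod>k\<in>C - {m}. (axis j t $ k) ^ E i k) = 0"
        by (intro prod_zero bexI[of _ k]) (auto simp: axis_def)
      thus ?thesis by simp
    next
      case False
      hence "(axis j t $ m) ^ (E i m - 1) = 0" by (auto simp: axis_def)
      thus ?thesis by simp
    qed
  qed
  obtain a where "\<forall>\<^sub>F z in nhds 0. critical E R C a z \<longrightarrow> (\<forall>j\<in>C. z $ j = 0)"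
    using iso unfolding isolated_def by blast
  then obtain d where d: "d > 0"
    and P: "\<And>z. dist z 0 < d \<Longrightarrow> critical E R C a z \<Longrightarrow> \<forall>j\<in>C. z $ j = 0"
    unfolding eventually_nhds_metric by blast
  have "dist (axis j (of_real (d / 2)) :: complex ^ 'c) 0 < d" using d by (simp add: norm_axis_complex)
  from P[OF this crit] j have "axis j (of_real (d / 2)) $ j = (0::complex)" by blast
  thus False using d by (simp add: axis_def)
qed

text \<open>The derivative of z^e (z^m)^p computed in two ways, in a form that remains true where an
  exponent is truncated at 0.\<close>

lemma power_product_rule:
  fixes z :: "'a::comm_ring_1"
  shows "of_nat (e + p * m) * z ^ (e + p * m - 1) =
    of_nat e * z ^ (e - 1) * (z ^ m) ^ p + of_nat p * of_nat m * z ^ (m - 1) * (z ^ m) ^ (p - 1) * z ^ e"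
proof -
  have 1: "of_nat e * z ^ (e + p * m - 1) = of_nat e * z ^ (e - 1) * (z ^ m) ^ p"
    by (cases e) (simp_all add: power_add power_mult[symmetric] mult.commute[of p m])
  have 2: "of_nat (p * m) * z ^ (e + p * m - 1) =
      of_nat p * of_nat m * z ^ (m - 1) * (z ^ m) ^ (p - 1) * z ^ e"
  proof (cases "p = 0 \<or> m = 0")
    case False
    then obtain p' m' where "p = Suc p'" "m = Suc m'" by (metis not0_implies_Suc)
    thus ?thesis by (simp add: power_add power_mult[symmetric] algebra_simps)
  qed auto
  show ?thesis using 1 2 by (simp add: distrib_right)
qed

locale reduction_finite = reduction E R C r s x y
  for E :: "'r::finite \<Rightarrow> 'c::finite \<Rightarrow> nat" and R C r s x y
begin

text \<open>The degree of a row does not drop, because M is not constant: otherwise row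
  \<open>s\<close> would be linear.\<close>

lemma row_D:
  assumes "\<And>i. i \<in> R \<Longrightarrow> sum (E i) C \<noteq> 1" and i: "i \<in> R'"
  shows "sum (D i) C' \<noteq> 1"
proof -
  have sC: "sum f C = f x + f y + sum f C'" for f :: "'c \<Rightarrow> nat"
  proof -
    have "sum f (insert x (insert y C')) = f x + f y + sum f C'"
      using xy by (simp add: C'_def add.assoc)
    thus ?thesis by (simp flip: C_eq)
  qed
  have 1: "sum (D i) C' = sum (E i) C' + E i y * sum (E s) C'"
    by (simp add: D_def sum.distrib sum_distrib_left)
  have "E i y + sum (E i) C' \<noteq> 1" using assms(1)[of i] i R'D[OF i] by (simp add: sC)
  moreover have "sum (E s) C' \<noteq> 0" using assms(1)[of s] sR by (simp add: sC Esy)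
  hence "sum (E s) C' \<ge> 1" by linarith
  moreover from this have "E i y \<le> E i y * sum (E s) C'" by simp
  ultimately show ?thesis unfolding 1 by (cases "E i y = 0") (simp, linarith)
qed

text \<open>A critical point of the reduced polynomial lifts to one of the original: y is determined
  by the vanishing of the x-derivative and x by that of the y-derivative. The lift is continuous and
  fixes the origin, so isolation descends.\<close>

lemma isolated_D:
  assumes iso: "isolated E R C" and row: "\<And>i. i \<in> R \<Longrightarrow> sum (E i) C \<noteq> 1"
  shows "isolated D R' C'"
proof -
  obtain a where a: "\<And>i. i \<in> R \<Longrightarrow> a i \<noteq> 0"
    and ev: "\<forall>\<^sub>F z in nhds 0. critical E R C a z \<longrightarrow> (\<forall>j\<in>C. z $ j = 0)"
    using iso unfolding isolated_def by blast
  \<comment> \<open>\<open>Y\<close> solves the x-derivative a_r y + a_s M = 0. \<open>X\<close>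
    solves the y-derivative, in which x occurs linearly with coefficient \<open>a r\<close>. The
    coefficients \<open>a'\<close> arise from the substitution of q M for y.\<close>
  define q where "q = - (a s / a r)"
  define M where "M z = (\<Prod>l\<in>C'. (z $ l) ^ E s l)" for z :: "complex ^ 'c"
  define Y where "Y z = q * M z" for z
  define X where "X z = - (\<Sum>i\<in>R'. a i * of_nat (E i y) * Y z ^ (E i y - 1) *
      (\<Prod>l\<in>C'. (z $ l) ^ E i l)) / a r" for z
  define T where "T z = (\<chi> k. if k = y then Y z else if k = x then X z else if k \<in> C' then z $ k else 0)"
    for z :: "complex ^ 'c"
  define a' where "a' i = a i * q ^ E i y" for i
  have ar: "a r \<noteq> 0" "a s \<noteq> 0" using a by (simp_all add: rR sR)
  hence q0: "q \<noteq> 0" by (simp add: q_def)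
  have T [simp]: "T z $ y = Y z" "T z $ x = X z" for z using xy by (simp_all add: T_def)
  have Tl [simp]: "l \<in> C' \<Longrightarrow> T z $ l = z $ l" for z l by (auto simp: T_def C'_def)
  have notin: "x \<notin> C'" "y \<notin> C'" by (simp_all add: C'_def)
  have Cx: "C - {x} = insert y C'" and Cy: "C - {y} = insert x C'" using xC yC xy by (auto simp: C'_def)
  have Cl: "C - {l} = insert x (insert y (C' - {l}))" if "l \<in> C'" for l
    using that xC yC by (auto simp: C'_def)
  have crit: "critical E R C a (T z)" if z: "critical D R' C' a' z" for z
    unfolding critical_def
  proof
    fix j assume "j \<in> C"
    then consider "j = x" | "j = y" | "j \<in> C'" by (auto simp: C'_def)
    thus "(\<Sum>i\<in>R. a i * of_nat (E i j) * (T z $ j) ^ (E i j - 1) * (\<Prod>k\<in>C - {j}. (T z $ k) ^ E i k)) = 0"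
    proof cases
      case 1
      have "a r * Y z + a s * M z = 0" using ar by (simp add: Y_def q_def)
      moreover have "(\<Prod>k\<in>C'. (T z $ k) ^ E s k) = M z" unfolding M_def by (intro prod.cong) auto
      ultimately show ?thesis unfolding 1 Cx using notin by (simp add: sum_R Esy)
    next
      case 2
      have "(\<Prod>k\<in>C'. (T z $ k) ^ E i k) = (\<Prod>k\<in>C'. (z $ k) ^ E i k)" for i
        by (intro prod.cong) auto
      thus ?thesis unfolding 2 Cy using notin ar by (simp add: sum_R Esy X_def)
    next
      case 3
      define e where "e i = (\<Prod>k\<in>C' - {j}. (z $ k) ^ E i k)" for i
      have e: "(\<Prod>k\<in>C' - {j}. (T z $ k) ^ E i k) = e i" for i
        unfolding e_def by (intro prod.cong) auto
      have e': "(\<Prod>k\<in>C'. (z $ k) ^ E i k) = (z $ j) ^ E i j * e i" for i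
        unfolding e_def using 3 by (intro prod.remove) auto
      have eD: "(\<Prod>k\<in>C' - {j}. (z $ k) ^ D i k) = e i * e s ^ E i y" for i
        unfolding e_def D_def
        by (simp add: power_add prod.distrib prod_power_distrib power_mult[symmetric] mult.commute)
      have "j \<noteq> x" "j \<noteq> y" using 3 notin by auto
      have red: "(\<Prod>k\<in>C - {j}. (T z $ k) ^ E i k) = X z ^ E i x * Y z ^ E i y * e i" for i
      proof -
        have "prod g (insert x (insert y (C' - {j}))) = g x * (g y * prod g (C' - {j}))"
          for g :: "'c \<Rightarrow> complex" using notin xy by simp
        thus ?thesis unfolding Cl[OF 3] e[symmetric] by simp
      qed
      have Ms: "M z = (z $ j) ^ E s j * e s" unfolding M_def by (rule e')
      \<comment> \<open>The derivative of M along x_j; the next identity is the chain rule for y = q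
        M.\<close>
      define c where "c = of_nat (E s j) * (z $ j) ^ (E s j - 1) * e s"
      have trm: "a' i * of_nat (D i j) * (z $ j) ^ (D i j - 1) * (\<Prod>k\<in>C' - {j}. (z $ k) ^ D i k) =
          a i * of_nat (E i j) * (z $ j) ^ (E i j - 1) * (Y z ^ E i y * e i) +
          c * q * (a i * of_nat (E i y) * Y z ^ (E i y - 1) * ((z $ j) ^ E i j * e i))" for i
      proof (cases "E i y")
        case 0
        hence "D i j = E i j" by (simp add: D_def)
        thus ?thesis unfolding eD a'_def 0 by simp
      next
        case (Suc p)
        have "of_nat (D i j) * (z $ j) ^ (D i j - 1) =
            of_nat (E i j) * (z $ j) ^ (E i j - 1) * ((z $ j) ^ E s j) ^ E i y +
            of_nat (E i y) * of_nat (E s j) * (z $ j) ^ (E s j - 1) * ((z $ j) ^ E s j) ^ (E i y - 1) * (z $ j) ^ E i j"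
          unfolding D_def by (rule power_product_rule)
        hence "a' i * (of_nat (D i j) * (z $ j) ^ (D i j - 1)) * (e i * e s ^ E i y) =
            a' i * (of_nat (E i j) * (z $ j) ^ (E i j - 1) * ((z $ j) ^ E s j) ^ E i y +
            of_nat (E i y) * of_nat (E s j) * (z $ j) ^ (E s j - 1) * ((z $ j) ^ E s j) ^ (E i y - 1) * (z $ j) ^ E i j) *
            (e i * e s ^ E i y)" by (simp only:)
        also have "\<dots> = a i * of_nat (E i j) * (z $ j) ^ (E i j - 1) * (Y z ^ E i y * e i) +
          c * q * (a i * of_nat (E i y) * Y z ^ (E i y - 1) * ((z $ j) ^ E i j * e i))"
          unfolding Y_def Ms c_def a'_def Suc by (simp add: power_mult_distrib algebra_simps)
        finally show ?thesis by (simp add: eD mult.assoc)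
      qed
      have "(\<Sum>i\<in>R'. a' i * of_nat (D i j) * (z $ j) ^ (D i j - 1) * (\<Prod>k\<in>C' - {j}. (z $ k) ^ D i k)) = 0"
        using z 3 by (simp add: critical_def)
      hence "(\<Sum>i\<in>R'. a i * of_nat (E i j) * (z $ j) ^ (E i j - 1) * (Y z ^ E i y * e i)) +
          c * q * (\<Sum>i\<in>R'. a i * of_nat (E i y) * Y z ^ (E i y - 1) * ((z $ j) ^ E i j * e i)) = 0"
        unfolding trm sum.distrib sum_distrib_left[symmetric] .
      moreover have "(\<Sum>i\<in>R'. a i * of_nat (E i y) * Y z ^ (E i y - 1) * ((z $ j) ^ E i j * e i)) = - a r * X z"
        unfolding X_def e' using ar by simp
      moreover have "c * q * (- a r * X z) = a s * c * X z" using ar by (simp add: q_def)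
      ultimately have "(\<Sum>i\<in>R'. a i * of_nat (E i j) * (z $ j) ^ (E i j - 1) * (Y z ^ E i y * e i)) +
          a s * c * X z = 0" by simp
      thus ?thesis
        unfolding red using 3 by (simp add: sum_R Esy c_def algebra_simps)
    qed
  qed
  have sC: "sum f C = f x + f y + sum f C'" for f :: "'c \<Rightarrow> nat"
  proof -
    have "sum f (insert x (insert y C')) = f x + f y + sum f C'"
      using xy by (simp add: C'_def add.assoc)
    thus ?thesis by (simp flip: C_eq)
  qed
  have prod0: "(\<Prod>l\<in>C'. (0 $ l) ^ E i l) = (0::complex)" if i: "sum (E i) C' \<noteq> 0" for i
  proof -
    obtain l where "l \<in> C'" "E i l \<noteq> 0" using i by (meson sum.neutral)
    thus ?thesis by (intro prod_zero) auto
  qed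
  \<comment> \<open>The origin is fixed because there are no linear monomials: M is not constant,
    and a row with y-exponent 1 contains a further variable.\<close>
  have "sum (E s) C' \<noteq> 0" using row[of s] sR by (simp add: sC Esy)
  hence Y0: "Y 0 = 0" by (simp add: Y_def M_def prod0)
  have X0: "X 0 = 0"
  proof -
    have "a i * of_nat (E i y) * Y 0 ^ (E i y - 1) * (\<Prod>l\<in>C'. (0 $ l) ^ E i l) = 0" if i: "i \<in> R'" for i
    proof (cases "E i y = 1")
      case True
      have "sum (E i) C' \<noteq> 0" using row[of i] True R'D[OF i] i by (simp add: sC)
      thus ?thesis by (simp add: prod0)
    next
      case False
      thus ?thesis by (cases "E i y = 0") (auto simp: Y0)
    qed
    hence "(\<Sum>i\<in>R'. a i * of_nat (E i y) * Y 0 ^ (E i y - 1) * (\<Prod>l\<in>C'. (0 $ l) ^ E i l)) = 0"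
      by (intro sum.neutral ballI)
    thus ?thesis unfolding X_def by (simp only:) simp
  qed
  have T0: "T 0 = 0" by (simp add: vec_eq_iff T_def X0 Y0)
  have contM: "continuous_on UNIV (\<lambda>z :: complex ^ 'c. \<Prod>l\<in>C'. (z $ l) ^ E i l)" for i
    by (intro continuous_intros)
  have contY: "continuous_on UNIV Y" unfolding Y_def M_def by (intro continuous_intros)
  have contX: "continuous_on UNIV X"
    unfolding X_def using ar by (intro continuous_intros contY contM) auto
  have contT: "continuous_on UNIV T"
    unfolding T_def
  proof (rule continuous_on_vec_lambda)
    fix k
    show "continuous_on UNIV (\<lambda>z. if k = y then Y z else if k = x then X z else if k \<in> C' then z $ k else 0)"
      using contX contY by (cases "k = y"; cases "k = x"; cases "k \<in> C'") (auto intro: continuous_intros)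
  qed
  obtain U where U: "open U" "0 \<in> U" "\<forall>z\<in>U. critical E R C a z \<longrightarrow> (\<forall>j\<in>C. z $ j = 0)"
    using ev unfolding eventually_nhds by blast
  have "open (T -` U)" using contT U(1) by (simp add: open_vimage)
  moreover have "0 \<in> T -` U" using T0 U(2) by simp
  moreover have "\<forall>z\<in>T -` U. critical D R' C' a' z \<longrightarrow> (\<forall>j\<in>C'. z $ j = 0)"
  proof (intro ballI impI)
    fix z j assume z: "z \<in> T -` U" "critical D R' C' a' z" and j: "j \<in> C'"
    have "T z $ j = 0" using U(3) z crit[OF z(2)] C'D[OF j] by auto
    thus "z $ j = 0" using j by simp
  qed
  ultimately have "\<forall>\<^sub>F z in nhds 0. critical D R' C' a' z \<longrightarrow> (\<forall>j\<in>C'. z $ j = 0)"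
    unfolding eventually_nhds by blast
  moreover have "\<forall>i\<in>R'. a' i \<noteq> 0" using a q0 by (auto simp: a'_def R'_def)
  ultimately show ?thesis unfolding isolated_def by blast
qed

end

section \<open>Duality of sectors\<close>

abbreviation (input) tr :: "('r \<Rightarrow> 'c \<Rightarrow> nat) \<Rightarrow> 'c \<Rightarrow> 'r \<Rightarrow> nat" where
  "tr E \<equiv> \<lambda>j i. E i j"

text \<open>The properties of an invertible polynomial and its transpose that survive the
  elimination. The positive weights serve to show that y does not occur in row
  \<open>s\<close>.\<close>

definition nondegenerate :: "('r::finite \<Rightarrow> 'c::finite \<Rightarrow> nat) \<Rightarrow> 'r set \<Rightarrow> 'c set \<Rightarrow> bool" where
  "nondegenerate E R C \<longleftrightarrow>
     independent_rows E R C \<and> independent_rows (tr E) C R \<and>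
     (\<forall>i\<in>R. sum (E i) C \<noteq> 1) \<and> (\<forall>j\<in>C. sum (tr E j) R \<noteq> 1) \<and>
     (\<exists>w :: 'c \<Rightarrow> rat. (\<forall>j\<in>C. w j > 0) \<and> (\<forall>i\<in>R. (\<Sum>j\<in>C. of_nat (E i j) * w j) = 1)) \<and>
     isolated E R C \<and> isolated (tr E) C R"

text \<open>The two sectors for a pair of group elements are those with the roles of the twist and the
  character exchanged. The last two equations say that the bidegrees match.\<close>

definition sector_duality :: "('r::finite \<Rightarrow> 'c::finite \<Rightarrow> nat) \<Rightarrow> 'r set \<Rightarrow> 'c set \<Rightarrow> bool" where
  "sector_duality E R C \<longleftrightarrow>
     (\<forall>\<alpha> b. (\<forall>j\<in>C. 0 \<le> \<alpha> j \<and> \<alpha> j < 1) \<longrightarrow> (\<forall>i\<in>R. 0 \<le> b i \<and> b i < 1) \<longrightarrow>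
        (\<forall>i\<in>R. pull (tr E) C \<alpha> i \<in> \<int>) \<longrightarrow> (\<forall>j\<in>C. pull E R b j \<in> \<int>) \<longrightarrow>
        (\<exists>N \<kappa> \<kappa>'. sector_dim E R C {j\<in>C. \<alpha> j = 0} (\<lambda>_. 1) b \<kappa> N \<and>
           sector_dim (tr E) C R {i\<in>R. b i = 0} (\<lambda>_. 1) \<alpha> \<kappa>' N \<and>
           (N > 0 \<longrightarrow> \<kappa> + sum \<alpha> C = \<kappa>' + sum b R \<and>
              of_nat (card {j\<in>C. \<alpha> j = 0} + card {i\<in>R. b i = 0}) + sum \<alpha> C + sum b R =
                of_nat (card R) + \<kappa> + \<kappa>')))"

lemma (in reduction_sector) reduce_fixed:
  assumes "x \<in> I" "sector_dim D R' C' I' (\<lambda>_. 1) b \<kappa> N"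
  shows "sector_dim E R C I (\<lambda>_. 1) b (\<kappa> + 1) N"
proof -
  interpret reduction_fixed E R C r s x y I b using assms(1) by unfold_locales
  show ?thesis using assms(2) by (rule sector_dim_reduce)
qed

lemma (in reduction_sector) reduce_free:
  assumes "x \<notin> I" "sector_dim D R' C' I' (\<lambda>_. 1) b \<kappa> N"
  shows "sector_dim E R C I (\<lambda>_. 1) b \<kappa> N"
proof -
  interpret reduction_free E R C r s x y I b using assms(1) by unfold_locales
  show ?thesis using assms(2) by (rule sector_dim_reduce)
qed

lemma Ints_range_sum:
  fixes p q :: rat
  assumes "0 \<le> p" "p < 1" "0 \<le> q" "q < 1" "p + q \<in> \<int>"
  shows "p + q = of_bool (p \<noteq> 0)" "p = 0 \<longleftrightarrow> q = 0"
proof -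
  obtain n where n: "p + q = of_int n" using assms(5) by (auto elim: Ints_cases)
  have "of_int n < (2::rat)" "of_int n \<ge> (0::rat)" using assms n by linarith+
  hence "n = 0 \<or> n = 1" by simp linarith
  thus "p + q = of_bool (p \<noteq> 0)" "p = 0 \<longleftrightarrow> q = 0" using n assms by auto
qed

context reduction_finite
begin

lemma reduction_transpose:
  assumes "independent_rows (tr E) C R"
  shows "reduction_finite (tr E) C R x y r s"
  using assms rR sR rs xC yC xy row_r col_x Esy by unfold_locales auto

lemma sector_facts:
  assumes a: "\<forall>j\<in>C. 0 \<le> \<alpha> j \<and> \<alpha> j < 1" and aint: "\<forall>i\<in>R. pull (tr E) C \<alpha> i \<in> \<int>"
    and bint: "\<forall>j\<in>C. pull E R b j \<in> \<int>"
  shows "reduction_sector E R C r s x y {j\<in>C. \<alpha> j = 0} b"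
    and "\<alpha> x + \<alpha> y = of_bool (\<alpha> x \<noteq> 0)" "\<alpha> x = 0 \<longleftrightarrow> \<alpha> y = 0"
    and "\<forall>i\<in>R'. pull (tr D) C' \<alpha> i \<in> \<int>"
    and "reduction_sector.I' x y {j\<in>C. \<alpha> j = 0} = {j\<in>C'. \<alpha> j = 0}"
    and "sum \<alpha> C = sum \<alpha> C' + of_bool (\<alpha> x \<noteq> 0)"
    and "card {j\<in>C. \<alpha> j = 0} = card {j\<in>C'. \<alpha> j = 0} + 2 * of_bool (\<alpha> x = 0)"
proof -
  have sC: "sum f C = f x + f y + sum f C'" for f :: "'c \<Rightarrow> 'z::comm_monoid_add"
  proof -
    have "sum f (insert x (insert y C')) = f x + f y + sum f C'"
      using xy by (simp add: C'_def add.assoc)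
    thus ?thesis by (simp flip: C_eq)
  qed
  have ar: "\<alpha> x + \<alpha> y \<in> \<int>"
    using aint rR by (auto simp: pull_def sC)
  have ranges: "0 \<le> \<alpha> x" "\<alpha> x < 1" "0 \<le> \<alpha> y" "\<alpha> y < 1" using a xC yC by auto
  show 1: "\<alpha> x + \<alpha> y = of_bool (\<alpha> x \<noteq> 0)" "\<alpha> x = 0 \<longleftrightarrow> \<alpha> y = 0"
    using Ints_range_sum[OF ranges ar] by auto
  define m where "m = (\<Sum>l\<in>C'. of_nat (E s l) * \<alpha> l)"
  have as: "\<alpha> x + m \<in> \<int>" using bspec[OF aint sR] by (simp add: pull_def sC Esy m_def)
  hence may: "m - \<alpha> y \<in> \<int>"
  proof -
    have "m - \<alpha> y = (\<alpha> x + m) - (\<alpha> x + \<alpha> y)" by simp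
    thus ?thesis using Ints_diff[OF as ar] by simp
  qed
  show "reduction_sector E R C r s x y {j\<in>C. \<alpha> j = 0} b"
  proof
    show "x \<in> {j\<in>C. \<alpha> j = 0} \<longleftrightarrow> y \<in> {j\<in>C. \<alpha> j = 0}" using 1(2) xC yC by simp
    assume "x \<notin> {j\<in>C. \<alpha> j = 0}"
    hence nz: "\<alpha> x \<noteq> 0" using xC by simp
    \<comment> \<open>Here \<open>m\<close> is the phase of M. If M contained fixed variables only,
      invariance of x M would make the phase of x an integer.\<close>
    show "\<exists>l\<in>C' - {j\<in>C. \<alpha> j = 0}. E s l > 0"
    proof (rule ccontr)
      assume "\<not> ?thesis"
      hence "of_nat (E s l) * \<alpha> l = 0" if "l \<in> C'" for l using that C'D[OF that] by auto
      hence "m = 0" unfolding m_def by (intro sum.neutral ballI)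
      hence "\<alpha> x \<in> \<int>" using as by simp
      thus False using nz ranges by (auto elim!: Ints_cases)
    qed
  qed (use bint in auto)
  show "\<forall>i\<in>R'. pull (tr D) C' \<alpha> i \<in> \<int>"
  proof
    fix i assume i: "i \<in> R'"
    have "pull (tr E) C \<alpha> i \<in> \<int>" using aint R'D[OF i] by simp
    \<comment> \<open>Row \<open>i\<close> of \<open>D\<close> has the phase of M in place of that
      of y, and both are congruent to minus the phase of x.\<close>
    moreover have "pull (tr D) C' \<alpha> i = pull (tr E) C \<alpha> i + of_nat (E i y) * (m - \<alpha> y)"
      using i by (simp add: pull_def sC D_def m_def sum.distrib sum_distrib_left algebra_simps)
    ultimately show "pull (tr D) C' \<alpha> i \<in> \<int>" using may by (simp add: Ints_add Ints_mult)
  qed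
  show "reduction_sector.I' x y {j\<in>C. \<alpha> j = 0} = {j\<in>C'. \<alpha> j = 0}"
    by (subst reduction_sector.I'_def[OF \<open>reduction_sector E R C r s x y {j\<in>C. \<alpha> j = 0} b\<close>])
       (auto simp: C'_def)
  show "sum \<alpha> C = sum \<alpha> C' + of_bool (\<alpha> x \<noteq> 0)" using 1(1) by (simp add: sC)
  have "card {j\<in>C. \<alpha> j = 0} = (\<Sum>j\<in>C. of_bool (\<alpha> j = 0))" by (simp add: Int_def)
  also have "\<dots> = 2 * of_bool (\<alpha> x = 0) + (\<Sum>j\<in>C'. of_bool (\<alpha> j = 0))" using 1(2) by (simp add: sC)
  also have "(\<Sum>j\<in>C'. of_bool (\<alpha> j = 0)) = card {j\<in>C'. \<alpha> j = 0}" by (simp add: Int_def)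
  finally show "card {j\<in>C. \<alpha> j = 0} = card {j\<in>C'. \<alpha> j = 0} + 2 * of_bool (\<alpha> x = 0)" by simp
qed

lemma sector_dim_lift:
  assumes "\<forall>j\<in>C. 0 \<le> \<alpha> j \<and> \<alpha> j < 1" "\<forall>i\<in>R. pull (tr E) C \<alpha> i \<in> \<int>" "\<forall>j\<in>C. pull E R b j \<in> \<int>"
    and "sector_dim D R' C' {j\<in>C'. \<alpha> j = 0} (\<lambda>_. 1) b \<kappa> N"
  shows "sector_dim E R C {j\<in>C. \<alpha> j = 0} (\<lambda>_. 1) b (\<kappa> + of_bool (\<alpha> x = 0)) N"
proof -
  interpret reduction_sector E R C r s x y "{j\<in>C. \<alpha> j = 0}" b
    by (rule sector_facts[OF assms(1-3)])
  have "sector_dim D R' C' I' (\<lambda>_. 1) b \<kappa> N"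
    using assms(4) sector_facts(5)[OF assms(1-3)] by simp
  thus ?thesis using reduce_fixed reduce_free xC by (cases "\<alpha> x = 0") auto
qed

text \<open>Transposition exchanges (r, s) with (x, y) and turns \<open>D\<close> into its
  transpose, so both sectors reduce to one smaller dual pair. Degrees, ages and fixed dimensions
  change by amounts that depend only on whether x and y, respectively \<open>r\<close> and
  \<open>s\<close>, are fixed.\<close>

lemma sector_duality_lift:
  assumes indT: "independent_rows (tr E) C R" and D: "sector_duality D R' C'"
  shows "sector_duality E R C"
  unfolding sector_duality_def
proof (intro allI impI)
  fix \<alpha> :: "'c \<Rightarrow> rat" and b :: "'r \<Rightarrow> rat"
  assume a: "\<forall>j\<in>C. 0 \<le> \<alpha> j \<and> \<alpha> j < 1" and br: "\<forall>i\<in>R. 0 \<le> b i \<and> b i < 1"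
    and aint: "\<forall>i\<in>R. pull (tr E) C \<alpha> i \<in> \<int>" and bint: "\<forall>j\<in>C. pull E R b j \<in> \<int>"
  interpret T: reduction_finite "tr E" C R x y r s by (rule reduction_transpose[OF indT])
  have RC: "T.R' = C'" "T.C' = R'" by (auto simp: T.R'_def T.C'_def C'_def R'_def)
  have TD: "T.D = tr D" by (simp add: fun_eq_iff T.D_def D_def)
  note A = sector_facts[OF a aint bint] and B = T.sector_facts[OF br bint aint, unfolded RC TD]
  have "\<forall>j\<in>C'. 0 \<le> \<alpha> j \<and> \<alpha> j < 1" "\<forall>i\<in>R'. 0 \<le> b i \<and> b i < 1"
    using a br by (auto simp: C'_def R'_def)
  then obtain N \<kappa> \<kappa>' where *: "sector_dim D R' C' {j\<in>C'. \<alpha> j = 0} (\<lambda>_. 1) b \<kappa> N"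
    "sector_dim (tr D) C' R' {i\<in>R'. b i = 0} (\<lambda>_. 1) \<alpha> \<kappa>' N"
    "N > 0 \<longrightarrow> \<kappa> + sum \<alpha> C' = \<kappa>' + sum b R' \<and>
              of_nat (card {j\<in>C'. \<alpha> j = 0} + card {i\<in>R'. b i = 0}) + sum \<alpha> C' + sum b R' =
                of_nat (card R') + \<kappa> + \<kappa>'"
    using D A(4) B(4) unfolding sector_duality_def by blast
  have 1: "sector_dim E R C {j\<in>C. \<alpha> j = 0} (\<lambda>_. 1) b (\<kappa> + of_bool (\<alpha> x = 0)) N"
    by (rule sector_dim_lift[OF a aint bint *(1)])
  have 2: "sector_dim (tr E) C R {i\<in>R. b i = 0} (\<lambda>_. 1) \<alpha> (\<kappa>' + of_bool (b r = 0)) N"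
    by (rule T.sector_dim_lift[OF br bint aint, unfolded RC TD, OF *(2)])
  have "card (insert r (insert s R')) = card R' + 2" using rs by (simp add: R'_def)
  hence card: "card R = card R' + 2" by (simp flip: R_eq)
  have "N > 0 \<longrightarrow> (\<kappa> + of_bool (\<alpha> x = 0)) + sum \<alpha> C = (\<kappa>' + of_bool (b r = 0)) + sum b R \<and>
      of_nat (card {j\<in>C. \<alpha> j = 0} + card {i\<in>R. b i = 0}) + sum \<alpha> C + sum b R =
        of_nat (card R) + (\<kappa> + of_bool (\<alpha> x = 0)) + (\<kappa>' + of_bool (b r = 0))"
  proof
    assume "N > 0"
    with *(3) have e: "\<kappa> + sum \<alpha> C' = \<kappa>' + sum b R'"
      "of_nat (card {j\<in>C'. \<alpha> j = 0} + card {i\<in>R'. b i = 0}) + sum \<alpha> C' + sum b R' =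
        of_nat (card R') + \<kappa> + \<kappa>'" by auto
    show "(\<kappa> + of_bool (\<alpha> x = 0)) + sum \<alpha> C = (\<kappa>' + of_bool (b r = 0)) + sum b R \<and>
      of_nat (card {j\<in>C. \<alpha> j = 0} + card {i\<in>R. b i = 0}) + sum \<alpha> C + sum b R =
        of_nat (card R) + (\<kappa> + of_bool (\<alpha> x = 0)) + (\<kappa>' + of_bool (b r = 0))"
      unfolding A(6,7) B(6,7) card using e
      by (cases "\<alpha> x = 0"; cases "b r = 0") (auto simp: algebra_simps)
  qed
  thus "\<exists>N \<kappa> \<kappa>'. sector_dim E R C {j\<in>C. \<alpha> j = 0} (\<lambda>_. 1) b \<kappa> N \<and>
           sector_dim (tr E) C R {i\<in>R. b i = 0} (\<lambda>_. 1) \<alpha> \<kappa>' N \<and>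
           (N > 0 \<longrightarrow> \<kappa> + sum \<alpha> C = \<kappa>' + sum b R \<and>
              of_nat (card {j\<in>C. \<alpha> j = 0} + card {i\<in>R. b i = 0}) + sum \<alpha> C + sum b R =
                of_nat (card R) + \<kappa> + \<kappa>')"
    using 1 2 by blast
qed

lemma nondegenerate_D:
  assumes "nondegenerate E R C"
  shows "nondegenerate D R' C'"
proof -
  note nd = assms[unfolded nondegenerate_def]
  interpret T: reduction_finite "tr E" C R x y r s by (rule reduction_transpose) (use nd in blast)
  have RC: "T.R' = C'" "T.C' = R'" by (auto simp: T.R'_def T.C'_def C'_def R'_def)
  have TD: "T.D = tr D" by (simp add: fun_eq_iff T.D_def D_def)
  obtain w :: "'c \<Rightarrow> rat" where w: "\<forall>j\<in>C. w j > 0" "\<forall>i\<in>R. (\<Sum>j\<in>C. of_nat (E i j) * w j) = 1"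
    using nd by blast
  have sC: "sum f C = f x + f y + sum f C'" for f :: "'c \<Rightarrow> rat"
  proof -
    have "sum f (insert x (insert y C')) = f x + f y + sum f C'"
      using xy by (simp add: C'_def add.assoc)
    thus ?thesis by (simp flip: C_eq)
  qed
  have wD: "(\<Sum>j\<in>C'. of_nat (D i j) * w j) = 1" if i: "i \<in> R'" for i
  proof -
    \<comment> \<open>M and y have the same weight, as x y and x M both have weight 1; so the
      substitution is homogeneous.\<close>
    have "w x + w y = 1" using bspec[OF w(2) rR] by (simp add: sC)
    moreover have "w x + (\<Sum>j\<in>C'. of_nat (E s j) * w j) = 1" using bspec[OF w(2) sR] by (simp add: sC Esy)
    ultimately have m: "(\<Sum>j\<in>C'. of_nat (E s j) * w j) = w y" by simp
    have "(\<Sum>j\<in>C'. of_nat (D i j) * w j) =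
        (\<Sum>j\<in>C'. of_nat (E i j) * w j) + of_nat (E i y) * (\<Sum>j\<in>C'. of_nat (E s j) * w j)"
      by (simp add: D_def sum.distrib sum_distrib_left algebra_simps)
    thus ?thesis using bspec[OF w(2), of i] R'D[OF i] i m by (simp add: sC)
  qed
  have w': "\<forall>j\<in>C'. w j > 0" using w(1) by (auto simp: C'_def)
  show ?thesis unfolding nondegenerate_def
  proof (intro conjI)
    show "independent_rows D R' C'" by (rule independent_D)
    show "independent_rows (tr D) C' R'" using T.independent_D by (simp add: RC TD)
    show "\<forall>i\<in>R'. sum (D i) C' \<noteq> 1" using row_D nd by blast
    show "\<forall>j\<in>C'. sum (tr D j) R' \<noteq> 1" using T.row_D nd unfolding RC TD by blast
    show "\<exists>w :: 'c \<Rightarrow> rat. (\<forall>j\<in>C'. w j > 0) \<and> (\<forall>i\<in>R'. (\<Sum>j\<in>C'. of_nat (D i j) * w j) = 1)"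
      using wD w' by blast
    show "isolated D R' C'" using isolated_D nd by blast
    show "isolated (tr D) C' R'" using T.isolated_D nd unfolding RC TD by blast
  qed
qed

end

section \<open>The two bases for chains and loops\<close>

context base
begin

text \<open>If \<open>b k\<close> is 0, the integral exponent in column \<open>k\<close> is
  \<open>b i\<close> itself.\<close>

lemma zero_closed:
  assumes "\<And>i. i \<in> R \<Longrightarrow> 0 \<le> b i \<and> b i < 1" "\<And>k. k \<in> R \<Longrightarrow> pull A R b k \<in> \<int>"
    and "pts i k" "b k = 0"
  shows "b i = (0::rat)"
proof -
  have "b i \<in> \<int>" using assms(2)[of k] pull_some[OF assms(3), of b] assms(4) pts_R[OF assms(3)] by simp
  thus ?thesis using assms(1)[of i] pts_R[OF assms(3)] by (auto elim!: Ints_cases)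
qed

end

text \<open>The injection is \<open>S \<mapsto> \<sigma> ` (K - S)\<close>.\<close>

lemma card_alternating_le:
  fixes \<sigma> :: "'r \<Rightarrow> 'c"
  assumes "base_sector A R I b" "base_sector A' R2 I' b'" and \<sigma>: "bij_betw \<sigma> R R2"
    and pts: "\<And>i k. i \<in> R \<Longrightarrow> k \<in> R \<Longrightarrow> base.pts A' R2 (\<sigma> i) (\<sigma> k) \<longleftrightarrow> base.pts A R k i"
    and K: "base_sector.K R2 I' b' = \<sigma> ` base_sector.K R I b"
  shows "card {S. base_sector.alternating A R I b S} \<le> card {S. base_sector.alternating A' R2 I' b' S}"
proof -
  interpret P: base_sector A R I b by fact
  interpret Q: base_sector A' R2 I' b' by fact
  have inj: "inj_on \<sigma> R" using \<sigma> by (simp add: bij_betw_def)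
  have KR: "P.K \<subseteq> R" using P.K_R by blast
  define F where "F S = \<sigma> ` (P.K - S)" for S
  have "Q.alternating (F S)" if S: "P.alternating S" for S
  proof -
    note SD = P.alternatingD[OF S]
    have mem: "\<sigma> i \<in> F S \<longleftrightarrow> i \<in> P.K - S" if "i \<in> R" for i
      using that KR inj by (auto simp: F_def inj_on_def)
    have pr: "Q.pts (\<sigma> i) (\<sigma> k) \<longleftrightarrow> P.pts k i" if "i \<in> P.K" "k \<in> P.K" for i k
      using pts that KR by blast
    show ?thesis unfolding Q.alternating_def
    proof (intro conjI ballI)
      show "F S \<subseteq> Q.K" using K by (auto simp: F_def)
    next
      fix m assume "m \<in> Q.K"
      then obtain i where i: "i \<in> P.K" "m = \<sigma> i" using K by blast
      have "i \<in> P.K - S \<longleftrightarrow> \<not> (\<exists>k\<in>P.K - S. P.pts i k)"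
      proof
        assume "i \<in> P.K - S"
        then obtain p where "p \<in> S" "P.pts p i" using SD(4) by blast
        show "\<not> (\<exists>k\<in>P.K - S. P.pts i k)"
          using \<open>i \<in> P.K - S\<close> SD(4) P.pts_unique(2) by blast
      next
        assume "\<not> (\<exists>k\<in>P.K - S. P.pts i k)"
        thus "i \<in> P.K - S" using i SD(2,5) by blast
      qed
      thus "m \<in> F S \<longleftrightarrow> \<not> (\<exists>p\<in>F S. Q.pts p m)"
        unfolding i(2) mem[OF subsetD[OF KR i(1)]] using pr[OF _ i(1)] by (auto simp: F_def)
    next
      fix m assume "m \<in> F S"
      then obtain i where i: "i \<in> P.K - S" "m = \<sigma> i" by (auto simp: F_def)
      then obtain p where p: "p \<in> S" "P.pts p i" using SD(4) by blast
      hence "Q.pts (\<sigma> i) (\<sigma> p)" using pr[of i p] i SD(1) by blast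
      thus "\<exists>k\<in>Q.K. Q.pts m k" using i p SD(1) K by blast
    qed
  qed
  moreover have "inj_on F {S. P.alternating S}"
  proof (rule inj_onI)
    fix S T assume "S \<in> {S. P.alternating S}" "T \<in> {S. P.alternating S}" "F S = F T"
    moreover from this have "P.K - S = P.K - T"
      using inj_on_image_eq_iff[OF inj, of "P.K - S" "P.K - T"] KR by (auto simp: F_def)
    ultimately show "S = T" using P.alternatingD(1) by blast
  qed
  moreover have "finite {T. Q.alternating T}"
    by (rule finite_subset[of _ "Pow R2"]) (use Q.alternatingD(1) Q.K_R Q.IR Q.finR in auto)
  ultimately show ?thesis by (intro card_inj_on_le[of F]) auto
qed

text \<open>The locale \<open>base\<close> has one index set for rows and columns. Such a renaming
  labels each column by the row whose dominant entry it contains.\<close>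

lemma states_columns:
  assumes "bij_betw \<sigma> R' C" "I \<subseteq> C"
  shows "states (\<lambda>i k. E i (\<sigma> k)) R R' {k\<in>R'. \<sigma> k \<in> I} b = states E R C I b"
    and "k \<in> R' \<Longrightarrow> walls (\<lambda>i k. E i (\<sigma> k)) R R' {k\<in>R'. \<sigma> k \<in> I} b k = walls E R C I b (\<sigma> k)"
proof -
  have C: "C = \<sigma> ` R'" and inj: "inj_on \<sigma> R'" using assms(1) by (auto simp: bij_betw_def)
  have p: "pull (\<lambda>i k. E i (\<sigma> k)) R c k = pull E R c (\<sigma> k)" for c k by (simp add: pull_def)
  show "states (\<lambda>i k. E i (\<sigma> k)) R R' {k\<in>R'. \<sigma> k \<in> I} b = states E R C I b"
    unfolding states_def p C using assms(2) unfolding C by blast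
  assume k: "k \<in> R'"
  have eq: "(\<forall>l\<in>{k\<in>R'. \<sigma> k \<in> I} - {k}. P (\<sigma> l)) \<longleftrightarrow> (\<forall>l\<in>I - {\<sigma> k}. P l)" for P
    using assms(2) k inj unfolding C inj_on_def by blast
  have eq': "(\<forall>l\<in>R' - {k\<in>R'. \<sigma> k \<in> I}. P (\<sigma> l)) \<longleftrightarrow> (\<forall>l\<in>C - I. P l)" for P
    unfolding C by blast
  show "walls (\<lambda>i k. E i (\<sigma> k)) R R' {k\<in>R'. \<sigma> k \<in> I} b k = walls E R C I b (\<sigma> k)"
    unfolding walls_def p using eq[of "\<lambda>l. 0 < pull E R _ l"] eq'[of "\<lambda>l. pull E R _ l = 0"] by simp
qed

lemma sector_dim_columns:
  assumes "bij_betw \<sigma> R' C" "I \<subseteq> C"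
  shows "sector_dim (\<lambda>i k. E i (\<sigma> k)) R R' {k\<in>R'. \<sigma> k \<in> I} a b \<kappa> N \<longleftrightarrow> sector_dim E R C I a b \<kappa> N"
proof -
  have C: "C = \<sigma> ` R'" using assms(1) by (auto simp: bij_betw_def)
  have "(\<forall>k\<in>{k\<in>R'. \<sigma> k \<in> I}. P (\<sigma> k)) \<longleftrightarrow> (\<forall>j\<in>I. P j)" for P using assms(2) C by blast
  note eq = this[of "\<lambda>j. \<forall>c\<in>walls E R C I b j. (\<Sum>i\<in>R. a i * of_nat (E i j) * _ (raise i c)) = 0"]
  have "functionals (\<lambda>i k. E i (\<sigma> k)) R R' {k\<in>R'. \<sigma> k \<in> I} a b = functionals E R C I a b"
    unfolding functionals_def states_columns(1)[OF assms] eq[symmetric]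
    using states_columns(2)[OF assms, of _ E R b] by auto
  thus ?thesis unfolding sector_dim_def states_columns(1)[OF assms] by simp
qed

lemma independent_rows_columns:
  assumes "bij_betw \<sigma> R' C" "independent_rows E R C"
  shows "independent_rows (\<lambda>i k. E i (\<sigma> k)) R R'"
  using assms unfolding independent_rows_def bij_betw_def by auto

lemma pull_columns: "pull (\<lambda>i k. E i (\<sigma> k)) R c k = pull E R c (\<sigma> k)"
  by (simp add: pull_def)

lemma base_of_dominant:
  fixes E :: "'r \<Rightarrow> 'c \<Rightarrow> nat"
  assumes fin: "finite R" "finite C" and \<sigma>: "bij_betw \<sigma> R C"
    and big: "\<And>i. i \<in> R \<Longrightarrow> E i (\<sigma> i) \<ge> 2"
    and row: "\<And>i. i \<in> R \<Longrightarrow> sum (E i) (C - {\<sigma> i}) \<le> 1"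
    and col: "\<And>i. i \<in> R \<Longrightarrow> (\<Sum>k\<in>R - {i}. E k (\<sigma> i)) \<le> 1"
  shows "base (\<lambda>i k. E i (\<sigma> k)) R"
proof
  have \<sigma>R: "\<sigma> i \<in> C" if "i \<in> R" for i using that \<sigma> by (auto simp: bij_betw_def)
  have inj: "\<sigma> i = \<sigma> k \<longleftrightarrow> i = k" if "i \<in> R" "k \<in> R" for i k
    using that \<sigma> by (auto simp: bij_betw_def inj_on_def)
  fix i k l assume R: "i \<in> R" "k \<in> R"
  show "E i (\<sigma> k) \<le> 1" if "i \<noteq> k"
  proof -
    have "E i (\<sigma> k) \<le> (\<Sum>m\<in>R - {k}. E m (\<sigma> k))" using R fin that by (intro member_le_sum) auto
    thus ?thesis using col[OF R(2)] by linarith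
  qed
  assume l: "l \<in> R" "k \<noteq> i" "l \<noteq> i"
  show "k = l" if "E i (\<sigma> k) = 1" "E i (\<sigma> l) = 1"
  proof (rule ccontr)
    assume "k \<noteq> l"
    have "sum (E i) {\<sigma> k, \<sigma> l} \<le> sum (E i) (C - {\<sigma> i})"
      using R l fin \<sigma>R inj by (intro sum_mono2) auto
    moreover have "sum (E i) {\<sigma> k, \<sigma> l} = 2" using R l that inj \<open>k \<noteq> l\<close> by auto
    ultimately show False using row[OF R(1)] by linarith
  qed
  show "k = l" if "E k (\<sigma> i) = 1" "E l (\<sigma> i) = 1"
  proof (rule ccontr)
    assume "k \<noteq> l"
    have "(\<Sum>m\<in>{k, l}. E m (\<sigma> i)) \<le> (\<Sum>m\<in>R - {i}. E m (\<sigma> i))"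
      using R l fin by (intro sum_mono2) auto
    moreover have "(\<Sum>m\<in>{k, l}. E m (\<sigma> i)) = 2" using that \<open>k \<noteq> l\<close> by auto
    ultimately show False using col[OF R(1)] by linarith
  qed
qed (use big fin in auto)

text \<open>\<open>K\<close> is the same on both sides, and transposition reverses the arrows, so
  complements of alternating sets match. The degrees are the sums of \<open>b\<close> and of
  \<alpha>, each increased by half of \<open>card K\<close>, and the last equation of the duality is
  inclusion-exclusion: the zero sets of \<alpha> and \<open>b\<close> cover all rows unless both
  sectors vanish.\<close>

lemma sector_duality_base:
  fixes E :: "'r::finite \<Rightarrow> 'c::finite \<Rightarrow> nat"
  assumes \<sigma>: "bij_betw \<sigma> R C"
    and big: "\<And>i. i \<in> R \<Longrightarrow> E i (\<sigma> i) \<ge> 2"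
    and row: "\<And>i. i \<in> R \<Longrightarrow> sum (E i) (C - {\<sigma> i}) \<le> 1"
    and col: "\<And>i. i \<in> R \<Longrightarrow> (\<Sum>k\<in>R - {i}. E k (\<sigma> i)) \<le> 1"
    and ind: "independent_rows E R C" "independent_rows (tr E) C R"
  shows "sector_duality E R C"
  unfolding sector_duality_def
proof (intro allI impI)
  fix \<alpha> :: "'c \<Rightarrow> rat" and b :: "'r \<Rightarrow> rat"
  assume a: "\<forall>j\<in>C. 0 \<le> \<alpha> j \<and> \<alpha> j < 1" and br: "\<forall>i\<in>R. 0 \<le> b i \<and> b i < 1"
    and aint: "\<forall>i\<in>R. pull (tr E) C \<alpha> i \<in> \<int>" and bint: "\<forall>j\<in>C. pull E R b j \<in> \<int>"
  define \<tau> where "\<tau> = inv_into R \<sigma>"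
  have \<tau>: "bij_betw \<tau> C R" unfolding \<tau>_def by (rule bij_betw_inv_into[OF \<sigma>])
  have \<tau>\<sigma> [simp]: "\<tau> (\<sigma> i) = i" if "i \<in> R" for i
    unfolding \<tau>_def using bij_betw_inv_into_left[OF \<sigma> that] .
  have \<sigma>\<tau> [simp]: "\<sigma> (\<tau> j) = j" if "j \<in> C" for j
    unfolding \<tau>_def using bij_betw_inv_into_right[OF \<sigma> that] .
  have \<sigma>R [simp]: "\<sigma> i \<in> C" if "i \<in> R" for i using that \<sigma> by (auto simp: bij_betw_def)
  have \<tau>C [simp]: "\<tau> j \<in> R" if "j \<in> C" for j using that \<tau> by (auto simp: bij_betw_def)
  let ?I = "{j\<in>C. \<alpha> j = 0}" and ?J = "{i\<in>R. b i = 0}"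
  define A where "A = (\<lambda>i k. E i (\<sigma> k))"
  define A' where "A' = (\<lambda>j m. tr E j (\<tau> m))"
  have bA: "base A R" unfolding A_def using \<sigma> big row col by (intro base_of_dominant) auto
  have bA': "base A' C" unfolding A'_def
  proof (rule base_of_dominant)
    fix j assume j: "j \<in> C"
    show "E (\<tau> j) j \<ge> 2" using big[of "\<tau> j"] j by simp
    show "(\<Sum>i\<in>R - {\<tau> j}. E i j) \<le> 1" using col[of "\<tau> j"] j by simp
    show "(\<Sum>k\<in>C - {j}. E (\<tau> j) k) \<le> 1" using row[of "\<tau> j"] j by simp
  qed (use \<tau> in auto)
  interpret BA: base A R by (rule bA)
  interpret BA': base A' C by (rule bA')
  have inj\<sigma>: "inj_on \<sigma> R" using \<sigma> by (simp add: bij_betw_def)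
  have pts: "BA'.pts (\<sigma> i) (\<sigma> k) \<longleftrightarrow> BA.pts k i" if "i \<in> R" "k \<in> R" for i k
    unfolding BA.pts_def BA'.pts_def using that inj\<sigma> by (auto simp: A_def A'_def inj_on_def)
  have bA_int: "pull A R b k \<in> \<int>" if "k \<in> R" for k
    unfolding A_def pull_columns using bint that by simp
  have aA'_int: "pull A' C \<alpha> m \<in> \<int>" if "m \<in> C" for m
    using pull_columns[of "tr E" \<tau> C \<alpha> m] aint that by (simp add: A'_def)
  have closA: "b i = 0" if "BA.pts i k" "b k = 0" for i k
    using BA.zero_closed[of b i k] br bA_int that by blast
  have closA': "\<alpha> i = 0" if "BA'.pts i k" "\<alpha> k = 0" for i k
    using BA'.zero_closed[of \<alpha> i k] a aA'_int that by blast
  have closA2: "\<alpha> (\<sigma> k) = 0" if "BA.pts i k" "\<alpha> (\<sigma> i) = 0" for i k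
    using closA'[of "\<sigma> k" "\<sigma> i"] pts[of k i] that BA.pts_R[OF that(1)] by blast
  have closA'2: "b (\<tau> k) = 0" if "BA'.pts i k" "b (\<tau> i) = 0" for i k
    using closA[of "\<tau> k" "\<tau> i"] pts[of "\<tau> i" "\<tau> k"] that BA'.pts_R[OF that(1)] by auto
  define I2 where "I2 = {k\<in>R. \<sigma> k \<in> ?I}"
  define J2 where "J2 = {m\<in>C. \<tau> m \<in> ?J}"
  have I2: "i \<in> I2 \<longleftrightarrow> i \<in> R \<and> \<alpha> (\<sigma> i) = 0" for i by (auto simp: I2_def)
  have J2: "m \<in> J2 \<longleftrightarrow> m \<in> C \<and> b (\<tau> m) = 0" for m by (auto simp: J2_def)
  interpret P: base_sector A R I2 b
  proof
    show "independent_rows A R R" unfolding A_def by (rule independent_rows_columns[OF \<sigma> ind(1)])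
    show "i \<in> I2 \<Longrightarrow> k \<in> I2" if "BA.pts i k" for i k
      using that closA2 BA.pts_R[OF that] by (auto simp: I2)
  qed (use br bA_int closA in \<open>auto simp: I2\<close>)
  interpret Q: base_sector A' C J2 \<alpha>
  proof
    show "independent_rows A' C C" unfolding A'_def by (rule independent_rows_columns[OF \<tau> ind(2)])
    show "i \<in> J2 \<Longrightarrow> k \<in> J2" if "BA'.pts i k" for i k
      using that closA'2 BA'.pts_R[OF that] by (auto simp: J2)
  qed (use a aA'_int closA' in \<open>auto simp: J2\<close>)
  have sE: "sector_dim A R R I2 (\<lambda>_. 1) b \<kappa> N \<longleftrightarrow> sector_dim E R C ?I (\<lambda>_. 1) b \<kappa> N" for \<kappa> N
    unfolding A_def I2_def using \<sigma> by (intro sector_dim_columns) auto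
  have sE': "sector_dim A' C C J2 (\<lambda>_. 1) \<alpha> \<kappa> N \<longleftrightarrow> sector_dim (tr E) C R ?J (\<lambda>_. 1) \<alpha> \<kappa> N" for \<kappa> N
    unfolding A'_def J2_def using \<tau> by (intro sector_dim_columns) auto
  have PJ: "P.J = ?J" and QJ: "Q.J = ?I" by (auto simp: P.J_def Q.J_def)
  have PK: "P.K = {i\<in>R. b i = 0 \<and> \<alpha> (\<sigma> i) = 0}" by (auto simp: P.K_def PJ I2)
  have QK: "Q.K = \<sigma> ` P.K"
  proof
    show "Q.K \<subseteq> \<sigma> ` P.K"
    proof
      fix m assume "m \<in> Q.K"
      hence "m \<in> C" "b (\<tau> m) = 0" "\<alpha> m = 0" by (auto simp: Q.K_def QJ J2)
      thus "m \<in> \<sigma> ` P.K" unfolding PK by (intro image_eqI[of _ _ "\<tau> m"]) auto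
    qed
  qed (auto simp: Q.K_def QJ J2 PK)
  have PKR: "P.K \<subseteq> R" by (auto simp: PK)
  have cardK: "card Q.K = card P.K" unfolding QK using inj_on_subset[OF inj\<sigma> PKR] by (rule card_image)
  show "\<exists>N \<kappa> \<kappa>'. sector_dim E R C ?I (\<lambda>_. 1) b \<kappa> N \<and>
           sector_dim (tr E) C R ?J (\<lambda>_. 1) \<alpha> \<kappa>' N \<and>
           (N > 0 \<longrightarrow> \<kappa> + sum \<alpha> C = \<kappa>' + sum b R \<and>
              of_nat (card ?I + card ?J) + sum \<alpha> C + sum b R = of_nat (card R) + \<kappa> + \<kappa>')"
  proof (cases "R - I2 \<subseteq> P.J")
    case True
    have True': "C - J2 \<subseteq> Q.J"
    proof
      fix m assume "m \<in> C - J2"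
      hence "m \<in> C" "\<tau> m \<notin> P.J" by (auto simp: J2 PJ)
      hence "\<tau> m \<in> I2" using True \<tau>C by blast
      thus "m \<in> Q.J" using \<open>m \<in> C\<close> by (simp add: QJ I2)
    qed
    have "card {S. P.alternating S} \<le> card {S. Q.alternating S}"
      by (rule card_alternating_le[OF P.base_sector_axioms Q.base_sector_axioms \<sigma> pts QK])
    moreover have "card {S. Q.alternating S} \<le> card {S. P.alternating S}"
    proof (rule card_alternating_le[OF Q.base_sector_axioms P.base_sector_axioms \<tau>])
      show "BA.pts (\<tau> i) (\<tau> k) \<longleftrightarrow> BA'.pts k i" if "i \<in> C" "k \<in> C" for i k
        using pts[of "\<tau> k" "\<tau> i"] that by simp
      have "\<tau> ` \<sigma> ` P.K = P.K" using PKR by (force simp: image_iff)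
      thus "P.K = \<tau> ` Q.K" by (simp add: QK)
    qed
    ultimately have N: "card {S. Q.alternating S} = card {S. P.alternating S}" by simp
    have c1: "card ?I = card I2"
    proof -
      have "I2 = \<tau> ` ?I" by (force simp: I2 image_iff)
      moreover have "inj_on \<tau> ?I" using \<tau> by (auto simp: bij_betw_def inj_on_def)
      ultimately show ?thesis by (simp add: card_image)
    qed
    have "I2 \<union> ?J = R" using True by (auto simp: PJ I2)
    moreover have "I2 \<inter> ?J = P.K" by (auto simp: PK I2)
    ultimately have "card R + card P.K = card I2 + card ?J" using card_Un_Int[of I2 ?J] by simp
    hence c2: "of_nat (card ?I + card ?J) = (of_nat (card R) + of_nat (card P.K) :: rat)"
      using c1 by (metis of_nat_add)
    show ?thesis
      using P.sector_dim_base[OF True] Q.sector_dim_base[OF True'] c2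
      unfolding sE sE' N cardK by (intro exI conjI impI) (assumption | simp)+
  next
    case False
    have False': "\<not> C - J2 \<subseteq> Q.J"
    proof -
      obtain i where "i \<in> R - I2" "i \<notin> P.J" using False by blast
      hence "\<sigma> i \<in> C - J2" "\<sigma> i \<notin> Q.J" by (auto simp: PJ QJ I2 J2)
      thus ?thesis by blast
    qed
    have "sector_dim E R C ?I (\<lambda>_. 1) b 0 0" "sector_dim (tr E) C R ?J (\<lambda>_. 1) \<alpha> 0 0"
      using sE sE' P.sector_dim_empty[OF False] Q.sector_dim_empty[OF False'] by blast+
    thus ?thesis by (intro exI conjI impI) (assumption | simp)+
  qed
qed

theorem sector_duality_nondegenerate:
  fixes E :: "'r::finite \<Rightarrow> 'c::finite \<Rightarrow> nat"
  assumes "nondegenerate E R C"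
  shows "sector_duality E R C"
  using assms
proof (induction "card R" arbitrary: E R C rule: less_induct)
  case less
  note nd = less.prems[unfolded nondegenerate_def]
  have ind: "independent_rows E R C" "independent_rows (tr E) C R" using nd by auto
  have row1: "sum (E i) C \<noteq> 1" if "i \<in> R" for i using nd that by blast
  have col1: "sum (tr E j) R \<noteq> 1" if "j \<in> C" for j using nd that by blast
  have good_row: "\<exists>i\<in>R. E i j \<ge> 1 \<and> sum (E i) (C - {j}) \<le> 1" if "j \<in> C" for j
    using nd row1 that by (intro isolated_good_row) auto
  have good_col: "\<exists>j\<in>C. E i j \<ge> 1 \<and> sum (tr E j) (R - {i}) \<le> 1" if "i \<in> R" for i
  proof -
    have "\<exists>j\<in>C. tr E j i \<ge> 1 \<and> sum (tr E j) (R - {i}) \<le> 1"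
      using nd col1 that by (intro isolated_good_row) auto
    thus ?thesis .
  qed
  have rowsum: "sum (E i) C = E i j + sum (E i) (C - {j})" if "j \<in> C" for i j
    using that by (intro sum.remove) auto
  have colsum: "sum (tr E j) R = E i j + sum (tr E j) (R - {i})" if "i \<in> R" for i j
    using sum.remove[of R i "tr E j"] that by simp
  show ?case
  proof (cases "\<exists>r\<in>R. \<exists>x\<in>C. E r x = 1 \<and> sum (E r) (C - {x}) = 1")
    case True
    then obtain r x0 where r: "r \<in> R" and x0: "x0 \<in> C" "E r x0 = 1" and s0: "sum (E r) (C - {x0}) = 1"
      by blast
    obtain y0 where y0: "y0 \<in> C - {x0}" "E r y0 = 1" "\<forall>k\<in>C - {x0}. y0 \<noteq> k \<longrightarrow> E r k = 0"
      using s0 sum_eq_1_iff[of "C - {x0}" "E r"] by auto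
    \<comment> \<open>A column that row \<open>r\<close> meets and in which the other entries sum to
      at most 1. It has to belong to one of the two variables of row \<open>r\<close>, and that
      variable takes the role of x.\<close>
    obtain c where c: "c \<in> C" "E r c \<ge> 1" "sum (tr E c) (R - {r}) \<le> 1" using good_col[OF r] by blast
    have "c = x0 \<or> c = y0" using c y0 by force
    obtain x y where xy: "x \<in> C" "y \<in> C" "x \<noteq> y" "E r x = 1" "E r y = 1" "c = x"
      and rest: "\<forall>k\<in>C. k \<noteq> x \<longrightarrow> k \<noteq> y \<longrightarrow> E r k = 0"
    proof (cases "c = x0")
      case True
      show ?thesis by (rule that[of x0 y0]) (use True x0 y0 in auto)
    next
      case False
      hence "c = y0" using \<open>c = x0 \<or> c = y0\<close> by simp
      thus ?thesis by (intro that[of y0 x0]) (use x0 y0 in auto)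
    qed
    have "sum (tr E x) R = 1 + sum (tr E x) (R - {r})" using xy colsum[OF r, of x] by simp
    moreover have "sum (tr E x) (R - {r}) \<le> 1" using c(3) xy(6) by blast
    \<comment> \<open>The column sum is not 1, so there is exactly one further row, with entry
      1.\<close>
    ultimately have "sum (tr E x) (R - {r}) = 1" using col1[OF xy(1)] by linarith
    then obtain s where s: "s \<in> R - {r}" "E s x = 1" "\<forall>k\<in>R - {r}. s \<noteq> k \<longrightarrow> E k x = 0"
      using sum_eq_1_iff[of "R - {r}" "tr E x"] by auto
    obtain w :: "'c \<Rightarrow> rat" where w: "\<forall>j\<in>C. w j > 0" "\<forall>i\<in>R. (\<Sum>j\<in>C. of_nat (E i j) * w j) = 1"
      using nd by blast
    have split: "sum f C = f x + f y + sum f (C - {x, y})" for f :: "'c \<Rightarrow> 'z::comm_monoid_add"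
    proof -
      have "sum f (insert x (insert y (C - {x, y}))) = f x + f y + sum f (C - {x, y})"
        using xy by (simp add: add.assoc)
      moreover have "insert x (insert y (C - {x, y})) = C" using xy by blast
      ultimately show ?thesis by metis
    qed
    have wxy: "w x + w y = 1"
      using bspec[OF w(2) r] xy rest by (simp add: split)
    \<comment> \<open>The monomial x y already has weight 1, so a row of weight 1 that contains both
      x and y would coincide with row \<open>r\<close>.\<close>
    have Esy: "E s y = 0"
    proof (rule ccontr)
      assume nz: "E s y \<noteq> 0"
      define m where "m = (\<Sum>j\<in>C - {x, y}. of_nat (E s j) * w j)"
      have m: "w x + of_nat (E s y) * w y + m = 1"
        using bspec[OF w(2), of s] s by (simp add: split m_def)
      have m0: "m \<ge> 0" unfolding m_def using w(1) by (intro sum_nonneg) (auto simp: less_imp_le)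
      have "of_nat (E s y) * w y \<ge> 1 * w y" using nz w(1) xy by (intro mult_right_mono) (auto simp: less_imp_le)
      hence "m = 0" and e: "of_nat (E s y) * w y = w y" using m m0 wxy by linarith+
      have "E s y = 1" using e w(1) xy by (auto simp: less_le)
      have "of_nat (E s j) * w j = 0" if "j \<in> C - {x, y}" for j
        using \<open>m = 0\<close> that w(1) unfolding m_def
        by (subst (asm) sum_nonneg_eq_0_iff) (auto simp: less_imp_le)
      hence "E s j = 0" if "j \<in> C - {x, y}" for j using that w(1) by force
      hence eq: "E s j = E r j" if "j \<in> C" for j
        using that rest xy s \<open>E s y = 1\<close> by (cases "j = x"; cases "j = y") auto
      have "(\<Sum>i\<in>R. (of_bool (i = r) - of_bool (i = s)) * of_nat (E i j)) = (0::complex)" if "j \<in> C" for j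
      proof -
        have "(\<Sum>i\<in>R. (of_bool (i = r) - of_bool (i = s)) * of_nat (E i j)) =
            (\<Sum>i\<in>{r, s}. (of_bool (i = r) - of_bool (i = s)) * of_nat (E i j) :: complex)"
          using r s by (intro sum.mono_neutral_right) auto
        moreover have "r \<noteq> s" using s by blast
        ultimately show ?thesis using eq[OF that] by simp
      qed
      hence "of_bool (r = r) - of_bool (r = s) = (0::complex)"
        using ind(1) r unfolding independent_rows_def
        by (elim allE[of _ "\<lambda>i. of_bool (i = r) - of_bool (i = s)"]) blast
      thus False using s by auto
    qed
    interpret reduction_finite E R C r s x y
    proof
      show "E r j = of_bool (j = x \<or> j = y)" if "j \<in> C" for j using that xy rest by auto
      show "E i x = of_bool (i = r \<or> i = s)" if "i \<in> R" for i using that xy s by auto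
    qed (use r s xy Esy ind in auto)
    have "card R' < card R" using r by (intro psubset_card_mono) (auto simp: R'_def)
    hence "sector_duality D R' C'" using less.hyps nondegenerate_D[OF less.prems] by blast
    thus ?thesis by (rule sector_duality_lift[OF ind(2)])
  next
    case False
    \<comment> \<open>A good row with entry 1 at \<open>j\<close> would be linear or a product of
      two variables, and both are excluded.\<close>
    have big_row: "\<exists>i\<in>R. E i j \<ge> 2 \<and> sum (E i) (C - {j}) \<le> 1" if j: "j \<in> C" for j
    proof -
      obtain i where i: "i \<in> R" "E i j \<ge> 1" "sum (E i) (C - {j}) \<le> 1" using good_row[OF j] by blast
      have "E i j \<noteq> 1"
        using False i j row1[OF i(1)] rowsum[OF j, of i] by (cases "sum (E i) (C - {j})") auto
      thus ?thesis using i by (intro bexI[of _ i]) auto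
    qed
    have big_col: "\<exists>j\<in>C. E i j \<ge> 2 \<and> sum (tr E j) (R - {i}) \<le> 1" if i: "i \<in> R" for i
    proof -
      obtain j where j: "j \<in> C" "E i j \<ge> 1" "sum (tr E j) (R - {i}) \<le> 1" using good_col[OF i] by blast
      have "E i j \<noteq> 1"
      proof
        assume one: "E i j = 1"
        obtain k where k: "k \<in> R" "E k j \<ge> 2" using big_row[OF j(1)] by blast
        have "E k j \<le> sum (tr E j) (R - {i})" using k one by (intro member_le_sum[of k _ "tr E j"]) auto
        thus False using k j by linarith
      qed
      thus ?thesis using j by (intro bexI[of _ j]) auto
    qed
    then obtain \<sigma> where \<sigma>: "\<And>i. i \<in> R \<Longrightarrow> \<sigma> i \<in> C \<and> E i (\<sigma> i) \<ge> 2 \<and> sum (tr E (\<sigma> i)) (R - {i}) \<le> 1"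
      by metis
    have uniq: "k = i" if "i \<in> R" "k \<in> R" "E k (\<sigma> i) \<ge> 2" for i k
    proof (rule ccontr)
      assume "k \<noteq> i"
      hence "E k (\<sigma> i) \<le> sum (tr E (\<sigma> i)) (R - {i})"
        using that by (intro member_le_sum[of k _ "tr E (\<sigma> i)"]) auto
      thus False using \<sigma>[OF that(1)] that(3) by linarith
    qed
    \<comment> \<open>Outside column \<open>j\<close> the entries of the row \<open>i\<close> found
      here sum to at most 1, so the column chosen for \<open>i\<close>, with its entry of at least
      2, is \<open>j\<close>.\<close>
    have surj: "\<exists>i\<in>R. j = \<sigma> i \<and> sum (E i) (C - {j}) \<le> 1" if j: "j \<in> C" for j
    proof -
      obtain i where i: "i \<in> R" "E i j \<ge> 2" "sum (E i) (C - {j}) \<le> 1" using big_row[OF j] by blast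
      have "j = \<sigma> i"
      proof (rule ccontr)
        assume "j \<noteq> \<sigma> i"
        hence "E i (\<sigma> i) \<le> sum (E i) (C - {j})" using \<sigma>[OF i(1)] by (intro member_le_sum) auto
        thus False using \<sigma>[OF i(1)] i(3) by linarith
      qed
      thus ?thesis using i by blast
    qed
    have inj: "inj_on \<sigma> R"
    proof (rule inj_onI)
      fix i k assume "i \<in> R" "k \<in> R" "\<sigma> i = \<sigma> k"
      thus "i = k" using uniq[of k i] \<sigma>[of i] by simp
    qed
    have "bij_betw \<sigma> R C" unfolding bij_betw_def using inj surj \<sigma> by blast
    moreover have "sum (E i) (C - {\<sigma> i}) \<le> 1" if i: "i \<in> R" for i
    proof -
      obtain k where k: "k \<in> R" "\<sigma> i = \<sigma> k" "sum (E k) (C - {\<sigma> i}) \<le> 1"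
        using surj[of "\<sigma> i"] \<sigma>[OF i] by blast
      have "k = i" using inj k i by (auto simp: inj_on_def)
      thus ?thesis using k by simp
    qed
    ultimately show ?thesis using \<sigma> ind by (intro sector_duality_base[of \<sigma>]) auto
  qed
qed

section \<open>Invertible polynomials and their diagonal symmetries\<close>

definition monomial :: "('n::finite \<Rightarrow> nat) \<Rightarrow> 'n \<Rightarrow>\<^sub>0 nat" where
  "monomial f = (\<Sum>j\<in>UNIV. Poly_Mapping.single j (f j))"

lemma lookup_monomial [simp]: "Poly_Mapping.lookup (monomial f) j = f j"
  by (simp add: monomial_def lookup_sum lookup_single when_def)

definition row_monomial :: "nat ^ 'n ^ 'n \<Rightarrow> 'n \<Rightarrow> 'n::finite \<Rightarrow>\<^sub>0 nat" where
  "row_monomial E i = monomial (\<lambda>j. E $ i $ j)"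

lemma lookup_row_monomial [simp]: "Poly_Mapping.lookup (row_monomial E i) j = E $ i $ j"
  by (simp add: row_monomial_def)

definition partial_poly :: "nat ^ 'n ^ 'n \<Rightarrow> complex ^ 'n \<Rightarrow> 'n set \<Rightarrow> 'n::finite mpoly" where
  "partial_poly E a S = (\<Sum>i\<in>S. Poly_Mapping.single (row_monomial E i) (a $ i))"

lemma mpoly_of_partial: "mpoly_of E a = partial_poly E a UNIV"
  by (simp add: mpoly_of_def partial_poly_def row_monomial_def monomial_def)

lemma mpoly_eval_superset:
  assumes "finite S" "Poly_Mapping.keys p \<subseteq> S"
  shows "mpoly_eval p z =
    (\<Sum>m\<in>S. Poly_Mapping.lookup p m * (\<Prod>j\<in>UNIV. (z $ j) ^ Poly_Mapping.lookup m j))"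
  unfolding mpoly_eval_def using assms
  by (intro sum.mono_neutral_left) (auto simp: in_keys_iff)

lemma mpoly_eval_add: "mpoly_eval (p + q) z = mpoly_eval p z + mpoly_eval q z"
proof -
  let ?S = "Poly_Mapping.keys p \<union> Poly_Mapping.keys q"
  have "Poly_Mapping.keys (p + q) \<subseteq> ?S" by (rule keys_add)
  thus ?thesis
    by (simp add: mpoly_eval_superset[of ?S] lookup_add distrib_right sum.distrib)
qed

lemma mpoly_eval_sum: "mpoly_eval (\<Sum>i\<in>S. f i) z = (\<Sum>i\<in>S. mpoly_eval (f i) z)"
proof -
  have "mpoly_eval 0 z = 0" by (simp add: mpoly_eval_def)
  thus ?thesis by (induction S rule: infinite_finite_induct) (simp_all add: mpoly_eval_add)
qed

lemma mpoly_eval_single: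
  "mpoly_eval (Poly_Mapping.single m c) z = c * (\<Prod>j\<in>UNIV. (z $ j) ^ Poly_Mapping.lookup m j)"
  by (cases "c = 0") (simp_all add: mpoly_eval_def)

definition entry :: "nat ^ 'n ^ 'n \<Rightarrow> 'n \<Rightarrow> 'n \<Rightarrow> nat" where
  "entry E = (\<lambda>i j. E $ i $ j)"

lemma entry_transpose: "entry (transpose E) = tr (entry E)"
  by (simp add: entry_def transpose_def fun_eq_iff)

locale invertible_matrix =
  fixes E :: "nat ^ 'n::finite ^ 'n"
  assumes det: "det (rat_matrix E) \<noteq> 0"
begin

definition B :: "rat ^ 'n ^ 'n" where "B = matrix_inv (rat_matrix E)"

lemma inverse: "rat_matrix E ** B = mat 1" "B ** rat_matrix E = mat 1"
proof -
  have "invertible (rat_matrix E)" using det by (simp add: invertible_det_nz)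
  hence "rat_matrix E ** B = mat 1 \<and> B ** rat_matrix E = mat 1"
    unfolding B_def matrix_inv_def invertible_def by (rule someI_ex)
  thus "rat_matrix E ** B = mat 1" "B ** rat_matrix E = mat 1" by auto
qed

lemma inverse_sum:
  "(\<Sum>j\<in>UNIV. of_nat (E $ i $ j) * B $ j $ k) = of_bool (i = k)"
  "(\<Sum>j\<in>UNIV. B $ i $ j * of_nat (E $ j $ k)) = of_bool (i = k)"
proof -
  have "(rat_matrix E ** B) $ i $ k = of_bool (i = k)" "(B ** rat_matrix E) $ i $ k = of_bool (i = k)"
    unfolding inverse by (simp_all add: mat_def)
  thus "(\<Sum>j\<in>UNIV. of_nat (E $ i $ j) * B $ j $ k) = of_bool (i = k)"
    "(\<Sum>j\<in>UNIV. B $ i $ j * of_nat (E $ j $ k)) = of_bool (i = k)"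
    by (simp_all add: matrix_matrix_mult_def rat_matrix_def)
qed

lemma transposed: "invertible_matrix (transpose E)"
proof
  have "rat_matrix (transpose E) = transpose (rat_matrix E)"
    by (simp add: rat_matrix_def transpose_def vec_eq_iff)
  thus "det (rat_matrix (transpose E)) \<noteq> 0" using det by (simp add: det_transpose)
qed

lemma independent: "independent_rows (entry E) UNIV UNIV"
  unfolding independent_rows_def
proof (intro allI impI ballI)
  fix x :: "'n \<Rightarrow> complex" and k
  assume x: "\<forall>j\<in>UNIV. (\<Sum>i\<in>UNIV. x i * of_nat (entry E i j)) = 0"
  have "x k = (\<Sum>i\<in>UNIV. x i * of_rat (\<Sum>j\<in>UNIV. of_nat (E $ i $ j) * B $ j $ k))"
  proof -
    have "of_rat (of_bool P) = (of_bool P :: complex)" for P by (cases P) auto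
    thus ?thesis by (simp add: inverse_sum)
  qed
  also have "\<dots> = (\<Sum>j\<in>UNIV. (\<Sum>i\<in>UNIV. x i * of_nat (entry E i j)) * of_rat (B $ j $ k))"
    unfolding of_rat_sum of_rat_mult of_rat_of_nat_eq sum_distrib_left sum_distrib_right
    by (subst sum.swap) (simp add: entry_def mult.assoc)
  also have "\<dots> = 0" using x by simp
  finally show "x k = 0" .
qed

lemma rows_distinct:
  assumes "\<And>j. E $ i $ j = E $ k $ j"
  shows "i = k"
proof (rule ccontr)
  assume "i \<noteq> k"
  have "of_bool (i = i) = (\<Sum>j\<in>UNIV. of_nat (E $ i $ j) * B $ j $ i)" by (simp only: inverse_sum)
  also have "\<dots> = (\<Sum>j\<in>UNIV. of_nat (E $ k $ j) * B $ j $ i)" by (simp add: assms)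
  also have "\<dots> = of_bool (k = i)" by (simp only: inverse_sum)
  finally show False using \<open>i \<noteq> k\<close> by simp
qed

lemma inj_row_monomial: "inj (row_monomial E)"
proof (rule injI)
  fix i k assume "row_monomial E i = row_monomial E k"
  hence "E $ i $ j = E $ k $ j" for j by (metis lookup_row_monomial)
  thus "i = k" by (rule rows_distinct)
qed

end

locale invertible_poly_data = invertible_matrix E
  for E :: "nat ^ 'n::finite ^ 'n" +
  fixes a :: "complex ^ 'n"
  assumes coeff: "\<And>i. a $ i \<noteq> 0"
begin

lemma lookup_partial_poly:
  "Poly_Mapping.lookup (partial_poly E a S) (row_monomial E i) = (if i \<in> S then a $ i else 0)"
proof -
  have "Poly_Mapping.lookup (partial_poly E a S) (row_monomial E i) = (\<Sum>k\<in>S. if k = i then a $ i else 0)"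
    unfolding partial_poly_def lookup_sum
    using inj_row_monomial by (intro sum.cong) (auto simp: lookup_single when_def inj_def)
  thus ?thesis by simp
qed

lemma keys_partial_poly: "Poly_Mapping.keys (partial_poly E a S) = row_monomial E ` S"
proof
  show "Poly_Mapping.keys (partial_poly E a S) \<subseteq> row_monomial E ` S"
    unfolding partial_poly_def by (rule order_trans[OF keys_sum]) (auto split: if_splits)
  show "row_monomial E ` S \<subseteq> Poly_Mapping.keys (partial_poly E a S)"
    using coeff by (auto simp: in_keys_iff lookup_partial_poly)
qed

lemma deriv_partial_poly:
  "mpoly_deriv j (partial_poly E a S) =
     (\<Sum>i\<in>S. Poly_Mapping.single (row_monomial E i - Poly_Mapping.single j 1) (of_nat (E $ i $ j) * a $ i))"
  unfolding mpoly_deriv_def keys_partial_poly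
  using inj_row_monomial
  by (subst sum.reindex) (auto simp: inj_def inj_on_def lookup_partial_poly intro!: sum.cong)

lemma eval_deriv:
  "mpoly_eval (mpoly_deriv j (mpoly_of E a)) z =
    (\<Sum>i\<in>UNIV. a $ i * of_nat (entry E i j) * (z $ j) ^ (entry E i j - 1) *
       (\<Prod>k\<in>UNIV - {j}. (z $ k) ^ entry E i k))"
proof -
  have "(\<Prod>k\<in>UNIV. (z $ k) ^ Poly_Mapping.lookup (row_monomial E i - Poly_Mapping.single j 1) k) =
      (z $ j) ^ (entry E i j - 1) * (\<Prod>k\<in>UNIV - {j}. (z $ k) ^ entry E i k)" for i
  proof -
    have "(\<Prod>k\<in>UNIV - {j}. (z $ k) ^ Poly_Mapping.lookup (row_monomial E i - Poly_Mapping.single j 1) k) =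
        (\<Prod>k\<in>UNIV - {j}. (z $ k) ^ entry E i k)"
      by (intro prod.cong) (auto simp: row_monomial_def entry_def lookup_minus lookup_single when_def)
    thus ?thesis
      by (subst prod.remove[of _ j]) (auto simp: row_monomial_def entry_def lookup_minus)
  qed
  thus ?thesis
    unfolding mpoly_of_partial deriv_partial_poly mpoly_eval_sum mpoly_eval_single
    by (intro sum.cong) (simp_all add: entry_def mult_ac)
qed

lemma critical_iff:
  "critical (entry E) UNIV UNIV (($) a) z \<longleftrightarrow> (\<forall>j. mpoly_eval (mpoly_deriv j (mpoly_of E a)) z = 0)"
  unfolding critical_def eval_deriv by simp

lemma isolated_entry:
  assumes "isolated_critical_point_0 (mpoly_of E a)"
  shows "isolated (entry E) UNIV UNIV"
proof -
  have "\<forall>\<^sub>F z in nhds 0. critical (entry E) UNIV UNIV (($) a) z \<longrightarrow> (\<forall>j\<in>UNIV. z $ j = 0)"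
    using assms unfolding isolated_critical_point_0_def eventually_at_filter critical_iff
    by (auto elim!: eventually_mono simp: vec_eq_iff)
  thus ?thesis unfolding isolated_def using coeff by (intro exI[of _ "($) a"]) auto
qed

text \<open>A linear monomial contributes a nonzero constant to a derivative, and no other row
  contributes to this constant because the rows are distinct.\<close>

lemma row_sum_not_1:
  assumes "isolated_critical_point_0 (mpoly_of E a)"
  shows "sum (entry E i) UNIV \<noteq> 1"
proof
  assume "sum (entry E i) UNIV = 1"
  then obtain j where j: "entry E i j = 1" "\<And>k. k \<noteq> j \<Longrightarrow> entry E i k = 0"
    unfolding sum_eq_1_iff[OF finite] by auto
  have zero: "a $ l * of_nat (entry E l j) * (0 $ j) ^ (entry E l j - 1) *
      (\<Prod>k\<in>UNIV - {j}. (0 $ k) ^ entry E l k) = 0" if l: "l \<noteq> i" for l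
  proof (rule ccontr)
    assume nz: "\<not> ?thesis"
    hence "(\<Prod>k\<in>UNIV - {j}. (0 $ k) ^ entry E l k) \<noteq> (0::complex)" by auto
    hence "entry E l k = 0" if "k \<noteq> j" for k using that by (auto simp: power_0_left split: if_splits)
    moreover have "entry E l j = 1" using nz by (cases "entry E l j") (auto simp: power_0_left split: if_splits)
    ultimately have "E $ l $ k = E $ i $ k" for k using j by (cases "k = j") (auto simp: entry_def)
    thus False using rows_distinct l by blast
  qed
  have "mpoly_eval (mpoly_deriv j (mpoly_of E a)) 0 = (\<Sum>l\<in>{i}. a $ l * of_nat (entry E l j) *
      (0 $ j) ^ (entry E l j - 1) * (\<Prod>k\<in>UNIV - {j}. (0 $ k) ^ entry E l k))"
    unfolding eval_deriv using zero by (intro sum.mono_neutral_right) auto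
  also have "\<dots> = a $ i" using j by simp
  finally show False using assms coeff unfolding isolated_critical_point_0_def by metis
qed

lemma positive_weights:
  assumes "quasihomogeneous (mpoly_of E a)"
  shows "\<exists>w :: 'n \<Rightarrow> rat. (\<forall>j\<in>UNIV. w j > 0) \<and> (\<forall>i\<in>UNIV. (\<Sum>j\<in>UNIV. of_nat (entry E i j) * w j) = 1)"
proof -
  obtain w :: "'n \<Rightarrow> nat" and d where w: "\<forall>j. w j > 0" "d > 0"
    and eq: "\<forall>m\<in>Poly_Mapping.keys (mpoly_of E a). (\<Sum>j\<in>UNIV. w j * Poly_Mapping.lookup m j) = d"
    using assms unfolding quasihomogeneous_def by blast
  have "(\<Sum>j\<in>UNIV. of_nat (entry E i j) * (of_nat (w j) / of_nat d)) = (1::rat)" for i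
  proof -
    have "(\<Sum>j\<in>UNIV. w j * entry E i j) = d"
      using eq by (auto simp: mpoly_of_partial keys_partial_poly row_monomial_def entry_def)
    hence "(\<Sum>j\<in>UNIV. of_nat (w j) * of_nat (entry E i j)) = (of_nat d :: rat)"
      by (metis (no_types, lifting) of_nat_mult of_nat_sum sum.cong)
    hence "(\<Sum>j\<in>UNIV. of_nat (w j) * of_nat (entry E i j)) / of_nat d = (1 :: rat)" using w by simp
    thus ?thesis by (simp add: sum_divide_distrib mult_ac)
  qed
  thus ?thesis using w by (intro exI[of _ "\<lambda>j. of_nat (w j) / of_nat d"]) auto
qed

end

lemma invertible_poly_data:
  assumes "invertible_poly E a"
  shows "invertible_poly_data E a" "invertible_poly_data (transpose E) a"
proof -
  show E: "invertible_poly_data E a" using assms by unfold_locales (auto simp: invertible_poly_def)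
  then interpret invertible_poly_data E a .
  interpret T: invertible_matrix "transpose E" by (rule transposed)
  show "invertible_poly_data (transpose E) a" using coeff by unfold_locales
qed

lemma invertible_poly_sector_duality:
  assumes "invertible_poly E a"
  shows "sector_duality (entry E) UNIV UNIV"
proof (rule sector_duality_nondegenerate)
  interpret invertible_poly_data E a by (rule invertible_poly_data[OF assms])
  interpret T: invertible_poly_data "transpose E" a by (rule invertible_poly_data[OF assms])
  have iso: "isolated_critical_point_0 (mpoly_of E a)" "isolated_critical_point_0 (mpoly_of (transpose E) a)"
    and qh: "quasihomogeneous (mpoly_of E a)"
    using assms by (auto simp: invertible_poly_def)
  show "nondegenerate (entry E) UNIV UNIV"
    unfolding nondegenerate_def
    using independent T.independent row_sum_not_1[OF iso(1)] T.row_sum_not_1[OF iso(2)]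
      positive_weights[OF qh] isolated_entry[OF iso(1)] T.isolated_entry[OF iso(2)]
    by (simp add: entry_transpose)
qed

section \<open>Diagonal symmetries as vectors of phases\<close>

definition diag_of :: "('n \<Rightarrow> rat) \<Rightarrow> complex ^ 'n::finite" where
  "diag_of \<alpha> = (\<chi> j. cis (2 * pi * of_rat (\<alpha> j)))"

lemma cis_rat_eq_1: "cis (2 * pi * of_rat q) = 1 \<longleftrightarrow> q \<in> \<int>"
proof
  assume "cis (2 * pi * of_rat q) = 1"
  hence "exp (\<i> * complex_of_real (2 * pi * of_rat q)) = 1" by (simp add: cis_conv_exp)
  then obtain n :: int where "2 * pi * of_rat q = of_int (2 * n) * pi"
    unfolding exp_eq_1 by auto
  hence "of_rat q = (of_int n :: real)" by simp
  hence "q = of_int n" by (metis of_rat_eq_iff of_rat_of_int_eq)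
  thus "q \<in> \<int>" by simp
next
  assume "q \<in> \<int>"
  hence "(of_rat q :: real) \<in> \<int>" by (auto elim!: Ints_cases)
  thus "cis (2 * pi * of_rat q) = 1" by simp
qed

lemma cis_rat_add: "cis (2 * pi * of_rat (p + q)) = cis (2 * pi * of_rat p) * cis (2 * pi * of_rat q)"
  by (simp add: cis_mult of_rat_add distrib_left)

lemma cis_rat_nat: "cis (2 * pi * of_rat (of_nat n * q)) = cis (2 * pi * of_rat q) ^ n"
proof -
  have "2 * pi * of_rat (of_nat n * q) = real n * (2 * pi * of_rat q)" by (simp add: of_rat_mult)
  thus ?thesis by (metis Complex.DeMoivre)
qed

lemma of_real_of_rat: "complex_of_real (of_rat q) = of_rat q"
  by (cases q) (simp add: of_rat_rat)

lemma cis_rat_sum: "cis (2 * pi * of_rat (sum f S)) = (\<Prod>j\<in>S. cis (2 * pi * of_rat (f j)))"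
  by (induction S rule: infinite_finite_induct) (simp_all add: cis_rat_add)

lemma cis_rat_eq_iff: "cis (2 * pi * of_rat p) = cis (2 * pi * of_rat q) \<longleftrightarrow> p - q \<in> \<int>"
proof -
  have "cis (2 * pi * of_rat p) = cis (2 * pi * of_rat (p - q)) * cis (2 * pi * of_rat q)"
    by (simp flip: cis_rat_add)
  thus ?thesis using cis_rat_eq_1[of "p - q"] by auto
qed

lemma range_Ints_eq: "0 \<le> p \<Longrightarrow> p < 1 \<Longrightarrow> 0 \<le> q \<Longrightarrow> q < 1 \<Longrightarrow> p - q \<in> \<int> \<Longrightarrow> p = (q::rat)"
  by (auto elim!: Ints_cases simp: diff_eq_eq)

lemma phase_cis:
  assumes "0 \<le> q" "q < 1"
  shows "phase (cis (2 * pi * of_rat q)) = q"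
  unfolding phase_def
proof (rule the_equality)
  fix r assume "0 \<le> r \<and> r < 1 \<and> cis (2 * pi * of_rat q) = cis (2 * pi * of_rat r)"
  thus "r = q" using assms range_Ints_eq[of q r] by (auto simp: cis_rat_eq_iff)
qed (use assms in auto)

definition unit_range :: "('n \<Rightarrow> rat) \<Rightarrow> bool" where
  "unit_range \<alpha> \<longleftrightarrow> (\<forall>j. 0 \<le> \<alpha> j \<and> \<alpha> j < 1)"

lemma phase_diag_of: "unit_range \<alpha> \<Longrightarrow> phase (diag_of \<alpha> $ j) = \<alpha> j"
  by (simp add: diag_of_def phase_cis unit_range_def)

lemma diag_of_eq_iff: "diag_of \<alpha> = diag_of \<beta> \<longleftrightarrow> (\<forall>j. \<alpha> j - \<beta> j \<in> \<int>)"
  by (simp add: diag_of_def vec_eq_iff cis_rat_eq_iff)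

lemma diag_of_frac: "diag_of (\<lambda>j. frac (\<alpha> j)) = diag_of \<alpha>"
  by (simp add: diag_of_eq_iff frac_def)

lemma unit_range_frac: "unit_range (\<lambda>j. frac (\<alpha> j))"
  by (simp add: unit_range_def frac_lt_1)

lemma inj_diag_of: "inj_on diag_of {\<alpha>. unit_range \<alpha>}"
proof (rule inj_onI)
  fix \<alpha> \<beta> :: "'n::finite \<Rightarrow> rat"
  assume "\<alpha> \<in> {\<alpha>. unit_range \<alpha>}" "\<beta> \<in> {\<alpha>. unit_range \<alpha>}" "diag_of \<alpha> = diag_of \<beta>"
  thus "\<alpha> = \<beta>" using range_Ints_eq by (auto simp: diag_of_eq_iff unit_range_def fun_eq_iff)
qed

definition phases :: "complex ^ 'n \<Rightarrow> 'n::finite \<Rightarrow> rat" where "phases g j = phase (g $ j)"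

lemma phases_diag_of: "unit_range \<alpha> \<Longrightarrow> phases (diag_of \<alpha>) = \<alpha>"
  by (simp add: phases_def phase_diag_of fun_eq_iff)

lemma age_diag_of: "unit_range \<alpha> \<Longrightarrow> age (diag_of \<alpha>) = sum \<alpha> UNIV"
  by (simp add: age_def phase_diag_of)

lemma fixed_coords_diag_of: "unit_range \<alpha> \<Longrightarrow> fixed_coords (diag_of \<alpha>) = {j. \<alpha> j = 0}"
proof -
  assume "unit_range \<alpha>"
  hence "\<alpha> j \<in> \<int> \<longleftrightarrow> \<alpha> j = 0" for j
    using range_Ints_eq[of "\<alpha> j" 0] by (auto simp: unit_range_def)
  thus ?thesis by (simp add: fixed_coords_def diag_of_def cis_rat_eq_1)
qed

context invertible_poly_data
begin

abbreviation "Gf \<equiv> carrier (diag_symmetries (mpoly_of E a))"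

definition row_pairing :: "('n \<Rightarrow> rat) \<Rightarrow> 'n \<Rightarrow> rat" where
  "row_pairing \<alpha> i = (\<Sum>j\<in>UNIV. of_nat (E $ i $ j) * \<alpha> j)"

lemma pull_transpose_row: "pull (tr (entry E)) UNIV \<alpha> i = row_pairing \<alpha> i"
  by (simp add: pull_def row_pairing_def entry_def)

text \<open>The monomials are distinct, so invariance of the sum is invariance of each
  monomial.\<close>

lemma Gf_iff: "l \<in> Gf \<longleftrightarrow> (\<forall>j. l $ j \<noteq> 0) \<and> (\<forall>i. (\<Prod>j\<in>UNIV. (l $ j) ^ (E $ i $ j)) = 1)"
proof -
  let ?p = "mpoly_of E a"
  have lk: "Poly_Mapping.lookup ?p (row_monomial E i) = a $ i" for i
    unfolding mpoly_of_partial lookup_partial_poly by simp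
  have keys: "Poly_Mapping.keys ?p = range (row_monomial E)"
    unfolding mpoly_of_partial keys_partial_poly by simp
  have "mpoly_diag l ?p = ?p \<longleftrightarrow>
      (\<forall>m. ((\<Prod>j\<in>UNIV. (l $ j) ^ Poly_Mapping.lookup m j) * Poly_Mapping.lookup ?p m
        when m \<in> Poly_Mapping.keys ?p) = Poly_Mapping.lookup ?p m)"
    by (simp add: poly_mapping_eq_iff fun_eq_iff mpoly_diag_def lookup_mapp)
  also have "\<dots> \<longleftrightarrow> (\<forall>m\<in>Poly_Mapping.keys ?p.
      (\<Prod>j\<in>UNIV. (l $ j) ^ Poly_Mapping.lookup m j) * Poly_Mapping.lookup ?p m = Poly_Mapping.lookup ?p m)"
    by (auto simp: when_def in_keys_iff)
  also have "\<dots> \<longleftrightarrow> (\<forall>i. (\<Prod>j\<in>UNIV. (l $ j) ^ (E $ i $ j)) = 1)"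
    unfolding keys using coeff by (simp add: lk)
  finally show ?thesis by (simp add: diag_symmetries_def)
qed

lemma diag_of_in_Gf: "diag_of \<alpha> \<in> Gf \<longleftrightarrow> (\<forall>i. row_pairing \<alpha> i \<in> \<int>)"
proof -
  have "(\<Prod>j\<in>UNIV. (diag_of \<alpha> $ j) ^ (E $ i $ j)) = cis (2 * pi * of_rat (row_pairing \<alpha> i))" for i
    by (simp add: row_pairing_def diag_of_def cis_rat_sum cis_rat_nat)
  thus ?thesis by (simp add: Gf_iff cis_rat_eq_1) (simp add: diag_of_def)
qed

text \<open>\<open>E\<close> maps the logarithms of the entries to integral multiples of 2 pi i. As
  \<open>E\<close> has a rational inverse, the entries are roots of unity.\<close>

lemma Gf_cases:
  assumes "l \<in> Gf"
  obtains \<alpha> where "unit_range \<alpha>" "l = diag_of \<alpha>" "\<And>i. row_pairing \<alpha> i \<in> \<int>"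
proof -
  define w where "w j = Ln (l $ j)" for j
  have w: "exp (w j) = l $ j" for j using assms by (simp add: w_def Gf_iff)
  have "\<exists>n::int. (\<Sum>j\<in>UNIV. of_nat (E $ i $ j) * w j) = of_int n * (2 * pi * \<i>)" for i
  proof -
    have "exp (\<Sum>j\<in>UNIV. of_nat (E $ i $ j) * w j) = (\<Prod>j\<in>UNIV. (l $ j) ^ (E $ i $ j))"
      by (simp add: exp_sum exp_of_nat_mult w)
    hence "exp (\<Sum>j\<in>UNIV. of_nat (E $ i $ j) * w j) = 1" using assms by (simp add: Gf_iff)
    then obtain n :: int where n: "Re (\<Sum>j\<in>UNIV. of_nat (E $ i $ j) * w j) = 0"
      "Im (\<Sum>j\<in>UNIV. of_nat (E $ i $ j) * w j) = of_int (2 * n) * pi"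
      unfolding exp_eq_1 by blast
    hence "(\<Sum>j\<in>UNIV. of_nat (E $ i $ j) * w j) = of_int n * (2 * pi * \<i>)"
      by (intro complex_eqI) (simp_all only: , simp_all)
    thus ?thesis by blast
  qed
  then obtain n :: "'n \<Rightarrow> int" where n: "\<And>i. (\<Sum>j\<in>UNIV. of_nat (E $ i $ j) * w j) = of_int (n i) * (2 * pi * \<i>)"
    by metis
  define \<beta> where "\<beta> k = (\<Sum>i\<in>UNIV. B $ k $ i * of_int (n i))" for k
  have of_bool: "of_rat (of_bool P) = (of_bool P :: complex)" for P by (cases P) auto
  have wk: "w k = of_rat (\<beta> k) * (2 * pi * \<i>)" for k
  proof -
    have "w k = (\<Sum>j\<in>UNIV. of_rat (\<Sum>i\<in>UNIV. B $ k $ i * of_nat (E $ i $ j)) * w j)"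
      by (simp add: inverse_sum of_bool)
    also have "\<dots> = (\<Sum>i\<in>UNIV. of_rat (B $ k $ i) * (\<Sum>j\<in>UNIV. of_nat (E $ i $ j) * w j))"
      unfolding of_rat_sum of_rat_mult of_rat_of_nat_eq sum_distrib_left sum_distrib_right
      by (subst sum.swap) (simp add: mult.assoc)
    also have "\<dots> = of_rat (\<beta> k) * (2 * pi * \<i>)"
      unfolding n \<beta>_def of_rat_sum of_rat_mult sum_distrib_right by (simp add: mult_ac)
    finally show ?thesis .
  qed
  have "l $ k = cis (2 * pi * of_rat (\<beta> k))" for k
  proof -
    have "of_rat (\<beta> k) * (2 * pi * \<i>) = \<i> * complex_of_real (2 * pi * of_rat (\<beta> k))"
      by (simp add: of_real_of_rat)
    thus ?thesis using w[of k] unfolding wk cis_conv_exp by metis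
  qed
  hence l: "l = diag_of \<beta>" by (simp add: diag_of_def vec_eq_iff)
  show ?thesis
  proof (rule that[of "\<lambda>j. frac (\<beta> j)"])
    show l': "l = diag_of (\<lambda>j. frac (\<beta> j))" using l by (simp add: diag_of_frac)
    show "row_pairing (\<lambda>j. frac (\<beta> j)) i \<in> \<int>" for i
      using assms diag_of_in_Gf unfolding l' by blast
  qed (rule unit_range_frac)
qed

lemma row_pairing_expand: "\<alpha> k = (\<Sum>i\<in>UNIV. B $ k $ i * row_pairing \<alpha> i)"
proof -
  have "(\<Sum>i\<in>UNIV. B $ k $ i * row_pairing \<alpha> i) =
      (\<Sum>j\<in>UNIV. (\<Sum>i\<in>UNIV. B $ k $ i * of_nat (E $ i $ j)) * \<alpha> j)"
    unfolding row_pairing_def sum_distrib_left sum_distrib_right by (subst sum.swap) (simp add: mult.assoc)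
  thus ?thesis by (simp add: inverse_sum)
qed

text \<open>A symmetry is determined by the integer vector of its row pairings, which is bounded
  because the phases lie between 0 and 1.\<close>

lemma finite_Gf: "finite Gf"
proof -
  define T where "T = {\<alpha>. unit_range \<alpha> \<and> (\<forall>i. row_pairing \<alpha> i \<in> \<int>)}"
  let ?F = "\<lambda>\<alpha> i. \<lfloor>row_pairing \<alpha> i\<rfloor>"
  define M where "M = (\<Sum>i\<in>UNIV. \<Sum>j\<in>UNIV. int (E $ i $ j))"
  have "inj_on ?F T"
  proof (rule inj_onI)
    fix \<alpha> \<beta> assume *: "\<alpha> \<in> T" "\<beta> \<in> T" "?F \<alpha> = ?F \<beta>"
    have eq: "row_pairing \<alpha> i = row_pairing \<beta> i" for i
    proof -
      have "row_pairing \<alpha> i \<in> \<int>" "row_pairing \<beta> i \<in> \<int>" using * by (auto simp: T_def)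
      thus ?thesis using fun_cong[OF *(3), of i] by (auto elim!: Ints_cases)
    qed
    show "\<alpha> = \<beta>"
      by (rule ext) (subst (1 2) row_pairing_expand, simp add: eq)
  qed
  moreover have "?F ` T \<subseteq> Pi UNIV (\<lambda>_. {0..M})"
  proof (intro image_subsetI Pi_I)
    fix \<alpha> i assume "\<alpha> \<in> T"
    hence r: "0 \<le> \<alpha> j" "\<alpha> j \<le> 1" for j by (auto simp: T_def unit_range_def less_imp_le)
    have 0: "row_pairing \<alpha> i \<ge> 0" unfolding row_pairing_def using r by (intro sum_nonneg) simp
    have "row_pairing \<alpha> i \<le> (\<Sum>j\<in>UNIV. of_nat (E $ i $ j) * 1)"
      unfolding row_pairing_def using r by (intro sum_mono mult_left_mono) auto
    also have "\<dots> = of_int (\<Sum>j\<in>UNIV. int (E $ i $ j))" by simp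
    finally have "\<lfloor>row_pairing \<alpha> i\<rfloor> \<le> (\<Sum>j\<in>UNIV. int (E $ i $ j))" by (metis floor_mono floor_of_int)
    also have "\<dots> \<le> M" unfolding M_def by (rule member_le_sum) (auto intro: sum_nonneg)
    finally show "\<lfloor>row_pairing \<alpha> i\<rfloor> \<in> {0..M}" using 0 by simp
  qed
  moreover have "finite (Pi UNIV (\<lambda>_::'n. {0..M}))"
    using finite_PiE[of "UNIV :: 'n set" "\<lambda>_. {0..M}"] by (simp add: PiE_def extensional_def)
  ultimately have "finite T" using finite_imageD finite_subset by blast
  moreover have "Gf \<subseteq> diag_of ` T"
  proof
    fix l assume "l \<in> Gf"
    then obtain \<alpha> where "unit_range \<alpha>" "l = diag_of \<alpha>" "\<And>i. row_pairing \<alpha> i \<in> \<int>" by (rule Gf_cases) blast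
    thus "l \<in> diag_of ` T" by (auto simp: T_def)
  qed
  ultimately show ?thesis using finite_surj by blast
qed

end

section \<open>The Jacobian module and its sectors\<close>

lemma lookup_smult [simp]: "Poly_Mapping.lookup (mpoly_smult c p) m = c * Poly_Mapping.lookup p m"
  unfolding mpoly_smult_def by (simp add: mult_map_scale_conv_mult[symmetric] map.rep_eq when_def)

global_interpretation mp: vector_space "mpoly_smult :: complex \<Rightarrow> 'n mpoly \<Rightarrow> 'n mpoly"
  by unfold_locales (auto intro!: poly_mapping_eqI simp: lookup_add algebra_simps)

text \<open>Every linear functional on polynomials is of this form, since the monomials are a
  basis.\<close>

definition appl :: "(('n \<Rightarrow>\<^sub>0 nat) \<Rightarrow> complex) \<Rightarrow> 'n mpoly \<Rightarrow> complex" where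
  "appl l P = (\<Sum>m\<in>Poly_Mapping.keys P. Poly_Mapping.lookup P m * l m)"

lemma appl_superset:
  "finite S \<Longrightarrow> Poly_Mapping.keys P \<subseteq> S \<Longrightarrow> appl l P = (\<Sum>m\<in>S. Poly_Mapping.lookup P m * l m)"
  unfolding appl_def by (intro sum.mono_neutral_left) (auto simp: in_keys_iff)

lemma appl_add: "appl l (P + Q) = appl l P + appl l Q"
proof -
  let ?S = "Poly_Mapping.keys P \<union> Poly_Mapping.keys Q"
  have "Poly_Mapping.keys (P + Q) \<subseteq> ?S" by (rule keys_add)
  thus ?thesis by (simp add: appl_superset[of ?S] lookup_add distrib_right sum.distrib)
qed

lemma appl_smult: "appl l (mpoly_smult c P) = c * appl l P"
proof -
  have "Poly_Mapping.keys (mpoly_smult c P) \<subseteq> Poly_Mapping.keys P" by (auto simp: in_keys_iff)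
  thus ?thesis by (simp add: appl_superset[of "Poly_Mapping.keys P"] sum_distrib_left mult.assoc)
qed

lemma appl_0 [simp]: "appl l 0 = 0" by (simp add: appl_def)

lemma appl_single [simp]: "appl l (Poly_Mapping.single m c) = c * l m"
  by (cases "c = 0") (simp_all add: appl_def)

lemma appl_sum: "appl l (\<Sum>i\<in>S. f i) = (\<Sum>i\<in>S. appl l (f i))"
  by (induction S rule: infinite_finite_induct) (simp_all add: appl_add)

lemma appl_diff: "appl l (P - Q) = appl l P - appl l Q"
  using appl_add[of l "P - Q" Q] by simp

lemma poly_sum_single: "(\<Sum>m\<in>Poly_Mapping.keys P. Poly_Mapping.single m (Poly_Mapping.lookup P m)) = P"
  by (rule poly_mapping_eqI) (simp add: lookup_sum lookup_single when_def in_keys_iff)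

lemma separating_functional:
  fixes W :: "'n mpoly set"
  assumes W: "mp.subspace W" and P: "P \<notin> W"
  shows "\<exists>l. (\<forall>Q\<in>W. appl l Q = 0) \<and> appl l P \<noteq> 0"
proof -
  interpret pr: vector_space_pair "mpoly_smult :: complex \<Rightarrow> 'n mpoly \<Rightarrow> 'n mpoly" "(*) :: complex \<Rightarrow> complex \<Rightarrow> complex"
    by unfold_locales (auto simp: algebra_simps)
  obtain Bw where Bw: "Bw \<subseteq> W" "mp.independent Bw" "W \<subseteq> mp.span Bw"
    by (rule mp.maximal_independent_subset)
  have sp: "mp.span Bw = W" using Bw W mp.span_minimal by blast
  have "mp.independent (insert P Bw)" using Bw(2) P sp by (intro mp.independent_insertI) auto
  then obtain f where f: "Vector_Spaces.linear mpoly_smult (*) f"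
    "\<forall>x\<in>insert P Bw. f x = (if x = P then 1 else 0)"
    using pr.linear_independent_extend[of "insert P Bw" "\<lambda>x. if x = P then 1 else 0"] by blast
  interpret f: Vector_Spaces.linear mpoly_smult "(*)" f by (rule f(1))
  define l where "l m = f (Poly_Mapping.single m 1)" for m
  have appl: "appl l Q = f Q" for Q
  proof -
    have "Poly_Mapping.single m c = mpoly_smult c (Poly_Mapping.single m 1)" for m and c :: complex
      by (rule poly_mapping_eqI) (simp add: lookup_single when_def)
    hence "f (Poly_Mapping.single m c) = f (mpoly_smult c (Poly_Mapping.single m 1))" for m c
      by (rule arg_cong)
    hence "f (Poly_Mapping.single m c) = c * l m" for m c
      unfolding l_def f.scale .
    hence "f (\<Sum>m\<in>Poly_Mapping.keys Q. Poly_Mapping.single m (Poly_Mapping.lookup Q m)) = appl l Q"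
      unfolding f.sum appl_def by (intro sum.cong) auto
    thus ?thesis by (simp add: poly_sum_single)
  qed
  have "P \<notin> Bw" using P Bw(1) by blast
  hence "f x = 0" if "x \<in> Bw" for x using f(2) that by auto
  hence "f Q = 0" if "Q \<in> mp.span Bw" for Q
    using f.eq_0_on_span that by blast
  thus ?thesis using f(2) sp by (intro exI[of _ l]) (auto simp: appl)
qed

definition top_form :: "'n set \<Rightarrow> 'n mpoly \<Rightarrow> 'n form" where
  "top_form I P = (\<lambda>J. if J = I then P else 0)"

lemma top_form_at [simp]: "top_form I P I = P" by (simp add: top_form_def)

lemma top_form_eq_iff [simp]: "top_form I P = top_form I Q \<longleftrightarrow> P = Q"
  by (metis top_form_at)

lemma lincomb_top:
  assumes "B = top_form I ` S"
  shows "form_lincomb c B = top_form I (\<Sum>P\<in>S. mpoly_smult (c (top_form I P)) P)"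
proof -
  have "inj_on (top_form I) S" by (rule inj_onI) simp
  hence "form_lincomb c B J = (\<Sum>P\<in>S. mpoly_smult (c (top_form I P)) (top_form I P J))" for J
    unfolding form_lincomb_def assms by (simp add: sum.reindex)
  thus ?thesis by (auto simp: top_form_def fun_eq_iff)
qed

text \<open>The functionals \<open>l m\<close> define a projection \<open>L\<close> onto the span of
  the monomials in \<open>Z\<close>. It kills \<open>W\<close> and is the identity modulo
  \<open>W\<close> on \<open>V\<close>, so it identifies the quotient with this span.\<close>

lemma dim_mod_top_form:
  fixes Z :: "('n \<Rightarrow>\<^sub>0 nat) set" and W :: "'n mpoly set"
  assumes Z: "finite Z" and W: "mp.subspace W" and V: "V \<subseteq> range (top_form I)"
    and ZV: "\<And>m. m \<in> Z \<Longrightarrow> top_form I (Poly_Mapping.single m 1) \<in> V"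
    and van: "\<And>m Q. m \<in> Z \<Longrightarrow> Q \<in> W \<Longrightarrow> appl (l m) Q = 0"
    and dual: "\<And>m m'. m \<in> Z \<Longrightarrow> m' \<in> Z \<Longrightarrow> l m m' = of_bool (m = m')"
    and gen: "\<And>P. top_form I P \<in> V \<Longrightarrow> P - (\<Sum>m\<in>Z. Poly_Mapping.single m (appl (l m) P)) \<in> W"
  shows "dim_mod V (top_form I ` W) = card Z"
proof -
  define L where "L P = (\<Sum>m\<in>Z. Poly_Mapping.single m (appl (l m) P))" for P
  define u where "u m = (Poly_Mapping.single m 1 :: 'n mpoly)" for m
  have in_W: "top_form I P \<in> top_form I ` W \<longleftrightarrow> P \<in> W" for P by auto
  have lookup_L: "Poly_Mapping.lookup (L P) m = (if m \<in> Z then appl (l m) P else 0)" for P m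
    unfolding L_def lookup_sum using Z by (simp add: lookup_single when_def)
  have L_W: "L Q = 0" if "Q \<in> W" for Q
    by (rule poly_mapping_eqI) (simp add: lookup_L van that)
  have L_add: "L (P + Q) = L P + L Q" for P Q
    by (rule poly_mapping_eqI) (simp add: lookup_L lookup_add appl_add)
  have L_smult: "L (mpoly_smult c P) = mpoly_smult c (L P)" for c P
    by (rule poly_mapping_eqI) (simp add: lookup_L appl_smult)
  have L_sum: "L (\<Sum>P\<in>S. f P) = (\<Sum>P\<in>S. L (f P))" for f and S :: "'n mpoly set"
    by (rule poly_mapping_eqI) (simp add: lookup_L lookup_sum appl_sum)
  have L_u: "L (u m) = u m" if "m \<in> Z" for m
    by (rule poly_mapping_eqI) (use that in \<open>auto simp: lookup_L u_def lookup_single when_def dual\<close>)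
  have L_span: "L P \<in> mp.span (u ` Z)" for P
  proof -
    have "L P = (\<Sum>m\<in>Z. mpoly_smult (appl (l m) P) (u m))"
      unfolding L_def by (intro sum.cong poly_mapping_eqI) (simp_all add: u_def lookup_single when_def)
    moreover have "(\<Sum>m\<in>Z. mpoly_smult (appl (l m) P) (u m)) \<in> mp.span (u ` Z)"
      by (intro mp.span_sum mp.span_scale mp.span_base imageI)
    ultimately show ?thesis by metis
  qed
  have inj_u: "inj u" by (rule injI) (metis u_def lookup_single_eq lookup_single_not_eq zero_neq_one)
  have ind_u: "mp.independent (u ` Z)"
  proof (rule mp.independent_if_scalars_zero)
    fix f x assume 0: "(\<Sum>x\<in>u ` Z. mpoly_smult (f x) x) = 0" and x: "x \<in> u ` Z"
    then obtain m where m: "m \<in> Z" "x = u m" by blast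
    have "Poly_Mapping.lookup (\<Sum>x\<in>u ` Z. mpoly_smult (f x) x) m =
        (\<Sum>k\<in>Z. f (u k) * Poly_Mapping.lookup (u k) m)"
      by (simp add: sum.reindex[OF inj_on_subset[OF inj_u]] lookup_sum)
    also have "\<dots> = (\<Sum>k\<in>Z. if k = m then f x else 0)"
      using m by (intro sum.cong) (auto simp: u_def lookup_single when_def)
    also have "\<dots> = f x" using m Z by simp
    finally have "Poly_Mapping.lookup (\<Sum>x\<in>u ` Z. mpoly_smult (f x) x) m = f x" .
    thus "f x = 0" using 0 by simp
  qed (use Z in simp)
  \<comment> \<open>\<open>dim_mod\<close> selects an arbitrary basis, so every basis must be shown
    to have \<open>card Z\<close> elements; its image under \<open>L\<close> is a basis of the
    span.\<close>
  have card_eq: "card B = card Z" if B: "basis_mod B V (top_form I ` W)" for B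
  proof -
    define S where "S = (\<lambda>\<omega>. \<omega> I) ` B"
    have BS: "B = top_form I ` S"
    proof -
      have "top_form I (\<omega> I) = \<omega>" if "\<omega> \<in> B" for \<omega>
      proof -
        have "\<omega> \<in> range (top_form I)" using B V that unfolding basis_mod_def by blast
        thus ?thesis by auto
      qed
      thus ?thesis unfolding S_def by (force simp: image_iff)
    qed
    have finS: "finite S" using B by (simp add: S_def basis_mod_def)
    have card_S: "card S = card B" unfolding BS by (rule card_image[symmetric]) (rule inj_onI, simp)
    have SV: "top_form I P \<in> V" if "P \<in> S" for P using B that unfolding BS basis_mod_def by blast
    have ind: "c P = 0" if 0: "(\<Sum>P\<in>S. mpoly_smult (c P) (L P)) = 0" and P: "P \<in> S" for c P
    proof -
      define T where "T = (\<Sum>P\<in>S. mpoly_smult (c P) P)"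
      have "T = (\<Sum>P\<in>S. mpoly_smult (c P) (P - L P))"
        unfolding mp.scale_right_diff_distrib sum_subtractf 0 T_def by simp
      also have "\<dots> \<in> W"
        using W gen SV by (intro mp.subspace_sum mp.subspace_scale) (auto simp: L_def)
      finally have "form_lincomb (\<lambda>\<omega>. c (\<omega> I)) B \<in> top_form I ` W"
        unfolding lincomb_top[OF BS] T_def by simp
      hence "\<forall>\<omega>\<in>B. c (\<omega> I) = 0" using B unfolding basis_mod_def by blast
      thus ?thesis using P BS by force
    qed
    have inj: "inj_on L S"
    proof (rule inj_onI, rule ccontr)
      fix P Q assume PQ: "P \<in> S" "Q \<in> S" "L P = L Q" "P \<noteq> Q"
      define c where "c R = (if R = P then 1 else if R = Q then - 1 else 0 :: complex)" for R
      have "(\<Sum>R\<in>S. mpoly_smult (c R) (L R)) = (\<Sum>R\<in>{P, Q}. mpoly_smult (c R) (L R))"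
        using finS PQ by (intro sum.mono_neutral_right) (auto simp: c_def)
      also have "\<dots> = 0" using PQ by (auto simp: c_def)
      finally have "c P = 0" using ind PQ(1) by blast
      thus False by (simp add: c_def)
    qed
    have "mp.independent (L ` S)"
    proof (rule mp.independent_if_scalars_zero)
      fix f x assume "(\<Sum>x\<in>L ` S. mpoly_smult (f x) x) = 0" "x \<in> L ` S"
      thus "f x = 0" using ind[of "\<lambda>P. f (L P)"] by (auto simp: sum.reindex[OF inj])
    qed (use finS in simp)
    hence le: "card (L ` S) \<le> card (u ` Z)"
      using mp.independent_span_bound[of "u ` Z" "L ` S"] Z L_span by blast
    have "u m \<in> mp.span (L ` S)" if m: "m \<in> Z" for m
    proof -
      obtain c where "(\<lambda>J. top_form I (u m) J - form_lincomb c B J) \<in> top_form I ` W"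
        using B ZV[OF m] unfolding basis_mod_def u_def by blast
      then obtain Q where Q: "Q \<in> W" "(\<lambda>J. top_form I (u m) J - form_lincomb c B J) = top_form I Q"
        by blast
      from fun_cong[OF Q(2), of I]
      have "u m = Q + (\<Sum>P\<in>S. mpoly_smult (c (top_form I P)) P)"
        unfolding lincomb_top[OF BS] by (simp add: algebra_simps)
      hence "L (u m) = (\<Sum>P\<in>S. mpoly_smult (c (top_form I P)) (L P))"
        by (simp add: L_add L_sum L_smult L_W Q)
      moreover have "(\<Sum>P\<in>S. mpoly_smult (c (top_form I P)) (L P)) \<in> mp.span (L ` S)"
        by (intro mp.span_sum mp.span_scale mp.span_base imageI)
      ultimately show ?thesis using L_u[OF m] by metis
    qed
    hence "card (u ` Z) \<le> card (L ` S)"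
      using mp.independent_span_bound[of "L ` S" "u ` Z"] finS ind_u by blast
    thus ?thesis using le card_S card_image[OF inj] card_image[OF inj_on_subset[OF inj_u]] by auto
  qed
  have "basis_mod (top_form I ` u ` Z) V (top_form I ` W)"
    unfolding basis_mod_def
  proof (intro conjI allI impI ballI)
    show "finite (top_form I ` u ` Z)" using Z by simp
    show "top_form I ` u ` Z \<subseteq> V" using ZV by (auto simp: u_def)
  next
    fix c \<omega> assume *: "form_lincomb c (top_form I ` u ` Z) \<in> top_form I ` W" "\<omega> \<in> top_form I ` u ` Z"
    hence "(\<Sum>P\<in>u ` Z. mpoly_smult (c (top_form I P)) P) \<in> W"
      unfolding lincomb_top[OF refl] in_W by blast
    hence "L (\<Sum>P\<in>u ` Z. mpoly_smult (c (top_form I P)) P) = 0" by (rule L_W)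
    moreover have "(\<Sum>P\<in>u ` Z. mpoly_smult (c (top_form I P)) (L P)) =
        (\<Sum>P\<in>u ` Z. mpoly_smult (c (top_form I P)) P)"
      by (intro sum.cong) (auto simp: L_u)
    ultimately have "(\<Sum>P\<in>u ` Z. mpoly_smult (c (top_form I P)) P) = 0"
      unfolding L_sum L_smult by simp
    thus "c \<omega> = 0"
      using mp.independentD[OF ind_u _ subset_refl, of "\<lambda>P. c (top_form I P)"] Z * by auto
  next
    fix \<omega> assume \<omega>: "\<omega> \<in> V"
    then obtain P where P: "\<omega> = top_form I P" using V by blast
    define c where "c \<eta> = (\<Sum>m\<in>Z. if \<eta> = top_form I (u m) then appl (l m) P else 0)" for \<eta> :: "'n form"
    have c: "c (top_form I (u m)) = appl (l m) P" if "m \<in> Z" for m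
      unfolding c_def using that Z inj_u by (simp add: inj_eq)
    have "(\<Sum>Q\<in>u ` Z. mpoly_smult (c (top_form I Q)) Q) = L P"
    proof -
      have "(\<Sum>Q\<in>u ` Z. mpoly_smult (c (top_form I Q)) Q) = (\<Sum>m\<in>Z. mpoly_smult (appl (l m) P) (u m))"
        by (subst sum.reindex[OF inj_on_subset[OF inj_u]]) (auto simp: c)
      also have "\<dots> = L P"
        unfolding L_def by (intro sum.cong poly_mapping_eqI) (simp_all add: u_def lookup_single when_def)
      finally show ?thesis .
    qed
    hence "(\<lambda>J. \<omega> J - form_lincomb c (top_form I ` u ` Z) J) = top_form I (P - L P)"
      unfolding lincomb_top[OF refl] P by (auto simp: top_form_def)
    thus "\<exists>c. (\<lambda>J. \<omega> J - form_lincomb c (top_form I ` u ` Z) J) \<in> top_form I ` W"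
      using gen[of P] \<omega> P by (auto simp: L_def)
  qed
  hence ex: "\<exists>B. basis_mod B V (top_form I ` W)" by blast
  thus ?thesis unfolding dim_mod_def using card_eq[OF someI_ex[OF ex]] by simp
qed

definition polys :: "'n set \<Rightarrow> 'n mpoly set" where
  "polys I = {P. \<forall>m\<in>Poly_Mapping.keys P. Poly_Mapping.keys m \<subseteq> I}"

lemma polys_add: "P \<in> polys I \<Longrightarrow> Q \<in> polys I \<Longrightarrow> P + Q \<in> polys I"
  using keys_add[of P Q] by (auto simp: polys_def)

lemma polys_0: "0 \<in> polys I" by (simp add: polys_def)

lemma polys_smult: "P \<in> polys I \<Longrightarrow> mpoly_smult c P \<in> polys I"
  by (auto simp: polys_def in_keys_iff)

lemma polys_single: "Poly_Mapping.keys m \<subseteq> I \<Longrightarrow> Poly_Mapping.single m c \<in> polys I"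
  by (auto simp: polys_def)

lemma sign_smult: "(- 1) ^ k * P = mpoly_smult ((- 1) ^ k) (P :: 'n mpoly)"
  by (cases "even k") (auto intro!: poly_mapping_eqI)

lemma forms_top:
  assumes "finite I"
  shows "forms I (card I) = top_form I ` polys I"
proof
  show "forms I (card I) \<subseteq> top_form I ` polys I"
  proof
    fix \<omega> assume w: "\<omega> \<in> forms I (card I)"
    have "\<omega> J = 0" if "J \<noteq> I" for J
      using w that card_subset_eq[OF assms, of J] by (auto simp: forms_def)
    hence "\<omega> = top_form I (\<omega> I)" by (auto simp: top_form_def)
    moreover have "\<omega> I \<in> polys I" using w by (auto simp: forms_def polys_def)
    ultimately show "\<omega> \<in> top_form I ` polys I" by blast
  qed
qed (auto simp: forms_def top_form_def polys_def split: if_splits)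

section \<open>The Jacobian ideal on a coordinate subspace\<close>

locale hodge = invertible_poly_data E a
  for E :: "nat ^ 'n::{finite,linorder} ^ 'n::{finite,linorder}" and a +
  fixes I :: "'n::{finite,linorder} set"
begin

abbreviation "pol \<equiv> mpoly_of E a"

text \<open>The monomials that survive the restriction to the coordinate subspace.\<close>

definition rows_in :: "'n set" where "rows_in = {i. \<forall>j. j \<notin> I \<longrightarrow> E $ i $ j = 0}"

lemma keys_row: "Poly_Mapping.keys (row_monomial E i) \<subseteq> I \<longleftrightarrow> i \<in> rows_in"
  by (auto simp: rows_in_def in_keys_iff subset_iff)

lemma restrict_poly: "mpoly_restrict I pol = partial_poly E a rows_in"
proof (rule poly_mapping_eqI)
  fix m
  show "Poly_Mapping.lookup (mpoly_restrict I pol) m = Poly_Mapping.lookup (partial_poly E a rows_in) m"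
  proof (cases "m \<in> range (row_monomial E)")
    case True
    then obtain i where "m = row_monomial E i" by blast
    thus ?thesis
      by (simp add: mpoly_restrict_def lookup_mapp mpoly_of_partial keys_partial_poly
        lookup_partial_poly keys_row)
  next
    case False
    hence "m \<notin> Poly_Mapping.keys (partial_poly E a rows_in)" "m \<notin> Poly_Mapping.keys pol"
      by (auto simp: mpoly_of_partial keys_partial_poly)
    thus ?thesis by (simp add: mpoly_restrict_def lookup_mapp in_keys_iff)
  qed
qed

definition dpoly :: "'n \<Rightarrow> 'n mpoly" where "dpoly j = mpoly_deriv j (mpoly_restrict I pol)"

lemma dpoly_eq: "dpoly j = (\<Sum>i\<in>rows_in.
    Poly_Mapping.single (row_monomial E i - Poly_Mapping.single j 1) (of_nat (E $ i $ j) * a $ i))"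
  by (simp add: dpoly_def restrict_poly deriv_partial_poly)

lemma dpoly_outside: "j \<notin> I \<Longrightarrow> dpoly j = 0"
  by (simp add: dpoly_eq rows_in_def)

definition jac :: "'n mpoly set" where
  "jac = {\<Sum>j\<in>I. dpoly j * H j | H. \<forall>j. H j \<in> polys I}"

lemma subspace_jac: "mp.subspace jac"
  unfolding mp.subspace_def
proof (intro conjI ballI allI)
  show "0 \<in> jac" unfolding jac_def by (intro CollectI exI[of _ "\<lambda>_. 0"]) (simp add: polys_0)
next
  fix P Q assume "P \<in> jac" "Q \<in> jac"
  then obtain H H' where "P = (\<Sum>j\<in>I. dpoly j * H j)" "\<forall>j. H j \<in> polys I"
    "Q = (\<Sum>j\<in>I. dpoly j * H' j)" "\<forall>j. H' j \<in> polys I" unfolding jac_def by blast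
  thus "P + Q \<in> jac" unfolding jac_def
    by (intro CollectI exI[of _ "\<lambda>j. H j + H' j"]) (simp add: polys_add sum.distrib distrib_left)
next
  fix c P assume "P \<in> jac"
  then obtain H where "P = (\<Sum>j\<in>I. dpoly j * H j)" "\<forall>j. H j \<in> polys I" unfolding jac_def by blast
  moreover have "mpoly_smult c (\<Sum>j\<in>I. dpoly j * H j) = (\<Sum>j\<in>I. dpoly j * mpoly_smult c (H j))"
    by (simp add: mpoly_smult_def sum_distrib_left mult_ac)
  ultimately show "mpoly_smult c P \<in> jac" unfolding jac_def
    by (intro CollectI exI[of _ "\<lambda>j. mpoly_smult c (H j)"]) (auto intro: polys_smult)
qed

definition sgn_exp :: "'n \<Rightarrow> nat" where
  "sgn_exp i = card {(k, j). k \<in> {i} \<and> j \<in> I - {i} \<and> j < k}"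

lemma wedge_at_top:
  "wedge (differential (mpoly_restrict I pol)) \<eta> I =
     (\<Sum>j\<in>I. (- 1) ^ sgn_exp j * dpoly j * \<eta> (I - {j}))"
proof -
  have "wedge (differential (mpoly_restrict I pol)) \<eta> I =
      (\<Sum>J\<in>(\<lambda>j. {j}) ` I. (- 1) ^ card {(k, j). k \<in> J \<and> j \<in> I - J \<and> j < k} *
        differential (mpoly_restrict I pol) J * \<eta> (I - J))"
    unfolding wedge_def
  proof (rule sum.mono_neutral_right)
    show "\<forall>J\<in>Pow I - (\<lambda>j. {j}) ` I. (- 1) ^ card {(k, j). k \<in> J \<and> j \<in> I - J \<and> j < k} *
        differential (mpoly_restrict I pol) J * \<eta> (I - J) = 0"
    proof
      fix J assume J: "J \<in> Pow I - (\<lambda>j. {j}) ` I"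
      have "card J \<noteq> 1"
      proof
        assume "card J = 1"
        then obtain j where "J = {j}" by (rule card_1_singletonE)
        thus False using J by auto
      qed
      thus "(- 1) ^ card {(k, j). k \<in> J \<and> j \<in> I - J \<and> j < k} *
        differential (mpoly_restrict I pol) J * \<eta> (I - J) = 0" by (simp add: differential_def)
    qed
  qed auto
  also have "\<dots> = (\<Sum>j\<in>I. (- 1) ^ sgn_exp j * dpoly j * \<eta> (I - {j}))"
    by (subst sum.reindex) (auto simp: inj_on_def differential_def dpoly_def sgn_exp_def)
  finally show ?thesis .
qed

text \<open>A nonzero coefficient at \<open>K\<close> needs some j in \<open>I\<close> for which
  \<open>K - {j}\<close> is a subset of \<open>I\<close> with one element less than
  \<open>I\<close>; this forces \<open>K = I\<close>.\<close>

lemma wedge_off_top: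
  assumes \<eta>: "\<eta> \<in> forms I (card I - 1)" and K: "K \<noteq> I"
  shows "wedge (differential (mpoly_restrict I pol)) \<eta> K = 0"
  unfolding wedge_def
proof (intro sum.neutral ballI)
  fix J assume J: "J \<in> Pow K"
  have "differential (mpoly_restrict I pol) J = 0 \<or> \<eta> (K - J) = 0"
  proof (cases "card J = 1")
    case True
    then obtain j where j: "J = {j}" by (rule card_1_singletonE)
    show ?thesis
    proof (rule ccontr)
      assume "\<not> ?thesis"
      hence "dpoly j \<noteq> 0" and e: "\<eta> (K - {j}) \<noteq> 0" by (auto simp: j differential_def dpoly_def)
      hence jI: "j \<in> I" using dpoly_outside by blast
      have sub: "K - {j} \<subseteq> I" and c: "card (K - {j}) = card I - 1" using e \<eta> by (auto simp: forms_def)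
      have KI: "K \<subseteq> I" using sub jI by blast
      have "j \<in> K" using J j by simp
      have "card I > 0" using jI by (auto simp: card_gt_0_iff)
      moreover have "card K > 0" using \<open>j \<in> K\<close> by (auto simp: card_gt_0_iff)
      ultimately have "card K = card I" using c \<open>j \<in> K\<close> by simp
      thus False using KI K by (simp add: card_subset_eq)
    qed
  qed (simp add: differential_def)
  thus "(- 1) ^ card {(i, j). i \<in> J \<and> j \<in> K - J \<and> j < i} *
      differential (mpoly_restrict I pol) J * \<eta> (K - J) = 0" by auto
qed

text \<open>The shuffle signs are absorbed by the arbitrary coefficients of the form with which the
  differential is multiplied.\<close>

lemma df_wedge_eq:
  assumes "fixed_coords g = I"
  shows "df_wedge pol g = top_form I ` jac"
proof -
  let ?w = "wedge (differential (mpoly_restrict I pol))"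
  have eq: "?w \<eta> = top_form I (\<Sum>j\<in>I. (- 1) ^ sgn_exp j * dpoly j * \<eta> (I - {j}))"
    if "\<eta> \<in> forms I (card I - 1)" for \<eta>
    using wedge_off_top[OF that] wedge_at_top[of \<eta>] by (auto simp: top_form_def fun_eq_iff)
  have "?w ` forms I (card I - 1) = top_form I ` jac"
  proof
    show "?w ` forms I (card I - 1) \<subseteq> top_form I ` jac"
    proof (rule image_subsetI)
      fix \<eta> assume \<eta>: "\<eta> \<in> forms I (card I - 1)"
      define H where "H j = mpoly_smult ((- 1) ^ sgn_exp j) (\<eta> (I - {j}))" for j
      have "\<forall>j. H j \<in> polys I" using \<eta> unfolding H_def
        by (intro allI polys_smult) (auto simp: forms_def polys_def)
      moreover have "(- 1) ^ sgn_exp j * dpoly j * \<eta> (I - {j}) = dpoly j * H j" for j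
        unfolding H_def sign_smult[symmetric] by (simp add: mult_ac)
      ultimately have "(\<Sum>j\<in>I. (- 1) ^ sgn_exp j * dpoly j * \<eta> (I - {j})) \<in> jac"
        unfolding jac_def by (intro CollectI exI[of _ H] conjI) (simp only:, blast)
      thus "?w \<eta> \<in> top_form I ` jac" using eq[OF \<eta>] by simp
    qed
    show "top_form I ` jac \<subseteq> ?w ` forms I (card I - 1)"
    proof (rule image_subsetI)
      fix P assume "P \<in> jac"
      then obtain H where H: "P = (\<Sum>j\<in>I. dpoly j * H j)" "\<And>j. H j \<in> polys I"
        unfolding jac_def by blast
      define \<eta> where "\<eta> J = (if J \<subseteq> I \<and> card (I - J) = 1
        then mpoly_smult ((- 1) ^ sgn_exp (the_elem (I - J))) (H (the_elem (I - J))) else 0)" for J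
      have \<eta>: "\<eta> \<in> forms I (card I - 1)"
        unfolding forms_def
      proof (intro CollectI allI conjI impI)
        fix J assume "\<eta> J \<noteq> 0"
        hence J: "J \<subseteq> I" "card (I - J) = 1" by (auto simp: \<eta>_def split: if_splits)
        moreover from this have "card J \<le> card I" by (intro card_mono) auto
        ultimately show "J \<subseteq> I" "card J = card I - 1"
          by (simp_all add: card_Diff_subset finite_subset[of J I])
      next
        fix J
        have "\<eta> J \<in> polys I" unfolding \<eta>_def using polys_smult[OF H(2)] polys_0 by auto
        thus "\<forall>m\<in>Poly_Mapping.keys (\<eta> J). Poly_Mapping.keys m \<subseteq> I" by (simp add: polys_def)
      qed
      have "\<eta> (I - {j}) = mpoly_smult ((- 1) ^ sgn_exp j) (H j)" if "j \<in> I" for j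
      proof -
        have "I - (I - {j}) = {j}" using that by blast
        thus ?thesis by (simp add: \<eta>_def Diff_subset)
      qed
      hence *: "(- 1) ^ sgn_exp j * dpoly j * \<eta> (I - {j}) = dpoly j * H j" if "j \<in> I" for j
        using that by (simp add: sign_smult[symmetric] mult_ac)
      have "(\<Sum>j\<in>I. (- 1) ^ sgn_exp j * dpoly j * \<eta> (I - {j})) = P"
        unfolding H(1) by (rule sum.cong[OF refl *])
      hence "?w \<eta> = top_form I P" using eq[OF \<eta>] by simp
      thus "top_form I P \<in> ?w ` forms I (card I - 1)" using \<eta> by (metis imageI)
    qed
  qed
  thus ?thesis unfolding df_wedge_def fixed_dim_def assms .
qed

lemma appl_jac:
  assumes "\<And>j m. j \<in> I \<Longrightarrow> Poly_Mapping.keys m \<subseteq> I \<Longrightarrow> appl l (dpoly j * Poly_Mapping.single m 1) = 0"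
    and "Q \<in> jac"
  shows "appl l Q = 0"
proof -
  obtain H where H: "Q = (\<Sum>j\<in>I. dpoly j * H j)" "\<And>j. H j \<in> polys I"
    using assms(2) unfolding jac_def by blast
  have "appl l (dpoly j * H j) = 0" if j: "j \<in> I" for j
  proof -
    have s: "Poly_Mapping.single m c = mpoly_smult c (Poly_Mapping.single m 1)" for m :: "'n \<Rightarrow>\<^sub>0 nat" and c
      by (rule poly_mapping_eqI) (simp add: lookup_single when_def)
    have "dpoly j * H j = dpoly j * (\<Sum>m\<in>Poly_Mapping.keys (H j). Poly_Mapping.single m (Poly_Mapping.lookup (H j) m))"
      by (simp only: poly_sum_single)
    also have "\<dots> = (\<Sum>m\<in>Poly_Mapping.keys (H j).
        mpoly_smult (Poly_Mapping.lookup (H j) m) (dpoly j * Poly_Mapping.single m 1))"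
      unfolding sum_distrib_left by (subst s) (simp add: mpoly_smult_def mult_ac)
    finally have "appl l (dpoly j * H j) = (\<Sum>m\<in>Poly_Mapping.keys (H j).
        Poly_Mapping.lookup (H j) m * appl l (dpoly j * Poly_Mapping.single m 1))"
      by (simp add: appl_sum appl_smult)
    moreover have "appl l (dpoly j * Poly_Mapping.single m 1) = 0" if "m \<in> Poly_Mapping.keys (H j)" for m
      using assms(1)[OF j] H(2)[of j] that by (auto simp: polys_def)
    ultimately show ?thesis by simp
  qed
  thus ?thesis unfolding H(1) by (simp add: appl_sum)
qed

lemma dpoly_single_jac:
  assumes "j \<in> I" "Poly_Mapping.keys m \<subseteq> I"
  shows "dpoly j * Poly_Mapping.single m 1 \<in> jac"
  unfolding jac_def
proof (intro CollectI exI conjI allI)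
  let ?H = "\<lambda>k. if k = j then Poly_Mapping.single m 1 else 0"
  have "(\<Sum>k\<in>I. dpoly k * ?H k) = (\<Sum>k\<in>I. if k = j then dpoly j * Poly_Mapping.single m 1 else 0)"
    by (intro sum.cong) auto
  thus "dpoly j * Poly_Mapping.single m 1 = (\<Sum>k\<in>I. dpoly k * ?H k)" using assms by simp
  show "?H k \<in> polys I" for k using polys_single[OF assms(2)] polys_0 by auto
qed

lemma appl_dpoly_single:
  "appl l (dpoly j * Poly_Mapping.single m 1) =
     (\<Sum>i\<in>rows_in. a $ i * of_nat (E $ i $ j) * l (row_monomial E i - Poly_Mapping.single j 1 + m))"
  unfolding dpoly_eq sum_distrib_right appl_sum mult_single by (simp add: mult_ac)

end

lemma functionals_diff:
  assumes "f \<in> functionals E R C I a b" "g \<in> functionals E R C I a b"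
  shows "(\<lambda>c. f c - g c) \<in> functionals E R C I a b"
  using assms unfolding functionals_def by (simp add: right_diff_distrib sum_subtractf)

text \<open>All points that occur in one relation have the same degree, so a functional splits into
  homogeneous parts.\<close>

lemma functionals_degree:
  assumes "finite R" "\<psi> \<in> functionals E R C I a b"
  shows "(\<lambda>c. if sum c R = \<kappa> then 0 else \<psi> c) \<in> functionals E R C I a b"
proof -
  have "(\<Sum>i\<in>R. a i * of_nat (E i j) * (if sum (raise i c) R = \<kappa> then 0 else \<psi> (raise i c))) = 0"
    if "j \<in> I" "c \<in> walls E R C I b j" for j c
  proof (cases "sum c R + 1 = \<kappa>")
    case False
    thus ?thesis using functionals_wall[OF assms(2) that] by (simp add: sum_raise[OF assms(1)] cong: sum.cong)
  qed (simp add: sum_raise[OF assms(1)] cong: sum.cong)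
  thus ?thesis using assms(2) unfolding functionals_def by auto
qed

context hodge
begin

abbreviation "pl \<equiv> pull (entry E) UNIV"
abbreviation "sts \<equiv> states (entry E) UNIV UNIV I"
abbreviation "fns \<equiv> functionals (entry E) UNIV UNIV I (($) a)"

lemma entry_apply: "entry E i j = E $ i $ j"
  by (simp add: entry_def)

definition cv :: "('n \<Rightarrow> rat) \<Rightarrow> 'n \<Rightarrow> rat" where "cv u i = (\<Sum>j\<in>UNIV. B $ j $ i * u j)"

lemma pull_cv: "pl (cv u) j = u j"
proof -
  have "pl (cv u) j = (\<Sum>k\<in>UNIV. (\<Sum>i\<in>UNIV. B $ k $ i * of_nat (E $ i $ j)) * u k)"
    unfolding pull_def cv_def entry_def sum_distrib_left sum_distrib_right
    by (subst sum.swap) (simp add: mult_ac)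
  thus ?thesis by (simp add: inverse_sum)
qed

lemma cv_pull: "cv (pl c) = c"
proof
  fix i
  have "cv (pl c) i = (\<Sum>k\<in>UNIV. (\<Sum>j\<in>UNIV. of_nat (E $ k $ j) * B $ j $ i) * c k)"
    unfolding pull_def cv_def entry_def sum_distrib_left sum_distrib_right
    by (subst sum.swap) (simp add: mult_ac)
  thus "cv (pl c) i = c i" by (simp add: inverse_sum)
qed

text \<open>The form \<open>x\<^sup>m dx\<^sub>I\<close> is \<open>x\<^sup>u dx\<^sub>I / x\<^sub>I\<close> with the exponents \<open>u = expo m\<close>.\<close>

definition expo :: "('n \<Rightarrow>\<^sub>0 nat) \<Rightarrow> 'n \<Rightarrow> rat" where
  "expo m j = of_nat (Poly_Mapping.lookup m j) + of_bool (j \<in> I)"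

definition cvec :: "('n \<Rightarrow>\<^sub>0 nat) \<Rightarrow> 'n \<Rightarrow> rat" where "cvec m = cv (expo m)"

text \<open>The inverse of \<open>cvec\<close> on the states for integral \<open>b\<close>: there
  the exponents on \<open>I\<close> are positive integers and the truncated subtraction is
  exact.\<close>

definition mono :: "('n \<Rightarrow> rat) \<Rightarrow> 'n \<Rightarrow>\<^sub>0 nat" where
  "mono c = monomial (\<lambda>j. if j \<in> I then nat \<lfloor>pl c j\<rfloor> - 1 else 0)"

text \<open>The label of the sector to which a monomial form belongs: the representative of its
  coset in the unit interval.\<close>

definition fr :: "('n \<Rightarrow>\<^sub>0 nat) \<Rightarrow> 'n \<Rightarrow> rat" where "fr m i = frac (cvec m i)"

definition integral :: "('n \<Rightarrow> rat) \<Rightarrow> bool" where "integral b \<longleftrightarrow> (\<forall>j. pl b j \<in> \<int>)"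

lemma pull_cvec: "pl (cvec m) j = expo m j" by (simp add: cvec_def pull_cv)

lemma cvecI: "(\<And>j. pl c j = expo m j) \<Longrightarrow> cvec m = c"
  by (metis cv_pull cvec_def ext)

lemma cvec_states:
  assumes "Poly_Mapping.keys m \<subseteq> I" "\<And>i. cvec m i - b i \<in> \<int>"
  shows "cvec m \<in> sts b"
proof -
  have "Poly_Mapping.lookup m j = 0" if "j \<notin> I" for j using assms(1) that by (auto simp: in_keys_iff)
  thus ?thesis using assms(2) by (auto simp: states_def coset_def pull_cvec expo_def add_nonneg_pos)
qed

lemma mono_cvec: "Poly_Mapping.keys m \<subseteq> I \<Longrightarrow> mono (cvec m) = m"
proof (rule poly_mapping_eqI)
  fix j assume m: "Poly_Mapping.keys m \<subseteq> I"
  have "expo m j = of_nat (Poly_Mapping.lookup m j + of_bool (j \<in> I))" by (simp add: expo_def)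
  hence "nat \<lfloor>pl (cvec m) j\<rfloor> = Poly_Mapping.lookup m j + of_bool (j \<in> I)"
    unfolding pull_cvec by (simp only: floor_of_nat nat_int)
  thus "Poly_Mapping.lookup (mono (cvec m)) j = Poly_Mapping.lookup m j"
    using m by (auto simp: mono_def in_keys_iff)
qed

lemma keys_mono: "Poly_Mapping.keys (mono c) \<subseteq> I"
  by (auto simp: in_keys_iff mono_def split: if_splits)

lemma pull_coset_int: "integral b \<Longrightarrow> c \<in> coset UNIV b \<Longrightarrow> pl c j \<in> \<int>"
  by (rule pull_coset_Ints) (auto simp: integral_def)

lemma cvec_mono:
  assumes "integral b" "c \<in> sts b"
  shows "cvec (mono c) = c"
proof (rule cvecI)
  fix j
  have "pl c j \<in> \<int>" using assms pull_coset_int by (auto simp: states_def)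
  then obtain n where n: "pl c j = of_int n" by (auto elim: Ints_cases)
  show "pl c j = expo (mono c) j"
  proof (cases "j \<in> I")
    case True
    hence "pl c j > 0" using assms by (simp add: states_def)
    hence "n > 0" using n by simp
    hence "of_nat (nat n - 1) + 1 = (of_int n :: rat)" by (simp add: of_nat_diff)
    thus ?thesis using True n by (simp add: expo_def mono_def)
  next
    case False
    thus ?thesis using assms by (simp add: expo_def mono_def states_def)
  qed
qed

lemma integral_fr: "integral (fr m)"
  unfolding integral_def
proof
  fix j
  have "pl (fr m) j = pl (cvec m) j - pl (\<lambda>i. of_int \<lfloor>cvec m i\<rfloor>) j"
    by (simp add: pull_def fr_def frac_def right_diff_distrib sum_subtractf)
  moreover have "pl (\<lambda>i. of_int \<lfloor>cvec m i\<rfloor>) j \<in> \<int>"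
    unfolding pull_def by (intro Ints_sum Ints_mult) auto
  moreover have "pl (cvec m) j \<in> \<int>" by (simp add: pull_cvec expo_def)
  ultimately show "pl (fr m) j \<in> \<int>" by simp
qed

lemma fr_eq_iff: "unit_range b \<Longrightarrow> fr m = b \<longleftrightarrow> (\<forall>i. cvec m i - b i \<in> \<int>)"
proof
  assume b: "unit_range b" and "\<forall>i. cvec m i - b i \<in> \<int>"
  hence "fr m i - b i \<in> \<int>" for i
  proof -
    have "cvec m i - b i - of_int \<lfloor>cvec m i\<rfloor> \<in> \<int>"
      using Ints_diff[OF spec[OF \<open>\<forall>i. cvec m i - b i \<in> \<int>\<close>] Ints_of_int] .
    moreover have "fr m i - b i = cvec m i - b i - of_int \<lfloor>cvec m i\<rfloor>" by (simp add: fr_def frac_def)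
    ultimately show ?thesis by metis
  qed
  thus "fr m = b"
    using b range_Ints_eq[of "fr m _" "b _"] by (auto simp: unit_range_def fr_def frac_lt_1 fun_eq_iff)
next
  assume "fr m = b"
  hence "cvec m i - b i = of_int \<lfloor>cvec m i\<rfloor>" for i by (auto simp: fr_def frac_def)
  thus "\<forall>i. cvec m i - b i \<in> \<int>" by simp
qed

lemma unit_range_fr: "unit_range (fr m)" by (simp add: unit_range_def fr_def frac_lt_1)

definition lam :: "(('n \<Rightarrow> rat) \<Rightarrow> complex) \<Rightarrow> ('n \<Rightarrow>\<^sub>0 nat) \<Rightarrow> complex" where
  "lam \<psi> m = (if Poly_Mapping.keys m \<subseteq> I then \<psi> (cvec m) else 0)"

lemma outside_raise:
  assumes "pl c k = 0" "k \<notin> I" "E $ i $ k > 0"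
  shows "raise i c \<notin> sts b"
proof
  assume "raise i c \<in> sts b"
  hence "pl (raise i c) k = 0" using assms(2) by (simp add: states_def)
  thus False using assms by (simp add: pull_raise entry_apply)
qed

text \<open>The product of a partial derivative with a monomial is a relation at a wall point. Rows
  outside \<open>rows_in\<close> are absent from the restricted polynomial, and their terms in the
  relation vanish because raising them leaves the states.\<close>

lemma lam_jac:
  assumes \<psi>: "\<psi> \<in> fns b" and Q: "Q \<in> jac"
  shows "appl (lam \<psi>) Q = 0"
proof (rule appl_jac[OF _ Q])
  fix j and m :: "'n \<Rightarrow>\<^sub>0 nat"
  assume j: "j \<in> I" and m: "Poly_Mapping.keys m \<subseteq> I"
  \<comment> \<open>The exponents of x^m dx_I divided by x_j. A derivative along x_j multiplies by a
    row and divides by x_j, so its terms are the raised points above this one.\<close>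
  define u :: "'n \<Rightarrow> rat" where "u k = of_nat (Poly_Mapping.lookup m k) + of_bool (k \<in> I - {j})" for k
  define c where "c = cv u"
  have pc: "pl c k = u k" for k by (simp add: c_def pull_cv)
  have m0: "Poly_Mapping.lookup m k = 0" if "k \<notin> I" for k using m that by (auto simp: in_keys_iff)
  have term_in: "a $ i * of_nat (E $ i $ j) * lam \<psi> (row_monomial E i - Poly_Mapping.single j 1 + m) =
      a $ i * of_nat (entry E i j) * \<psi> (raise i c)" if i: "i \<in> rows_in" for i
  proof (cases "E $ i $ j = 0")
    case False
    let ?m = "row_monomial E i - Poly_Mapping.single j 1 + m"
    have "cvec ?m = raise i c"
      using False j by (intro cvecI) (auto simp: pull_raise pc u_def expo_def lookup_add lookup_minus
          lookup_single entry_apply when_def of_nat_diff)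
    moreover have "Poly_Mapping.keys ?m \<subseteq> I"
      using i m0 by (force simp: in_keys_iff lookup_add lookup_minus rows_in_def)
    ultimately show ?thesis by (simp add: lam_def entry_apply)
  qed (simp add: entry_apply)
  have term_out: "a $ i * of_nat (entry E i j) * \<psi> (raise i c) = 0" if i: "i \<notin> rows_in" for i
  proof -
    obtain k where k: "k \<notin> I" "E $ i $ k > 0" using i by (auto simp: rows_in_def)
    have "raise i c \<notin> sts b" using k m0 by (intro outside_raise[of c k]) (auto simp: pc u_def)
    thus ?thesis using functionals_zero_outside[OF \<psi>] by simp
  qed
  have "appl (lam \<psi>) (dpoly j * Poly_Mapping.single m 1) =
      (\<Sum>i\<in>rows_in. a $ i * of_nat (entry E i j) * \<psi> (raise i c))"
    unfolding appl_dpoly_single by (intro sum.cong refl term_in)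
  also have "\<dots> = (\<Sum>i\<in>UNIV. a $ i * of_nat (entry E i j) * \<psi> (raise i c))"
    using term_out by (intro sum.mono_neutral_left) auto
  also have "\<dots> = 0"
  proof (cases "c \<in> coset UNIV b")
    case True
    hence "c \<in> walls (entry E) UNIV UNIV I b j"
      using j m0 by (auto simp: walls_def pc u_def add_nonneg_pos)
    thus ?thesis using functionals_wall[OF \<psi> j] by blast
  next
    case False
    have "raise i c \<notin> sts b" for i
    proof
      assume "raise i c \<in> sts b"
      hence "lower i (raise i c) \<in> coset UNIV b" by (intro coset_lower) (auto simp: states_def)
      thus False using False by simp
    qed
    thus ?thesis using functionals_zero_outside[OF \<psi>] by simp
  qed
  finally show "appl (lam \<psi>) (dpoly j * Poly_Mapping.single m 1) = 0" .
qed

text \<open>The converse translation: a functional on the quotient induces one on each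
  sector.\<close>

lemma functional_of_jac:
  assumes l: "\<And>Q. Q \<in> jac \<Longrightarrow> appl l Q = 0" and b: "integral b"
  shows "(\<lambda>c. if c \<in> sts b then l (mono c) else 0) \<in> fns b"
proof -
  let ?\<psi> = "\<lambda>c. if c \<in> sts b then l (mono c) else 0"
  have "(\<Sum>i\<in>UNIV. a $ i * of_nat (entry E i j) * ?\<psi> (raise i c)) = 0"
    if j: "j \<in> I" and c: "c \<in> walls (entry E) UNIV UNIV I b j" for j c
  proof -
    have cos: "c \<in> coset UNIV b" using c by (simp add: walls_def)
    have off: "pl c k = 0" if "k \<notin> I" for k using c that by (simp add: walls_def)
    have pos: "pl c k > 0" if "k \<in> I" "k \<noteq> j" for k using c that by (simp add: walls_def)
    have nn: "pl c k \<ge> 0" for k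
      using c off[of k] pos[of k] by (cases "k = j"; cases "k \<in> I") (auto simp: walls_def less_imp_le)
    define n where "n k = nat \<lfloor>pl c k\<rfloor>" for k
    have n: "pl c k = of_nat (n k)" for k
      using pull_coset_int[OF b cos, of k] nn[of k] by (auto simp: n_def elim!: Ints_cases)
    have n1: "n k \<ge> 1" if "k \<in> I" "k \<noteq> j" for k using pos[OF that] n[of k] by simp
    define m where "m = monomial (\<lambda>k. if k = j then n j else if k \<in> I then n k - 1 else 0)"
    have m: "Poly_Mapping.keys m \<subseteq> I" using j by (auto simp: m_def in_keys_iff split: if_splits)
    have "a $ i * of_nat (entry E i j) * ?\<psi> (raise i c) =
        a $ i * of_nat (E $ i $ j) * l (row_monomial E i - Poly_Mapping.single j 1 + m)"
      if i: "i \<in> rows_in" for i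
    proof (cases "E $ i $ j = 0")
      case False
      have "pl (raise i c) k > 0" if "k \<in> I" for k
      proof (cases "k = j")
        case True
        thus ?thesis using False c by (simp add: pull_raise entry_apply walls_def add_nonneg_pos)
      next
        case False
        thus ?thesis using c that by (simp add: pull_raise walls_def add_pos_nonneg)
      qed
      moreover have "pl (raise i c) k = 0" if "k \<notin> I" for k
        using that i off by (simp add: pull_raise entry_apply rows_in_def)
      ultimately have "raise i c \<in> sts b" using cos by (simp add: states_def coset_raise)
      moreover have "mono (raise i c) = row_monomial E i - Poly_Mapping.single j 1 + m"
      proof (rule poly_mapping_eqI)
        fix k
        have "pl (raise i c) k = of_nat (n k + E $ i $ k)" by (simp add: pull_raise n entry_apply)
        hence "nat \<lfloor>pl (raise i c) k\<rfloor> = n k + E $ i $ k" by (simp only: floor_of_nat nat_int)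
        thus "Poly_Mapping.lookup (mono (raise i c)) k =
            Poly_Mapping.lookup (row_monomial E i - Poly_Mapping.single j 1 + m) k"
          using False i n1[of k] j
          by (auto simp: mono_def m_def lookup_add lookup_minus lookup_single when_def rows_in_def)
      qed
      ultimately show ?thesis by (simp add: entry_apply)
    qed (simp add: entry_apply)
    moreover have "a $ i * of_nat (entry E i j) * ?\<psi> (raise i c) = 0" if i: "i \<notin> rows_in" for i
    proof -
      obtain k where "k \<notin> I" "E $ i $ k > 0" using i by (auto simp: rows_in_def)
      hence "raise i c \<notin> sts b" using off by (intro outside_raise[of c k]) auto
      thus ?thesis by simp
    qed
    ultimately have "(\<Sum>i\<in>UNIV. a $ i * of_nat (entry E i j) * ?\<psi> (raise i c)) =
        (\<Sum>i\<in>rows_in. a $ i * of_nat (E $ i $ j) * l (row_monomial E i - Poly_Mapping.single j 1 + m))"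
      by (intro sum.mono_neutral_cong_right) auto
    also have "\<dots> = 0" unfolding appl_dpoly_single[symmetric] by (rule l[OF dpoly_single_jac[OF j m]])
    finally show ?thesis .
  qed
  thus ?thesis unfolding functionals_def by simp
qed

end

section \<open>The group action and the invariant part\<close>

definition (in invertible_poly_data) dual_phases :: "(complex ^ 'n) set \<Rightarrow> ('n \<Rightarrow> rat) set" where
  "dual_phases G = {b. unit_range b \<and> (\<forall>j. pull (entry E) UNIV b j \<in> \<int>) \<and>
     (\<forall>g\<in>G. (\<Sum>i\<in>UNIV. b i * row_pairing (phases g) i) \<in> \<int>)}"

context hodge
begin

definition char_at :: "'n diag \<Rightarrow> ('n \<Rightarrow>\<^sub>0 nat) \<Rightarrow> complex" where
  "char_at h m = (\<Prod>j\<in>I. h $ j) * (\<Prod>j\<in>UNIV. (h $ j) ^ Poly_Mapping.lookup m j)"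

definition act :: "'n diag \<Rightarrow> 'n mpoly \<Rightarrow> 'n mpoly" where
  "act h P = mpoly_smult (\<Prod>j\<in>I. h $ j) (mpoly_diag h P)"

lemma lookup_act: "Poly_Mapping.lookup (act h P) m = char_at h m * Poly_Mapping.lookup P m"
  by (simp add: act_def char_at_def mpoly_diag_def lookup_mapp when_def in_keys_iff mult.assoc)

lemma form_diag_top: "form_diag h (top_form I P) = top_form I (act h P)"
proof
  fix J
  have "mpoly_diag h 0 = 0"
    by (rule poly_mapping_eqI) (simp add: mpoly_diag_def lookup_mapp)
  thus "form_diag h (top_form I P) J = top_form I (act h P) J"
    by (simp add: form_diag_def top_form_def act_def)
qed

lemma char_at_diag_of:
  "char_at (diag_of \<beta>) m = cis (2 * pi * of_rat (\<Sum>i\<in>UNIV. cvec m i * row_pairing \<beta> i))"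
proof -
  have "(\<Prod>j\<in>UNIV. cis (2 * pi * of_rat (of_bool (j \<in> I) * \<beta> j))) = (\<Prod>j\<in>I. diag_of \<beta> $ j)"
    by (intro prod.mono_neutral_cong_right) (auto simp: diag_of_def)
  moreover have "cis (2 * pi * of_rat (expo m j * \<beta> j)) = (diag_of \<beta> $ j) ^ Poly_Mapping.lookup m j *
      cis (2 * pi * of_rat (of_bool (j \<in> I) * \<beta> j))" for j
    unfolding expo_def distrib_right cis_rat_add cis_rat_nat by (simp add: diag_of_def)
  ultimately have "char_at (diag_of \<beta>) m = cis (2 * pi * of_rat (\<Sum>j\<in>UNIV. expo m j * \<beta> j))"
    unfolding char_at_def cis_rat_sum by (simp only: prod.distrib mult.commute)
  also have "(\<Sum>j\<in>UNIV. expo m j * \<beta> j) = (\<Sum>j\<in>UNIV. pl (cvec m) j * \<beta> j)"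
    by (simp add: pull_cvec)
  also have "\<dots> = (\<Sum>i\<in>UNIV. cvec m i * row_pairing \<beta> i)"
    unfolding pull_def row_pairing_def entry_def sum_distrib_left sum_distrib_right
    by (subst sum.swap) (simp add: mult_ac)
  finally show ?thesis .
qed

text \<open>The row pairings of a symmetry are integral, so its character on a monomial form depends
  only on the coordinates modulo integers.\<close>

lemma char_at_sector:
  assumes "\<And>i. row_pairing \<beta> i \<in> \<int>"
  shows "char_at (diag_of \<beta>) m = cis (2 * pi * of_rat (\<Sum>i\<in>UNIV. fr m i * row_pairing \<beta> i))"
proof -
  have "(\<Sum>i\<in>UNIV. cvec m i * row_pairing \<beta> i) - (\<Sum>i\<in>UNIV. fr m i * row_pairing \<beta> i) =
      (\<Sum>i\<in>UNIV. of_int \<lfloor>cvec m i\<rfloor> * row_pairing \<beta> i)"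
    by (simp add: sum_subtractf[symmetric] fr_def frac_def algebra_simps)
  also have "\<dots> \<in> \<int>" using assms by (intro Ints_sum Ints_mult) auto
  finally show ?thesis unfolding char_at_diag_of cis_rat_eq_iff .
qed

text \<open>The weights are the row sums of the inverse matrix, which turns the weighted degree into
  the sum of the coordinates.\<close>

lemma sum_weights: "(\<Sum>j\<in>UNIV. weights E $ j * of_nat (Poly_Mapping.lookup m j)) + (\<Sum>j\<in>I. weights E $ j) =
    sum (cvec m) UNIV"
proof -
  have w: "weights E $ j = (\<Sum>i\<in>UNIV. B $ j $ i)" for j
    by (simp add: weights_def B_def matrix_vector_mult_def)
  have "(\<Sum>j\<in>I. weights E $ j) = (\<Sum>j\<in>UNIV. weights E $ j * of_bool (j \<in> I))"
    by (intro sum.mono_neutral_cong_left) auto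
  hence "(\<Sum>j\<in>UNIV. weights E $ j * of_nat (Poly_Mapping.lookup m j)) + (\<Sum>j\<in>I. weights E $ j) =
      (\<Sum>j\<in>UNIV. weights E $ j * expo m j)"
    by (simp add: expo_def sum.distrib distrib_left)
  also have "\<dots> = sum (cvec m) UNIV"
    unfolding w cvec_def cv_def sum_distrib_right by (rule sum.swap)
  finally show ?thesis .
qed

lemma form_homogeneous_top:
  "form_homogeneous (weights E) q (top_form I P) \<longleftrightarrow> (\<forall>m\<in>Poly_Mapping.keys P. sum (cvec m) UNIV = q)"
  unfolding form_homogeneous_def sum_weights[symmetric] by (auto simp: top_form_def)

text \<open>The bases of the sectors of the right degree together form a basis, dual to the
  functionals \<open>psi\<close>. Generation is tested on functionals that vanish on
  \<open>jac\<close>, split by sectors: in a sector outside \<open>dual_phases G\<close> they vanish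
  on invariant classes.\<close>

lemma hodge_dim_sum:
  assumes g: "fixed_coords g = I" and G: "G \<subseteq> Gf" and fin: "finite (dual_phases G)"
    and sec: "\<And>b. b \<in> dual_phases G \<Longrightarrow> sector_dim (entry E) UNIV UNIV I (($) a) b (\<kappa> b) (N b)"
  shows "hodge_dim E a G g p q =
    (if p + q = of_nat (card I) then \<Sum>b\<in>dual_phases G. if \<kappa> b = q then N b else 0 else 0)"
proof -
  let ?D = "dual_phases G"
  define good where "good b S \<longleftrightarrow> finite S \<and> card S = N b \<and> S \<subseteq> sts b \<and> (\<forall>c\<in>S. sum c UNIV = \<kappa> b) \<and>
        (\<forall>v. \<exists>\<psi>\<in>fns b. \<forall>c\<in>S. \<psi> c = v c) \<and>
        (\<forall>\<psi>\<in>fns b. (\<forall>c\<in>S. \<psi> c = 0) \<longrightarrow> (\<forall>c. \<psi> c = 0))" for b S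
  define Bs where "Bs b = (SOME S. good b S)" for b
  have good: "good b (Bs b)" if "b \<in> ?D" for b
    unfolding Bs_def using sec[OF that] unfolding sector_dim_def good_def by (rule someI_ex)
  have Bs: "\<And>b. b \<in> ?D \<Longrightarrow> finite (Bs b)" "\<And>b. b \<in> ?D \<Longrightarrow> card (Bs b) = N b"
    "\<And>b. b \<in> ?D \<Longrightarrow> Bs b \<subseteq> sts b" "\<And>b c. b \<in> ?D \<Longrightarrow> c \<in> Bs b \<Longrightarrow> sum c UNIV = \<kappa> b"
    using good by (auto simp: good_def)
  have ex: "\<exists>\<psi>\<in>fns b. \<forall>c\<in>Bs b. \<psi> c = v c" if "b \<in> ?D" for b v
  proof -
    have "\<forall>v. \<exists>\<psi>\<in>fns b. \<forall>c\<in>Bs b. \<psi> c = v c" using good[OF that] unfolding good_def by (elim conjE)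
    thus ?thesis by (rule spec)
  qed
  have un: "\<psi> c = 0" if "b \<in> ?D" "\<psi> \<in> fns b" "\<And>c. c \<in> Bs b \<Longrightarrow> \<psi> c = 0" for b \<psi> c
    using good[OF that(1)] that(2,3) unfolding good_def by simp
  define psi where "psi b c = (SOME \<psi>. \<psi> \<in> fns b \<and> (\<forall>c'\<in>Bs b. \<psi> c' = of_bool (c = c')))" for b c
  have psi: "psi b c \<in> fns b" "\<And>c'. c' \<in> Bs b \<Longrightarrow> psi b c c' = of_bool (c = c')" if "b \<in> ?D" for b c
  proof -
    have "\<exists>\<psi>. \<psi> \<in> fns b \<and> (\<forall>c'\<in>Bs b. \<psi> c' = of_bool (c = c'))"
      using ex[OF that, of "\<lambda>c'. of_bool (c = c')"] by blast
    hence "psi b c \<in> fns b \<and> (\<forall>c'\<in>Bs b. psi b c c' = of_bool (c = c'))"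
      unfolding psi_def by (rule someI_ex)
    thus "psi b c \<in> fns b" "\<And>c'. c' \<in> Bs b \<Longrightarrow> psi b c c' = of_bool (c = c')" by auto
  qed
  \<comment> \<open>The part of \<open>psi b c\<close> outside degree \<open>\<kappa> b\<close> is
    again a functional, and it vanishes on the basis.\<close>
  have psi_deg: "psi b c c' = 0" if "b \<in> ?D" "sum c' UNIV \<noteq> \<kappa> b" for b c c'
  proof -
    have "(if sum c' UNIV = \<kappa> b then 0 else psi b c c') = 0"
      by (rule un[OF that(1) functionals_degree[OF finite psi(1)[OF that(1)]]])
         (use Bs(4)[OF that(1)] in simp)
    thus ?thesis using that(2) by simp
  qed
  have D: "unit_range b" "integral b" if "b \<in> ?D" for b using that by (auto simp: dual_phases_def integral_def)
  have in_sts: "c \<in> sts b" if "b \<in> ?D" "c \<in> Bs b" for b c using Bs(3) that by blast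
  have cvm: "cvec (mono c) = c" if "b \<in> ?D" "c \<in> Bs b" for b c
    using cvec_mono D(2) in_sts that by blast
  have frm: "fr (mono c) = b" if "b \<in> ?D" "c \<in> Bs b" for b c
    unfolding fr_eq_iff[OF D(1)[OF that(1)]] cvm[OF that]
    using in_sts[OF that] by (auto simp: states_def coset_def)
  define T where "T = Sigma {b \<in> ?D. \<kappa> b = q} Bs"
  define Z where "Z = (\<lambda>(b, c). mono c) ` T"
  have finT: "finite T" unfolding T_def using fin Bs(1) by auto
  hence finZ: "finite Z" by (simp add: Z_def)
  have injT: "inj_on (\<lambda>(b, c). mono c) T"
  proof (rule inj_onI)
    fix x y assume x: "x \<in> T" and y: "y \<in> T" and eq: "(\<lambda>(b, c). mono c) x = (\<lambda>(b, c). mono c) y"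
    obtain b c b' c' where xy: "x = (b, c)" "y = (b', c')" by force
    have "b \<in> ?D" "c \<in> Bs b" "b' \<in> ?D" "c' \<in> Bs b'" "mono c = mono c'"
      using x y eq by (auto simp: xy T_def)
    thus "x = y" unfolding xy using frm cvm by (metis prod.inject)
  qed
  define l where "l m = lam (psi (fr m) (cvec m))" for m
  define V where "V = {\<omega> \<in> forms I (card I). form_homogeneous (weights E) q \<omega> \<and>
      (\<forall>h\<in>G. (\<lambda>J. form_diag h \<omega> J - \<omega> J) \<in> top_form I ` jac)}"
  have diff_top: "(\<lambda>J. top_form I P J - top_form I Q J) = top_form I (P - Q)" for P Q :: "'n mpoly"
    by (auto simp: top_form_def)
  have V_iff: "top_form I P \<in> V \<longleftrightarrow> P \<in> polys I \<and> (\<forall>m\<in>Poly_Mapping.keys P. sum (cvec m) UNIV = q) \<and>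
      (\<forall>h\<in>G. act h P - P \<in> jac)" for P
    unfolding V_def by (auto simp: forms_top form_homogeneous_top form_diag_top diff_top)
  have trivial: "char_at h m = 1" if hG: "h \<in> G" and fD: "fr m \<in> ?D" for h m
  proof -
    obtain \<beta> where \<beta>: "unit_range \<beta>" "h = diag_of \<beta>" "\<And>i. row_pairing \<beta> i \<in> \<int>"
      by (rule Gf_cases[of h]) (use G hG in blast)+
    have "(\<Sum>i\<in>UNIV. fr m i * row_pairing \<beta> i) \<in> \<int>"
      using hG fD \<beta> by (auto simp: dual_phases_def phases_diag_of)
    thus ?thesis unfolding \<beta>(2) char_at_sector[OF \<beta>(3)] by (simp only: cis_rat_eq_1)
  qed
  have "dim_mod V (top_form I ` jac) = card Z"
  proof (rule dim_mod_top_form[OF finZ subspace_jac])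
    show "V \<subseteq> range (top_form I)" unfolding V_def forms_top[OF finite] by blast
  next
    fix m assume "m \<in> Z"
    then obtain b c where bc: "b \<in> ?D" "\<kappa> b = q" "c \<in> Bs b" "m = mono c" by (auto simp: Z_def T_def)
    have "act h (Poly_Mapping.single m 1) - Poly_Mapping.single m 1 = 0" if "h \<in> G" for h
      using trivial[OF that, of m] frm[OF bc(1,3)] bc
      by (intro poly_mapping_eqI) (auto simp: lookup_minus lookup_act lookup_single when_def)
    hence "act h (Poly_Mapping.single m 1) - Poly_Mapping.single m 1 \<in> jac" if "h \<in> G" for h
      using that mp.subspace_0[OF subspace_jac] by simp
    moreover have "sum (cvec m) UNIV = q" using cvm[OF bc(1,3)] Bs(4)[OF bc(1,3)] bc by simp
    ultimately show "top_form I (Poly_Mapping.single m 1) \<in> V"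
      unfolding V_iff using keys_mono bc by (auto intro: polys_single)
  next
    fix m Q assume "m \<in> Z" "Q \<in> jac"
    then obtain b c where bc: "b \<in> ?D" "\<kappa> b = q" "c \<in> Bs b" "m = mono c" by (auto simp: Z_def T_def)
    show "appl (l m) Q = 0"
      unfolding l_def bc(4) frm[OF bc(1,3)] by (rule lam_jac[OF psi(1)[OF bc(1)] \<open>Q \<in> jac\<close>])
  next
    fix m m' assume "m \<in> Z" "m' \<in> Z"
    then obtain b c b' c' where bc: "b \<in> ?D" "\<kappa> b = q" "c \<in> Bs b" "m = mono c"
      and bc': "b' \<in> ?D" "\<kappa> b' = q" "c' \<in> Bs b'" "m' = mono c'" by (auto simp: Z_def T_def)
    have eq: "l m m' = psi b c c'"
      unfolding l_def bc(4) bc'(4) frm[OF bc(1,3)] lam_def cvm[OF bc(1,3)] cvm[OF bc'(1,3)]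
      using keys_mono by simp
    show "l m m' = of_bool (m = m')"
    proof (cases "b = b'")
      case True
      have "m = m' \<longleftrightarrow> c = c'" using bc bc' cvm by metis
      thus ?thesis using eq psi(2)[OF bc(1)] bc'(3) True by simp
    next
      case False
      have "c' \<notin> sts b"
      proof
        assume "c' \<in> sts b"
        hence "\<forall>i. cvec m' i - b i \<in> \<int>"
          using cvm[OF bc'(1,3)] by (auto simp: bc'(4) states_def coset_def)
        hence "fr m' = b" using fr_eq_iff[OF D(1)[OF bc(1)]] by blast
        thus False using frm[OF bc'(1,3)] bc'(4) False by simp
      qed
      hence "l m m' = 0" using eq functionals_zero_outside[OF psi(1)[OF bc(1)]] by simp
      moreover have "m \<noteq> m'" using False frm bc bc' by metis
      ultimately show ?thesis by simp
    qed
  next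
    fix P assume "top_form I P \<in> V"
    hence P: "P \<in> polys I" and hom: "\<And>m. m \<in> Poly_Mapping.keys P \<Longrightarrow> sum (cvec m) UNIV = q"
      and inv: "\<And>h. h \<in> G \<Longrightarrow> act h P - P \<in> jac" by (auto simp: V_iff)
    let ?R = "P - (\<Sum>m\<in>Z. Poly_Mapping.single m (appl (l m) P))"
    show "?R \<in> jac"
    proof (rule ccontr)
      assume "?R \<notin> jac"
      then obtain l0 where l0: "\<And>Q. Q \<in> jac \<Longrightarrow> appl l0 Q = 0" "appl l0 ?R \<noteq> 0"
        using separating_functional[OF subspace_jac] by blast
      define psib where "psib b c = (if c \<in> sts b then l0 (mono c) else 0)" for b c
      \<comment> \<open>The part of \<open>l0\<close> in the sector \<open>b\<close>. It still
        vanishes on \<open>jac\<close>, because it comes from a functional of that sector.\<close>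
      define lb where "lb b m = (if Poly_Mapping.keys m \<subseteq> I \<and> fr m = b then l0 m else 0)" for b m
      have psib: "psib b \<in> fns b" if "integral b" for b
        unfolding psib_def by (rule functional_of_jac[OF l0(1) that])
      have lb: "lb b = lam (psib b)" if b: "unit_range b" for b
      proof
        fix m
        show "lb b m = lam (psib b) m"
        proof (cases "Poly_Mapping.keys m \<subseteq> I")
          case True
          have "cvec m \<in> sts b \<longleftrightarrow> fr m = b"
            unfolding fr_eq_iff[OF b] using cvec_states[OF True] by (auto simp: states_def coset_def)
          thus ?thesis using True mono_cvec[OF True] by (simp add: lb_def lam_def psib_def)
        qed (simp add: lb_def lam_def)
      qed
      have lb_jac: "appl (lb b) Q = 0" if "unit_range b" "integral b" "Q \<in> jac" for b Q
        unfolding lb[OF that(1)] by (rule lam_jac[OF psib[OF that(2)] that(3)])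
      let ?F = "fr ` Poly_Mapping.keys P"
      have keysP: "Poly_Mapping.keys m \<subseteq> I" if "m \<in> Poly_Mapping.keys P" for m
        using P that by (auto simp: polys_def)
      have "l0 m = (\<Sum>b\<in>?F. lb b m)" if "m \<in> Poly_Mapping.keys P" for m
        using that keysP[OF that] by (simp add: lb_def)
      hence "appl l0 P = (\<Sum>b\<in>?F. appl (lb b) P)"
        unfolding appl_def by (simp add: sum_distrib_left cong: sum.cong) (rule sum.swap)
      also have "\<dots> = (\<Sum>b\<in>?F \<inter> ?D. appl (lb b) P)"
      proof (rule sum.mono_neutral_right)
        \<comment> \<open>Some symmetry in \<open>G\<close> acts on this sector by a scalar x
          different from 1 but preserves the class of \<open>P\<close>, so x - 1 times the value is
          0.\<close>
        show "\<forall>b\<in>?F - ?F \<inter> ?D. appl (lb b) P = 0"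
        proof
          fix b assume b: "b \<in> ?F - ?F \<inter> ?D"
          then obtain m0 where m0: "b = fr m0" by blast
          have ub: "unit_range b" "integral b" by (simp_all add: m0 unit_range_fr integral_fr)
          then obtain h where h: "h \<in> G" "(\<Sum>i\<in>UNIV. b i * row_pairing (phases h) i) \<notin> \<int>"
            using b by (auto simp: dual_phases_def integral_def)
          obtain \<beta> where \<beta>: "unit_range \<beta>" "h = diag_of \<beta>" "\<And>i. row_pairing \<beta> i \<in> \<int>"
            by (rule Gf_cases[of h]) (use G h(1) in blast)+
          define x where "x = cis (2 * pi * of_rat (\<Sum>i\<in>UNIV. b i * row_pairing \<beta> i))"
          have x: "x \<noteq> 1" using h(2) \<beta> by (simp add: x_def cis_rat_eq_1 phases_diag_of)
          have ch: "char_at h m = x" if "fr m = b" for m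
            unfolding \<beta>(2) char_at_sector[OF \<beta>(3)] that x_def ..
          have "Poly_Mapping.keys (act h P) \<subseteq> Poly_Mapping.keys P" by (auto simp: in_keys_iff lookup_act)
          hence "appl (lb b) (act h P) = (\<Sum>m\<in>Poly_Mapping.keys P. Poly_Mapping.lookup (act h P) m * lb b m)"
            by (rule appl_superset[OF finite_keys])
          also have "\<dots> = x * appl (lb b) P"
            unfolding appl_def sum_distrib_left
            by (intro sum.cong) (auto simp: lookup_act lb_def ch)
          finally have "appl (lb b) (act h P) = x * appl (lb b) P" .
          moreover have "appl (lb b) (act h P - P) = 0" by (rule lb_jac[OF ub inv[OF h(1)]])
          ultimately have "(x - 1) * appl (lb b) P = 0" by (simp add: appl_diff algebra_simps)
          thus "appl (lb b) P = 0" using x by simp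
        qed
      qed auto
      also have "\<dots> = (\<Sum>b\<in>?D. appl (lb b) P)"
      proof (rule sum.mono_neutral_left)
        show "\<forall>b\<in>?D - ?F \<inter> ?D. appl (lb b) P = 0"
        proof
          fix b assume "b \<in> ?D - ?F \<inter> ?D"
          hence "lb b m = 0" if "m \<in> Poly_Mapping.keys P" for m using that by (auto simp: lb_def)
          thus "appl (lb b) P = 0" by (simp add: appl_def)
        qed
      qed (use fin in auto)
      also have "\<dots> = (\<Sum>b\<in>?D. if \<kappa> b = q then \<Sum>c\<in>Bs b. l0 (mono c) * appl (lam (psi b c)) P else 0)"
      proof (rule sum.cong)
        fix b assume b: "b \<in> ?D"
        \<comment> \<open>Subtracting the expansion in the dual basis leaves a functional that
          vanishes on the basis of the sector and hence everywhere.\<close>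
        define \<psi>' where "\<psi>' c = psib b c - (\<Sum>c'\<in>Bs b. l0 (mono c') * psi b c' c)" for c
        have "\<psi>' \<in> fns b"
          unfolding \<psi>'_def using psib[OF D(2)[OF b]] psi(1)[OF b]
          by (intro functionals_diff functionals_sum) auto
        moreover have "\<psi>' c = 0" if c: "c \<in> Bs b" for c
        proof -
          have "(\<Sum>c'\<in>Bs b. l0 (mono c') * psi b c' c) = (\<Sum>c'\<in>Bs b. if c' = c then l0 (mono c) else 0)"
            using psi(2)[OF b c] by (intro sum.cong) auto
          also have "\<dots> = l0 (mono c)" using Bs(1)[OF b] c by simp
          finally show ?thesis using in_sts[OF b c] by (simp add: \<psi>'_def psib_def)
        qed
        ultimately have "\<psi>' c = 0" for c using un[OF b] by blast
        hence eq: "psib b c = (\<Sum>c'\<in>Bs b. l0 (mono c') * psi b c' c)" for c by (simp add: \<psi>'_def)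
        have "lb b m = (\<Sum>c'\<in>Bs b. l0 (mono c') * lam (psi b c') m)" for m
          unfolding lb[OF D(1)[OF b]] by (simp add: lam_def eq)
        hence A: "appl (lb b) P = (\<Sum>c\<in>Bs b. l0 (mono c) * appl (lam (psi b c)) P)"
          unfolding appl_def sum_distrib_left by (subst sum.swap) (simp add: sum_distrib_left mult_ac)
        show "appl (lb b) P = (if \<kappa> b = q then \<Sum>c\<in>Bs b. l0 (mono c) * appl (lam (psi b c)) P else 0)"
        proof (cases "\<kappa> b = q")
          case False
          have "lam (psi b c) m = 0" if "m \<in> Poly_Mapping.keys P" for m c
            using psi_deg[OF b] hom[OF that] False by (simp add: lam_def)
          hence "appl (lam (psi b c)) P = 0" for c by (simp add: appl_def)
          thus ?thesis using A False by simp
        qed (simp add: A)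
      qed simp
      also have "\<dots> = (\<Sum>b\<in>{b \<in> ?D. \<kappa> b = q}. \<Sum>c\<in>Bs b. l0 (mono c) * appl (lam (psi b c)) P)"
        using fin by (simp add: sum.inter_filter)
      also have "\<dots> = (\<Sum>(b, c)\<in>T. l0 (mono c) * appl (lam (psi b c)) P)"
        unfolding T_def using fin Bs(1) by (subst sum.Sigma) auto
      also have "\<dots> = (\<Sum>m\<in>Z. l0 m * appl (l m) P)"
        unfolding Z_def sum.reindex[OF injT]
      proof (rule sum.cong)
        fix y assume "y \<in> T"
        then obtain b c where "b \<in> ?D" "c \<in> Bs b" "y = (b, c)" by (auto simp: T_def)
        thus "(case y of (b, c) \<Rightarrow> l0 (mono c) * appl (lam (psi b c)) P) =
            ((\<lambda>m. l0 m * appl (l m) P) \<circ> (\<lambda>(b, c). mono c)) y"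
          by (simp add: l_def frm cvm)
      qed simp
      also have "\<dots> = appl l0 (\<Sum>m\<in>Z. Poly_Mapping.single m (appl (l m) P))"
        by (simp add: appl_sum mult.commute)
      finally show False using l0(2) by (simp add: appl_diff)
    qed
  qed
  moreover have "card Z = (\<Sum>b\<in>?D. if \<kappa> b = q then N b else 0)"
  proof -
    have "card Z = card T" unfolding Z_def by (rule card_image[OF injT])
    also have "\<dots> = (\<Sum>b\<in>{b \<in> ?D. \<kappa> b = q}. card (Bs b))"
      unfolding T_def using fin Bs(1) by (subst card_SigmaI) auto
    also have "\<dots> = (\<Sum>b\<in>{b \<in> ?D. \<kappa> b = q}. N b)" using Bs(2) by (intro sum.cong) auto
    also have "\<dots> = (\<Sum>b\<in>?D. if \<kappa> b = q then N b else 0)" using fin by (simp add: sum.inter_filter)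
    finally show ?thesis .
  qed
  ultimately show ?thesis
    unfolding hodge_dim_def fixed_dim_def df_wedge_eq[OF g] g V_def by simp
qed

end

section \<open>Characters and the double dual\<close>

text \<open>Homomorphisms to \<open>\<rat>/\<int>\<close>, represented by rational-valued functions.\<close>

definition hom_mod_1 :: "(rat ^ 'n) set \<Rightarrow> (rat ^ 'n::finite \<Rightarrow> rat) \<Rightarrow> bool" where
  "hom_mod_1 H f \<longleftrightarrow> 0 \<in> H \<and> (\<forall>x\<in>H. \<forall>y\<in>H. x - y \<in> H \<and> f (x - y) - (f x - f y) \<in> \<int>)"

lemma hom_mod_1_diff: "hom_mod_1 H f \<Longrightarrow> x \<in> H \<Longrightarrow> y \<in> H \<Longrightarrow> x - y \<in> H \<and> f (x - y) - (f x - f y) \<in> \<int>"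
  by (simp add: hom_mod_1_def)

lemma hom_mod_1_add:
  assumes "hom_mod_1 H f" "x \<in> H" "y \<in> H"
  shows "x + y \<in> H \<and> f (x + y) - (f x + f y) \<in> \<int>"
proof -
  have 0: "0 \<in> H" using assms(1) by (simp add: hom_mod_1_def)
  have z: "f 0 \<in> \<int>" using hom_mod_1_diff[OF assms(1) 0 0] by simp
  have n: "- y \<in> H" "f (- y) - (f 0 - f y) \<in> \<int>" using hom_mod_1_diff[OF assms(1) 0 assms(3)] by simp_all
  have s: "x + y \<in> H" "f (x + y) - (f x - f (- y)) \<in> \<int>"
    using hom_mod_1_diff[OF assms(1,2) n(1)] by simp_all
  have "f (x + y) - (f x + f y) = (f (x + y) - (f x - f (- y))) - (f (- y) - (f 0 - f y)) - f 0"
    by simp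
  also have "\<dots> \<in> \<int>" by (rule Ints_diff[OF Ints_diff[OF s(2) n(2)] z])
  finally show ?thesis using s by simp
qed

lemma hom_mod_1_mult_nat:
  assumes "hom_mod_1 H f" "x \<in> H"
  shows "of_nat k *s x \<in> H \<and> f (of_nat k *s x) - of_nat k * f x \<in> \<int>"
proof (induction k)
  case 0
  have "0 \<in> H" using assms(1) by (simp add: hom_mod_1_def)
  thus ?case using hom_mod_1_diff[OF assms(1) \<open>0 \<in> H\<close> \<open>0 \<in> H\<close>] by simp
next
  case (Suc k)
  have eq: "of_nat (Suc k) *s x = of_nat k *s x + x" by (simp add: vec_eq_iff algebra_simps)
  have s: "of_nat k *s x + x \<in> H \<and> f (of_nat k *s x + x) - (f (of_nat k *s x) + f x) \<in> \<int>"
    by (rule hom_mod_1_add[OF assms(1) _ assms(2)]) (use Suc in blast)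
  have "f (of_nat k *s x + x) - of_nat (Suc k) * f x =
      (f (of_nat k *s x + x) - (f (of_nat k *s x) + f x)) + (f (of_nat k *s x) - of_nat k * f x)"
    by (simp add: algebra_simps)
  also have "\<dots> \<in> \<int>" by (rule Ints_add[OF conjunct2[OF s] conjunct2[OF Suc]])
  finally show ?case unfolding eq using s by simp
qed

lemma hom_mod_1_mult:
  assumes "hom_mod_1 H f" "x \<in> H"
  shows "of_int k *s x \<in> H \<and> f (of_int k *s x) - of_int k * f x \<in> \<int>"
proof (cases "k \<ge> 0")
  case True
  then obtain n where "k = int n" by (metis nonneg_int_cases)
  thus ?thesis using hom_mod_1_mult_nat[OF assms, of n] by simp
next
  case False
  then obtain n where k: "k = - int n" by (metis int_cases2 nle_le of_nat_0_le_iff)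
  have 0: "0 \<in> H" using assms(1) by (simp add: hom_mod_1_def)
  note m = hom_mod_1_mult_nat[OF assms, of n]
  have z: "f 0 \<in> \<int>" using hom_mod_1_diff[OF assms(1) 0 0] by simp
  have d: "- (of_nat n *s x) \<in> H" "f (- (of_nat n *s x)) - (f 0 - f (of_nat n *s x)) \<in> \<int>"
    using hom_mod_1_diff[OF assms(1) 0 conjunct1[OF m]] by simp_all
  have eq: "of_int k *s x = - (of_nat n *s x)" by (simp add: k vec_eq_iff)
  have "f (- (of_nat n *s x)) - of_int k * f x =
      (f (- (of_nat n *s x)) - (f 0 - f (of_nat n *s x))) - (f (of_nat n *s x) - of_nat n * f x) + f 0"
    by (simp add: k)
  also have "\<dots> \<in> \<int>" by (rule Ints_add[OF Ints_diff[OF d(2) conjunct2[OF m]] z])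
  finally show ?thesis unfolding eq using d by simp
qed

text \<open>Here \<open>k\<close> is the order of \<open>v\<close> modulo \<open>H\<close>, so the
  only condition on the new value \<open>t\<close> is its compatibility with the given value at
  \<open>k\<close> times \<open>v\<close>.\<close>

lemma hom_mod_1_extend:
  assumes H: "hom_mod_1 H f" and k: "k > 0" "of_nat k *s v \<in> H"
    and min: "\<And>l. 0 < l \<Longrightarrow> l < k \<Longrightarrow> of_nat l *s v \<notin> H"
    and t: "of_nat k * t - f (of_nat k *s v) \<in> \<int>"
  shows "\<exists>H' f'. hom_mod_1 H' f' \<and> H \<subseteq> H' \<and> v \<in> H' \<and> f' v - t \<in> \<int> \<and> (\<forall>x\<in>H. f' x - f x \<in> \<int>)"
proof -
  have 0: "0 \<in> H" using H by (simp add: hom_mod_1_def)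
  define H' where "H' = {h + of_int m *s v | h m. h \<in> H}"
  define P where "P y = (SOME p. fst p \<in> H \<and> y = fst p + of_int (snd p) *s v)" for y
  define f' where "f' y = f (fst (P y)) + of_int (snd (P y)) * t" for y
  have P: "fst (P y) \<in> H \<and> y = fst (P y) + of_int (snd (P y)) *s v" if "y \<in> H'" for y
    unfolding P_def by (rule someI_ex) (use that in \<open>auto simp: H'_def\<close>)
  \<comment> \<open>Two decompositions of one element differ by a multiple of \<open>k\<close> times
    \<open>v\<close>, because \<open>k\<close> is minimal; so the chosen one does not matter modulo
    integers.\<close>
  have wd: "(f h + of_int m * t) - (f h' + of_int m' * t) \<in> \<int>"
    if h: "h \<in> H" "h' \<in> H" and eq: "h + of_int m *s v = h' + of_int m' *s v" for h h' m m'
  proof -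
    define r where "r = nat ((m - m') mod int k)"
    define q where "q = (m - m') div int k"
    have mm: "m - m' = int k * q + int r" using k by (simp add: r_def q_def)
    have "of_int (m - m') *s v = h' - h" using eq by (simp add: vec_eq_iff algebra_simps)
    hence mv: "of_int (m - m') *s v \<in> H" using hom_mod_1_diff[OF H h(2,1)] by simp
    have "of_nat r *s v = of_int (m - m') *s v - of_int q *s (of_nat k *s v)"
      unfolding mm by (simp add: vec_eq_iff algebra_simps)
    hence "of_nat r *s v \<in> H" using hom_mod_1_diff[OF H mv conjunct1[OF hom_mod_1_mult[OF H k(2), of q]]] by simp
    moreover have "r < k" using k by (simp add: r_def nat_less_iff)
    ultimately have "r = 0" using min by blast
    hence m: "m - m' = int k * q" using mm by simp
    have eq': "h' - h = of_int q *s (of_nat k *s v)"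
      using eq m by (simp add: vec_eq_iff algebra_simps)
    have a: "f (h' - h) - (f h' - f h) \<in> \<int>" using hom_mod_1_diff[OF H h(2,1)] by blast
    have b: "f (h' - h) - of_int q * f (of_nat k *s v) \<in> \<int>"
      unfolding eq' using hom_mod_1_mult[OF H k(2), of q] by blast
    have c: "of_int q * (of_nat k * t - f (of_nat k *s v)) \<in> \<int>" using t by (intro Ints_mult) auto
    have mt: "of_int m * t - of_int m' * t = of_int q * (of_nat k * t)"
      by (simp add: left_diff_distrib[symmetric] m flip: of_int_diff)
    have "(f h + of_int m * t) - (f h' + of_int m' * t) =
        (f (h' - h) - (f h' - f h)) - (f (h' - h) - of_int q * f (of_nat k *s v)) +
        of_int q * (of_nat k * t - f (of_nat k *s v))"
      using mt by (simp add: right_diff_distrib)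
    also have "\<dots> \<in> \<int>" by (rule Ints_add[OF Ints_diff[OF a b] c])
    finally show ?thesis .
  qed
  have f': "f' (h + of_int m *s v) - (f h + of_int m * t) \<in> \<int>" if "h \<in> H" for h m
  proof -
    have "h + of_int m *s v \<in> H'" using that by (auto simp: H'_def)
    from P[OF this] show ?thesis unfolding f'_def using wd[of "fst (P (h + of_int m *s v))" h] that by metis
  qed
  have "hom_mod_1 H' f'"
    unfolding hom_mod_1_def
  proof (intro conjI ballI)
    show "0 \<in> H'" unfolding H'_def using 0 by (intro CollectI exI[of _ 0]) simp
    fix x y assume "x \<in> H'" "y \<in> H'"
    then obtain h m h' m' where x: "x = h + of_int m *s v" "h \<in> H" and y: "y = h' + of_int m' *s v" "h' \<in> H"
      unfolding H'_def by blast
    have eq: "x - y = (h - h') + of_int (m - m') *s v" unfolding x y by (simp add: vec_eq_iff algebra_simps)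
    have d: "h - h' \<in> H" "f (h - h') - (f h - f h') \<in> \<int>" using hom_mod_1_diff[OF H x(2) y(2)] by simp_all
    have fx: "f' x - (f h + of_int m * t) \<in> \<int>" "f' y - (f h' + of_int m' * t) \<in> \<int>"
      unfolding x(1) y(1) using f' x(2) y(2) by simp_all
    have fd: "f' (x - y) - (f (h - h') + of_int (m - m') * t) \<in> \<int>" unfolding eq by (rule f'[OF d(1)])
    show "x - y \<in> H'" unfolding eq H'_def using d by blast
    have "f' (x - y) - (f' x - f' y) =
        (f' (x - y) - (f (h - h') + of_int (m - m') * t)) - (f' x - (f h + of_int m * t)) +
        (f' y - (f h' + of_int m' * t)) + (f (h - h') - (f h - f h'))"
      by (simp add: algebra_simps)
    also have "\<dots> \<in> \<int>" by (rule Ints_add[OF Ints_add[OF Ints_diff[OF fd fx(1)] fx(2)] d(2)])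
    finally show "f' (x - y) - (f' x - f' y) \<in> \<int>" .
  qed
  moreover have "H \<subseteq> H'"
  proof
    fix h assume "h \<in> H"
    thus "h \<in> H'" unfolding H'_def by (intro CollectI exI[of _ h] exI[of _ 0]) simp
  qed
  moreover have "v \<in> H'" unfolding H'_def using 0 by (intro CollectI exI[of _ 0] exI[of _ 1]) simp
  moreover have "f' v - t \<in> \<int>"
  proof -
    have "f 0 \<in> \<int>" using hom_mod_1_diff[OF H 0 0] by simp
    moreover have "f' v - (f 0 + t) \<in> \<int>" using f'[OF 0, of 1] by simp
    ultimately have "(f' v - (f 0 + t)) + f 0 \<in> \<int>" by (rule Ints_add[rotated])
    thus ?thesis by simp
  qed
  moreover have "\<forall>x\<in>H. f' x - f x \<in> \<int>" using f'[of _ 0] by simp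
  ultimately show ?thesis by blast
qed

lemma common_denominator:
  fixes v :: "rat ^ 'n::finite"
  shows "\<exists>d>0. \<forall>j. of_nat d * v $ j \<in> \<int>"
proof -
  have "\<exists>d>0. \<forall>j\<in>S. of_nat d * v $ j \<in> \<int>" if "finite S" for S
    using that
  proof (induction S)
    case (insert i S)
    then obtain d where d: "d > 0" "\<forall>j\<in>S. of_nat d * v $ j \<in> \<int>" by blast
    obtain p q where pq: "v $ i = Fract p q" "q > 0" by (cases "v $ i") blast
    have "of_nat (nat q) * v $ i = of_int p" using pq by (simp add: Fract_of_int_quotient)
    hence i: "of_nat (nat q) * v $ i \<in> \<int>" by simp
    have "of_nat (d * nat q) * v $ j \<in> \<int>" if "j \<in> insert i S" for j
    proof (cases "j = i")
      case True
      have "of_nat d * (of_nat (nat q) * v $ i) \<in> \<int>" by (rule Ints_mult[OF Ints_of_nat i])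
      thus ?thesis unfolding True of_nat_mult by (simp only: mult.assoc)
    next
      case False
      hence "of_nat d * v $ j \<in> \<int>" using d that by blast
      hence "of_nat (nat q) * (of_nat d * v $ j) \<in> \<int>" by (rule Ints_mult[OF Ints_of_nat])
      thus ?thesis unfolding of_nat_mult by (simp only: mult_ac)
    qed
    thus ?case using d pq by (intro exI[of _ "d * nat q"]) auto
  qed (auto intro: exI[of _ 1])
  from this[of UNIV] show ?thesis by simp
qed

text \<open>The rationals modulo integers form a divisible group, so a character extends by one
  element at a time. It is 0 on \<open>L\<close> and takes the value 1/k at \<beta>, with k the
  order of \<beta> modulo \<open>L\<close>. Adjoining just the finitely many \<open>w i\<close>
  avoids a maximality argument.\<close>

lemma separating_character:
  fixes L :: "(rat ^ 'n::finite) set" and w :: "'k \<Rightarrow> rat ^ 'n"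
  assumes L: "0 \<in> L" "\<And>x y. x \<in> L \<Longrightarrow> y \<in> L \<Longrightarrow> x - y \<in> L"
    and Z: "\<And>x. (\<forall>j. x $ j \<in> \<int>) \<Longrightarrow> x \<in> L" and \<beta>: "\<beta> \<notin> L" and S: "finite S"
  shows "\<exists>H f. hom_mod_1 H f \<and> L \<subseteq> H \<and> \<beta> \<in> H \<and> (\<forall>x\<in>L. f x \<in> \<int>) \<and> f \<beta> \<notin> \<int> \<and> (\<forall>i\<in>S. w i \<in> H)"
proof -
  \<comment> \<open>\<open>L\<close> contains the integer vectors, so every rational vector has
    finite order modulo each larger group.\<close>
  have tors: "\<exists>k>0. of_nat k *s v \<in> H \<and> (\<forall>l. 0 < l \<longrightarrow> l < k \<longrightarrow> of_nat l *s v \<notin> H)" if "L \<subseteq> H" for v H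
  proof -
    obtain d where "d > 0" "\<forall>j. of_nat d * v $ j \<in> \<int>" using common_denominator by blast
    hence ex: "0 < d \<and> of_nat d *s v \<in> H" using Z[of "of_nat d *s v"] that by auto
    let ?k = "LEAST k. 0 < k \<and> of_nat k *s v \<in> H"
    have "0 < ?k \<and> of_nat ?k *s v \<in> H" using ex by (rule LeastI)
    moreover have "of_nat l *s v \<notin> H" if "0 < l" "l < ?k" for l using not_less_Least[OF that(2)] that by blast
    ultimately show ?thesis by blast
  qed
  show ?thesis using S
  proof (induction S)
    case empty
    have zero: "hom_mod_1 L (\<lambda>_. 0)" using L by (simp add: hom_mod_1_def)
    obtain k where k: "k > 0" "of_nat k *s \<beta> \<in> L" "\<And>l. 0 < l \<Longrightarrow> l < k \<Longrightarrow> of_nat l *s \<beta> \<notin> L"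
      using tors[of L \<beta>] by blast
    have "k \<noteq> 1"
    proof
      assume "k = 1"
      hence "\<beta> \<in> L" using k(2) by simp
      thus False using \<beta> by blast
    qed
    hence k2: "k > 1" using k(1) by simp
    obtain H f where H: "hom_mod_1 H f" "L \<subseteq> H" "\<beta> \<in> H" "f \<beta> - 1 / of_nat k \<in> \<int>" "\<forall>x\<in>L. f x - 0 \<in> \<int>"
      using hom_mod_1_extend[OF zero k, of "1 / of_nat k"] k(1) by auto
    have "f \<beta> \<notin> \<int>"
    proof
      assume "f \<beta> \<in> \<int>"
      hence "f \<beta> - (f \<beta> - 1 / of_nat k) \<in> \<int>" using H(4) by (rule Ints_diff)
      hence "1 / of_nat k \<in> (\<int> :: rat set)" by simp
      then obtain z where z: "1 / of_nat k = (of_int z :: rat)" by (rule Ints_cases)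
      moreover have "0 < 1 / (of_nat k :: rat)" "1 / (of_nat k :: rat) < 1" using k2 by simp_all
      ultimately show False unfolding z by simp
    qed
    thus ?case using H by (intro exI[of _ H] exI[of _ f]) auto
  next
    case (insert i S)
    then obtain H f where H: "hom_mod_1 H f" "L \<subseteq> H" "\<beta> \<in> H" "\<forall>x\<in>L. f x \<in> \<int>" "f \<beta> \<notin> \<int>" "\<forall>i\<in>S. w i \<in> H"
      by blast
    obtain k where k: "k > 0" "of_nat k *s w i \<in> H" "\<And>l. 0 < l \<Longrightarrow> l < k \<Longrightarrow> of_nat l *s w i \<notin> H"
      using tors[OF H(2), of "w i"] by blast
    obtain H' f' where H': "hom_mod_1 H' f'" "H \<subseteq> H'" "w i \<in> H'" "\<forall>x\<in>H. f' x - f x \<in> \<int>"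
      using hom_mod_1_extend[OF H(1) k, of "f (of_nat k *s w i) / of_nat k"] k(1) by auto
    have "f' x \<in> \<int> \<longleftrightarrow> f x \<in> \<int>" if "x \<in> H" for x
    proof -
      have "f' x - f x \<in> \<int>" using H'(4) that by blast
      thus ?thesis using Ints_add[of "f' x - f x" "f x"] Ints_diff[of "f' x" "f' x - f x"] by auto
    qed
    hence "\<forall>x\<in>L. f' x \<in> \<int>" "f' \<beta> \<notin> \<int>" using H by auto
    thus ?case using H H' by (intro exI[of _ H'] exI[of _ f']) auto
  qed
qed

lemma hom_mod_1_sum:
  assumes "hom_mod_1 H f" "finite S" "\<And>i. i \<in> S \<Longrightarrow> w i \<in> H"
  shows "(\<Sum>i\<in>S. of_int (n i) *s w i) \<in> H \<and> f (\<Sum>i\<in>S. of_int (n i) *s w i) - (\<Sum>i\<in>S. of_int (n i) * f (w i)) \<in> \<int>"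
  using assms(2,3)
proof (induction S)
  case empty
  have "0 \<in> H" using assms(1) by (simp add: hom_mod_1_def)
  thus ?case using hom_mod_1_diff[OF assms(1) \<open>0 \<in> H\<close> \<open>0 \<in> H\<close>] by simp
next
  case (insert i S)
  let ?s = "\<Sum>i\<in>S. of_int (n i) *s w i"
  have IH: "?s \<in> H" "f ?s - (\<Sum>i\<in>S. of_int (n i) * f (w i)) \<in> \<int>" using insert by auto
  have m: "of_int (n i) *s w i \<in> H" "f (of_int (n i) *s w i) - of_int (n i) * f (w i) \<in> \<int>"
    using hom_mod_1_mult[OF assms(1), of "w i" "n i"] insert.prems by auto
  note a = hom_mod_1_add[OF assms(1) m(1) IH(1)]
  have "f (of_int (n i) *s w i + ?s) - (of_int (n i) * f (w i) + (\<Sum>i\<in>S. of_int (n i) * f (w i))) =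
      (f (of_int (n i) *s w i + ?s) - (f (of_int (n i) *s w i) + f ?s)) +
      (f (of_int (n i) *s w i) - of_int (n i) * f (w i)) + (f ?s - (\<Sum>i\<in>S. of_int (n i) * f (w i)))"
    by simp
  also have "\<dots> \<in> \<int>" by (rule Ints_add[OF Ints_add[OF conjunct2[OF a] m(2)] IH(2)])
  finally show ?case using a insert.hyps by simp
qed

section \<open>The dual group in terms of phases\<close>

context invertible_poly_data
begin

lemma transposed_data: "invertible_poly_data (transpose E) a"
proof -
  interpret T: invertible_matrix "transpose E" by (rule transposed)
  show ?thesis using coeff by unfold_locales
qed

interpretation T: invertible_poly_data "transpose E" a by (rule transposed_data)

lemma row_pairing_transpose: "T.row_pairing b j = pull (entry E) UNIV b j"
  unfolding T.pull_transpose_row[symmetric] entry_transpose ..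

lemma pairing_swap: "(\<Sum>j\<in>UNIV. \<alpha> j * T.row_pairing b j) = (\<Sum>i\<in>UNIV. b i * row_pairing \<alpha> i)"
  unfolding row_pairing_def T.row_pairing_def sum_distrib_left
  by (subst sum.swap) (simp add: transpose_def mult_ac)

lemma dual_phases_iff:
  "b \<in> dual_phases G \<longleftrightarrow> unit_range b \<and> diag_of b \<in> dual_group E a G"
proof (cases "unit_range b")
  case True
  have "(\<Sum>i\<in>UNIV. \<Sum>j\<in>UNIV. phase (diag_of b $ i) * of_nat (E $ i $ j) * phase (g $ j)) =
      (\<Sum>i\<in>UNIV. b i * row_pairing (phases g) i)" for g
    by (simp add: phase_diag_of[OF True] row_pairing_def phases_def sum_distrib_left mult.assoc)
  thus ?thesis
    using True by (simp add: dual_phases_def dual_group_def T.diag_of_in_Gf row_pairing_transpose)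
qed (simp add: dual_phases_def)

lemma dual_group_subset: "dual_group E a G \<subseteq> T.Gf"
  by (auto simp: dual_group_def)

lemma finite_unit_range:
  assumes "finite H"
  shows "finite {\<alpha>. unit_range \<alpha> \<and> diag_of \<alpha> \<in> H}"
proof (rule finite_imageD)
  show "finite (diag_of ` {\<alpha>. unit_range \<alpha> \<and> diag_of \<alpha> \<in> H})"
    by (rule finite_subset[OF _ assms]) auto
  show "inj_on diag_of {\<alpha>. unit_range \<alpha> \<and> diag_of \<alpha> \<in> H}"
    by (rule inj_on_subset[OF inj_diag_of]) auto
qed

lemma finite_dual_phases: "finite (dual_phases G)"
proof -
  have "dual_phases G = {b. unit_range b \<and> diag_of b \<in> dual_group E a G}"
    using dual_phases_iff by blast
  thus ?thesis using finite_unit_range[OF finite_subset[OF dual_group_subset T.finite_Gf]] by simp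
qed

text \<open>The inverse of a diagonal symmetry has the negated phases, so closure of
  \<open>G\<close> becomes closure of its phase vectors under differences.\<close>

lemma subgroup_diff:
  assumes G: "subgroup G (diag_symmetries (mpoly_of E a))"
    and xy: "diag_of x \<in> G" "diag_of y \<in> G"
  shows "diag_of (\<lambda>j. x j - y j) \<in> G"
proof -
  let ?S = "diag_symmetries (mpoly_of E a)"
  have sub: "G \<subseteq> Gf" using G by (rule subgroup.subset)
  have inv: "diag_of (\<lambda>j. - y j) * diag_of y = 1" "diag_of y * diag_of (\<lambda>j. - y j) = 1"
    by (simp_all add: vec_eq_iff diag_of_def of_rat_minus cis_mult)
  have "row_pairing (\<lambda>j. - y j) i = - row_pairing y i" for i
    by (simp add: row_pairing_def sum_negf)
  hence car: "diag_of (\<lambda>j. - y j) \<in> Gf"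
    using xy(2) sub diag_of_in_Gf[of y] by (auto simp: diag_of_in_Gf)
  have "inv\<^bsub>?S\<^esub> (diag_of y) = diag_of (\<lambda>j. - y j)"
    unfolding m_inv_def
  proof (rule the_equality)
    show "diag_of (\<lambda>j. - y j) \<in> Gf \<and> diag_of y \<otimes>\<^bsub>?S\<^esub> diag_of (\<lambda>j. - y j) = \<one>\<^bsub>?S\<^esub> \<and>
        diag_of (\<lambda>j. - y j) \<otimes>\<^bsub>?S\<^esub> diag_of y = \<one>\<^bsub>?S\<^esub>"
      using car inv by (simp add: diag_symmetries_def)
  next
    fix z assume "z \<in> Gf \<and> diag_of y \<otimes>\<^bsub>?S\<^esub> z = \<one>\<^bsub>?S\<^esub> \<and> z \<otimes>\<^bsub>?S\<^esub> diag_of y = \<one>\<^bsub>?S\<^esub>"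
    hence "z * diag_of y = 1" by (simp add: diag_symmetries_def)
    hence "z * (diag_of y * diag_of (\<lambda>j. - y j)) = diag_of (\<lambda>j. - y j)"
      by (simp add: mult.assoc[symmetric])
    thus "z = diag_of (\<lambda>j. - y j)" unfolding inv by simp
  qed
  hence "diag_of (\<lambda>j. - y j) \<in> G" using subgroup.m_inv_closed[OF G xy(2)] by simp
  hence "diag_of x \<otimes>\<^bsub>?S\<^esub> diag_of (\<lambda>j. - y j) \<in> G" by (rule subgroup.m_closed[OF G xy(1)])
  moreover have "diag_of x * diag_of (\<lambda>j. - y j) = diag_of (\<lambda>j. x j - y j)"
    by (simp add: vec_eq_iff diag_of_def of_rat_minus of_rat_diff cis_mult right_diff_distrib)
  ultimately show ?thesis by (simp add: diag_symmetries_def)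
qed

text \<open>The dual of the dual group is \<open>G\<close>: a diagonal symmetry outside \<open>G\<close> is separated from \<open>G\<close> by a
  character, whose values on the columns of the inverse of \<open>E\<close> form an element of the dual group.\<close>

lemma double_dual:
  assumes G: "subgroup G (diag_symmetries (mpoly_of E a))"
  shows "T.dual_phases (dual_group E a G) = {\<alpha>. unit_range \<alpha> \<and> diag_of \<alpha> \<in> G}"
proof (intro equalityI subsetI)
  fix \<alpha> assume "\<alpha> \<in> {\<alpha>. unit_range \<alpha> \<and> diag_of \<alpha> \<in> G}"
  hence \<alpha>: "unit_range \<alpha>" "diag_of \<alpha> \<in> G" by auto
  have "diag_of \<alpha> \<in> Gf" using \<alpha>(2) subgroup.subset[OF G] by blast
  hence "pull (entry (transpose E)) UNIV \<alpha> i \<in> \<int>" for i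
    by (simp add: entry_transpose pull_transpose_row diag_of_in_Gf)
  moreover have "(\<Sum>j\<in>UNIV. \<alpha> j * T.row_pairing (phases h) j) \<in> \<int>" if h: "h \<in> dual_group E a G" for h
  proof -
    have "h \<in> T.Gf" using h dual_group_subset by blast
    then obtain b where b: "unit_range b" "h = diag_of b" by (rule T.Gf_cases) blast
    have "b \<in> dual_phases G" using dual_phases_iff b h by blast
    hence "(\<Sum>i\<in>UNIV. b i * row_pairing (phases (diag_of \<alpha>)) i) \<in> \<int>" using \<alpha>(2) by (simp add: dual_phases_def)
    thus ?thesis unfolding pairing_swap b(2) phases_diag_of[OF b(1)] phases_diag_of[OF \<alpha>(1)] .
  qed
  ultimately show "\<alpha> \<in> T.dual_phases (dual_group E a G)" using \<alpha>(1) by (simp add: T.dual_phases_def)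
next
  fix \<beta> assume \<beta>: "\<beta> \<in> T.dual_phases (dual_group E a G)"
  have ub: "unit_range \<beta>" using \<beta> by (simp add: T.dual_phases_def)
  have \<beta>int: "row_pairing \<beta> i \<in> \<int>" for i
    using \<beta> by (simp add: T.dual_phases_def entry_transpose pull_transpose_row)
  show "\<beta> \<in> {\<alpha>. unit_range \<alpha> \<and> diag_of \<alpha> \<in> G}"
  proof (rule ccontr)
    assume "\<beta> \<notin> {\<alpha>. unit_range \<alpha> \<and> diag_of \<alpha> \<in> G}"
    hence notin: "diag_of \<beta> \<notin> G" using ub by blast
    \<comment> \<open>All phase vectors of elements of \<open>G\<close>, a lattice that contains the
      integer vectors.\<close>
    define L where "L = {x. diag_of (($) x) \<in> G}"
    \<comment> \<open>The columns of the inverse matrix generate the lattice of phase vectors of all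
      diagonal symmetries, so a character of that lattice is given by its values on them.\<close>
    define w where "w i = (\<chi> j. B $ j $ i)" for i
    have one: "diag_of (\<lambda>_. 0) \<in> G"
      using subgroup.one_closed[OF G] by (simp add: diag_of_def diag_symmetries_def one_vec_def)
    have Z: "diag_of (($) x) \<in> G" if "\<forall>j. x $ j \<in> \<int>" for x
    proof -
      have "diag_of (($) x) = diag_of (\<lambda>_. 0)" using that by (simp add: diag_of_eq_iff)
      thus ?thesis using one by simp
    qed
    have "0 \<in> L" using Z[of 0] by (simp add: L_def)
    moreover have "x - y \<in> L" if "x \<in> L" "y \<in> L" for x y
    proof -
      have "($) (x - y) = (\<lambda>j. x $ j - y $ j)" by auto
      thus ?thesis using subgroup_diff[OF G] that by (simp add: L_def)
    qed
    moreover have "(\<chi> j. \<beta> j) \<notin> L"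
    proof -
      have "($) (\<chi> j. \<beta> j) = \<beta>" by auto
      thus ?thesis using notin by (simp add: L_def)
    qed
    ultimately obtain H f where H: "hom_mod_1 H f" "L \<subseteq> H" "(\<chi> j. \<beta> j) \<in> H" "\<forall>x\<in>L. f x \<in> \<int>"
        "f (\<chi> j. \<beta> j) \<notin> \<int>" "\<forall>i\<in>UNIV. w i \<in> H"
      using separating_character[of L "\<chi> j. \<beta> j" UNIV w] Z by (auto simp: L_def)
    define b where "b i = frac (f (w i))" for i
    have f: "f (\<chi> j. x j) - (\<Sum>i\<in>UNIV. b i * row_pairing x i) \<in> \<int>"
      if x: "\<And>i. row_pairing x i \<in> \<int>" for x
    proof -
      obtain n where n: "\<And>i. row_pairing x i = of_int (n i)" using x unfolding Ints_def image_iff by metis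
      have "(\<chi> j. x j) = (\<Sum>i\<in>UNIV. of_int (n i) *s w i)"
        using row_pairing_expand[of x] by (simp add: vec_eq_iff w_def n mult.commute)
      hence 1: "f (\<chi> j. x j) - (\<Sum>i\<in>UNIV. of_int (n i) * f (w i)) \<in> \<int>"
        using hom_mod_1_sum[OF H(1), of UNIV w n] H(6) by simp
      have "(\<Sum>i\<in>UNIV. of_int (n i) * f (w i)) - (\<Sum>i\<in>UNIV. b i * row_pairing x i) =
          (\<Sum>i\<in>UNIV. of_int (n i * \<lfloor>f (w i)\<rfloor>))"
        unfolding sum_subtractf[symmetric] b_def frac_def n by (intro sum.cong) (simp_all add: algebra_simps)
      also have "\<dots> \<in> \<int>" by (intro Ints_sum) simp
      finally have "(\<Sum>i\<in>UNIV. of_int (n i) * f (w i)) - (\<Sum>i\<in>UNIV. b i * row_pairing x i) \<in> \<int>" .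
      from Ints_add[OF 1 this] show ?thesis by (simp only: diff_add_cancel diff_add_eq add_diff_eq)
    qed
    have fL: "(\<Sum>i\<in>UNIV. b i * row_pairing x i) \<in> \<int>"
      if x: "\<And>i. row_pairing x i \<in> \<int>" "diag_of x \<in> G" for x
    proof -
      have "($) (\<chi> j. x j) = x" by auto
      hence "(\<chi> j. x j) \<in> L" using x(2) by (simp add: L_def)
      hence "f (\<chi> j. x j) \<in> \<int>" using H(4) by blast
      from Ints_diff[OF this f[OF x(1)]] show ?thesis by simp
    qed
    \<comment> \<open>Unit vectors represent the identity of \<open>G\<close>, and triviality of the
      character on them is the integrality that makes \<open>b\<close> a symmetry of the
      transpose.\<close>
    have "pull (entry E) UNIV b j \<in> \<int>" for j
    proof -
      let ?e = "\<lambda>k. of_bool (k = j) :: rat"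
      have e: "row_pairing ?e i = of_nat (E $ i $ j)" for i by (simp add: row_pairing_def)
      have "diag_of ?e = diag_of (\<lambda>_. 0)" by (simp add: diag_of_eq_iff)
      hence "(\<Sum>i\<in>UNIV. b i * row_pairing ?e i) \<in> \<int>" using one by (intro fL) (simp_all add: e)
      thus ?thesis by (simp add: e pull_def entry_def mult.commute)
    qed
    moreover have "(\<Sum>i\<in>UNIV. b i * row_pairing (phases g) i) \<in> \<int>" if "g \<in> G" for g
    proof -
      have "g \<in> Gf" using that subgroup.subset[OF G] by blast
      then obtain x where x: "unit_range x" "g = diag_of x" "\<And>i. row_pairing x i \<in> \<int>" by (rule Gf_cases) blast
      show ?thesis unfolding x(2) phases_diag_of[OF x(1)] using x that by (intro fL) auto
    qed
    moreover have ubb: "unit_range b" unfolding b_def by (rule unit_range_frac)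
    ultimately have "b \<in> dual_phases G" by (simp add: dual_phases_def)
    hence "diag_of b \<in> dual_group E a G" by (simp add: dual_phases_iff)
    hence "(\<Sum>j\<in>UNIV. \<beta> j * T.row_pairing (phases (diag_of b)) j) \<in> \<int>" using \<beta> by (simp add: T.dual_phases_def)
    hence "(\<Sum>i\<in>UNIV. b i * row_pairing \<beta> i) \<in> \<int>" unfolding phases_diag_of[OF ubb] pairing_swap .
    from Ints_add[OF f[OF \<beta>int] this] have "f (\<chi> j. \<beta> j) \<in> \<int>" by simp
    thus False using H(5) by blast
  qed
qed

end

section \<open>Comparison of the E-functions\<close>

lemma E_function_sum:
  fixes E :: "nat ^ 'n::{finite,linorder} ^ 'n::{finite,linorder}"
  assumes E: "invertible_poly_data E a"
    and G: "G \<subseteq> carrier (diag_symmetries (mpoly_of E a))"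
    and A: "A = {\<alpha>. unit_range \<alpha> \<and> diag_of \<alpha> \<in> G}" and D: "D = invertible_poly_data.dual_phases E G"
    and sec: "\<And>\<alpha> b. \<alpha> \<in> A \<Longrightarrow> b \<in> D \<Longrightarrow>
      sector_dim (entry E) UNIV UNIV {j. \<alpha> j = 0} (($) a) b (\<kappa> \<alpha> b) (N \<alpha> b)"
  shows "E_function i E a G x y = (\<Sum>\<alpha>\<in>A. \<Sum>b\<in>D.
     if card {j. \<alpha> j = 0} mod 2 = i \<and> x + y + of_nat CARD('n) - 2 * sum \<alpha> UNIV = of_nat (card {j. \<alpha> j = 0}) \<and>
       \<kappa> \<alpha> b = y + of_nat CARD('n) / 2 - sum \<alpha> UNIV then N \<alpha> b else 0)"
proof -
  interpret invertible_poly_data E a by (rule E)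
  let ?n = "of_nat CARD('n) :: rat"
  define A' where "A' = {\<alpha> \<in> A. card {j. \<alpha> j = 0} mod 2 = i}"
  have finA: "finite A" unfolding A by (rule finite_unit_range[OF finite_subset[OF G finite_Gf]])
  have inj: "inj_on diag_of A'"
    by (rule inj_on_subset[OF inj_diag_of]) (auto simp: A'_def A)
  have fd: "fixed_dim (diag_of \<alpha>) = card {j. \<alpha> j = 0}" if "\<alpha> \<in> A" for \<alpha>
    using that by (simp add: A fixed_dim_def fixed_coords_diag_of)
  have GA: "{g \<in> G. fixed_dim g mod 2 = i} = diag_of ` A'"
  proof (intro equalityI subsetI)
    fix g assume g: "g \<in> {g \<in> G. fixed_dim g mod 2 = i}"
    hence "g \<in> Gf" using G by blast
    then obtain \<alpha> where \<alpha>: "unit_range \<alpha>" "g = diag_of \<alpha>" by (rule Gf_cases) blast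
    have "\<alpha> \<in> A" using \<alpha> g by (simp add: A)
    moreover from this have "card {j. \<alpha> j = 0} mod 2 = i" using fd[of \<alpha>] \<alpha> g by simp
    ultimately show "g \<in> diag_of ` A'" using \<alpha>(2) by (auto simp: A'_def)
  next
    fix g assume "g \<in> diag_of ` A'"
    then obtain \<alpha> where "\<alpha> \<in> A" "g = diag_of \<alpha>" "card {j. \<alpha> j = 0} mod 2 = i" by (auto simp: A'_def)
    thus "g \<in> {g \<in> G. fixed_dim g mod 2 = i}" using fd[of \<alpha>] by (simp add: A)
  qed
  have "E_function i E a G x y = (\<Sum>\<alpha>\<in>A'. hodge_dim E a G (diag_of \<alpha>)
      (x + ?n / 2 - sum \<alpha> UNIV) (y + ?n / 2 - sum \<alpha> UNIV))"
    unfolding E_function_def bigraded_dim_def GA sum.reindex[OF inj]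
    by (intro sum.cong) (auto simp: A'_def A age_diag_of)
  also have "\<dots> = (\<Sum>\<alpha>\<in>A'. \<Sum>b\<in>D. if x + y + ?n - 2 * sum \<alpha> UNIV = of_nat (card {j. \<alpha> j = 0}) \<and>
       \<kappa> \<alpha> b = y + ?n / 2 - sum \<alpha> UNIV then N \<alpha> b else 0)"
  proof (rule sum.cong)
    fix \<alpha> assume "\<alpha> \<in> A'"
    hence \<alpha>: "\<alpha> \<in> A" by (simp add: A'_def)
    interpret hodge E a "{j. \<alpha> j = 0}" by unfold_locales
    have fc: "fixed_coords (diag_of \<alpha>) = {j. \<alpha> j = 0}" using \<alpha> by (simp add: A fixed_coords_diag_of)
    have eq: "(x + ?n / 2 - sum \<alpha> UNIV) + (y + ?n / 2 - sum \<alpha> UNIV) = x + y + ?n - 2 * sum \<alpha> UNIV"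
      by simp
    show "hodge_dim E a G (diag_of \<alpha>) (x + ?n / 2 - sum \<alpha> UNIV) (y + ?n / 2 - sum \<alpha> UNIV) =
        (\<Sum>b\<in>D. if x + y + ?n - 2 * sum \<alpha> UNIV = of_nat (card {j. \<alpha> j = 0}) \<and>
          \<kappa> \<alpha> b = y + ?n / 2 - sum \<alpha> UNIV then N \<alpha> b else 0)"
      using hodge_dim_sum[OF fc G finite_dual_phases, of "\<kappa> \<alpha>" "N \<alpha>"
          "x + ?n / 2 - sum \<alpha> UNIV" "y + ?n / 2 - sum \<alpha> UNIV", OF sec[OF \<alpha>, unfolded D]]
      unfolding eq D by simp
  qed simp
  also have "\<dots> = (\<Sum>\<alpha>\<in>A. if card {j. \<alpha> j = 0} mod 2 = i then
      \<Sum>b\<in>D. if x + y + ?n - 2 * sum \<alpha> UNIV = of_nat (card {j. \<alpha> j = 0}) \<and>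
       \<kappa> \<alpha> b = y + ?n / 2 - sum \<alpha> UNIV then N \<alpha> b else 0 else 0)"
    unfolding A'_def using finA by (rule sum.inter_filter)
  also have "\<dots> = (\<Sum>\<alpha>\<in>A. \<Sum>b\<in>D.
     if card {j. \<alpha> j = 0} mod 2 = i \<and> x + y + ?n - 2 * sum \<alpha> UNIV = of_nat (card {j. \<alpha> j = 0}) \<and>
       \<kappa> \<alpha> b = y + ?n / 2 - sum \<alpha> UNIV then N \<alpha> b else 0)"
    by (intro sum.cong) auto
  finally show ?thesis .
qed

text \<open>Within a sector the coordinates are fixed modulo integers, hence so is the degree. This
  decides the parity of the fixed dimensions.\<close>

lemma sector_dim_degree_cong:
  assumes "sector_dim E UNIV C I a b \<kappa> N" "N > 0"
  shows "\<kappa> - sum b UNIV \<in> \<int>"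
proof -
  obtain S where S: "card S = N" "S \<subseteq> states E UNIV C I b" "\<forall>c\<in>S. sum c UNIV = \<kappa>"
    using assms(1) unfolding sector_dim_def by (elim exE conjE)
  obtain c where c: "c \<in> S" using S(1) assms(2) by fastforce
  have "c i - b i \<in> \<int>" for i using S(2) c by (auto simp: states_def coset_def)
  hence "(\<Sum>i\<in>UNIV. c i - b i) \<in> \<int>" by (intro Ints_sum)
  thus ?thesis using S(3) c by (simp add: sum_subtractf)
qed

lemma E_function_duality:
  fixes E :: "nat ^ 'n::{finite,linorder} ^ 'n::{finite,linorder}"
  assumes E: "invertible_poly E a"
    and G: "subgroup G (diag_symmetries (mpoly_of E a))"
    and i: "i < 2" "i' = (if even CARD('n) then i else 1 - i)"
  shows "E_function i E a G x y = E_function i' (transpose E) a (dual_group E a G) (- x) y"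
proof -
  interpret invertible_poly_data E a by (rule invertible_poly_data[OF E])
  interpret T: invertible_poly_data "transpose E" a by (rule invertible_poly_data[OF E])
  let ?n = "of_nat CARD('n) :: rat"
  define A where "A = {\<alpha>. unit_range \<alpha> \<and> diag_of \<alpha> \<in> G}"
  define D where "D = dual_phases G"
  have sub: "G \<subseteq> Gf" by (rule subgroup.subset[OF G])
  have D': "D = {b. unit_range b \<and> diag_of b \<in> dual_group E a G}"
    unfolding D_def using dual_phases_iff by blast
  have A': "A = T.dual_phases (dual_group E a G)"
    unfolding A_def by (rule double_dual[OF G, symmetric])
  define P where "P \<alpha> b N \<kappa> \<kappa>' \<longleftrightarrow>
      sector_dim (entry E) UNIV UNIV {j. \<alpha> j = 0} (($) a) b \<kappa> N \<and>
      sector_dim (entry (transpose E)) UNIV UNIV {i. b i = 0} (($) a) \<alpha> \<kappa>' N \<and>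
      (N > 0 \<longrightarrow> \<kappa> + sum \<alpha> UNIV = \<kappa>' + sum b UNIV \<and>
        of_nat (card {j. \<alpha> j = 0} + card {i. b i = 0}) + sum \<alpha> UNIV + sum b UNIV = ?n + \<kappa> + \<kappa>')"
    for \<alpha> b :: "'n \<Rightarrow> rat" and N \<kappa> \<kappa>'
  have ex: "\<exists>N \<kappa> \<kappa>'. P \<alpha> b N \<kappa> \<kappa>'" if ab: "\<alpha> \<in> A" "b \<in> D" for \<alpha> b
  proof -
    have "diag_of \<alpha> \<in> Gf" using ab(1) sub by (auto simp: A_def)
    hence 1: "\<forall>i\<in>UNIV. pull (tr (entry E)) UNIV \<alpha> i \<in> \<int>" by (simp add: pull_transpose_row diag_of_in_Gf)
    have 2: "\<forall>j\<in>UNIV. pull (entry E) UNIV b j \<in> \<int>" using ab(2) by (simp add: D_def dual_phases_def)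
    have 3: "\<forall>j\<in>UNIV. 0 \<le> \<alpha> j \<and> \<alpha> j < 1" "\<forall>j\<in>UNIV. 0 \<le> b j \<and> b j < 1"
      using ab by (auto simp: A_def D' unit_range_def)
    obtain N \<kappa> \<kappa>' where
      s: "sector_dim (entry E) UNIV UNIV {j\<in>UNIV. \<alpha> j = 0} (\<lambda>_. 1) b \<kappa> N"
         "sector_dim (tr (entry E)) UNIV UNIV {i\<in>UNIV. b i = 0} (\<lambda>_. 1) \<alpha> \<kappa>' N"
      and N: "N > 0 \<longrightarrow> \<kappa> + sum \<alpha> UNIV = \<kappa>' + sum b UNIV \<and>
        of_nat (card {j\<in>UNIV. \<alpha> j = 0} + card {i\<in>UNIV. b i = 0}) + sum \<alpha> UNIV + sum b UNIV = ?n + \<kappa> + \<kappa>'"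
      using invertible_poly_sector_duality[OF E, unfolded sector_duality_def, rule_format (no_asm), OF 3 1 2]
      by (elim exE conjE)
    have "\<forall>i\<in>UNIV. a $ i \<noteq> 0" using coeff by blast
    from sector_dim_rescale[OF finite this s(1)] sector_dim_rescale[OF finite this s(2)]
    have "P \<alpha> b N \<kappa> \<kappa>'" using N by (simp add: P_def entry_transpose)
    thus ?thesis by blast
  qed
  then obtain N \<kappa> \<kappa>' where P: "\<And>\<alpha> b. \<alpha> \<in> A \<Longrightarrow> b \<in> D \<Longrightarrow> P \<alpha> b (N \<alpha> b) (\<kappa> \<alpha> b) (\<kappa>' \<alpha> b)" by metis
  have "E_function i E a G x y = (\<Sum>\<alpha>\<in>A. \<Sum>b\<in>D.
     if card {j. \<alpha> j = 0} mod 2 = i \<and> x + y + ?n - 2 * sum \<alpha> UNIV = of_nat (card {j. \<alpha> j = 0}) \<and>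
       \<kappa> \<alpha> b = y + ?n / 2 - sum \<alpha> UNIV then N \<alpha> b else 0)"
    by (rule E_function_sum[OF invertible_poly_data(1)[OF E] sub A_def D_def]) (use P in \<open>simp add: P_def\<close>)
  also have "\<dots> = (\<Sum>\<alpha>\<in>A. \<Sum>b\<in>D.
     if card {j. b j = 0} mod 2 = i' \<and> - x + y + ?n - 2 * sum b UNIV = of_nat (card {j. b j = 0}) \<and>
       \<kappa>' \<alpha> b = y + ?n / 2 - sum b UNIV then N \<alpha> b else 0)"
  proof (intro sum.cong refl)
    fix \<alpha> b assume ab: "\<alpha> \<in> A" "b \<in> D"
    show "(if card {j. \<alpha> j = 0} mod 2 = i \<and> x + y + ?n - 2 * sum \<alpha> UNIV = of_nat (card {j. \<alpha> j = 0}) \<and>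
         \<kappa> \<alpha> b = y + ?n / 2 - sum \<alpha> UNIV then N \<alpha> b else 0) =
      (if card {j. b j = 0} mod 2 = i' \<and> - x + y + ?n - 2 * sum b UNIV = of_nat (card {j. b j = 0}) \<and>
         \<kappa>' \<alpha> b = y + ?n / 2 - sum b UNIV then N \<alpha> b else 0)"
    proof (cases "N \<alpha> b > 0")
      case True
      define s where "s = sum \<alpha> UNIV"
      define t where "t = sum b UNIV"
      define l where "l = card {j. \<alpha> j = 0}"
      define m where "m = card {j. b j = 0}"
      have e: "\<kappa> \<alpha> b + s = \<kappa>' \<alpha> b + t" "of_nat (l + m) + s + t = ?n + \<kappa> \<alpha> b + \<kappa>' \<alpha> b"
        using P[OF ab] True by (auto simp: P_def s_def t_def l_def m_def)
      \<comment> \<open>The two degree equations combine to l + m = n + 2 (\<kappa> - t), with n the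
        number of variables. So l + m and n have the same parity once \<kappa> - t is an
        integer.\<close>
      have "\<kappa> \<alpha> b - t \<in> \<int>"
        unfolding t_def using P[OF ab] True unfolding P_def by (intro sector_dim_degree_cong) blast+
      then obtain z where z: "\<kappa> \<alpha> b - t = of_int z" by (rule Ints_cases)
      have "(of_int (int l + int m) :: rat) = of_int (int CARD('n) + 2 * z)"
        using e z by simp
      hence "int l + int m = int CARD('n) + 2 * z" by (simp only: of_int_eq_iff)
      hence "l mod 2 = i \<longleftrightarrow> m mod 2 = i'" using i by (cases "even CARD('n)") (simp, presburger)+
      \<comment> \<open>The sector contributes at the exponents x = l - \<kappa> + s - n/2 and y =
        \<kappa> + s - n/2. The degree equations place the dual sector at -x and y.\<close>
      moreover have "x + y + ?n - 2 * s = of_nat l \<and> \<kappa> \<alpha> b = y + ?n / 2 - s \<longleftrightarrow>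
          - x + y + ?n - 2 * t = of_nat m \<and> \<kappa>' \<alpha> b = y + ?n / 2 - t"
        using e by auto
      ultimately show ?thesis unfolding s_def t_def l_def m_def by simp
    qed simp
  qed
  also have "\<dots> = (\<Sum>b\<in>D. \<Sum>\<alpha>\<in>A.
     if card {j. b j = 0} mod 2 = i' \<and> - x + y + ?n - 2 * sum b UNIV = of_nat (card {j. b j = 0}) \<and>
       \<kappa>' \<alpha> b = y + ?n / 2 - sum b UNIV then N \<alpha> b else 0)"
    by (rule sum.swap)
  also have "\<dots> = E_function i' (transpose E) a (dual_group E a G) (- x) y"
    by (rule E_function_sum[OF invertible_poly_data(2)[OF E] dual_group_subset D' A', symmetric])
      (use P in \<open>simp add: P_def\<close>)
  finally show ?thesis .
qed

theorem theorem4: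
  fixes E :: "nat ^ 'n::{finite,linorder} ^ 'n::{finite,linorder}"
    and a :: "complex ^ 'n::{finite,linorder}"
    and G :: "(complex ^ 'n::{finite,linorder}) set"
  assumes "invertible_poly E a"
    and "subgroup G (diag_symmetries (mpoly_of E a))"
  shows
    "(even CARD('n) \<longrightarrow>
        (\<forall>i\<in>{0, 1}. E_function i E a G =
           invert_first (E_function i (transpose E) a (dual_group E a G)))) \<and>
     (odd CARD('n) \<longrightarrow>
        E_function 0 E a G =
          invert_first (E_function 1 (transpose E) a (dual_group E a G)) \<and>
        E_function 1 E a G =
          invert_first (E_function 0 (transpose E) a (dual_group E a G)))"
  using E_function_duality[OF assms] by (auto simp: invert_first_def fun_eq_iff)

end
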